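(* For every $\varphi \in \mathscr{S}(W)$, the zeta integral normalized by the gamma factor, $$\frac{1}{\Gamma_{\widetilde{\Omega}}(s)}\, Z_{\widetilde{\Omega}}(\varphi, s),$$ initially defined for $\operatorname{Re} s_1, \operatorname{Re} s_2$ sufficiently large, extends to an entire function of $s=(s_1,s_2)\in\mathbb{C}^2$. In other words, $Z_{\widetilde{\Omega}}(\varphi,s)$ extends to a meromorphic function on $\mathbb{C}^2$ with possible poles specified by the gamma factor $\Gamma_{\widetilde{\Omega}}(s)$.
   Context: Let $1\le d \le n$ be integers. Let $V=\mathrm{Sym}_n(\mathbb{R})$ (real symmetric $n\times n$ matrices), $E=\mathrm{M}_{n,d}(\mathbb{R})$ (real $n\times d$ matrices), $W=V\oplus E$, and let $\mathscr{S}(W)$ be the Schwartz space of rapidly decreasing smooth functions on $W$. For $(z,y)\in W$ put $$P_1(z,y)=\det z,\qquad P_2(z,y)=(-1)^d\det\begin{pmatrix} z & y\\ {}^t y & 0\end{pmatrix};$$ when $z$ is invertible, $P_2(z,y)=\det z\cdot\det({}^t y z^{-1}y)$. Let $\Omega=\mathrm{Sym}_n^+(\mathbb{R})$ be the set of positive definite matrices in $V$, let $\mathrm{M}^{\circ}_{n,d}(\mathbb{R})$ be the set of matrices of full rank $d$ in $E$, and let $\widetilde{\Omega}=\Omega\times \mathrm{M}^{\circ}_{n,d}(\mathbb{R})$ (the enhanced positive cone); $P_1,P_2>0$ on $\widetilde{\Omega}$. The enhanced zeta integral is $$Z_{\widetilde{\Omega}}(\varphi,s)=\int_{\widetilde{\Omega}}\varphi(z,y)\,P_1(z,y)^{s_1}P_2(z,y)^{s_2}\,dz\,dy,\qquad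 s=(s_1,s_2)\in\mathbb{C}^2,$$ where $dz,dy$ are Lebesgue measures; it converges for $\operatorname{Re}s_1,\operatorname{Re}s_2$ sufficiently large. For an integer $k\ge 0$ and $\alpha\in\mathbb{C}$ let $\Gamma_k(\alpha)=\prod_{j=1}^k\Gamma\bigl(\alpha-\tfrac{j-1}{2}\bigr)$, and define $$\Gamma_{\widetilde{\Omega}}(s)=\Gamma_d\bigl(s_1+\tfrac{d+1}{2}\bigr)\,\Gamma_d\bigl(s_2+\tfrac{d+1}{2}\bigr)\,\Gamma_d\bigl(s_2+\tfrac{n}{2}\bigr)\,\Gamma_{n-d}\bigl(s_1+s_2+\tfrac{n+1}{2}\bigr).$$ *)

theory Defs
  imports "HOL-Analysis.Analysis"
begin

section \<open>The space of real symmetric matrices\<close>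

typedef 'n symmat = "{A :: real^'n::finite^'n. transpose A = A}"
  morphisms mat_of_sym Abs_symmat
  by (rule exI[of _ "mat 1"]) simp

setup_lifting type_definition_symmat

instantiation symmat :: (finite) real_vector
begin

lift_definition zero_symmat :: "'a symmat" is 0
  by (simp add: transpose_def vec_eq_iff)

lift_definition plus_symmat :: "'a symmat \<Rightarrow> 'a symmat \<Rightarrow> 'a symmat" is "(+)"
  by (simp add: transpose_def vec_eq_iff)

lift_definition minus_symmat :: "'a symmat \<Rightarrow> 'a symmat \<Rightarrow> 'a symmat" is "(-)"
  by (simp add: transpose_def vec_eq_iff)

lift_definition uminus_symmat :: "'a symmat \<Rightarrow> 'a symmat" is uminus
  by (simp add: transpose_def vec_eq_iff)

lift_definition scaleR_symmat :: "real \<Rightarrow> 'a symmat \<Rightarrow> 'a symmat" is scaleR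
  by (simp add: transpose_def vec_eq_iff)

instance
  by standard (transfer, simp add: scaleR_add_left scaleR_add_right ac_simps)+

end

text \<open>
  The weights \<open>1/2\<close> make the inner product of \<open>A\<close> and \<open>B\<close> equal to the sum of \<open>A i j * B i j\<close>
  over all unordered pairs of indices. Hence the entries on and above the diagonal are orthonormal
  coordinates, and \<^const>\<open>lborel\<close> on symmetric matrices is the product of the measures
  \<open>dz i j\<close> over \<open>i \<le> j\<close>. (The trace inner product would rescale this by a constant.)
\<close>

instantiation symmat :: (finite) real_inner
begin

lift_definition inner_symmat :: "'a symmat \<Rightarrow> 'a symmat \<Rightarrow> real" is
  "\<lambda>A B. \<Sum>i\<in>UNIV. \<Sum>j\<in>UNIV. (if i = j then 1 else 1/2) * (A $ i $ j * B $ i $ j)" .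

definition norm_symmat :: "'a symmat \<Rightarrow> real"
  where "norm_symmat A = sqrt (inner A A)"

definition sgn_symmat :: "'a symmat \<Rightarrow> 'a symmat"
  where "sgn_symmat A = A /\<^sub>R norm A"

definition dist_symmat :: "'a symmat \<Rightarrow> 'a symmat \<Rightarrow> real"
  where "dist_symmat A B = norm (A - B)"

definition uniformity_symmat :: "('a symmat \<times> 'a symmat) filter"
  where "uniformity_symmat = (INF e\<in>{0 <..}. principal {(x, y). dist x y < e})"

definition open_symmat :: "'a symmat set \<Rightarrow> bool"
  where "open_symmat U = (\<forall>x\<in>U. eventually (\<lambda>(x', y). x' = x \<longrightarrow> y \<in> U) uniformity)"

instance
proof
  fix A B C :: "'a symmat" and r :: real
  show "inner A B = inner B A"
    by transfer (simp add: mult.commute)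
  show "inner (A + B) C = inner A C + inner B C"
    by transfer (simp add: distrib_left distrib_right sum.distrib del: mult_cancel_left mult_cancel_right)
  show "inner (r *\<^sub>R A) B = r * inner A B"
    by transfer (simp add: sum_distrib_left mult.left_commute mult.assoc)
  show "0 \<le> inner A A"
    by transfer (intro sum_nonneg, auto)
  show "inner A A = 0 \<longleftrightarrow> A = 0"
  proof (transfer, rule iffI)
    fix A :: "real^'a^'a"
    assume *: "(\<Sum>i\<in>UNIV. \<Sum>j\<in>UNIV. (if i = j then 1 else 1/2) * (A $ i $ j * A $ i $ j)) = 0"
    have nn: "0 \<le> (if i = j then 1 else 1/2) * (A $ i $ j * A $ i $ j)" for i j
      by auto
    have "(\<Sum>j\<in>UNIV. (if i = j then 1 else 1/2) * (A $ i $ j * A $ i $ j)) = 0" for i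
      using * nn by (simp add: sum_nonneg_eq_0_iff sum_nonneg del: mult_eq_0_iff)
    then have z: "(if i = j then 1 else 1/2) * (A $ i $ j * A $ i $ j) = 0" for i j
      using nn by (simp add: sum_nonneg_eq_0_iff del: mult_eq_0_iff)
    have "A $ i $ j = 0" for i j
      using z[of i j] by (cases "i = j") simp_all
    then show "A = 0" by (simp add: vec_eq_iff)
  qed auto
qed (simp_all add: norm_symmat_def sgn_symmat_def dist_symmat_def
      uniformity_symmat_def open_symmat_def)

end

lift_definition sym_unit :: "'n \<Rightarrow> 'n \<Rightarrow> 'n::finite symmat" is
  "\<lambda>i j. \<chi> k l. if (k = i \<and> l = j) \<or> (k = j \<and> l = i) then 1 else 0"
  by (auto simp: transpose_def vec_eq_iff)

lemma mat_of_sym_commute: "mat_of_sym A $ i $ j = mat_of_sym A $ j $ i"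
proof -
  have "transpose (mat_of_sym A) = mat_of_sym A" using mat_of_sym[of A] by simp
  then have "transpose (mat_of_sym A) $ i $ j = mat_of_sym A $ i $ j" by (rule arg_cong)
  then show ?thesis by (simp add: transpose_def)
qed

lemma inner_sym_unit: "inner A (sym_unit i j) = mat_of_sym A $ i $ j"
proof -
  have *: "(if k = l then 1 else 1/2) * (mat_of_sym A $ k $ l * mat_of_sym (sym_unit i j) $ k $ l)
      = (if k = i then if l = j then (1/2) * mat_of_sym A $ k $ l else 0 else 0)
        + (if k = j then if l = i then (1/2) * mat_of_sym A $ k $ l else 0 else 0)" for k l
    by (cases "k = i"; cases "l = j"; cases "k = j"; cases "l = i"; simp add: sym_unit.rep_eq)
  have "inner A (sym_unit i j) =
      (\<Sum>k\<in>UNIV. if k = i then \<Sum>l\<in>UNIV. if l = j then (1/2) * mat_of_sym A $ k $ l else 0 else 0)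
      + (\<Sum>k\<in>UNIV. if k = j then \<Sum>l\<in>UNIV. if l = i then (1/2) * mat_of_sym A $ k $ l else 0 else 0)"
    unfolding inner_symmat.rep_eq * sum.distrib
    by (rule arg_cong2[where f="(+)"]; rule sum.cong; simp)
  also have "\<dots> = (1/2) * mat_of_sym A $ i $ j + (1/2) * mat_of_sym A $ j $ i"
    by simp
  finally show ?thesis using mat_of_sym_commute[of A i j] by simp
qed

instantiation symmat :: (finite) euclidean_space
begin

definition Basis_symmat :: "'a symmat set"
  where "Basis_symmat = {sym_unit i j | i j. True}"

instance
proof
  have eq: "Basis = (\<lambda>(i, j). sym_unit i j :: 'a symmat) ` UNIV"
    by (auto simp: Basis_symmat_def)
  show "Basis \<noteq> ({} :: 'a symmat set)" "finite (Basis :: 'a symmat set)"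
    by (auto simp: eq)
next
  fix u v :: "'a symmat"
  assume "u \<in> Basis" "v \<in> Basis"
  then obtain i j k l where uv: "u = sym_unit i j" "v = sym_unit k l"
    by (auto simp: Basis_symmat_def)
  have "inner u v = (if (k = i \<and> l = j) \<or> (k = j \<and> l = i) then 1 else 0)"
    by (simp add: uv inner_sym_unit sym_unit.rep_eq)
  moreover have "u = v \<longleftrightarrow> (k = i \<and> l = j) \<or> (k = j \<and> l = i)"
  proof
    assume "u = v"
    then have "mat_of_sym u $ k $ l = mat_of_sym v $ k $ l" by simp
    then show "(k = i \<and> l = j) \<or> (k = j \<and> l = i)"
      by (simp add: uv sym_unit.rep_eq split: if_splits)
  next
    assume "(k = i \<and> l = j) \<or> (k = j \<and> l = i)"
    then show "u = v" unfolding uv by transfer (auto simp: vec_eq_iff)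
  qed
  ultimately show "inner u v = (if u = v then 1 else 0)" by simp
next
  fix A :: "'a symmat"
  have "(\<forall>u\<in>Basis. inner A u = 0) \<longleftrightarrow> (\<forall>i j. mat_of_sym A $ i $ j = 0)"
    unfolding Basis_symmat_def inner_sym_unit[symmetric] by blast
  also have "\<dots> \<longleftrightarrow> A = 0" by transfer (simp add: vec_eq_iff)
  finally show "(\<forall>u\<in>Basis. inner A u = 0) \<longleftrightarrow> A = 0" .
qed

end

definition pos_definite :: "'n::finite symmat \<Rightarrow> bool"
  where "pos_definite z \<longleftrightarrow> (\<forall>x. x \<noteq> 0 \<longrightarrow> x \<bullet> (mat_of_sym z *v x) > 0)"


section \<open>Schwartz functions\<close>

text \<open>\<open>iter_deriv [b\<^sub>1, \<dots>, b\<^sub>m] f\<close> is the iterated directional derivative of \<open>f\<close> along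
  \<open>b\<^sub>m\<close>, \dots, \<open>b\<^sub>1\<close>. It is meaningful only where the inner derivatives exist, which is why
  \<open>schwartz\<close> requires differentiability at every stage; this amounts to smoothness.\<close>

primrec iter_deriv ::
  "'a::real_normed_vector list \<Rightarrow> ('a \<Rightarrow> 'b::real_normed_vector) \<Rightarrow> 'a \<Rightarrow> 'b"
where
  "iter_deriv [] f = f"
| "iter_deriv (b # bs) f = (\<lambda>x. frechet_derivative (iter_deriv bs f) (at x) b)"

definition schwartz :: "('a::euclidean_space \<Rightarrow> complex) set"
  where "schwartz = {f. \<forall>bs. set bs \<subseteq> Basis \<longrightarrow>
    (\<forall>x. iter_deriv bs f differentiable (at x)) \<and>
    (\<forall>k::nat. \<exists>C. \<forall>x. norm x ^ k * norm (iter_deriv bs f x) \<le> C)}"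


section \<open>Holomorphic and meromorphic functions of two variables\<close>

definition holomorphic2_on :: "(complex \<times> complex \<Rightarrow> complex) \<Rightarrow> (complex \<times> complex) set \<Rightarrow> bool"
  where "holomorphic2_on f U \<longleftrightarrow>
    open U \<and> (\<forall>s\<in>U. \<exists>a b. (f has_derivative (\<lambda>(h1, h2). a * h1 + b * h2)) (at s))"

text \<open>Locally a quotient of holomorphic functions; as HOL functions are total, the value on the
  zero set of the denominator is left unconstrained.\<close>

definition meromorphic2 :: "(complex \<times> complex \<Rightarrow> complex) \<Rightarrow> bool"
  where "meromorphic2 f \<longleftrightarrow> (\<forall>s. \<exists>U g h. s \<in> U \<and> connected U \<and>
    holomorphic2_on g U \<and> holomorphic2_on h U \<and> (\<exists>t\<in>U. h t \<noteq> 0) \<and>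
    (\<forall>t\<in>U. h t \<noteq> 0 \<longrightarrow> f t = g t / h t))"


section \<open>The enhanced positive cone and its zeta integral\<close>

definition bordered :: "real^'n^'n \<Rightarrow> real^'d^'n \<Rightarrow> real^('n::finite + 'd::finite)^('n + 'd)"
  where "bordered z y = (\<chi> p q. case (p, q) of
      (Inl i, Inl j) \<Rightarrow> z $ i $ j
    | (Inl i, Inr b) \<Rightarrow> y $ i $ b
    | (Inr a, Inl j) \<Rightarrow> transpose y $ a $ j
    | (Inr a, Inr b) \<Rightarrow> 0)"

definition P1 :: "'n::finite symmat \<times> (real^'d::finite^'n) \<Rightarrow> real"
  where "P1 = (\<lambda>(z, y). det (mat_of_sym z))"

definition P2 :: "'n::finite symmat \<times> (real^'d::finite^'n) \<Rightarrow> real"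
  where "P2 = (\<lambda>(z, y). (-1) ^ CARD('d) * det (bordered (mat_of_sym z) y))"

definition enhanced_cone :: "('n::finite symmat \<times> (real^'d::finite^'n)) set"
  where "enhanced_cone = {(z, y). pos_definite z \<and> rank y = CARD('d)}"

definition zeta_integrand ::
  "('n::finite symmat \<times> (real^'d::finite^'n) \<Rightarrow> complex) \<Rightarrow> complex \<times> complex \<Rightarrow>
    'n symmat \<times> (real^'d^'n) \<Rightarrow> complex"
  where "zeta_integrand \<phi> = (\<lambda>(s1, s2) w.
    \<phi> w * complex_of_real (P1 w) powr s1 * complex_of_real (P2 w) powr s2)"

definition zeta_integral ::
  "('n::finite symmat \<times> (real^'d::finite^'n) \<Rightarrow> complex) \<Rightarrow> complex \<times> complex \<Rightarrow> complex"
  where "zeta_integral \<phi> s = set_lebesgue_integral lborel enhanced_cone (zeta_integrand \<phi> s)"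


section \<open>The gamma factor\<close>

definition Gamma_multi :: "nat \<Rightarrow> complex \<Rightarrow> complex"
  where "Gamma_multi k \<alpha> = (\<Prod>j=1..k. Gamma (\<alpha> - (of_nat j - 1) / 2))"

definition Gamma_multi_poles :: "nat \<Rightarrow> complex set"
  where "Gamma_multi_poles k = {\<alpha>. \<exists>j\<in>{1..k}. \<alpha> - (of_nat j - 1) / 2 \<in> \<int>\<^sub>\<le>\<^sub>0}"

definition Gamma_enhanced :: "nat \<Rightarrow> nat \<Rightarrow> complex \<times> complex \<Rightarrow> complex"
  where "Gamma_enhanced n d = (\<lambda>(s1, s2).
      Gamma_multi d (s1 + (of_nat d + 1) / 2)
    * Gamma_multi d (s2 + (of_nat d + 1) / 2)
    * Gamma_multi d (s2 + of_nat n / 2)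
    * Gamma_multi (n - d) (s1 + s2 + (of_nat n + 1) / 2))"

text \<open>The library's \<^const>\<open>Gamma\<close> takes the value 0 at its poles, so the polar locus of the gamma
  factor has to be recorded separately. \<^const>\<open>Gamma\<close> has no zeros, hence no poles cancel and
  the locus is the union of those of the factors.\<close>

definition Gamma_enhanced_poles :: "nat \<Rightarrow> nat \<Rightarrow> (complex \<times> complex) set"
  where "Gamma_enhanced_poles n d = {(s1, s2).
      s1 + (of_nat d + 1) / 2 \<in> Gamma_multi_poles d
    \<or> s2 + (of_nat d + 1) / 2 \<in> Gamma_multi_poles d
    \<or> s2 + of_nat n / 2 \<in> Gamma_multi_poles d
    \<or> s1 + s2 + (of_nat n + 1) / 2 \<in> Gamma_multi_poles (n - d)}"

end

theory Submission
  imports Defs "HOL-Complex_Analysis.Complex_Analysis" "HOL-Combinatorics.Multiset_Permutations"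
begin

text \<open>The zeta integral is continued by making both determinants monomials. Write \<open>y = L R\<close> by Gaussian
elimination, with \<open>L\<close> unipotent lower triangular and \<open>R\<close> upper trapezoidal with pivots \<open>r c\<close>, and
write \<open>z = L U (L U)\<^sup>T\<close> with \<open>U\<close> upper triangular with diagonal entries \<open>u j\<close>. Then \<open>P1\<close> is the
product of all \<open>(u j)\<^sup>2\<close>, \<open>P2\<close> is the product of all \<open>(r c)\<^sup>2\<close> and of the \<open>(u j)\<^sup>2\<close> with \<open>d \<le> j\<close>
(counting from 0), and the Jacobian is a product of powers of \<open>\<bar>r c\<bar>\<close> and \<open>\<bar>u j\<bar>\<close> as well
(\<open>P1_chart\<close>, \<open>P2_chart\<close>, \<open>nn_integral_chart\<close>). In these coordinates the zeta integral has the form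
\<open>\<integral> \<phi> (\<Phi> x) * (\<Prod>i. \<bar>x i\<bar> powr \<lambda> i s)\<close>, where \<open>\<Phi>\<close> is polynomial and the exponents \<open>\<lambda> i\<close> are
affine in \<open>s\<close>.\<close>

text \<open>One variable of such an integral is classical: \<open>\<bar>t\<bar> powr z / Gamma ((z + 1) / 2)\<close> is an entire family
of tempered distributions. Here this is made explicit by integrating by parts \<open>2 N\<close> times against a
kernel that is holomorphic in \<open>z\<close> and locally integrable in \<open>t\<close> for \<open>Re z > - 2 * N - 1\<close>
(\<open>mellin_kernel_integral\<close>). Doing this in all the variables that carry a power, and letting \<open>N\<close>
grow, gives the entire continuation (\<open>entire_extension\<close>), with one factor
\<open>Gamma ((\<lambda> i s + 1) / 2)\<close> for each power. Their product consists of three of the four factors of the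
enhanced gamma factor (\<open>prod_rGamma_pivot_exponent\<close>), and the reciprocal of the fourth one is entire.\<close>

text \<open>For convergence, \<open>\<phi> (\<Phi> x)\<close> has to decrease rapidly in \<open>x\<close>, so that \<open>x\<close> has to be bounded
polynomially by \<open>\<Phi> x\<close>. Without row exchanges this fails, since the multipliers in \<open>L\<close> are
quotients that may be large while \<open>y\<close> is small. With partial pivoting the multipliers are at most
1 in absolute value, and the bound holds (\<open>chart_growth\<close>). Hence the integral is cut into cells,
one for each order in which the rows may be chosen as pivots, by a partition of unity that splits ties
evenly (\<open>sum_pivot_weight\<close>). In the coordinates of its own cell, the weight depends on the
multipliers only (\<open>bounded_weight_cong\<close>). So it is constant in the pivots, and it does not interfere
with the integrations by parts although it is not even continuous.\<close>

section \<open>Changing variables one coordinate at a time\<close>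

lemma nn_integral_along_coordinate:
  fixes F :: "'a::euclidean_space \<Rightarrow> ennreal"
  assumes b: "b \<in> Basis" and F[measurable]: "F \<in> borel_measurable borel"
  shows "(\<integral>\<^sup>+x. F x \<partial>lborel) =
    (\<integral>\<^sup>+g. (\<integral>\<^sup>+t. F ((\<Sum>c\<in>Basis - {b}. g c *\<^sub>R c) + t *\<^sub>R b) \<partial>lborel) \<partial>(\<Pi>\<^sub>M c\<in>Basis - {b}. lborel))"
proof -
  interpret product_sigma_finite "\<lambda>c::'a. lborel :: real measure"
    by standard
  have ins: "Basis = insert b (Basis - {b})" using b by auto
  have dec: "(\<Sum>c\<in>Basis. (g(b := t)) c *\<^sub>R c) = (\<Sum>c\<in>Basis - {b}. g c *\<^sub>R c) + t *\<^sub>R b" for g t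
    using b by (subst sum.remove[of _ b]) (auto simp: add.commute intro!: sum.cong)
  have m[measurable]: "(\<lambda>g. \<Sum>c\<in>Basis. g c *\<^sub>R c) \<in> measurable (\<Pi>\<^sub>M c\<in>Basis. lborel) (borel::'a measure)"
    by measurable
  have "(\<integral>\<^sup>+x. F x \<partial>lborel) = (\<integral>\<^sup>+g. F (\<Sum>c\<in>Basis. g c *\<^sub>R c) \<partial>(\<Pi>\<^sub>M c\<in>Basis. lborel))"
    by (subst lborel_eq) (subst nn_integral_distr, auto)
  also have "\<dots> = (\<integral>\<^sup>+g. F (\<Sum>c\<in>Basis. g c *\<^sub>R c) \<partial>(\<Pi>\<^sub>M c\<in>insert b (Basis - {b}). lborel))"
    using ins by simp
  also have "\<dots> = (\<integral>\<^sup>+g. (\<integral>\<^sup>+t. F (\<Sum>c\<in>Basis. (g(b := t)) c *\<^sub>R c) \<partial>lborel) \<partial>(\<Pi>\<^sub>M c\<in>Basis - {b}. lborel))"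
  proof (rule product_nn_integral_insert)
    have "(\<lambda>g. F (\<Sum>c\<in>Basis. g c *\<^sub>R c)) \<in> borel_measurable (\<Pi>\<^sub>M c\<in>Basis. lborel)" by measurable
    then show "(\<lambda>g. F (\<Sum>c\<in>Basis. g c *\<^sub>R c)) \<in> borel_measurable (\<Pi>\<^sub>M c\<in>insert b (Basis - {b}). lborel)"
      using ins by simp
  qed auto
  finally show ?thesis by (simp only: dec)
qed

lemma nn_integral_coordinate_cong:
  fixes F G :: "'a::euclidean_space \<Rightarrow> ennreal"
  assumes "b \<in> Basis" "F \<in> borel_measurable borel" "G \<in> borel_measurable borel"
    and "\<And>x. (\<integral>\<^sup>+t. F (x + t *\<^sub>R b) \<partial>lborel) = (\<integral>\<^sup>+t. G (x + t *\<^sub>R b) \<partial>lborel)"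
  shows "(\<integral>\<^sup>+x. F x \<partial>lborel) = (\<integral>\<^sup>+x. G x \<partial>lborel)"
  unfolding nn_integral_along_coordinate[OF assms(1,2)] nn_integral_along_coordinate[OF assms(1,3)]
  by (simp only: assms(4))

lemma integral_along_coordinate:
  fixes F :: "'a::euclidean_space \<Rightarrow> 'b::{banach,second_countable_topology}"
  assumes b: "b \<in> Basis" and F: "integrable lborel F"
  shows "(\<integral>x. F x \<partial>lborel) =
    (\<integral>g. (\<integral>t. F ((\<Sum>c\<in>Basis - {b}. g c *\<^sub>R c) + t *\<^sub>R b) \<partial>lborel) \<partial>(\<Pi>\<^sub>M c\<in>Basis - {b}. lborel))"
proof -
  interpret product_sigma_finite "\<lambda>c::'a. lborel :: real measure"
    by standard
  have ins: "Basis = insert b (Basis - {b})" using b by auto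
  have dec: "(\<Sum>c\<in>Basis. (g(b := t)) c *\<^sub>R c) = (\<Sum>c\<in>Basis - {b}. g c *\<^sub>R c) + t *\<^sub>R b" for g t
    using b by (subst sum.remove[of _ b]) (auto simp: add.commute intro!: sum.cong)
  have [measurable]: "F \<in> borel_measurable borel" using F by simp
  have m[measurable]: "(\<lambda>g. \<Sum>c\<in>Basis. g c *\<^sub>R c) \<in> measurable (\<Pi>\<^sub>M c\<in>Basis. lborel) (borel::'a measure)"
    by measurable
  have "integrable (distr (\<Pi>\<^sub>M c\<in>Basis. lborel) borel (\<lambda>g. \<Sum>c\<in>Basis. g c *\<^sub>R c)) F"
    using F by (subst (asm) lborel_eq)
  then have int: "integrable (\<Pi>\<^sub>M c\<in>Basis. lborel) (\<lambda>g. F (\<Sum>c\<in>Basis. g c *\<^sub>R c))"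
    by (subst (asm) integrable_distr_eq) auto
  have "(\<integral>x. F x \<partial>lborel) = (\<integral>g. F (\<Sum>c\<in>Basis. g c *\<^sub>R c) \<partial>(\<Pi>\<^sub>M c\<in>Basis. lborel))"
    by (subst lborel_eq) (subst integral_distr, auto)
  also have "\<dots> = (\<integral>g. F (\<Sum>c\<in>Basis. g c *\<^sub>R c) \<partial>(\<Pi>\<^sub>M c\<in>insert b (Basis - {b}). lborel))"
    using ins by simp
  also have "\<dots> = (\<integral>g. (\<integral>t. F (\<Sum>c\<in>Basis. (g(b := t)) c *\<^sub>R c) \<partial>lborel) \<partial>(\<Pi>\<^sub>M c\<in>Basis - {b}. lborel))"
    using int ins by (intro product_integral_insert) auto
  finally show ?thesis by (simp only: dec)
qed

lemma integrable_prod_coordinates: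
  fixes q :: "'a::euclidean_space \<Rightarrow> real \<Rightarrow> real"
  assumes "\<And>b. b \<in> Basis \<Longrightarrow> integrable lborel (q b)"
  shows "integrable lborel (\<lambda>x. \<Prod>b\<in>Basis. q b (x \<bullet> b))"
proof -
  interpret product_sigma_finite "\<lambda>c::'a. lborel :: real measure"
    by standard
  have [measurable]: "q b \<in> borel_measurable borel" if "b \<in> Basis" for b
    using assms[OF that] by simp
  have "integrable (\<Pi>\<^sub>M c\<in>Basis. lborel) (\<lambda>g. \<Prod>b\<in>Basis. q b (g b))"
    using assms by (intro product_integrable_prod) auto
  then have "integrable (\<Pi>\<^sub>M c\<in>Basis. lborel) (\<lambda>g. \<Prod>b\<in>Basis. q b ((\<Sum>c\<in>Basis. g c *\<^sub>R c) \<bullet> b))"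
    by (simp cong: prod.cong)
  then show ?thesis
    by (subst lborel_eq) (subst integrable_distr_eq, auto)
qed

text \<open>When the substitution in each coordinate depends on coordinates of smaller rank only, the coordinates can be treated
one at a time, in order of increasing rank, each time by Tonelli's theorem. The hypothesis \<open>one\<close> is the
one-dimensional substitution rule: \<open>\<theta> b x\<close> covers the set \<open>A b\<close>, possibly several times, with weight \<open>\<rho> b x\<close>.\<close>

lemma triangular_substitution:
  fixes h :: "'a::euclidean_space \<Rightarrow> nat" and \<theta> :: "'a \<Rightarrow> 'a \<Rightarrow> real \<Rightarrow> real"
    and \<rho> :: "'a \<Rightarrow> 'a \<Rightarrow> real \<Rightarrow> ennreal"
  assumes dep: "\<And>b x x' u. b \<in> Basis \<Longrightarrow> (\<And>c. c \<in> Basis \<Longrightarrow> h c < h b \<Longrightarrow> x \<bullet> c = x' \<bullet> c) \<Longrightarrow>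
      \<theta> b x u = \<theta> b x' u \<and> \<rho> b x u = \<rho> b x' u"
    and one: "\<And>b x f. b \<in> Basis \<Longrightarrow> f \<in> borel_measurable borel \<Longrightarrow>
      (\<integral>\<^sup>+t. f t * indicator (A b) t \<partial>lborel) = (\<integral>\<^sup>+u. f (\<theta> b x u) * \<rho> b x u \<partial>lborel)"
    and m\<theta>: "\<And>b. b \<in> Basis \<Longrightarrow> (\<lambda>x. \<theta> b x (x \<bullet> b)) \<in> borel_measurable borel"
    and m\<rho>: "\<And>b. b \<in> Basis \<Longrightarrow> (\<lambda>x. \<rho> b x (x \<bullet> b)) \<in> borel_measurable borel"
    and mA: "\<And>b. b \<in> Basis \<Longrightarrow> A b \<in> sets borel"
    and mf: "f \<in> borel_measurable borel"
  shows "(\<integral>\<^sup>+x. f x * (\<Prod>b\<in>Basis. indicator (A b) (x \<bullet> b)) \<partial>lborel) =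
    (\<integral>\<^sup>+x. f (\<Sum>b\<in>Basis. \<theta> b x (x \<bullet> b) *\<^sub>R b) * (\<Prod>b\<in>Basis. \<rho> b x (x \<bullet> b)) \<partial>lborel)"
proof -
  define T where "T S x = (\<Sum>b\<in>Basis. (if b \<in> S then \<theta> b x (x \<bullet> b) else x \<bullet> b) *\<^sub>R b)" for S x
  define w where "w S x = (\<Prod>b\<in>Basis. if b \<in> S then \<rho> b x (x \<bullet> b) else indicator (A b) (x \<bullet> b))"
    for S x
  note [measurable] = mf m\<theta> m\<rho> mA
  have meas[measurable]: "T S \<in> borel_measurable borel" "w S \<in> borel_measurable borel" for S
  proof -
    have "(\<lambda>x. (if b \<in> S then \<theta> b x (x \<bullet> b) else x \<bullet> b)) \<in> borel_measurable borel" if "b \<in> Basis" for b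
      using m\<theta>[OF that] by (cases "b \<in> S") auto
    then show "T S \<in> borel_measurable borel"
      unfolding T_def by (intro borel_measurable_sum borel_measurable_scaleR) auto
    have "(\<lambda>x. (if b \<in> S then \<rho> b x (x \<bullet> b) else indicator (A b) (x \<bullet> b))) \<in> borel_measurable borel"
      if "b \<in> Basis" for b
    proof (cases "b \<in> S")
      case False
      have "(\<lambda>x. indicator (A b) (x \<bullet> b) :: ennreal) \<in> borel_measurable borel"
        using mA[OF that] by measurable
      then show ?thesis using False by simp
    qed (use m\<rho>[OF that] in auto)
    then show "w S \<in> borel_measurable borel"
      unfolding w_def by (intro borel_measurable_prod_ennreal)
  qed
  \<comment> \<open>the coordinates in \<open>S\<close>, a set closed under passing to smaller rank, are already substituted\<close>
  have down: "(\<integral>\<^sup>+x. f x * (\<Prod>b\<in>Basis. indicator (A b) (x \<bullet> b)) \<partial>lborel) = (\<integral>\<^sup>+x. f (T S x) * w S x \<partial>lborel)"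
    if "S \<subseteq> Basis" "\<And>b c. b \<in> S \<Longrightarrow> c \<in> Basis \<Longrightarrow> h c < h b \<Longrightarrow> c \<in> S" for S
    using finite_subset[OF that(1) finite_Basis] that
  proof (induction "card S" arbitrary: S)
    case 0
    then have "S = {}" by simp
    then show ?case by (simp add: T_def w_def euclidean_representation)
  next
    case (Suc n)
    then have "S \<noteq> {}" by auto
    \<comment> \<open>a coordinate of maximal rank is not used by the other coordinates in \<open>S\<close>\<close>
    obtain b where b: "b \<in> S" "\<And>c. c \<in> S \<Longrightarrow> h c \<le> h b"
    proof -
      have "Max (h ` S) \<in> h ` S"
        using \<open>S \<noteq> {}\<close> Suc.prems(1) by (intro Max_in) auto
      then obtain b where "b \<in> S" "h b = Max (h ` S)" by auto
      then show ?thesis using that Suc.prems(1) by auto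
    qed
    define R where "R = S - {b}"
    have bB: "b \<in> Basis" and bR: "b \<notin> R" and S: "S = insert b R" using b(1) Suc.prems by (auto simp: R_def)
    have "(\<integral>\<^sup>+x. f x * (\<Prod>b\<in>Basis. indicator (A b) (x \<bullet> b)) \<partial>lborel) = (\<integral>\<^sup>+x. f (T R x) * w R x \<partial>lborel)"
    proof (rule Suc.hyps(1))
      show "n = card R" using Suc.hyps(2) b(1) Suc.prems(1) by (simp add: R_def)
      show "c \<in> R" if "b' \<in> R" "c \<in> Basis" "h c < h b'" for b' c
        using that b(2)[of b'] Suc.prems(3)[of b' c] by (auto simp: R_def)
    qed (use Suc.prems in \<open>auto simp: R_def intro: finite_subset\<close>)
    also have "\<dots> = (\<integral>\<^sup>+x. f (T S x) * w S x \<partial>lborel)"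
    proof (rule nn_integral_coordinate_cong[OF bB])
      fix x
      have fix_le: "\<theta> c (x + t *\<^sub>R b) v = \<theta> c x v" "\<rho> c (x + t *\<^sub>R b) v = \<rho> c x v"
        if "c \<in> Basis" "h c \<le> h b" for c t v
      proof -
        have "(x + t *\<^sub>R b) \<bullet> c' = x \<bullet> c'" if "c' \<in> Basis" "h c' < h c" for c'
          using that \<open>h c \<le> h b\<close> bB by (auto simp: inner_add_left inner_Basis)
        from dep[OF that(1) this] show "\<theta> c (x + t *\<^sub>R b) v = \<theta> c x v" "\<rho> c (x + t *\<^sub>R b) v = \<rho> c x v"
          by auto
      qed
      have comp: "(x + t *\<^sub>R b) \<bullet> c = x \<bullet> c" if "c \<in> Basis" "c \<noteq> b" for c t
        using that bB by (auto simp: inner_add_left inner_Basis)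
      have compb: "(x + t *\<^sub>R b) \<bullet> b = x \<bullet> b + t" for t
        using bB by (simp add: inner_add_left)
      define y where "y = (\<Sum>c\<in>Basis - {b}. (if c \<in> R then \<theta> c x (x \<bullet> c) else x \<bullet> c) *\<^sub>R c)"
      define p where "p = (\<Prod>c\<in>Basis - {b}. if c \<in> R then \<rho> c x (x \<bullet> c) else indicator (A c) (x \<bullet> c))"
      have hR: "h c \<le> h b" if "c \<in> R" for c using that b(2) by (auto simp: R_def)
      have cT: "(if c \<in> Q then \<theta> c (x + t *\<^sub>R b) ((x + t *\<^sub>R b) \<bullet> c) else (x + t *\<^sub>R b) \<bullet> c) =
          (if c \<in> R then \<theta> c x (x \<bullet> c) else x \<bullet> c)"
        and cw: "(if c \<in> Q then \<rho> c (x + t *\<^sub>R b) ((x + t *\<^sub>R b) \<bullet> c) else indicator (A c) ((x + t *\<^sub>R b) \<bullet> c)) =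
          (if c \<in> R then \<rho> c x (x \<bullet> c) else indicator (A c) (x \<bullet> c))"
        if "c \<in> Basis - {b}" "Q \<in> {R, S}" for c t Q
        using that fix_le[of c] comp[of c] hR[of c] by (auto simp: S)
      have sT: "(\<Sum>c\<in>Basis - {b}. (if c \<in> Q then \<theta> c (x + t *\<^sub>R b) ((x + t *\<^sub>R b) \<bullet> c)
            else (x + t *\<^sub>R b) \<bullet> c) *\<^sub>R c) = y"
        and sw: "(\<Prod>c\<in>Basis - {b}. if c \<in> Q then \<rho> c (x + t *\<^sub>R b) ((x + t *\<^sub>R b) \<bullet> c)
            else indicator (A c) ((x + t *\<^sub>R b) \<bullet> c)) = p"
        if "Q \<in> {R, S}" for t Q
        subgoal unfolding y_def by (rule sum.cong[OF refl]) (simp only: cT[OF _ that])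
        subgoal unfolding p_def by (rule prod.cong[OF refl]) (simp only: cw[OF _ that])
        done
      have TR: "T R (x + t *\<^sub>R b) = y + (x \<bullet> b + t) *\<^sub>R b" for t
        unfolding T_def sum.remove[OF finite_Basis bB]
        using bR by (simp add: compb add.commute sT)
      have TS: "T S (x + t *\<^sub>R b) = y + \<theta> b x (x \<bullet> b + t) *\<^sub>R b" for t
        unfolding T_def sum.remove[OF finite_Basis bB]
        using bB b(1) by (simp add: compb fix_le add.commute sT)
      have wR: "w R (x + t *\<^sub>R b) = indicator (A b) (x \<bullet> b + t) * p" for t
        unfolding w_def prod.remove[OF finite_Basis bB]
        using bR by (simp add: compb sw)
      have wS: "w S (x + t *\<^sub>R b) = \<rho> b x (x \<bullet> b + t) * p" for t
        unfolding w_def prod.remove[OF finite_Basis bB]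
        using bB b(1) by (simp add: compb fix_le sw)
      have m\<theta>b: "\<theta> b x \<in> borel_measurable borel" "\<rho> b x \<in> borel_measurable borel"
      proof -
        have [measurable]: "(\<lambda>t. x + (t - x \<bullet> b) *\<^sub>R b) \<in> borel_measurable borel" by measurable
        have "(\<lambda>t. \<theta> b (x + (t - x \<bullet> b) *\<^sub>R b) ((x + (t - x \<bullet> b) *\<^sub>R b) \<bullet> b)) \<in> borel_measurable borel"
          using m\<theta>[OF bB] by (rule measurable_compose[rotated]) measurable
        then show "\<theta> b x \<in> borel_measurable borel" using bB by (simp add: fix_le compb)
        have "(\<lambda>t. \<rho> b (x + (t - x \<bullet> b) *\<^sub>R b) ((x + (t - x \<bullet> b) *\<^sub>R b) \<bullet> b)) \<in> borel_measurable borel"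
          using m\<rho>[OF bB] by (rule measurable_compose[rotated]) measurable
        then show "\<rho> b x \<in> borel_measurable borel" using bB by (simp add: fix_le compb)
      qed
      note [measurable] = m\<theta>b mA[OF bB]
      define g where "g v = f (y + v *\<^sub>R b)" for v
      have [measurable]: "g \<in> borel_measurable borel" unfolding g_def by measurable
      have shift: "(\<integral>\<^sup>+t. k (x \<bullet> b + t) \<partial>lborel) = (\<integral>\<^sup>+t. k t \<partial>lborel)"
        if [measurable]: "k \<in> borel_measurable borel" for k :: "real \<Rightarrow> ennreal"
        using nn_integral_real_affine[of k 1 "x \<bullet> b"] by simp
      have "(\<integral>\<^sup>+t. f (T R (x + t *\<^sub>R b)) * w R (x + t *\<^sub>R b) \<partial>lborel) =
          (\<integral>\<^sup>+t. g (x \<bullet> b + t) * indicator (A b) (x \<bullet> b + t) * p \<partial>lborel)"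
        unfolding TR wR g_def by (simp add: mult.assoc)
      also have "\<dots> = (\<integral>\<^sup>+t. g t * indicator (A b) t * p \<partial>lborel)"
        by (rule shift[of "\<lambda>v. g v * indicator (A b) v * p"]) measurable
      also have "\<dots> = (\<integral>\<^sup>+t. g t * indicator (A b) t \<partial>lborel) * p"
        by (rule nn_integral_multc) measurable
      also have "\<dots> = (\<integral>\<^sup>+u. g (\<theta> b x u) * \<rho> b x u \<partial>lborel) * p"
        by (subst one[OF bB]) auto
      also have "\<dots> = (\<integral>\<^sup>+u. g (\<theta> b x u) * \<rho> b x u * p \<partial>lborel)"
        by (rule nn_integral_multc[symmetric]) measurable
      also have "\<dots> = (\<integral>\<^sup>+u. g (\<theta> b x (x \<bullet> b + u)) * \<rho> b x (x \<bullet> b + u) * p \<partial>lborel)"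
        by (rule shift[of "\<lambda>u. g (\<theta> b x u) * \<rho> b x u * p", symmetric]) measurable
      also have "\<dots> = (\<integral>\<^sup>+t. f (T S (x + t *\<^sub>R b)) * w S (x + t *\<^sub>R b) \<partial>lborel)"
        unfolding TS wS g_def by (simp add: mult.assoc)
      finally show "(\<integral>\<^sup>+t. f (T R (x + t *\<^sub>R b)) * w R (x + t *\<^sub>R b) \<partial>lborel) =
          (\<integral>\<^sup>+t. f (T S (x + t *\<^sub>R b)) * w S (x + t *\<^sub>R b) \<partial>lborel)" .
    qed measurable
    finally show ?case .
  qed
  show ?thesis
    using down[of Basis] unfolding T_def w_def by simp
qed

lemma nn_integral_affine_coordinate:
  fixes f :: "real \<Rightarrow> ennreal"
  assumes "f \<in> borel_measurable borel" "a \<noteq> 0"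
  shows "(\<integral>\<^sup>+t. f t \<partial>lborel) = (\<integral>\<^sup>+u. f (c + a * u) * ennreal \<bar>a\<bar> \<partial>lborel)"
proof -
  note [measurable] = assms(1)
  have "(\<integral>\<^sup>+u. f (c + a * u) * ennreal \<bar>a\<bar> \<partial>lborel) = (\<integral>\<^sup>+u. f (c + a * u) \<partial>lborel) * ennreal \<bar>a\<bar>"
    by (rule nn_integral_multc) measurable
  then show ?thesis
    using nn_integral_real_affine[OF assms, of c] by (simp add: mult.commute)
qed

text \<open>Both signs of the square root occur, hence \<open>\<bar>u\<bar>\<close> instead of \<open>2 * u\<close>. Integrating over the whole line
avoids a boundary at 0, where integration by parts would produce boundary terms.\<close>

lemma nn_integral_square_substitution:
  fixes f :: "real \<Rightarrow> ennreal"
  assumes [measurable]: "f \<in> borel_measurable borel"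
  shows "(\<integral>\<^sup>+t. f t * indicator {0<..} t \<partial>lborel) = (\<integral>\<^sup>+u. f (u\<^sup>2) * ennreal \<bar>u\<bar> \<partial>lborel)"
proof -
  define k where "k u = f (u\<^sup>2) * ennreal \<bar>u\<bar>" for u
  have [measurable]: "k \<in> borel_measurable borel" unfolding k_def by measurable
  have fin: "(\<integral>\<^sup>+t. f t * indicator {0..(real n)\<^sup>2} t \<partial>lborel) = (\<integral>\<^sup>+u. 2 * k u * indicator {0..real n} u \<partial>lborel)"
    if "n > 0" for n :: nat
  proof -
    have "(\<integral>\<^sup>+t. f t * indicator {0\<^sup>2..(real n)\<^sup>2} t \<partial>lborel) =
        (\<integral>\<^sup>+u. f (u\<^sup>2) * ennreal (2 * u) * indicator {0..real n} u \<partial>lborel)"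
      by (rule nn_integral_substitution_aux[where g = "\<lambda>u. u\<^sup>2"])
        (use that in \<open>auto intro!: derivative_eq_intros continuous_intros\<close>)
    also have "\<dots> = (\<integral>\<^sup>+u. 2 * k u * indicator {0..real n} u \<partial>lborel)"
      by (intro nn_integral_cong) (auto simp: k_def ennreal_mult mult_ac split: split_indicator)
    finally show ?thesis by simp
  qed
  have lim: "(\<integral>\<^sup>+t. q t * indicator {0<..} t \<partial>lborel) = (SUP n. \<integral>\<^sup>+t. q t * indicator {0..b n} t \<partial>lborel)"
    if [measurable]: "q \<in> borel_measurable borel" and b: "incseq b" "\<And>t. \<exists>n. t \<le> b n"
    for q :: "real \<Rightarrow> ennreal" and b :: "nat \<Rightarrow> real"
  proof -
    have "(SUP n. \<integral>\<^sup>+t. q t * indicator {0..b n} t \<partial>lborel) = (\<integral>\<^sup>+t. (SUP n. q t * indicator {0..b n} t) \<partial>lborel)"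
      by (rule nn_integral_monotone_convergence_SUP[symmetric])
        (use b(1) in \<open>auto simp: incseq_def le_fun_def split: split_indicator intro: order_trans\<close>)
    also have "\<dots> = (\<integral>\<^sup>+t. q t * indicator {0<..} t \<partial>lborel)"
    proof (rule nn_integral_cong_AE, rule AE_mp[OF AE_lborel_singleton[of 0]], rule AE_I2, rule impI)
      fix t :: real assume "t \<noteq> 0"
      show "(SUP n. q t * indicator {0..b n} t) = q t * indicator {0<..} t"
      proof (cases "t > 0")
        case True
        obtain n where "t \<le> b n" using b(2) by blast
        show ?thesis
          by (rule antisym, rule SUP_least)
            (use True \<open>t \<le> b n\<close> in \<open>auto split: split_indicator intro!: SUP_upper2[of n]\<close>)
      qed (use \<open>t \<noteq> 0\<close> in simp)
    qed
    finally show ?thesis by simp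
  qed
  have "(\<integral>\<^sup>+t. f t * indicator {0<..} t \<partial>lborel) =
      (SUP n. \<integral>\<^sup>+t. f t * indicator {0..(real (Suc n))\<^sup>2} t \<partial>lborel)"
  proof (rule lim)
    show "\<exists>n. t \<le> (real (Suc n))\<^sup>2" for t
    proof -
      obtain n where n: "t \<le> real n" using real_arch_simple by blast
      have "real n \<le> (real (Suc n))\<^sup>2" by (simp add: power2_eq_square algebra_simps)
      then show ?thesis using n by (meson order_trans)
    qed
    show "incseq (\<lambda>n. (real (Suc n))\<^sup>2)" by (auto simp: incseq_def intro!: power_mono)
  qed measurable
  also have "\<dots> = (SUP n. \<integral>\<^sup>+u. 2 * k u * indicator {0..real (Suc n)} u \<partial>lborel)"
    using fin[of "Suc _"] by simp
  also have "\<dots> = (\<integral>\<^sup>+u. 2 * k u * indicator {0<..} u \<partial>lborel)"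
  proof (rule lim[symmetric])
    show "\<exists>n. t \<le> real (Suc n)" for t
      using real_arch_simple[of t] by (metis le_Suc_eq of_nat_mono order_refl order_trans)
  qed (auto simp: incseq_def)
  also have "\<dots> = 2 * (\<integral>\<^sup>+u. k u * indicator {0<..} u \<partial>lborel)"
    by (simp add: mult.assoc nn_integral_cmult)
  also have "\<dots> = (\<integral>\<^sup>+u. k u * indicator {0<..} u \<partial>lborel) + (\<integral>\<^sup>+u. k u * indicator {..<0} u \<partial>lborel)"
  proof -
    have "(\<integral>\<^sup>+u. k u * indicator {..<0} u \<partial>lborel) =
        (\<integral>\<^sup>+u. k (0 + - 1 * u) * indicator {..<0} (0 + - 1 * u) * ennreal \<bar>- 1\<bar> \<partial>lborel)"
      by (rule nn_integral_affine_coordinate) auto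
    also have "\<dots> = (\<integral>\<^sup>+u. k u * indicator {0<..} u \<partial>lborel)"
      by (intro nn_integral_cong) (auto simp: k_def split: split_indicator)
    finally show ?thesis by (simp add: mult_2)
  qed
  also have "\<dots> = (\<integral>\<^sup>+u. k u * indicator {0<..} u + k u * indicator {..<0} u \<partial>lborel)"
    by (rule nn_integral_add[symmetric]) measurable
  also have "\<dots> = (\<integral>\<^sup>+u. k u \<partial>lborel)"
    by (intro nn_integral_cong) (auto simp: k_def split: split_indicator)
  finally show ?thesis unfolding k_def .
qed

section \<open>Holomorphic functions of two variables\<close>

lemma holomorphic2_on_along_line:
  assumes "holomorphic2_on f U"
  shows "(\<lambda>\<zeta>. f (a1 + \<zeta> * h1, a2 + \<zeta> * h2)) holomorphic_on {\<zeta>. (a1 + \<zeta> * h1, a2 + \<zeta> * h2) \<in> U}"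
proof (rule holomorphic_onI)
  fix z assume z: "z \<in> {\<zeta>. (a1 + \<zeta> * h1, a2 + \<zeta> * h2) \<in> U}"
  then obtain a b where d: "(f has_derivative (\<lambda>(k1, k2). a * k1 + b * k2)) (at (a1 + z * h1, a2 + z * h2))"
    using assms unfolding holomorphic2_on_def by blast
  have l: "((\<lambda>\<zeta>. (a1 + \<zeta> * h1, a2 + \<zeta> * h2)) has_derivative (\<lambda>k. (k * h1, k * h2))) (at z)"
    by (auto intro!: derivative_eq_intros)
  have "((\<lambda>\<zeta>. f (a1 + \<zeta> * h1, a2 + \<zeta> * h2)) has_field_derivative (a * h1 + b * h2)) (at z)"
    unfolding has_field_derivative_def
    by (rule has_derivative_eq_rhs[OF has_derivative_compose[OF l d]]) (auto simp: algebra_simps)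
  then show "(\<lambda>\<zeta>. f (a1 + \<zeta> * h1, a2 + \<zeta> * h2)) field_differentiable at z within
      {\<zeta>. (a1 + \<zeta> * h1, a2 + \<zeta> * h2) \<in> U}"
    using field_differentiable_at_within field_differentiable_def by blast
qed

lemma holomorphic2_on_open: "holomorphic2_on f U \<Longrightarrow> open U"
  by (simp add: holomorphic2_on_def)

lemma holomorphic2_on_subset: "holomorphic2_on f U \<Longrightarrow> open V \<Longrightarrow> V \<subseteq> U \<Longrightarrow> holomorphic2_on f V"
  unfolding holomorphic2_on_def by blast

lemma holomorphic2_on_cong:
  assumes "holomorphic2_on f U" "\<And>s. s \<in> U \<Longrightarrow> g s = f s"
  shows "holomorphic2_on g U"
  unfolding holomorphic2_on_def
proof (intro conjI ballI)
  show "open U" using assms(1) by (rule holomorphic2_on_open)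
  fix s assume s: "s \<in> U"
  with assms(1) obtain a b where "(f has_derivative (\<lambda>(k1, k2). a * k1 + b * k2)) (at s)"
    unfolding holomorphic2_on_def by blast
  then have "(g has_derivative (\<lambda>(k1, k2). a * k1 + b * k2)) (at s)"
    using \<open>open U\<close> s by (rule has_derivative_transform_within_open) (simp add: assms(2))
  then show "\<exists>a b. (g has_derivative (\<lambda>(h1, h2). a * h1 + b * h2)) (at s)" by blast
qed

lemma holomorphic2_on_const: "open U \<Longrightarrow> holomorphic2_on (\<lambda>s. c) U"
  unfolding holomorphic2_on_def
  by (auto intro!: exI[of _ 0] simp: case_prod_unfold)

lemma holomorphic2_on_mult:
  assumes "holomorphic2_on f U" "holomorphic2_on g U"
  shows "holomorphic2_on (\<lambda>s. f s * g s) U"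
  unfolding holomorphic2_on_def
proof (intro conjI ballI)
  show "open U" using assms(1) by (rule holomorphic2_on_open)
  fix s assume s: "s \<in> U"
  from assms(1) s obtain a b where f: "(f has_derivative (\<lambda>(k1, k2). a * k1 + b * k2)) (at s)"
    unfolding holomorphic2_on_def by blast
  from assms(2) s obtain a' b' where g: "(g has_derivative (\<lambda>(k1, k2). a' * k1 + b' * k2)) (at s)"
    unfolding holomorphic2_on_def by blast
  have "((\<lambda>s. f s * g s) has_derivative
      (\<lambda>(k1, k2). (f s * a' + a * g s) * k1 + (f s * b' + b * g s) * k2)) (at s)"
    using has_derivative_mult[OF f g] by (simp add: case_prod_unfold algebra_simps)
  then show "\<exists>a b. ((\<lambda>s. f s * g s) has_derivative (\<lambda>(h1, h2). a * h1 + b * h2)) (at s)"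
    by blast
qed

lemma holomorphic2_on_prod:
  assumes "open U" "\<And>i. i \<in> I \<Longrightarrow> holomorphic2_on (f i) U"
  shows "holomorphic2_on (\<lambda>s. \<Prod>i\<in>I. f i s) U"
  using assms(2)
  by (induction I rule: infinite_finite_induct)
    (auto intro: holomorphic2_on_const holomorphic2_on_mult assms(1))

lemma holomorphic2_on_add:
  assumes "holomorphic2_on f U" "holomorphic2_on g U"
  shows "holomorphic2_on (\<lambda>s. f s + g s) U"
  unfolding holomorphic2_on_def
proof (intro conjI ballI)
  show "open U" using assms(1) by (rule holomorphic2_on_open)
  fix s assume s: "s \<in> U"
  from assms(1) s obtain a b where f: "(f has_derivative (\<lambda>(k1, k2). a * k1 + b * k2)) (at s)"
    unfolding holomorphic2_on_def by blast
  from assms(2) s obtain a' b' where g: "(g has_derivative (\<lambda>(k1, k2). a' * k1 + b' * k2)) (at s)"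
    unfolding holomorphic2_on_def by blast
  have "((\<lambda>s. f s + g s) has_derivative (\<lambda>(k1, k2). (a + a') * k1 + (b + b') * k2)) (at s)"
    using has_derivative_add[OF f g] by (simp add: case_prod_unfold algebra_simps)
  then show "\<exists>a b. ((\<lambda>s. f s + g s) has_derivative (\<lambda>(h1, h2). a * h1 + b * h2)) (at s)"
    by blast
qed

lemma holomorphic2_on_sum:
  assumes "open U" "\<And>i. i \<in> I \<Longrightarrow> holomorphic2_on (f i) U"
  shows "holomorphic2_on (\<lambda>s. \<Sum>i\<in>I. f i s) U"
  using assms(2)
  by (induction I rule: infinite_finite_induct)
    (auto intro: holomorphic2_on_const holomorphic2_on_add assms(1))

lemma holomorphic2_on_compose_affine:
  assumes g: "g holomorphic_on V" and V: "open V" and U: "open U"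
    and sub: "\<And>s. s \<in> U \<Longrightarrow> \<alpha> * fst s + \<beta> * snd s + c \<in> V"
  shows "holomorphic2_on (\<lambda>s. g (\<alpha> * fst s + \<beta> * snd s + c)) U"
  unfolding holomorphic2_on_def
proof (intro conjI ballI)
  fix s assume s: "s \<in> U"
  obtain g' where g': "(g has_field_derivative g') (at (\<alpha> * fst s + \<beta> * snd s + c))"
    using holomorphic_on_imp_differentiable_at[OF g V sub[OF s]] unfolding field_differentiable_def by blast
  have "((\<lambda>s. \<alpha> * fst s + \<beta> * snd s + c) has_derivative (\<lambda>k. \<alpha> * fst k + \<beta> * snd k)) (at s)"
    by (auto intro!: derivative_eq_intros)
  from has_derivative_compose[OF this g'[unfolded has_field_derivative_def]]
  have "((\<lambda>s. g (\<alpha> * fst s + \<beta> * snd s + c)) has_derivative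
      (\<lambda>(k1, k2). (g' * \<alpha>) * k1 + (g' * \<beta>) * k2)) (at s)"
    by (simp add: case_prod_unfold algebra_simps)
  then show "\<exists>a b. ((\<lambda>s. g (\<alpha> * fst s + \<beta> * snd s + c)) has_derivative (\<lambda>(h1, h2). a * h1 + b * h2)) (at s)"
    by blast
qed (rule U)

text \<open>Restricting to a complex line through a point of \<open>W\<close> reduces the identity theorem to that of one
variable. Convexity makes the part of the line that lies in \<open>U\<close> connected.\<close>

lemma holomorphic2_identity:
  assumes f: "holomorphic2_on f U" and g: "holomorphic2_on g U" and U: "convex U"
    and W: "open W" "W \<noteq> {}" "W \<subseteq> U" and eq: "\<And>s. s \<in> W \<Longrightarrow> f s = g s" and s: "s \<in> U"
  shows "f s = g s"
proof -
  obtain a1 a2 where a: "(a1, a2) \<in> W" using W(2) by fastforce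
  obtain s1 s2 where s12: "s = (s1, s2)" by fastforce
  define L where "L \<zeta> = (a1 + \<zeta> * (s1 - a1), a2 + \<zeta> * (s2 - a2))" for \<zeta>
  have contL: "continuous_on UNIV L" unfolding L_def by (intro continuous_intros)
  have "open U" using f by (rule holomorphic2_on_open)
  have oV: "open (L -` U)" "open (L -` W)"
    using contL \<open>open U\<close> W(1) by (auto simp: continuous_on_open_vimage)
  have "convex (L -` U)"
  proof (rule convexI)
    fix x y :: complex and u v :: real
    assume xy: "x \<in> L -` U" "y \<in> L -` U" and uv: "0 \<le> u" "0 \<le> v" "u + v = 1"
    have "L (u *\<^sub>R x + v *\<^sub>R y) = u *\<^sub>R L x + v *\<^sub>R L y"
    proof -
      have v: "v = 1 - u" using uv(3) by simp
      have "u *\<^sub>R (c + x * e) + v *\<^sub>R (c + y * e) = c + (u *\<^sub>R x + v *\<^sub>R y) * e" for c e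
        unfolding v scaleR_conv_of_real of_real_diff of_real_1 by algebra
      then show ?thesis by (simp only: L_def scaleR_Pair add_Pair)
    qed
    then show "u *\<^sub>R x + v *\<^sub>R y \<in> L -` U"
      using convexD[OF U, of "L x" "L y" u v] xy uv by simp
  qed
  then have conn: "connected (L -` U)" by (rule convex_connected)
  have L0: "L 0 = (a1, a2)" and L1: "L 1 = s" by (auto simp: L_def s12)
  have "(\<lambda>\<zeta>. f (L \<zeta>)) holomorphic_on L -` U" "(\<lambda>\<zeta>. g (L \<zeta>)) holomorphic_on L -` U"
    using holomorphic2_on_along_line[OF f, of a1 "s1 - a1" a2 "s2 - a2"]
      holomorphic2_on_along_line[OF g, of a1 "s1 - a1" a2 "s2 - a2"]
    by (auto simp: L_def vimage_def)
  then have hol: "(\<lambda>\<zeta>. f (L \<zeta>) - g (L \<zeta>)) holomorphic_on L -` U" by (intro holomorphic_on_diff)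
  have lim: "0 islimpt (L -` W)"
    using oV(2) a by (intro interior_limit_point) (auto simp: interior_open L0)
  have "f (L 1) - g (L 1) = 0"
  proof (rule analytic_continuation[OF hol oV(1) conn _ _ lim])
    show "L -` W \<subseteq> L -` U" using W(3) by (rule vimage_mono)
    show "f (L z) - g (L z) = 0" if "z \<in> L -` W" for z using that eq by simp
    show "0 \<in> L -` U" "1 \<in> L -` U" using a W(3) s by (auto simp: L0 L1)
  qed
  then show ?thesis by (simp add: L1)
qed

text \<open>Cauchy's inequality on discs of radius \<open>R / 4\<close> bounds the second derivative near the unit segment, so
that a bound for a holomorphic function alone gives a quadratic error in its linear approximation.\<close>

lemma holomorphic_second_order_remainder:
  assumes f: "f holomorphic_on ball 0 R" and R: "R \<ge> 4" and B: "\<And>z. z \<in> ball 0 R \<Longrightarrow> norm (f z) \<le> B"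
  shows "norm (f 1 - f 0 - deriv f 0) \<le> 32 * B / R\<^sup>2"
proof -
  have d2: "norm ((deriv ^^ 2) f w) \<le> 32 * B / R\<^sup>2" if w: "w \<in> ball 0 2" for w
  proof -
    have sub: "cball w (R / 4) \<subseteq> ball 0 R"
    proof
      fix z assume "z \<in> cball w (R / 4)"
      then have "norm z \<le> norm w + R / 4"
        using norm_triangle_sub[of z w] by (simp add: dist_norm norm_minus_commute)
      then show "z \<in> ball 0 R" using w R by simp
    qed
    have "norm ((deriv ^^ 2) f w) \<le> fact 2 * B / (R / 4) ^ 2"
    proof (rule Cauchy_inequality)
      show "f holomorphic_on ball w (R / 4)" "continuous_on (cball w (R / 4)) f"
        using f sub by (meson ball_subset_cball holomorphic_on_subset holomorphic_on_imp_continuous_on order_trans)+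
      show "norm (f x) \<le> B" if "norm (w - x) = R / 4" for x
        using that sub by (intro B) (auto simp: dist_norm)
    qed (use R in auto)
    then show ?thesis by (simp add: power2_eq_square field_simps)
  qed
  have hol: "(deriv ^^ n) f holomorphic_on ball 0 R" for n
    using f by (intro holomorphic_higher_deriv) auto
  have "norm ((deriv ^^ 0) f 1 - (\<Sum>i\<le>1. (deriv ^^ i) f 0 * (1 - 0) ^ i / fact i)) \<le> 32 * B / R\<^sup>2 * norm (1 - 0 :: complex) ^ Suc 1 / fact 1"
  proof (rule complex_Taylor[of "ball 0 2" 1 "\<lambda>i. (deriv ^^ i) f" "32 * B / R\<^sup>2" 0 1])
    fix i :: nat and x :: complex assume "x \<in> ball 0 2" "i \<le> 1"
    then have "x \<in> ball 0 R" using R by auto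
    then have "((deriv ^^ i) f has_field_derivative (deriv ^^ Suc i) f x) (at x)"
      using holomorphic_derivI[OF hol[of i] open_ball] by simp
    then show "((deriv ^^ i) f has_field_derivative (deriv ^^ Suc i) f x) (at x within ball 0 2)"
      by (rule has_field_derivative_at_within)
  qed (use d2 in \<open>auto simp: numeral_2_eq_2\<close>)
  then show ?thesis by (simp add: algebra_simps)
qed

text \<open>On complex lines, a locally uniform integrable bound on the integrand controls its second-order remainder, which can
then be integrated.\<close>

lemma holomorphic2_on_integral:
  fixes k :: "complex \<times> complex \<Rightarrow> 'x \<Rightarrow> complex"
  assumes U: "open U"
    and meas: "\<And>s. s \<in> U \<Longrightarrow> k s \<in> borel_measurable M"
    and hol: "\<And>x. x \<in> space M \<Longrightarrow> holomorphic2_on (\<lambda>s. k s x) U"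
    and dom: "\<And>s0. s0 \<in> U \<Longrightarrow> \<exists>r>0. \<exists>H. integrable M H \<and>
      (\<forall>s\<in>ball s0 r. s \<in> U \<and> (\<forall>x\<in>space M. norm (k s x) \<le> H x))"
  shows "holomorphic2_on (\<lambda>s. \<integral>x. k s x \<partial>M) U"
  unfolding holomorphic2_on_def
proof (intro conjI ballI)
  fix s0 assume s0: "s0 \<in> U"
  obtain r H where r: "r > 0" and H: "integrable M H"
    and rU: "\<And>s. s \<in> ball s0 r \<Longrightarrow> s \<in> U" and kH: "\<And>s x. s \<in> ball s0 r \<Longrightarrow> x \<in> space M \<Longrightarrow> norm (k s x) \<le> H x"
    using dom[OF s0] by blast
  have "\<exists>a b. ((\<lambda>s. k s x) has_derivative (\<lambda>(h1, h2). a * h1 + b * h2)) (at s0)" if "x \<in> space M" for x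
    using hol[OF that] s0 unfolding holomorphic2_on_def by blast
  then obtain a b where ab: "\<And>x. x \<in> space M \<Longrightarrow>
      ((\<lambda>s. k s x) has_derivative (\<lambda>(h1, h2). a x * h1 + b x * h2)) (at s0)"
    by metis
  obtain p p' where pq: "s0 = (p, p')" by fastforce
  have int: "integrable M (k s)" if "s \<in> ball s0 r" for s
    using H by (rule Bochner_Integration.integrable_bound)
      (use that kH[OF that] rU meas in \<open>auto intro!: AE_I2 order_trans[OF _ abs_ge_self]\<close>)
  have rem: "norm (k (s0 + h) x - k s0 x - (a x * fst h + b x * snd h)) \<le> 32 * H x * (norm h)\<^sup>2 / r\<^sup>2"
    if x: "x \<in> space M" and h: "norm h \<le> r / 4" for x h
  proof (cases "h = 0")
    case False
    \<comment> \<open>the line through \<open>s0\<close> in direction \<open>h\<close> stays in the ball for parameters below \<open>R\<close>\<close>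
    define R where "R = r / norm h"
    have R4: "R \<ge> 4" using h False r by (simp add: R_def field_simps)
    define f where "f \<zeta> = k (p + \<zeta> * fst h, p' + \<zeta> * snd h) x" for \<zeta>
    have nrm: "norm (\<zeta> * fst h, \<zeta> * snd h) = norm \<zeta> * norm h" for \<zeta>
      by (simp add: norm_Pair norm_prod_def norm_mult power_mult_distrib real_sqrt_mult flip: distrib_left)
    have inb: "(p + \<zeta> * fst h, p' + \<zeta> * snd h) \<in> ball s0 r" if "\<zeta> \<in> ball 0 R" for \<zeta>
    proof -
      have "dist s0 (p + \<zeta> * fst h, p' + \<zeta> * snd h) = norm (\<zeta> * fst h, \<zeta> * snd h)"
        unfolding pq dist_norm by (simp add: norm_Pair)
      also have "\<dots> < r" using that False unfolding nrm by (simp add: R_def field_simps)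
      finally show ?thesis by simp
    qed
    have "f holomorphic_on ball 0 R"
      unfolding f_def
      by (rule holomorphic_on_subset[OF holomorphic2_on_along_line[OF hol[OF x]]]) (use inb rU in auto)
    moreover have "norm (f \<zeta>) \<le> H x" if "\<zeta> \<in> ball 0 R" for \<zeta>
      unfolding f_def by (rule kH[OF inb[OF that] x])
    ultimately have "norm (f 1 - f 0 - deriv f 0) \<le> 32 * H x / R\<^sup>2"
      using R4 by (intro holomorphic_second_order_remainder) auto
    moreover have "deriv f 0 = a x * fst h + b x * snd h"
    proof (rule DERIV_imp_deriv)
      have d: "((\<lambda>s. k s x) has_derivative (\<lambda>(k1, k2). a x * k1 + b x * k2)) (at (p + 0 * fst h, p' + 0 * snd h))"
        using ab[OF x] by (simp add: pq)
      have l: "((\<lambda>\<zeta>. (p + \<zeta> * fst h, p' + \<zeta> * snd h)) has_derivative (\<lambda>k. (k * fst h, k * snd h))) (at 0)"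
        by (auto intro!: derivative_eq_intros)
      show "(f has_field_derivative (a x * fst h + b x * snd h)) (at 0)"
        unfolding has_field_derivative_def f_def
        by (rule has_derivative_eq_rhs[OF has_derivative_compose[OF l d]]) (auto simp: algebra_simps)
    qed
    moreover have "f 1 = k (s0 + h) x" "f 0 = k s0 x"
      by (simp_all add: f_def pq plus_prod_def)
    ultimately show ?thesis using False by (simp add: R_def field_simps)
  qed simp
  define t where "t = r / 4"
  have t: "t > 0" "t < r" using r by (auto simp: t_def)
  \<comment> \<open>the partial derivatives are limits of difference quotients, which are measurable and dominated\<close>
  have lim: "c \<in> borel_measurable M \<and> integrable M c"
    if c: "\<And>x. x \<in> space M \<Longrightarrow> a x * fst h + b x * snd h = c x" and nh: "norm h = 1" for c h
  proof -
    have nin: "s0 + (u * t) *\<^sub>R h \<in> ball s0 r" if "0 \<le> u" "u \<le> 1" for u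
    proof -
      have "u * t \<le> 1 * t" using that t by (intro mult_right_mono) auto
      then have "u * t < r" using t by linarith
      then show ?thesis using that nh t by (simp add: dist_norm abs_mult)
    qed
    define q where "q n x = (k (s0 + (inverse (Suc n) * t) *\<^sub>R h) x - k s0 x) / of_real (inverse (Suc n) * t)" for n x
    have qlim: "(\<lambda>n. q n x) \<longlonglongrightarrow> c x"
      if x: "x \<in> space M" for x
      unfolding q_def
    proof (rule LIM_zero_cancel, rule Lim_null_comparison)
      show "\<forall>\<^sub>F n in sequentially.
          norm ((k (s0 + (inverse (Suc n) * t) *\<^sub>R h) x - k s0 x) / of_real (inverse (Suc n) * t) - c x)
          \<le> (32 * H x * t / r\<^sup>2) * inverse (Suc n)"
      proof (rule eventuallyI)
        fix n
        define e where "e = inverse (real (Suc n)) * t"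
        have e: "e > 0" "e \<le> t" using t by (auto simp: e_def field_simps)
        have "norm (k (s0 + e *\<^sub>R h) x - k s0 x - (a x * fst (e *\<^sub>R h) + b x * snd (e *\<^sub>R h))) \<le> 32 * H x * (norm (e *\<^sub>R h))\<^sup>2 / r\<^sup>2"
          using e nh by (intro rem[OF x]) (auto simp: t_def)
        moreover have "a x * fst (e *\<^sub>R h) + b x * snd (e *\<^sub>R h) = of_real e * c x"
          unfolding c[OF x, symmetric] by (simp add: scaleR_conv_of_real algebra_simps)
        ultimately have *: "norm (k (s0 + e *\<^sub>R h) x - k s0 x - of_real e * c x) \<le> 32 * H x * e\<^sup>2 / r\<^sup>2"
          using nh e by simp
        have "(k (s0 + e *\<^sub>R h) x - k s0 x) / of_real e - c x = (k (s0 + e *\<^sub>R h) x - k s0 x - of_real e * c x) / of_real e"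
          using e by (simp add: field_simps)
        then have "norm ((k (s0 + e *\<^sub>R h) x - k s0 x) / of_real e - c x) = norm (k (s0 + e *\<^sub>R h) x - k s0 x - of_real e * c x) / e"
          using e by (simp add: norm_divide)
        also have "\<dots> \<le> (32 * H x * e\<^sup>2 / r\<^sup>2) / e" using * e by (intro divide_right_mono) auto
        also have "\<dots> = (32 * H x * t / r\<^sup>2) * inverse (Suc n)" using e by (simp add: e_def power2_eq_square)
        finally show "norm ((k (s0 + (inverse (Suc n) * t) *\<^sub>R h) x - k s0 x) / of_real (inverse (Suc n) * t) - c x)
          \<le> (32 * H x * t / r\<^sup>2) * inverse (Suc n)" unfolding e_def .
      qed
      show "(\<lambda>n. (32 * H x * t / r\<^sup>2) * inverse (Suc n)) \<longlonglongrightarrow> 0"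
        by (rule tendsto_mult_right_zero) (rule LIMSEQ_inverse_real_of_nat)
    qed
    have qmeas: "q n \<in> borel_measurable M" for n
    proof -
      have [measurable]: "k (s0 + (inverse (Suc n) * t) *\<^sub>R h) \<in> borel_measurable M" "k s0 \<in> borel_measurable M"
        using s0 rU[OF nin[of "inverse (Suc n)"]] meas by (auto simp: field_simps)
      show ?thesis unfolding q_def by measurable
    qed
    have cm: "c \<in> borel_measurable M" by (rule borel_measurable_LIMSEQ_metric[OF qmeas qlim])
    have "integrable M c"
    proof (rule Bochner_Integration.integrable_bound[OF _ cm])
      show "integrable M (\<lambda>x. (2 * H x + 32 * H x * t\<^sup>2 / r\<^sup>2) / t)" using H by simp
      show "AE x in M. norm (c x) \<le> norm ((2 * H x + 32 * H x * t\<^sup>2 / r\<^sup>2) / t)"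
      proof (rule AE_I2)
        fix x assume x: "x \<in> space M"
        have "norm (k (s0 + t *\<^sub>R h) x - k s0 x - (a x * fst (t *\<^sub>R h) + b x * snd (t *\<^sub>R h))) \<le> 32 * H x * (norm (t *\<^sub>R h))\<^sup>2 / r\<^sup>2"
          using t nh by (intro rem[OF x]) (auto simp: t_def)
        moreover have "a x * fst (t *\<^sub>R h) + b x * snd (t *\<^sub>R h) = of_real t * c x"
          unfolding c[OF x, symmetric] by (simp add: scaleR_conv_of_real algebra_simps)
        ultimately have *: "norm (k (s0 + t *\<^sub>R h) x - k s0 x - of_real t * c x) \<le> 32 * H x * t\<^sup>2 / r\<^sup>2"
          using nh t by simp
        have "norm (of_real t * c x) \<le> norm (k (s0 + t *\<^sub>R h) x) + norm (k s0 x) + norm (k (s0 + t *\<^sub>R h) x - k s0 x - of_real t * c x)"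
          using norm_triangle_ineq4[of "k (s0 + t *\<^sub>R h) x - k s0 x" "k (s0 + t *\<^sub>R h) x - k s0 x - of_real t * c x"]
            norm_triangle_ineq4[of "k (s0 + t *\<^sub>R h) x" "k s0 x"] by simp
        also have "\<dots> \<le> H x + H x + 32 * H x * t\<^sup>2 / r\<^sup>2"
          using nin[of 1] r x by (intro add_mono * kH) auto
        finally have "t * norm (c x) \<le> 2 * H x + 32 * H x * t\<^sup>2 / r\<^sup>2" using t by (simp add: norm_mult)
        then show "norm (c x) \<le> norm ((2 * H x + 32 * H x * t\<^sup>2 / r\<^sup>2) / t)"
          using t by (simp add: field_simps)
      qed
    qed
    with cm show ?thesis by simp
  qed
  have ia: "integrable M a" and ib: "integrable M b"
    using lim[of "(1, 0)" a] lim[of "(0, 1)" b] by auto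
  define A where "A = (\<integral>x. a x \<partial>M)"
  define B where "B = (\<integral>x. b x \<partial>M)"
  define C where "C = 32 * (\<integral>x. H x \<partial>M) / r\<^sup>2"
  have bound: "norm ((\<integral>x. k (s0 + h) x \<partial>M) - (\<integral>x. k s0 x \<partial>M) - (case h of (h1, h2) \<Rightarrow> A * h1 + B * h2)) \<le> C * (norm h)\<^sup>2"
    if h: "norm h \<le> t" for h
  proof -
    have i1: "integrable M (k (s0 + h))" "integrable M (k s0)"
      using h t r by (auto intro!: int simp: dist_norm)
    have "(\<integral>x. k (s0 + h) x \<partial>M) - (\<integral>x. k s0 x \<partial>M) - (case h of (h1, h2) \<Rightarrow> A * h1 + B * h2) =
        (\<integral>x. k (s0 + h) x - k s0 x - (a x * fst h + b x * snd h) \<partial>M)"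
      using i1 ia ib by (simp add: A_def B_def case_prod_unfold)
    also have "norm \<dots> \<le> (\<integral>x. norm (k (s0 + h) x - k s0 x - (a x * fst h + b x * snd h)) \<partial>M)"
      by (rule integral_norm_bound)
    also have "\<dots> \<le> (\<integral>x. 32 * H x * (norm h)\<^sup>2 / r\<^sup>2 \<partial>M)"
      using i1 ia ib H rem h by (intro integral_mono) (auto simp: t_def)
    also have "\<dots> = C * (norm h)\<^sup>2" by (simp add: C_def)
    finally show ?thesis .
  qed
  have "((\<lambda>s. \<integral>x. k s x \<partial>M) has_derivative (\<lambda>(h1, h2). A * h1 + B * h2)) (at s0)"
    unfolding has_derivative_at
  proof
    show "bounded_linear (\<lambda>(h1, h2). A * h1 + B * h2)"
      unfolding case_prod_unfold
      by (intro bounded_linear_add bounded_linear_const_mult bounded_linear_fst bounded_linear_snd)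
    show "(\<lambda>h. norm ((\<integral>x. k (s0 + h) x \<partial>M) - (\<integral>x. k s0 x \<partial>M) - (case h of (h1, h2) \<Rightarrow> A * h1 + B * h2)) / norm h) \<midarrow>0\<rightarrow> 0"
    proof (rule Lim_null_comparison)
      show "\<forall>\<^sub>F h in at 0. norm (norm ((\<integral>x. k (s0 + h) x \<partial>M) - (\<integral>x. k s0 x \<partial>M) - (case h of (h1, h2) \<Rightarrow> A * h1 + B * h2)) / norm h) \<le> C * norm h"
        unfolding eventually_at
      proof (intro exI[of _ t] conjI ballI impI)
        fix h :: "complex \<times> complex" assume "h \<noteq> 0 \<and> dist h 0 < t"
        then show "norm (norm ((\<integral>x. k (s0 + h) x \<partial>M) - (\<integral>x. k s0 x \<partial>M) - (case h of (h1, h2) \<Rightarrow> A * h1 + B * h2)) / norm h) \<le> C * norm h"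
          using bound[of h] by (simp add: field_simps power2_eq_square)
      qed (use t in auto)
      show "((\<lambda>h. C * norm h) \<longlongrightarrow> 0) (at 0)"
        by (intro tendsto_mult_right_zero tendsto_norm_zero tendsto_ident_at)
    qed
  qed
  then show "\<exists>a b. ((\<lambda>s. \<integral>x. k s x \<partial>M) has_derivative (\<lambda>(h1, h2). a * h1 + b * h2)) (at s0)" by blast
qed (rule U)

section \<open>Integrating powers against rapidly decreasing functions\<close>

lemma integrable_powr_pieces:
  fixes \<sigma> :: real
  assumes "\<sigma> > -1"
  shows "integrable lborel (\<lambda>t::real. indicator {0..1} t * t powr \<sigma>)"
    and "integrable lborel (\<lambda>t::real. indicator {1..} t * t powr (-2))"
proof -
  have "((\<lambda>t::real. t powr \<sigma>) has_integral (1 powr (\<sigma> + 1) / (\<sigma> + 1))) {0..1}"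
    using assms by (intro has_integral_powr_from_0) auto
  moreover have "(\<lambda>t::real. indicator {0..1} t * t powr \<sigma>) = (\<lambda>t. if t \<in> {0..1} then t powr \<sigma> else 0)"
    by (auto simp: fun_eq_iff)
  ultimately have "((\<lambda>t::real. indicator {0..1} t * t powr \<sigma>) has_integral (1 powr (\<sigma> + 1) / (\<sigma> + 1))) UNIV"
    by (simp only: has_integral_restrict_UNIV)
  from nn_integral_has_integral_lborel[OF _ _ this]
  have "(\<integral>\<^sup>+t. ennreal (indicator {0..1} t * t powr \<sigma>) \<partial>lborel) < \<infinity>" by simp
  then show "integrable lborel (\<lambda>t::real. indicator {0..1} t * t powr \<sigma>)"
    by (intro integrableI_nonneg) auto
  have "((\<lambda>t::real. t powr (-2)) has_integral (-(1 powr (-2 + 1)) / (-2 + 1))) {1..}"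
    by (intro has_integral_powr_to_inf) auto
  moreover have "(\<lambda>t::real. indicator {1..} t * t powr (-2)) = (\<lambda>t. if t \<in> {1..} then t powr (-2) else 0)"
    by (auto simp: fun_eq_iff)
  ultimately have "((\<lambda>t::real. indicator {1..} t * t powr (-2)) has_integral (-(1 powr (-2 + 1)) / (-2 + 1))) UNIV"
    by (simp only: has_integral_restrict_UNIV)
  from nn_integral_has_integral_lborel[OF _ _ this]
  have "(\<integral>\<^sup>+t. ennreal (indicator {1..} t * t powr (-2)) \<partial>lborel) < \<infinity>" by simp
  then show "integrable lborel (\<lambda>t::real. indicator {1..} t * t powr (-2))"
    by (intro integrableI_nonneg) auto
qed

lemma integrable_powr_decay:
  fixes \<sigma> :: real
  assumes "\<sigma> > -1" "real M \<ge> \<sigma> + 2"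
  shows "integrable lborel (\<lambda>t::real. \<bar>t\<bar> powr \<sigma> / (1 + \<bar>t\<bar>) ^ M)"
proof -
  define g where "g t = indicator {0..1} t * t powr \<sigma> + indicator {1..} t * t powr (-2)" for t :: real
  have g: "integrable lborel g" unfolding g_def using integrable_powr_pieces[OF assms(1)] by simp
  then have "integrable lborel (\<lambda>t. g (0 + (-1) * t))"
    by (subst lborel_integrable_real_affine_iff) auto
  with g have "integrable lborel (\<lambda>t. g t + g (- t))" by simp
  then show ?thesis
  proof (rule Bochner_Integration.integrable_bound)
    show "AE t in lborel. norm (\<bar>t\<bar> powr \<sigma> / (1 + \<bar>t\<bar>) ^ M) \<le> norm (g t + g (- t))"
    proof (rule AE_I2)
      fix t :: real
      have pos: "\<bar>s\<bar> powr \<sigma> / (1 + \<bar>s\<bar>) ^ M \<le> g s" if s: "s \<ge> 0" for s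
      proof (cases "s \<le> 1")
        case True
        have "\<bar>s\<bar> powr \<sigma> / (1 + \<bar>s\<bar>) ^ M \<le> s powr \<sigma> / 1"
          using s by (intro frac_le) auto
        also have "s powr \<sigma> / 1 \<le> g s" using True s by (simp add: g_def)
        finally show ?thesis .
      next
        case False
        have "\<bar>s\<bar> powr \<sigma> / (1 + \<bar>s\<bar>) ^ M \<le> s powr \<sigma> / s ^ M"
          using False by (intro frac_le power_mono) auto
        also have "\<dots> = s powr (\<sigma> - M)" using False by (simp add: powr_diff powr_realpow)
        also have "\<dots> \<le> s powr (-2)" using False assms(2) by (intro powr_mono) auto
        finally show ?thesis using False by (simp add: g_def)
      qed
      have g0: "g s \<ge> 0" for s by (simp add: g_def)
      have "\<bar>t\<bar> powr \<sigma> / (1 + \<bar>t\<bar>) ^ M \<le> g t + g (- t)"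
        using pos[of t] pos[of "-t"] g0[of t] g0[of "-t"] by (cases "t \<ge> 0") auto
      then show "norm (\<bar>t\<bar> powr \<sigma> / (1 + \<bar>t\<bar>) ^ M) \<le> norm (g t + g (- t))"
        using g0 by simp
    qed
  qed measurable
qed

definition rapid :: "(real \<Rightarrow> complex) \<Rightarrow> bool"
  where "rapid g \<longleftrightarrow> (\<forall>M::nat. \<exists>D. \<forall>t. norm (g t) * (1 + \<bar>t\<bar>) ^ M \<le> D)"

text \<open>The exponent \<open>\<sigma>\<close> controls the singularity at 0 and \<open>\<tau>\<close> the growth at infinity.\<close>

definition power_bound :: "real \<Rightarrow> real \<Rightarrow> real \<Rightarrow> real"
  where "power_bound \<sigma> \<tau> t = \<bar>t\<bar> powr \<sigma> + \<bar>t\<bar> powr \<tau>"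

lemma power_bound_measurable [measurable]: "power_bound \<sigma> \<tau> \<in> borel_measurable borel"
  unfolding power_bound_def by measurable

lemma power_bound_nonneg: "power_bound \<sigma> \<tau> t \<ge> 0"
  by (simp add: power_bound_def)

lemma integrable_power_bound_decay:
  assumes "\<sigma> > -1" "\<tau> > -1"
  shows "\<exists>M0. \<forall>M\<ge>M0. integrable lborel (\<lambda>t. power_bound \<sigma> \<tau> t / (1 + \<bar>t\<bar>) ^ M)"
proof -
  define M0 where "M0 = nat \<lceil>max \<sigma> \<tau> + 2\<rceil>"
  have "integrable lborel (\<lambda>t. power_bound \<sigma> \<tau> t / (1 + \<bar>t\<bar>) ^ M)" if "M \<ge> M0" for M
  proof -
    have "real M \<ge> max \<sigma> \<tau> + 2" using that unfolding M0_def by linarith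
    then show ?thesis unfolding power_bound_def add_divide_distrib
      using assms by (intro Bochner_Integration.integrable_add integrable_powr_decay) auto
  qed
  then show ?thesis by blast
qed

lemma powr_le_power_bound:
  assumes "\<sigma> \<le> x" "x \<le> \<tau>" "t \<noteq> 0"
  shows "\<bar>t\<bar> powr x \<le> power_bound \<sigma> \<tau> t"
proof (cases "\<bar>t\<bar> \<le> 1")
  case True
  then have "\<bar>t\<bar> powr x \<le> \<bar>t\<bar> powr \<sigma>" using assms by (intro powr_mono') auto
  then show ?thesis unfolding power_bound_def by (smt (verit) powr_ge_zero)
next
  case False
  then have "\<bar>t\<bar> powr x \<le> \<bar>t\<bar> powr \<tau>" using assms by (intro powr_mono) auto
  then show ?thesis unfolding power_bound_def by (smt (verit) powr_ge_zero)
qed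

lemma power_bound_mono:
  assumes "\<sigma>' \<le> \<sigma>" "\<tau> \<le> \<tau>'" "\<sigma> \<le> \<tau>" "t \<noteq> 0"
  shows "power_bound \<sigma> \<tau> t \<le> 2 * power_bound \<sigma>' \<tau>' t"
  using powr_le_power_bound[of \<sigma>' \<sigma> \<tau>' t] powr_le_power_bound[of \<sigma>' \<tau> \<tau>' t] assms
  unfolding power_bound_def[of \<sigma> \<tau>] by auto

lemma integrable_kernel_times_rapid:
  assumes k[measurable]: "k \<in> borel_measurable borel" and g[measurable]: "g \<in> borel_measurable borel"
    and kb: "\<And>t. t \<noteq> 0 \<Longrightarrow> norm (k t) \<le> C * power_bound \<sigma> \<tau> t" and st: "\<sigma> > -1" "\<tau> > -1"
    and rg: "rapid g"
  shows "integrable lborel (\<lambda>t. k t * g t :: complex)"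
proof -
  obtain M where M: "integrable lborel (\<lambda>t. power_bound \<sigma> \<tau> t / (1 + \<bar>t\<bar>) ^ M)"
    using integrable_power_bound_decay[OF st] by blast
  obtain D where D: "\<And>t. norm (g t) * (1 + \<bar>t\<bar>) ^ M \<le> D" using rg unfolding rapid_def by blast
  show ?thesis
  proof (rule Bochner_Integration.integrable_bound)
    show "integrable lborel (\<lambda>t. (C * D) * (power_bound \<sigma> \<tau> t / (1 + \<bar>t\<bar>) ^ M))" using M by (rule integrable_mult_right)
    show "AE t in lborel. norm (k t * g t) \<le> norm ((C * D) * (power_bound \<sigma> \<tau> t / (1 + \<bar>t\<bar>) ^ M))"
    proof (rule AE_mp[OF AE_lborel_singleton[of 0]], rule AE_I2, rule impI)
      fix t :: real assume "t \<noteq> 0"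
      have "norm (g t) \<le> D / (1 + \<bar>t\<bar>) ^ M" using D[of t] by (simp add: field_simps)
      then have "norm (k t * g t) \<le> (C * power_bound \<sigma> \<tau> t) * (D / (1 + \<bar>t\<bar>) ^ M)"
        unfolding norm_mult using kb[OF \<open>t \<noteq> 0\<close>] by (intro mult_mono) (auto intro: order_trans[OF norm_ge_zero])
      also have "\<dots> \<le> norm ((C * D) * (power_bound \<sigma> \<tau> t / (1 + \<bar>t\<bar>) ^ M))"
        unfolding real_norm_def by (rule order_trans[OF _ abs_ge_self]) (simp add: mult_ac)
      finally show "norm (k t * g t) \<le> norm ((C * D) * (power_bound \<sigma> \<tau> t / (1 + \<bar>t\<bar>) ^ M))" .
    qed
  qed measurable
qed

lemma rapid_times_power_bound_tendsto_0:
  assumes rg: "rapid g" and kb: "\<And>t. t \<noteq> 0 \<Longrightarrow> norm (k t) \<le> C * power_bound \<sigma> \<tau> t"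
  shows "((\<lambda>n. k (real n) * g (real n)) \<longlonglongrightarrow> 0) \<and> ((\<lambda>n. k (- real n) * g (- real n)) \<longlonglongrightarrow> 0)"
proof -
  obtain M where M: "real M \<ge> max \<sigma> \<tau> + 1" using real_arch_simple by blast
  obtain D where D: "\<And>t. norm (g t) * (1 + \<bar>t\<bar>) ^ M \<le> D" using rg unfolding rapid_def by blast
  have bd: "norm (k t * g t) \<le> (2 * \<bar>C\<bar> * \<bar>D\<bar>) * inverse \<bar>t\<bar>" if t: "\<bar>t\<bar> \<ge> 1" for t
  proof -
    have "norm (g t) \<le> D / (1 + \<bar>t\<bar>) ^ M" using D[of t] by (simp add: field_simps)
    also have "\<dots> \<le> \<bar>D\<bar> / \<bar>t\<bar> ^ M" using t by (intro frac_le power_mono) auto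
    finally have g: "norm (g t) \<le> \<bar>D\<bar> / \<bar>t\<bar> ^ M" .
    have "\<bar>t\<bar> powr \<sigma> \<le> \<bar>t\<bar> powr (real M - 1)" "\<bar>t\<bar> powr \<tau> \<le> \<bar>t\<bar> powr (real M - 1)"
      using t M by (auto intro!: powr_mono)
    then have pb: "power_bound \<sigma> \<tau> t \<le> 2 * \<bar>t\<bar> powr (real M - 1)" by (simp add: power_bound_def)
    have "norm (k t) \<le> C * power_bound \<sigma> \<tau> t" using t by (intro kb) auto
    also have "\<dots> \<le> \<bar>C\<bar> * (2 * \<bar>t\<bar> powr (real M - 1))" using pb power_bound_nonneg by (intro mult_mono) auto
    also have "\<bar>t\<bar> powr (real M - 1) = \<bar>t\<bar> ^ M * inverse \<bar>t\<bar>"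
      using t by (simp add: powr_diff powr_realpow field_simps)
    finally have "norm (k t) \<le> \<bar>C\<bar> * (2 * (\<bar>t\<bar> ^ M * inverse \<bar>t\<bar>))" .
    then have "norm (k t * g t) \<le> (\<bar>C\<bar> * (2 * (\<bar>t\<bar> ^ M * inverse \<bar>t\<bar>))) * (\<bar>D\<bar> / \<bar>t\<bar> ^ M)"
      unfolding norm_mult using g by (intro mult_mono) auto
    also have "\<dots> = (2 * \<bar>C\<bar> * \<bar>D\<bar>) * inverse \<bar>t\<bar>" using t by (simp add: field_simps)
    finally show ?thesis .
  qed
  have lim: "(\<lambda>n. (2 * \<bar>C\<bar> * \<bar>D\<bar>) * inverse (real n)) \<longlonglongrightarrow> 0"
    by (rule tendsto_mult_right_zero) (rule lim_inverse_n)
  show ?thesis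
  proof
    show "(\<lambda>n. k (real n) * g (real n)) \<longlonglongrightarrow> 0"
      by (rule Lim_null_comparison[OF eventually_mono[OF eventually_ge_at_top[of 1]] lim]) (use bd[of "real _"] in simp)
    show "(\<lambda>n. k (- real n) * g (- real n)) \<longlonglongrightarrow> 0"
      by (rule Lim_null_comparison[OF eventually_mono[OF eventually_ge_at_top[of 1]] lim]) (use bd[of "- real _"] in simp)
  qed
qed

lemma integration_by_parts_rapid:
  fixes u v g g' :: "real \<Rightarrow> complex"
  assumes u: "continuous_on UNIV u" and uv: "\<And>t. t \<noteq> 0 \<Longrightarrow> (u has_vector_derivative v t) (at t)"
    and v: "v \<in> borel_measurable borel" and g: "\<And>t. (g has_vector_derivative g' t) (at t)"
    and g': "g' \<in> borel_measurable borel" "rapid g" "rapid g'"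
    and ub: "\<And>t. t \<noteq> 0 \<Longrightarrow> norm (u t) \<le> C * power_bound \<sigma> \<tau> t" "\<sigma> > -1" "\<tau> > -1"
    and vb: "\<And>t. t \<noteq> 0 \<Longrightarrow> norm (v t) \<le> C' * power_bound \<sigma>' \<tau>' t" "\<sigma>' > -1" "\<tau>' > -1"
  shows "(\<integral>t. u t * g' t \<partial>lborel) = - (\<integral>t. v t * g t \<partial>lborel)"
proof -
  have cg: "continuous_on UNIV g"
    using g by (auto intro!: continuous_at_imp_continuous_on has_vector_derivative_continuous)
  have [measurable]: "u \<in> borel_measurable borel" "g \<in> borel_measurable borel"
    using u cg by (auto intro: borel_measurable_continuous_onI)
  have i1: "integrable lborel (\<lambda>t. u t * g' t)" and i2: "integrable lborel (\<lambda>t. v t * g t)"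
    using integrable_kernel_times_rapid[OF _ _ ub] integrable_kernel_times_rapid[OF _ _ vb] v g' by auto
  define w where "w t = u t * g' t + v t * g t" for t
  have iw: "integrable lborel w" unfolding w_def using i1 i2 by simp
  have [measurable]: "w \<in> borel_measurable borel" using iw by simp
  have ftc: "(\<integral>t. indicator {- real n..real n} t *\<^sub>R w t \<partial>lborel) = u (real n) * g (real n) - u (- real n) * g (- real n)" for n
  proof -
    have "(w has_integral (u (real n) * g (real n) - u (- real n) * g (- real n))) {- real n..real n}"
    proof (rule fundamental_theorem_of_calculus_interior_strong[where S = "{0}"])
      show "continuous_on {- real n..real n} (\<lambda>t. u t * g t)"
        using u cg by (intro continuous_on_mult) (auto intro: continuous_on_subset)
      show "((\<lambda>t. u t * g t) has_vector_derivative w t) (at t)" if "t \<in> {- real n<..<real n} - {0}" for t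
        unfolding w_def using has_vector_derivative_mult[OF uv g] that by simp
    qed auto
    moreover have "set_integrable lborel {- real n..real n} w"
      using iw unfolding set_integrable_def by (intro integrable_mult_indicator) auto
    ultimately show ?thesis
      by (metis integral_unique set_borel_integral_eq_integral(2) set_lebesgue_integral_def)
  qed
  have "(\<lambda>n. \<integral>t. indicator {- real n..real n} t *\<^sub>R w t \<partial>lborel) \<longlonglongrightarrow> (\<integral>t. w t \<partial>lborel)"
  proof (rule integral_dominated_convergence[where w = "\<lambda>t. norm (w t)"])
    show "AE t in lborel. (\<lambda>n. indicator {- real n..real n} t *\<^sub>R w t) \<longlonglongrightarrow> w t"
    proof (rule AE_I2, rule tendsto_eventually)
      fix t :: real
      obtain m where "\<bar>t\<bar> \<le> real m" using real_arch_simple by blast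
      then have "indicator {- real n..real n} t *\<^sub>R w t = w t" if "n \<ge> m" for n
        using that by (auto split: split_indicator)
      then show "\<forall>\<^sub>F n in sequentially. indicator {- real n..real n} t *\<^sub>R w t = w t"
        by (rule eventually_sequentiallyI)
    qed
  qed (use iw in \<open>auto split: split_indicator\<close>)
  moreover have "(\<lambda>n. u (real n) * g (real n) - u (- real n) * g (- real n)) \<longlonglongrightarrow> 0 - 0"
    using rapid_times_power_bound_tendsto_0[OF g'(2) ub(1)] by (intro tendsto_diff) auto
  ultimately have "(\<integral>t. w t \<partial>lborel) = 0"
    unfolding ftc by (simp add: LIMSEQ_unique)
  then show ?thesis unfolding w_def using i1 i2 by (simp add: eq_neg_iff_add_eq_0)
qed

section \<open>Normalized Mellin kernels on the line\<close>

definition divided_difference :: "complex \<Rightarrow> (complex \<Rightarrow> complex) \<Rightarrow> complex \<Rightarrow> complex"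
  where "divided_difference a f z = (if z = a then deriv f a else (f z - f a) / (z - a))"

lemma holomorphic_divided_difference:
  "f holomorphic_on UNIV \<Longrightarrow> divided_difference a f holomorphic_on UNIV"
  using pole_lemma[of f UNIV a] by (simp add: divided_difference_def[abs_def])

text \<open>Integrating \<open>\<bar>t\<bar> powr z\<close> by parts \<open>2 * N\<close> times produces \<open>\<bar>t\<bar> powr (z + 2 * N)\<close> divided by
the product of \<open>z + j\<close> over \<open>1 \<le> j \<le> 2 * N\<close>. The zeros of the normalizing factor \<open>1 / Gamma\<close> cancel the
odd \<open>j\<close>. For even \<open>j\<close> the numerator at \<open>z = - j\<close> is a polynomial in \<open>t\<close> of degree less than
\<open>2 * N\<close>, which is invisible to a derivative of order \<open>2 * N\<close> and may be subtracted. Iterated divided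
differences at the nodes \<open>- 2, - 4, \<dots>\<close> do both the division and the subtraction, and stay entire in \<open>z\<close>.\<close>

primrec regular_power :: "nat \<Rightarrow> nat \<Rightarrow> real \<Rightarrow> complex \<Rightarrow> complex" where
  "regular_power N 0 t = (\<lambda>z. of_real \<bar>t\<bar> powr (z + 2 * of_nat N))"
| "regular_power N (Suc k) t = divided_difference (- 2 * of_nat (Suc k)) (regular_power N k t)"

definition mellin_kernel :: "nat \<Rightarrow> complex \<Rightarrow> real \<Rightarrow> complex"
  where "mellin_kernel N z t = rGamma ((z + 1) / 2 + of_nat N) / 2 ^ N * regular_power N N t z"

lemma holomorphic_regular_power: "regular_power N k t holomorphic_on UNIV"
proof (induction k)
  case 0
  show ?case by (cases "t = 0") (auto intro!: holomorphic_intros)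
qed (simp add: holomorphic_divided_difference)

lemma holomorphic_mellin_kernel: "(\<lambda>z. mellin_kernel N z t) holomorphic_on UNIV"
proof -
  have "regular_power N N t holomorphic_on UNIV" by (rule holomorphic_regular_power)
  then show ?thesis unfolding mellin_kernel_def by (auto intro!: holomorphic_intros)
qed

lemma powr_even_exponent:
  assumes "t \<noteq> 0" "j \<le> N"
  shows "of_real \<bar>t\<bar> powr (- 2 * of_nat j + 2 * of_nat N) = (of_real (t ^ (2 * N - 2 * j)) :: complex)"
proof -
  have "(- 2 * of_nat j + 2 * of_nat N :: complex) = of_nat (2 * N - 2 * j)"
    using assms(2) by (simp add: of_nat_diff)
  then have "of_real \<bar>t\<bar> powr (- 2 * of_nat j + 2 * of_nat N) = (of_real \<bar>t\<bar> :: complex) ^ (2 * N - 2 * j)"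
    using assms(1) by (simp add: powr_nat')
  also have "\<dots> = of_real (\<bar>t\<bar> ^ (2 * (N - j)))" by (simp add: diff_mult_distrib2)
  also have "\<bar>t\<bar> ^ (2 * (N - j)) = t ^ (2 * (N - j))" by (simp add: power_mult)
  finally show ?thesis by (simp add: diff_mult_distrib2)
qed

text \<open>The explicit form away from the nodes: what distinguishes the regularized power from the quotient is a
combination of even powers of \<open>t\<close> of degree at most \<open>2 * N - 2\<close>.\<close>

lemma regular_power_eq:
  assumes "k \<le> N"
  shows "\<exists>c. \<forall>z t. t \<noteq> 0 \<longrightarrow> (\<forall>j\<in>{1..k}. z \<noteq> - 2 * of_nat j) \<longrightarrow>
    regular_power N k t z = of_real \<bar>t\<bar> powr (z + 2 * of_nat N) / (\<Prod>j=1..k. z + 2 * of_nat j)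
      - (\<Sum>j=1..k. c j z * of_real (t ^ (2 * N - 2 * j)))"
  using assms
proof (induction k)
  case (Suc k)
  then obtain c where c: "\<And>z t. t \<noteq> 0 \<Longrightarrow> (\<forall>j\<in>{1..k}. z \<noteq> - 2 * of_nat j) \<Longrightarrow>
    regular_power N k t z = of_real \<bar>t\<bar> powr (z + 2 * of_nat N) / (\<Prod>j=1..k. z + 2 * of_nat j)
      - (\<Sum>j=1..k. c j z * of_real (t ^ (2 * N - 2 * j)))" by auto
  define a :: complex where "a = - 2 * of_nat (Suc k)"
  define c' where "c' j z = (if j = Suc k then 1 / (\<Prod>j=1..k. a + 2 * of_nat j) / (z - a) else (c j z - c j a) / (z - a))" for j z
  show ?case
  proof (intro exI[of _ c'] allI impI)
    fix z :: complex and t :: real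
    assume t: "t \<noteq> 0" and z: "\<forall>j\<in>{1..Suc k}. z \<noteq> - 2 * of_nat j"
    have za: "z \<noteq> a" using bspec[OF z, of "Suc k"] by (simp add: a_def)
    have a: "\<forall>j\<in>{1..k}. a \<noteq> - 2 * of_nat j" by (auto simp: a_def simp del: of_nat_Suc)
    have "regular_power N (Suc k) t z = (regular_power N k t z - regular_power N k t a) / (z - a)"
      using za by (simp add: divided_difference_def a_def)
    also have "regular_power N k t a = of_real (t ^ (2 * N - 2 * Suc k)) / (\<Prod>j=1..k. a + 2 * of_nat j)
      - (\<Sum>j=1..k. c j a * of_real (t ^ (2 * N - 2 * j)))"
      using powr_even_exponent[OF t Suc.prems] c[OF t a] by (simp add: a_def del: of_nat_Suc)
    also have "regular_power N k t z = of_real \<bar>t\<bar> powr (z + 2 * of_nat N) / (\<Prod>j=1..k. z + 2 * of_nat j)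
      - (\<Sum>j=1..k. c j z * of_real (t ^ (2 * N - 2 * j)))"
      using z by (intro c t) auto
    finally have "regular_power N (Suc k) t z = (of_real \<bar>t\<bar> powr (z + 2 * of_nat N) / (\<Prod>j=1..k. z + 2 * of_nat j)
      - (\<Sum>j=1..k. c j z * of_real (t ^ (2 * N - 2 * j))) - (of_real (t ^ (2 * N - 2 * Suc k)) / (\<Prod>j=1..k. a + 2 * of_nat j)
      - (\<Sum>j=1..k. c j a * of_real (t ^ (2 * N - 2 * j))))) / (z - a)" .
    also have "\<dots> = of_real \<bar>t\<bar> powr (z + 2 * of_nat N) / (\<Prod>j=1..k. z + 2 * of_nat j) / (z - a)
      - ((\<Sum>j=1..k. c j z * of_real (t ^ (2 * N - 2 * j))) - (\<Sum>j=1..k. c j a * of_real (t ^ (2 * N - 2 * j)))) / (z - a)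
      - of_real (t ^ (2 * N - 2 * Suc k)) / (\<Prod>j=1..k. a + 2 * of_nat j) / (z - a)"
      by (simp only: diff_divide_distrib) (simp add: algebra_simps)
    also have "((\<Sum>j=1..k. c j z * of_real (t ^ (2 * N - 2 * j))) - (\<Sum>j=1..k. c j a * of_real (t ^ (2 * N - 2 * j)))) / (z - a)
        = (\<Sum>j=1..k. c' j z * of_real (t ^ (2 * N - 2 * j)))"
      unfolding sum_subtractf[symmetric] sum_divide_distrib
      by (intro sum.cong refl) (simp add: c'_def diff_divide_distrib left_diff_distrib)
    also have "of_real \<bar>t\<bar> powr (z + 2 * of_nat N) / (\<Prod>j=1..k. z + 2 * of_nat j) / (z - a)
        = of_real \<bar>t\<bar> powr (z + 2 * of_nat N) / (\<Prod>j=1..Suc k. z + 2 * of_nat j)"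
      by (simp add: a_def)
    also have "of_real (t ^ (2 * N - 2 * Suc k)) / (\<Prod>j=1..k. a + 2 * of_nat j) / (z - a) = c' (Suc k) z * of_real (t ^ (2 * N - 2 * Suc k))"
      by (simp add: c'_def)
    finally show "regular_power N (Suc k) t z = of_real \<bar>t\<bar> powr (z + 2 * of_nat N) / (\<Prod>j=1..Suc k. z + 2 * of_nat j)
      - (\<Sum>j=1..Suc k. c' j z * of_real (t ^ (2 * N - 2 * j)))"
      by simp
  qed
qed simp

text \<open>Bounds locally uniform in the parameter. They hold on the half plane in which \<open>\<bar>t\<bar> powr (z + 2 * N)\<close> is
locally integrable.\<close>

definition locally_power_bounded :: "nat \<Rightarrow> (complex \<Rightarrow> real \<Rightarrow> complex) \<Rightarrow> bool"
  where "locally_power_bounded N f \<longleftrightarrow> (\<forall>z0. Re z0 > - 2 * real N - 1 \<longrightarrow>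
    (\<exists>\<epsilon>>0. \<exists>C\<ge>0. \<exists>\<sigma> \<tau>. -1 < \<sigma> \<and> \<sigma> \<le> \<tau> \<and>
      (\<forall>z\<in>ball z0 \<epsilon>. \<forall>t. t \<noteq> 0 \<longrightarrow> norm (f z t) \<le> C * power_bound \<sigma> \<tau> t)))"

lemma locally_power_boundedD:
  assumes "locally_power_bounded N f" "Re z0 > - 2 * real N - 1"
  obtains \<epsilon> C \<sigma> \<tau> where "\<epsilon> > 0" "C \<ge> 0" "-1 < \<sigma>" "\<sigma> \<le> \<tau>"
    "\<And>z t. z \<in> ball z0 \<epsilon> \<Longrightarrow> t \<noteq> 0 \<Longrightarrow> norm (f z t) \<le> C * power_bound \<sigma> \<tau> t"
  using assms unfolding locally_power_bounded_def by blast

text \<open>Away from the node the denominator is bounded below. Near the node the maximum modulus principle carries the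
bound over from a small circle.\<close>

lemma locally_power_bounded_divided_difference:
  assumes f: "locally_power_bounded N (\<lambda>z t. f t z)" and hol: "\<And>t. f t holomorphic_on UNIV"
    and a: "Re a > - 2 * real N - 1"
  shows "locally_power_bounded N (\<lambda>z t. divided_difference a (f t) z)"
  unfolding locally_power_bounded_def
proof (intro allI impI)
  fix z0 assume z0: "Re z0 > - 2 * real N - 1"
  from f z0 obtain \<epsilon> C \<sigma> \<tau> where e: "\<epsilon> > 0" "C \<ge> 0" "-1 < \<sigma>" "\<sigma> \<le> \<tau>" and
    b: "\<And>z t. z \<in> ball z0 \<epsilon> \<Longrightarrow> t \<noteq> 0 \<Longrightarrow> norm (f t z) \<le> C * power_bound \<sigma> \<tau> t"
    by (rule locally_power_boundedD) blast
  from f a obtain \<epsilon>' C' \<sigma>' \<tau>' where e': "\<epsilon>' > 0" "C' \<ge> 0" "-1 < \<sigma>'" "\<sigma>' \<le> \<tau>'" and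
    b': "\<And>z t. z \<in> ball a \<epsilon>' \<Longrightarrow> t \<noteq> 0 \<Longrightarrow> norm (f t z) \<le> C' * power_bound \<sigma>' \<tau>' t"
    by (rule locally_power_boundedD) blast
  define \<sigma>'' \<tau>'' where "\<sigma>'' = min \<sigma> \<sigma>'" and "\<tau>'' = max \<tau> \<tau>'"
  have s: "-1 < \<sigma>''" "\<sigma>'' \<le> \<tau>''" using e e' by (auto simp: \<sigma>''_def \<tau>''_def)
  have b2: "norm (f t z - f t a) \<le> 2 * (C + C') * power_bound \<sigma>'' \<tau>'' t" if "z \<in> ball z0 \<epsilon>" "t \<noteq> 0" for z t
  proof -
    have "C * power_bound \<sigma> \<tau> t \<le> C * (2 * power_bound \<sigma>'' \<tau>'' t)"
      using e that by (intro mult_left_mono power_bound_mono) (auto simp: \<sigma>''_def \<tau>''_def)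
    moreover have "C' * power_bound \<sigma>' \<tau>' t \<le> C' * (2 * power_bound \<sigma>'' \<tau>'' t)"
      using e' that by (intro mult_left_mono power_bound_mono) (auto simp: \<sigma>''_def \<tau>''_def)
    moreover have "norm (f t z - f t a) \<le> norm (f t z) + norm (f t a)" by (rule norm_triangle_ineq4)
    ultimately show ?thesis
      using b[OF that] b'[of a t] that e' by (simp add: algebra_simps)
  qed
  define r where "r = (if z0 = a then \<epsilon> / 2 else min \<epsilon> (dist z0 a / 2))"
  have r: "r > 0" using e by (auto simp: r_def)
  have b3: "norm (divided_difference a (f t) z) \<le> 2 * (C + C') * power_bound \<sigma>'' \<tau>'' t / r"
    if "z \<in> ball z0 \<epsilon>" "t \<noteq> 0" "norm (z - a) \<ge> r" for z t
  proof -
    have "norm (divided_difference a (f t) z) = norm (f t z - f t a) / norm (z - a)"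
      using that r by (auto simp: divided_difference_def norm_divide)
    also have "\<dots> \<le> 2 * (C + C') * power_bound \<sigma>'' \<tau>'' t / r"
      using that b2[OF that(1,2)] r e e' power_bound_nonneg[of \<sigma>'' \<tau>'' t] by (intro frac_le mult_nonneg_nonneg) auto
    finally show ?thesis .
  qed
  have b4: "norm (divided_difference a (f t) z) \<le> 2 * (C + C') * power_bound \<sigma>'' \<tau>'' t / r"
    if z: "z \<in> ball z0 r" and t: "t \<noteq> 0" for z t
  proof (cases "z0 = a")
    case True
    have h: "divided_difference a (f t) holomorphic_on UNIV" using hol by (rule holomorphic_divided_difference)
    show ?thesis
    proof (rule maximum_modulus_frontier[of "divided_difference a (f t)" "ball a r"])
      show "divided_difference a (f t) holomorphic_on interior (ball a r)"
        "continuous_on (closure (ball a r)) (divided_difference a (f t))"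
        using h by (auto intro: holomorphic_on_subset holomorphic_on_imp_continuous_on continuous_on_subset)
      show "norm (divided_difference a (f t) z) \<le> 2 * (C + C') * power_bound \<sigma>'' \<tau>'' t / r" if "z \<in> frontier (ball a r)" for z
      proof (rule b3)
        have "dist a z = r" using that r by (simp add: frontier_ball)
        then show "z \<in> ball z0 \<epsilon>" "r \<le> norm (z - a)" using True e by (auto simp: r_def dist_norm norm_minus_commute)
      qed (rule t)
    qed (use z True in auto)
  next
    case False
    show ?thesis
    proof (rule b3[OF _ t])
      show "z \<in> ball z0 \<epsilon>" using z False by (simp add: r_def)
      have "dist z0 a \<le> dist z0 z + dist z a" by (rule dist_triangle)
      moreover have "dist z0 z < r" "r \<le> dist z0 a / 2" using z False by (auto simp: r_def)
      ultimately show "r \<le> norm (z - a)" by (simp add: dist_norm)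
    qed
  qed
  show "\<exists>\<epsilon>>0. \<exists>C\<ge>0. \<exists>\<sigma> \<tau>. -1 < \<sigma> \<and> \<sigma> \<le> \<tau> \<and>
      (\<forall>z\<in>ball z0 \<epsilon>. \<forall>t. t \<noteq> 0 \<longrightarrow> norm (divided_difference a (f t) z) \<le> C * power_bound \<sigma> \<tau> t)"
  proof -
    have "2 * (C + C') / r \<ge> 0" using e e' r by simp
    moreover have "norm (divided_difference a (f t) z) \<le> 2 * (C + C') / r * power_bound \<sigma>'' \<tau>'' t"
      if "z \<in> ball z0 r" "t \<noteq> 0" for z t using b4[OF that] by simp
    ultimately show ?thesis using r s by blast
  qed
qed

lemma locally_power_bounded_regular_power:
  "k \<le> N \<Longrightarrow> locally_power_bounded N (\<lambda>z t. regular_power N k t z)"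
proof (induction k)
  case 0
  show ?case unfolding locally_power_bounded_def
  proof (intro allI impI)
    fix z0 assume z0: "Re z0 > - 2 * real N - 1"
    define \<epsilon> where "\<epsilon> = (Re z0 + 2 * N + 1) / 2"
    have e: "\<epsilon> > 0" using z0 by (simp add: \<epsilon>_def)
    show "\<exists>\<epsilon>>0. \<exists>C\<ge>0. \<exists>\<sigma> \<tau>. - 1 < \<sigma> \<and> \<sigma> \<le> \<tau> \<and>
      (\<forall>z\<in>ball z0 \<epsilon>. \<forall>t. t \<noteq> 0 \<longrightarrow> cmod (regular_power N 0 t z) \<le> C * power_bound \<sigma> \<tau> t)"
    proof -
      define \<sigma> \<tau> where "\<sigma> = Re z0 + 2 * N - \<epsilon>" and "\<tau> = Re z0 + 2 * N + \<epsilon>"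
      have st: "-1 < \<sigma>" "\<sigma> \<le> \<tau>" using e z0 by (auto simp: \<sigma>_def \<tau>_def \<epsilon>_def field_simps)
      have "cmod (regular_power N 0 t z) \<le> 1 * power_bound \<sigma> \<tau> t" if z: "z \<in> ball z0 \<epsilon>" and t: "t \<noteq> 0" for z t
      proof -
      have "\<bar>Re (z0 - z)\<bar> < \<epsilon>" using z abs_Re_le_cmod[of "z0 - z"] by (simp add: dist_norm)
      then have "\<bar>t\<bar> powr (Re z + 2 * N) \<le> power_bound \<sigma> \<tau> t"
        using t unfolding \<sigma>_def \<tau>_def by (intro powr_le_power_bound) auto
      moreover have "cmod (regular_power N 0 t z) = \<bar>t\<bar> powr (Re z + 2 * N)"
        using t by (simp add: norm_powr_real_powr)
      ultimately show ?thesis by simp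
      qed
      then show ?thesis using e st zero_le_one by blast
    qed
  qed
next
  case (Suc k)
  then show ?case
    unfolding regular_power.simps
    by (intro locally_power_bounded_divided_difference holomorphic_regular_power) auto
qed

lemma locally_power_bounded_mellin_kernel: "locally_power_bounded N (mellin_kernel N)"
  unfolding locally_power_bounded_def
proof (intro allI impI)
  fix z0 assume z0: "Re z0 > - 2 * real N - 1"
  obtain \<epsilon> C \<sigma> \<tau> where e: "\<epsilon> > 0" "C \<ge> 0" "-1 < \<sigma>" "\<sigma> \<le> \<tau>" and
    b: "\<And>z t. z \<in> ball z0 \<epsilon> \<Longrightarrow> t \<noteq> 0 \<Longrightarrow> norm (regular_power N N t z) \<le> C * power_bound \<sigma> \<tau> t"
    using locally_power_boundedD[OF locally_power_bounded_regular_power[OF order_refl] z0] by blast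
  have "continuous_on (cball z0 \<epsilon>) (\<lambda>z. rGamma ((z + 1) / 2 + of_nat N) / 2 ^ N :: complex)"
    by (intro holomorphic_on_imp_continuous_on holomorphic_intros) auto
  then have "bounded ((\<lambda>z. rGamma ((z + 1) / 2 + of_nat N) / 2 ^ N :: complex) ` cball z0 \<epsilon>)"
    by (intro compact_imp_bounded compact_continuous_image) auto
  then obtain B where "\<forall>z\<in>cball z0 \<epsilon>. norm (rGamma ((z + 1) / 2 + of_nat N) / 2 ^ N :: complex) \<le> B"
    unfolding bounded_iff by auto
  then have B: "norm (rGamma ((z + 1) / 2 + of_nat N) / 2 ^ N :: complex) \<le> B" if "z \<in> cball z0 \<epsilon>" for z
    using that by blast
  have B0: "B \<ge> 0" using B[of z0] e by (auto intro: order_trans[OF norm_ge_zero])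
  show "\<exists>\<epsilon>>0. \<exists>C\<ge>0. \<exists>\<sigma> \<tau>. -1 < \<sigma> \<and> \<sigma> \<le> \<tau> \<and>
      (\<forall>z\<in>ball z0 \<epsilon>. \<forall>t. t \<noteq> 0 \<longrightarrow> norm (mellin_kernel N z t) \<le> C * power_bound \<sigma> \<tau> t)"
  proof -
    have "norm (mellin_kernel N z t) \<le> (B * C) * power_bound \<sigma> \<tau> t"
      if "z \<in> ball z0 \<epsilon>" "t \<noteq> 0" for z t
      unfolding mellin_kernel_def norm_mult mult.assoc using that B[of z] b[of z t] B0
      by (intro mult_mono) auto
    moreover have "B * C \<ge> 0" using e B0 by simp
    ultimately show ?thesis using e by blast
  qed
qed

lemma regular_power_measurable: "(\<lambda>t. regular_power N k t z) \<in> borel_measurable borel"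
proof (induction k arbitrary: z)
  case (Suc k)
  note [measurable] = Suc
  show ?case
  proof (cases "z = - 2 * of_nat (Suc k)")
    case False
    then have "(\<lambda>t. regular_power N (Suc k) t z) = (\<lambda>t. (regular_power N k t z - regular_power N k t (- 2 * of_nat (Suc k))) / (z - - 2 * of_nat (Suc k)))"
      by (simp add: divided_difference_def fun_eq_iff)
    then show ?thesis by simp
  next
    case True
    define a where "a = z"
    define q where "q n t = (regular_power N k t (a + of_real (inverse (Suc n))) - regular_power N k t a) / of_real (inverse (Suc n))" for n t
    have q: "(\<lambda>n. q n t) \<longlonglongrightarrow> regular_power N (Suc k) t z" for t
    proof -
      have "(regular_power N k t has_field_derivative deriv (regular_power N k t) a) (at a)"
        using holomorphic_derivI[OF holomorphic_regular_power open_UNIV] by auto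
      then have "(\<lambda>h. (regular_power N k t (a + h) - regular_power N k t a) / h) \<midarrow>0\<rightarrow> deriv (regular_power N k t) a"
        by (simp add: DERIV_def)
      from filterlim_compose[OF this, of "\<lambda>n. of_real (inverse (real (Suc n)))" sequentially]
      have "(\<lambda>n. q n t) \<longlonglongrightarrow> deriv (regular_power N k t) a"
        if "filterlim (\<lambda>n. of_real (inverse (real (Suc n))) :: complex) (at 0) sequentially"
        using that unfolding q_def by blast
      moreover have "filterlim (\<lambda>n. of_real (inverse (real (Suc n))) :: complex) (at 0) sequentially"
        unfolding filterlim_at
      proof
        show "(\<lambda>n. of_real (inverse (real (Suc n))) :: complex) \<longlonglongrightarrow> 0"
          using tendsto_of_real[OF LIMSEQ_inverse_real_of_nat, where 'a = complex] by simp
      qed (auto simp: eventually_sequentially simp del: of_nat_Suc)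
      ultimately show ?thesis
        using True by (simp add: divided_difference_def a_def)
    qed
    have "q n \<in> borel_measurable borel" for n unfolding q_def by measurable
    from borel_measurable_LIMSEQ_metric[OF this q] show ?thesis .
  qed
qed simp

lemma regular_power_zero: "regular_power N k 0 z = 0"
proof (induction k arbitrary: z)
  case (Suc k)
  then have "regular_power N k 0 = (\<lambda>z. 0)" by auto
  then show ?case by (simp add: divided_difference_def)
qed simp

lemma mellin_kernel_zero: "mellin_kernel N z 0 = 0"
  by (simp add: mellin_kernel_def regular_power_zero)

lemma mellin_kernel_0: "mellin_kernel 0 z t = rGamma ((z + 1) / 2) * of_real \<bar>t\<bar> powr z"
  by (simp add: mellin_kernel_def)

lemma mellin_kernel_measurable [measurable]: "mellin_kernel N z \<in> borel_measurable borel"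
proof -
  note [measurable] = regular_power_measurable
  show ?thesis unfolding mellin_kernel_def[abs_def] by measurable
qed

text \<open>The \<open>m\<close>-fold antiderivative of \<open>\<bar>t\<bar> powr z\<close>, up to the factor that \<open>signed_power_has_vector_derivative\<close>
shows. For \<open>m \<ge> 1\<close> and \<open>Re z > -1\<close> it is continuous, so that integration by parts over the whole line has no
boundary terms at 0.\<close>

definition signed_power :: "complex \<Rightarrow> nat \<Rightarrow> real \<Rightarrow> complex"
  where "signed_power z m t = of_real (sgn t ^ m) * of_real \<bar>t\<bar> powr (z + of_nat m)"

lemma norm_signed_power: "t \<noteq> 0 \<Longrightarrow> norm (signed_power z m t) = \<bar>t\<bar> powr (Re z + m)"
  by (simp add: signed_power_def norm_mult norm_powr_real_powr norm_power abs_sgn_eq)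

lemma signed_power_measurable [measurable]: "signed_power z m \<in> borel_measurable borel"
  unfolding signed_power_def[abs_def] by measurable

lemma signed_power_has_vector_derivative:
  assumes "t \<noteq> 0"
  shows "(signed_power z (Suc m) has_vector_derivative (z + of_nat (Suc m)) * signed_power z m t) (at t)"
proof -
  define c where "c = sgn t"
  define w where "w = z + of_nat (Suc m)"
  have c2: "c * c = 1" "c * t = \<bar>t\<bar>" using assms by (auto simp: c_def sgn_if)
  have "((\<lambda>s. of_real (c * s) :: complex) has_vector_derivative of_real c) (at t)"
    by (auto intro!: derivative_eq_intros has_vector_derivative_of_real)
  moreover have "((\<lambda>s. s powr w) has_field_derivative (w * of_real (c * t) powr (w - 1))) (at (of_real (c * t)))"
    using assms c2 by (intro has_field_derivative_powr) (auto simp: complex_nonpos_Reals_iff)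
  ultimately have "(((\<lambda>s. s powr w) \<circ> (\<lambda>s. of_real (c * s))) has_vector_derivative of_real c * (w * of_real (c * t) powr (w - 1))) (at t)"
    by (rule field_vector_diff_chain_at)
  then have "((\<lambda>s. of_real (c ^ Suc m) * (of_real (c * s) powr w)) has_vector_derivative
      of_real (c ^ Suc m) * (of_real c * (w * of_real (c * t) powr (w - 1)))) (at t)"
    unfolding o_def by (rule has_vector_derivative_mult_right)
  then have d: "(signed_power z (Suc m) has_vector_derivative
      of_real (c ^ Suc m) * (of_real c * (w * of_real (c * t) powr (w - 1)))) (at t)"
  proof (rule has_vector_derivative_transform_within_open)
    show "open (if t > 0 then {0<..} else {..<0::real})" by simp
    show "t \<in> (if t > 0 then {0<..} else {..<0})" using assms by auto
    show "of_real (c ^ Suc m) * (of_real (c * s) powr w) = signed_power z (Suc m) s"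
      if "s \<in> (if t > 0 then {0<..} else {..<0})" for s
      using that assms by (auto simp: signed_power_def w_def c_def sgn_if split: if_splits)
  qed
  have eq: "of_real (c ^ Suc m) * (of_real c * (w * of_real (c * t) powr (w - 1))) = w * signed_power z m t"
  proof -
    have "of_real (c ^ Suc m) * (of_real c * (w * of_real (c * t) powr (w - 1)))
        = of_real (c * c) * (of_real (c ^ m) * (w * of_real (c * t) powr (w - 1)))"
      by simp
    then show ?thesis unfolding c2 by (simp add: signed_power_def w_def c_def)
  qed
  show ?thesis using d unfolding eq unfolding w_def .
qed

lemma continuous_signed_power:
  assumes "Re z > -1"
  shows "continuous_on UNIV (signed_power z (Suc m))"
  unfolding continuous_on_eq_continuous_at[OF open_UNIV]
proof
  fix t :: real
  show "isCont (signed_power z (Suc m)) t"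
  proof (cases "t = 0")
    case True
    have "((\<lambda>s::real. \<bar>s\<bar> powr (Re z + Suc m)) \<longlongrightarrow> \<bar>0\<bar> powr (Re z + Suc m)) (at 0)"
      using assms by (intro tendsto_powr' tendsto_intros) (auto intro: tendsto_rabs_zero)
    then have "((\<lambda>s::real. \<bar>s\<bar> powr (Re z + Suc m)) \<longlongrightarrow> 0) (at 0)" by simp
    moreover have "\<forall>\<^sub>F s in at 0. norm (signed_power z (Suc m) s) \<le> \<bar>s\<bar> powr (Re z + Suc m)"
      by (auto simp: eventually_at norm_signed_power intro!: exI[of _ 1])
    ultimately have "(signed_power z (Suc m) \<longlongrightarrow> 0) (at 0)" by (rule Lim_null_comparison[rotated])
    then show ?thesis using True by (simp add: isCont_def signed_power_def)
  qed (use signed_power_has_vector_derivative has_vector_derivative_continuous in blast)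
qed

text \<open>The functional equation of the Gamma function, applied \<open>N\<close> times: half of the \<open>2 * N\<close> linear factors from the
integrations by parts are absorbed by \<open>rGamma\<close>, the other half by the denominator of the regularized power.\<close>

lemma mellin_kernel_normalization:
  assumes "Re z > -1"
  shows "rGamma ((z + 1) / 2 + of_nat N) / 2 ^ N * (\<Prod>j=1..2*N. z + of_nat j) / (\<Prod>j=1..N. z + 2 * of_nat j)
    = rGamma ((z + 1) / 2)"
proof (induction N)
  case (Suc N)
  have nz: "z + 2 * of_nat j \<noteq> 0" if "j \<ge> 1" for j :: nat
  proof
    assume "z + 2 * of_nat j = 0"
    then have "Re z = - 2 * real j" by (simp add: complex_eq_iff)
    with assms that show False by simp
  qed
  have 1: "rGamma ((z + 1) / 2 + of_nat N) = ((z + 1) / 2 + of_nat N) * rGamma ((z + 1) / 2 + of_nat (Suc N))"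
    using rGamma_plus1[of "(z + 1) / 2 + of_nat N"] by (simp add: add_ac)
  have 2: "(\<Prod>j=1..2*Suc N. z + of_nat j) = (\<Prod>j=1..2*N. z + of_nat j) * (2 * ((z + 1) / 2 + of_nat N)) * (z + 2 * of_nat (Suc N))"
    by (simp add: algebra_simps)
  have 3: "(\<Prod>j=1..Suc N. z + 2 * of_nat j) = (\<Prod>j=1..N. z + 2 * of_nat j) * (z + 2 * of_nat (Suc N))"
    by simp
  have 4: "(\<Prod>j=1..N. z + 2 * of_nat j) \<noteq> 0" "z + 2 * of_nat (Suc N) \<noteq> 0"
    using nz[of "Suc N"] nz by auto
  have "g / 2 ^ Suc N * (q * (2 * w) * v) / (p * v) = (w * g) / 2 ^ N * q / p" if "p \<noteq> 0" "v \<noteq> 0"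
    for g q w v p :: complex
    using that by simp
  from this[OF 4] show ?case unfolding 2 3 Suc[symmetric] 1 .
qed simp

text \<open>The core of the continuation: the right-hand side makes sense for \<open>Re z > -1\<close> only, but the left-hand
side is holomorphic for \<open>Re z > - 2 * N - 1\<close>.\<close>

lemma mellin_kernel_integral:
  assumes z: "Re z > -1" and der: "\<And>m t. (f m has_vector_derivative f (Suc m) t) (at t)" and rap: "\<And>m. rapid (f m)"
  shows "(\<integral>t. mellin_kernel N z t * f (2 * N) t \<partial>lborel) = (\<integral>t. mellin_kernel 0 z t * f 0 t \<partial>lborel)"
proof -
  have cont: "continuous_on UNIV (f m)" for m
    using der by (auto intro!: continuous_at_imp_continuous_on has_vector_derivative_continuous)
  have fm[measurable]: "f m \<in> borel_measurable borel" for m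
    by (rule borel_measurable_continuous_onI[OF cont])
  have sb: "norm (signed_power z m t) \<le> 1 * power_bound (Re z + m) (Re z + m) t" if "t \<noteq> 0" for m t
    using that by (simp add: norm_signed_power power_bound_def)
  have sb': "norm ((z + of_nat (Suc m)) * signed_power z m t) \<le> norm (z + of_nat (Suc m)) * power_bound (Re z + m) (Re z + m) t" if "t \<noteq> 0" for m t
    using sb[OF that, of m] by (simp add: norm_mult mult_left_mono)
  have mb: "norm (of_real (t ^ m) :: complex) \<le> 1 * power_bound (real m) (real m) t" if "t \<noteq> 0" for m t
    using that by (simp add: power_bound_def norm_power powr_realpow)
  have mb': "norm (of_nat m * of_real (t ^ (m - 1)) :: complex) \<le> real m * power_bound (real (m - 1)) (real (m - 1)) t" if "t \<noteq> 0" for m t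
    using mb[OF that, of "m - 1"] by (simp add: norm_mult mult_left_mono)
  \<comment> \<open>integration by parts, moving \<open>m\<close> derivatives to the test function\<close>
  have sp: "(\<integral>t. signed_power z m t * f m t \<partial>lborel) = (-1) ^ m * (\<Prod>j=1..m. z + of_nat j) * (\<integral>t. signed_power z 0 t * f 0 t \<partial>lborel)" for m
  proof (induction m)
    case (Suc m)
    have "(\<integral>t. signed_power z (Suc m) t * f (Suc m) t \<partial>lborel) = - (\<integral>t. ((z + of_nat (Suc m)) * signed_power z m t) * f m t \<partial>lborel)"
      by (rule integration_by_parts_rapid[OF continuous_signed_power[OF z] signed_power_has_vector_derivative _ der fm rap rap sb _ _ sb'])
        (use z in auto)
    also have "\<dots> = - ((z + of_nat (Suc m)) * (\<integral>t. signed_power z m t * f m t \<partial>lborel))"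
      by (simp add: mult.assoc)
    finally show ?case unfolding Suc by (simp add: algebra_simps)
  qed simp
  \<comment> \<open>polynomials of degree below the order of the derivative integrate to 0\<close>
  have mono: "(\<integral>t. of_real (t ^ m) * f n t \<partial>lborel) = 0" if "m < n" for m n
    using that
  proof (induction m arbitrary: n)
    case (0 n)
    then obtain n' where n: "n = Suc n'" by (cases n) auto
    have "(\<integral>t. 1 * f n t \<partial>lborel) = - (\<integral>t. 0 * f n' t \<partial>lborel)"
      unfolding n
      by (rule integration_by_parts_rapid[OF _ _ _ der fm rap rap, where C = 1 and \<sigma> = 0 and \<tau> = 0 and C' = 1 and \<sigma>' = 0 and \<tau>' = 0])
        (auto simp: power_bound_def)
    then show ?case by simp
  next
    case (Suc m n)
    then obtain n' where n: "n = Suc n'" "m < n'" by (cases n) auto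
    have "(\<integral>t. of_real (t ^ Suc m) * f n t \<partial>lborel) = - (\<integral>t. (of_nat (Suc m) * of_real (t ^ (Suc m - 1))) * f n' t \<partial>lborel)"
      unfolding n
    proof (rule integration_by_parts_rapid[OF _ _ _ der fm rap rap mb _ _ mb'])
      show "((\<lambda>t. of_real (t ^ Suc m) :: complex) has_vector_derivative of_nat (Suc m) * of_real (t ^ (Suc m - 1))) (at t)" for t
      proof -
        have "((\<lambda>t. t ^ Suc m) has_real_derivative real (Suc m) * t ^ m) (at t)"
          by (rule derivative_eq_intros refl | simp)+
        from has_vector_derivative_of_real[OF this]
        show ?thesis by simp
      qed
    qed (auto intro!: continuous_intros)
    also have "(\<integral>t. (of_nat (Suc m) * of_real (t ^ (Suc m - 1))) * f n' t \<partial>lborel) = of_nat (Suc m) * (\<integral>t. of_real (t ^ m) * f n' t \<partial>lborel)"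
      by (simp add: mult.assoc del: of_nat_Suc)
    finally show ?case using Suc.IH[OF n(2)] by simp
  qed
  obtain c where c: "\<And>z t. t \<noteq> 0 \<Longrightarrow> (\<forall>j\<in>{1..N}. z \<noteq> - 2 * of_nat j) \<Longrightarrow>
      regular_power N N t z = of_real \<bar>t\<bar> powr (z + 2 * of_nat N) / (\<Prod>j=1..N. z + 2 * of_nat j)
      - (\<Sum>j=1..N. c j z * of_real (t ^ (2 * N - 2 * j)))"
    using regular_power_eq[OF order_refl, of N] by blast
  define A where "A = rGamma ((z + 1) / 2 + of_nat N) / 2 ^ N"
  define P where "P = (\<Prod>j=1..N. z + 2 * of_nat j)"
  have np: "\<forall>j\<in>{1..N}. z \<noteq> - 2 * of_nat j" using z by (auto simp: complex_eq_iff)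
  have ker: "mellin_kernel N z t = (A / P) * signed_power z (2 * N) t - (\<Sum>j=1..N. (A * c j z) * of_real (t ^ (2 * N - 2 * j)))" if "t \<noteq> 0" for t
  proof -
    have "signed_power z (2 * N) t = of_real \<bar>t\<bar> powr (z + 2 * of_nat N)"
      using that by (simp add: signed_power_def power_mult sgn_if)
    then show ?thesis
      unfolding mellin_kernel_def c[OF that np] A_def[symmetric] P_def[symmetric]
      by (simp add: right_diff_distrib sum_distrib_left mult.assoc)
  qed
  have isp: "integrable lborel (\<lambda>t. signed_power z (2 * N) t * f (2 * N) t)"
    by (rule integrable_kernel_times_rapid[OF _ _ sb _ _ rap]) (use z in auto)
  have im: "integrable lborel (\<lambda>t. of_real (t ^ m) * f (2 * N) t)" for m
    by (rule integrable_kernel_times_rapid[OF _ _ mb _ _ rap]) auto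
  have "(\<integral>t. mellin_kernel N z t * f (2 * N) t \<partial>lborel) =
      (\<integral>t. (A / P) * (signed_power z (2 * N) t * f (2 * N) t) - (\<Sum>j=1..N. (A * c j z) * (of_real (t ^ (2 * N - 2 * j)) * f (2 * N) t)) \<partial>lborel)"
  proof (rule integral_cong_AE)
    show "AE t in lborel. mellin_kernel N z t * f (2 * N) t = (A / P) * (signed_power z (2 * N) t * f (2 * N) t) -
        (\<Sum>j=1..N. (A * c j z) * (of_real (t ^ (2 * N - 2 * j)) * f (2 * N) t))"
      by (rule AE_mp[OF AE_lborel_singleton[of 0]], rule AE_I2, rule impI)
        (simp add: ker left_diff_distrib sum_distrib_right mult.assoc)
  qed measurable
  also have "\<dots> = (A / P) * (\<integral>t. signed_power z (2 * N) t * f (2 * N) t \<partial>lborel) - (\<Sum>j=1..N. (A * c j z) * (\<integral>t. of_real (t ^ (2 * N - 2 * j)) * f (2 * N) t \<partial>lborel))"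
  proof -
    have i: "integrable lborel (\<lambda>t. (A * c j z) * (of_real (t ^ (2 * N - 2 * j)) * f (2 * N) t))" for j
      by (rule integrable_mult_right) (rule im)
    have "integrable lborel (\<lambda>t. (A / P) * (signed_power z (2 * N) t * f (2 * N) t))"
      by (rule integrable_mult_right) (rule isp)
    moreover have "integrable lborel (\<lambda>t. \<Sum>j=1..N. (A * c j z) * (of_real (t ^ (2 * N - 2 * j)) * f (2 * N) t))"
      by (rule Bochner_Integration.integrable_sum) (rule i)
    ultimately show ?thesis
      by (simp only: Bochner_Integration.integral_diff Bochner_Integration.integral_sum[OF i] integral_mult_right_zero)
  qed
  also have "(\<Sum>j=1..N. (A * c j z) * (\<integral>t. of_real (t ^ (2 * N - 2 * j)) * f (2 * N) t \<partial>lborel)) = 0"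
    by (intro sum.neutral ballI) (subst mono, auto)
  also have "(A / P) * (\<integral>t. signed_power z (2 * N) t * f (2 * N) t \<partial>lborel) = (A * (\<Prod>j=1..2*N. z + of_nat j) / P) * (\<integral>t. signed_power z 0 t * f 0 t \<partial>lborel)"
    by (subst sp) simp
  also have "A * (\<Prod>j=1..2*N. z + of_nat j) / P = rGamma ((z + 1) / 2)"
    unfolding A_def P_def using mellin_kernel_normalization[OF z, of N] by simp
  also have "rGamma ((z + 1) / 2) * (\<integral>t. signed_power z 0 t * f 0 t \<partial>lborel) = (\<integral>t. mellin_kernel 0 z t * f 0 t \<partial>lborel)"
    by (simp add: mellin_kernel_0 signed_power_def mult.assoc)
  finally show ?thesis by simp
qed

section \<open>Schwartz functions pulled back along polynomial maps\<close>

lemma integral_coordinate_cong: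
  fixes F G :: "'a::euclidean_space \<Rightarrow> 'b::{banach,second_countable_topology}"
  assumes b: "b \<in> Basis" and int: "integrable lborel F" "integrable lborel G"
    and eq: "\<And>x. x \<bullet> b = 0 \<Longrightarrow> (\<integral>t. F (x + t *\<^sub>R b) \<partial>lborel) = (\<integral>t. G (x + t *\<^sub>R b) \<partial>lborel)"
  shows "(\<integral>x. F x \<partial>lborel) = (\<integral>x. G x \<partial>lborel)"
proof -
  have "(\<Sum>c\<in>Basis - {b}. g c *\<^sub>R c) \<bullet> b = 0" for g
    using b by (auto simp: inner_sum_left inner_Basis intro!: sum.neutral)
  then show ?thesis
    unfolding integral_along_coordinate[OF b int(1)] integral_along_coordinate[OF b int(2)]
    by (simp only: eq)
qed

lemma real_polynomial_function_directional_derivative: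
  assumes "real_polynomial_function p"
  shows "\<exists>p'. real_polynomial_function p' \<and>
    (\<forall>x. ((\<lambda>t. p (x + t *\<^sub>R b)) has_real_derivative p' x) (at 0))"
  using assms
proof induction
  case (linear f)
  have "((\<lambda>t. f (x + t *\<^sub>R b)) has_real_derivative f b) (at 0)" for x
  proof -
    have "(\<lambda>t. f (x + t *\<^sub>R b)) = (\<lambda>t. f x + t * f b)"
      using linear by (simp add: linear_add linear_scale bounded_linear.linear)
    then show ?thesis by (auto intro!: derivative_eq_intros)
  qed
  then show ?case by blast
next
  case (const c)
  then show ?case by (intro exI[of _ "\<lambda>_. 0"]) auto
next
  case (add f g)
  then obtain f' g' where "real_polynomial_function f'" "real_polynomial_function g'"
    "\<And>x. ((\<lambda>t. f (x + t *\<^sub>R b)) has_real_derivative f' x) (at 0)"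
    "\<And>x. ((\<lambda>t. g (x + t *\<^sub>R b)) has_real_derivative g' x) (at 0)" by blast
  then show ?case
    by (intro exI[of _ "\<lambda>x. f' x + g' x"]) (auto intro!: DERIV_add)
next
  case (mult f g)
  then obtain f' g' where fg: "real_polynomial_function f'" "real_polynomial_function g'"
    "\<And>x. ((\<lambda>t. f (x + t *\<^sub>R b)) has_real_derivative f' x) (at 0)"
    "\<And>x. ((\<lambda>t. g (x + t *\<^sub>R b)) has_real_derivative g' x) (at 0)" by blast
  have "((\<lambda>t. f (x + t *\<^sub>R b) * g (x + t *\<^sub>R b)) has_real_derivative f' x * g x + g' x * f x) (at 0)" for x
    using DERIV_mult[OF fg(3)[of x] fg(4)[of x]] by simp
  moreover have "real_polynomial_function (\<lambda>x. f' x * g x + g' x * f x)"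
    using fg mult by (auto intro: real_polynomial_function.intros(3,4))
  ultimately show ?case by blast
qed

lemma real_polynomial_function_bound:
  assumes "real_polynomial_function p"
  shows "\<exists>C k. \<forall>x. \<bar>p x\<bar> \<le> C * (1 + norm x) ^ k"
  using assms
proof induction
  case (linear f)
  then obtain K where K: "\<And>x. \<bar>f x\<bar> \<le> norm x * K" "K > 0" using bounded_linear.pos_bounded[of f] by force
  have "\<bar>f x\<bar> \<le> K * (1 + norm x) ^ 1" for x using K(1)[of x] K(2) by (simp add: algebra_simps)
  then show ?case by blast
next
  case (const c)
  have "\<bar>c\<bar> \<le> \<bar>c\<bar> * (1 + norm x) ^ 0" for x :: 'a by simp
  then show ?case by blast
next
  case (add f g)
  then obtain C k D l where b: "\<And>x. \<bar>f x\<bar> \<le> C * (1 + norm x) ^ k" "\<And>x. \<bar>g x\<bar> \<le> D * (1 + norm x) ^ l" by blast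
  have "\<bar>f x + g x\<bar> \<le> (\<bar>C\<bar> + \<bar>D\<bar>) * (1 + norm x) ^ (k + l)" for x
  proof -
    have "C * (1 + norm x) ^ k \<le> \<bar>C\<bar> * (1 + norm x) ^ (k + l)" "D * (1 + norm x) ^ l \<le> \<bar>D\<bar> * (1 + norm x) ^ (k + l)"
      by (intro mult_mono power_increasing; simp)+
    then show ?thesis using b[of x] by (simp add: algebra_simps)
  qed
  then show ?case by blast
next
  case (mult f g)
  then obtain C k D l where b: "\<And>x. \<bar>f x\<bar> \<le> C * (1 + norm x) ^ k" "\<And>x. \<bar>g x\<bar> \<le> D * (1 + norm x) ^ l" by blast
  have "\<bar>f x * g x\<bar> \<le> (C * D) * (1 + norm x) ^ (k + l)" for x
  proof -
    have "\<bar>f x * g x\<bar> \<le> (C * (1 + norm x) ^ k) * (D * (1 + norm x) ^ l)"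
      unfolding abs_mult using b[of x] by (intro mult_mono) (auto intro: order_trans[OF abs_ge_zero])
    then show ?thesis by (simp add: power_add mult_ac)
  qed
  then show ?case by blast
qed

lemma schwartz_iter_deriv_differentiable:
  "\<phi> \<in> schwartz \<Longrightarrow> set bs \<subseteq> Basis \<Longrightarrow> iter_deriv bs \<phi> differentiable (at x)"
  by (simp add: schwartz_def)

lemma schwartz_iter_deriv_bound:
  assumes "\<phi> \<in> schwartz" "set bs \<subseteq> Basis"
  shows "\<exists>D. \<forall>x. (1 + norm x) ^ k * norm (iter_deriv bs \<phi> x) \<le> D"
proof -
  obtain C0 Ck where C: "\<And>x. norm x ^ 0 * norm (iter_deriv bs \<phi> x) \<le> C0" "\<And>x. norm x ^ k * norm (iter_deriv bs \<phi> x) \<le> Ck"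
    using assms unfolding schwartz_def by blast
  have "(1 + norm x) ^ k * norm (iter_deriv bs \<phi> x) \<le> 2 ^ k * (\<bar>C0\<bar> + \<bar>Ck\<bar>)" for x
  proof -
    have "(1 + norm x) ^ k \<le> 2 ^ k * (1 + norm x ^ k)"
    proof (cases "norm x \<le> 1")
      case True
      then have "(1 + norm x) ^ k \<le> 2 ^ k" by (intro power_mono) auto
      then show ?thesis by (simp add: algebra_simps add_increasing2)
    next
      case False
      then have "(1 + norm x) ^ k \<le> (2 * norm x) ^ k" by (intro power_mono) auto
      also have "\<dots> \<le> 2 ^ k * (1 + norm x ^ k)" by (simp add: power_mult_distrib)
      finally show ?thesis .
    qed
    then have "(1 + norm x) ^ k * norm (iter_deriv bs \<phi> x) \<le> 2 ^ k * (1 + norm x ^ k) * norm (iter_deriv bs \<phi> x)"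
      by (intro mult_right_mono) auto
    also have "\<dots> = 2 ^ k * (norm x ^ 0 * norm (iter_deriv bs \<phi> x) + norm x ^ k * norm (iter_deriv bs \<phi> x))"
      by (simp add: algebra_simps)
    also have "\<dots> \<le> 2 ^ k * (\<bar>C0\<bar> + \<bar>Ck\<bar>)"
      using C[of x] by (intro mult_left_mono) auto
    finally show ?thesis .
  qed
  then show ?thesis by blast
qed

text \<open>The smallest class that contains \<open>\<lambda>x. \<phi> (\<Phi> x)\<close> and is closed under the derivatives that integration by
parts produces: each chain rule differentiates \<open>\<phi>\<close> once more and multiplies by a derivative of the
polynomial map.\<close>

inductive polynomial_pullback ::
  "('b::euclidean_space \<Rightarrow> complex) \<Rightarrow> ('a::euclidean_space \<Rightarrow> 'b) \<Rightarrow> ('a \<Rightarrow> complex) \<Rightarrow> bool"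
  for \<phi> \<Phi> where
  base: "set bs \<subseteq> Basis \<Longrightarrow> real_polynomial_function p \<Longrightarrow>
    polynomial_pullback \<phi> \<Phi> (\<lambda>x. of_real (p x) * iter_deriv bs \<phi> (\<Phi> x))"
| add: "polynomial_pullback \<phi> \<Phi> f \<Longrightarrow> polynomial_pullback \<phi> \<Phi> g \<Longrightarrow> polynomial_pullback \<phi> \<Phi> (\<lambda>x. f x + g x)"

lemma polynomial_pullback_sum:
  assumes "finite S" "\<And>c. c \<in> S \<Longrightarrow> polynomial_pullback \<phi> \<Phi> (F c)"
  shows "polynomial_pullback \<phi> \<Phi> (\<lambda>x. \<Sum>c\<in>S. F c x)"
  using assms
proof (induction S rule: finite_induct)
  case empty
  show ?case using polynomial_pullback.base[of "[]" "\<lambda>_. 0" \<phi> \<Phi>] by auto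
qed (auto intro: polynomial_pullback.add)

lemma polynomial_pullback_self: "polynomial_pullback \<phi> \<Phi> (\<lambda>x. \<phi> (\<Phi> x))"
  using polynomial_pullback.base[of "[]" "\<lambda>_. 1" \<phi> \<Phi>] by auto

lemma polynomial_pullback_derivative:
  fixes \<Phi> :: "'a::euclidean_space \<Rightarrow> 'b::euclidean_space"
  assumes \<phi>: "\<phi> \<in> schwartz" and \<Phi>: "\<And>c. c \<in> Basis \<Longrightarrow> real_polynomial_function (\<lambda>x. \<Phi> x \<bullet> c)"
    and f: "polynomial_pullback \<phi> \<Phi> f"
  shows "\<exists>f'. polynomial_pullback \<phi> \<Phi> f' \<and> (\<forall>x t. ((\<lambda>t. f (x + t *\<^sub>R b)) has_vector_derivative f' (x + t *\<^sub>R b)) (at t))"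
proof -
  have "\<exists>f'. polynomial_pullback \<phi> \<Phi> f' \<and> (\<forall>x. ((\<lambda>t. f (x + t *\<^sub>R b)) has_vector_derivative f' x) (at 0))"
    using f
  proof induction
    case (base bs p)
    obtain p' where p': "real_polynomial_function p'" "\<And>x. ((\<lambda>t. p (x + t *\<^sub>R b)) has_real_derivative p' x) (at 0)"
      using real_polynomial_function_directional_derivative[OF base(2)] by blast
    have "\<forall>c\<in>Basis. \<exists>q. real_polynomial_function q \<and> (\<forall>x. ((\<lambda>t. \<Phi> (x + t *\<^sub>R b) \<bullet> c) has_real_derivative q x) (at 0))"
      using real_polynomial_function_directional_derivative[OF \<Phi>] by blast
    then obtain q where q: "\<And>c. c \<in> Basis \<Longrightarrow> real_polynomial_function (q c)"
      "\<And>c x. c \<in> Basis \<Longrightarrow> ((\<lambda>t. \<Phi> (x + t *\<^sub>R b) \<bullet> c) has_real_derivative q c x) (at 0)" by metis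
    define f' where "f' x = of_real (p' x) * iter_deriv bs \<phi> (\<Phi> x) +
      (\<Sum>c\<in>Basis. of_real (p x * q c x) * iter_deriv (c # bs) \<phi> (\<Phi> x))" for x
    have "polynomial_pullback \<phi> \<Phi> f'"
      unfolding f'_def
      using base p'(1) q(1) by (intro polynomial_pullback.intros polynomial_pullback_sum) auto
    moreover have "((\<lambda>t. of_real (p (x + t *\<^sub>R b)) * iter_deriv bs \<phi> (\<Phi> (x + t *\<^sub>R b))) has_vector_derivative f' x) (at 0)" for x
    proof -
      define \<psi> where "\<psi> = iter_deriv bs \<phi>"
      have d\<Phi>: "((\<lambda>t. \<Phi> (x + t *\<^sub>R b)) has_vector_derivative (\<Sum>c\<in>Basis. q c x *\<^sub>R c)) (at 0)"
      proof -
        have "((\<lambda>t. \<Sum>c\<in>Basis. (\<Phi> (x + t *\<^sub>R b) \<bullet> c) *\<^sub>R c) has_vector_derivative (\<Sum>c\<in>Basis. q c x *\<^sub>R c)) (at 0)"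
          using q(2) by (intro has_vector_derivative_sum)
            (auto intro!: derivative_eq_intros simp: has_real_derivative_iff_has_vector_derivative)
        then show ?thesis by (simp add: euclidean_representation)
      qed
      have d\<psi>: "(\<psi> has_derivative frechet_derivative \<psi> (at (\<Phi> x))) (at (\<Phi> x))"
        using schwartz_iter_deriv_differentiable[OF \<phi> base(1)] unfolding \<psi>_def
        by (simp add: frechet_derivative_works)
      then have lin: "linear (frechet_derivative \<psi> (at (\<Phi> x)))" by (rule has_derivative_linear)
      have "((\<lambda>t. \<psi> (\<Phi> (x + t *\<^sub>R b))) has_vector_derivative frechet_derivative \<psi> (at (\<Phi> x)) (\<Sum>c\<in>Basis. q c x *\<^sub>R c)) (at 0)"
        using vector_derivative_diff_chain_within[OF d\<Phi>, of \<psi> "frechet_derivative \<psi> (at (\<Phi> x))"] d\<psi>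
        by (simp add: o_def has_derivative_at_withinI)
      also have "frechet_derivative \<psi> (at (\<Phi> x)) (\<Sum>c\<in>Basis. q c x *\<^sub>R c) = (\<Sum>c\<in>Basis. q c x *\<^sub>R iter_deriv (c # bs) \<phi> (\<Phi> x))"
        using lin by (simp add: linear_sum linear_scale \<psi>_def)
      finally have d: "((\<lambda>t. \<psi> (\<Phi> (x + t *\<^sub>R b))) has_vector_derivative (\<Sum>c\<in>Basis. q c x *\<^sub>R iter_deriv (c # bs) \<phi> (\<Phi> x))) (at 0)" .
      have "((\<lambda>t. of_real (p (x + t *\<^sub>R b)) * \<psi> (\<Phi> (x + t *\<^sub>R b))) has_vector_derivative
          of_real (p (x + 0 *\<^sub>R b)) * (\<Sum>c\<in>Basis. q c x *\<^sub>R iter_deriv (c # bs) \<phi> (\<Phi> x)) + of_real (p' x) * \<psi> (\<Phi> (x + 0 *\<^sub>R b))) (at 0)"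
        by (rule has_vector_derivative_mult[OF has_vector_derivative_of_real[OF p'(2)] d])
      also have "of_real (p (x + 0 *\<^sub>R b)) * (\<Sum>c\<in>Basis. q c x *\<^sub>R iter_deriv (c # bs) \<phi> (\<Phi> x)) + of_real (p' x) * \<psi> (\<Phi> (x + 0 *\<^sub>R b)) = f' x"
        unfolding f'_def \<psi>_def by (simp add: sum_distrib_left scaleR_conv_of_real mult.assoc del: iter_deriv.simps)
      finally show ?thesis unfolding \<psi>_def .
    qed
    ultimately show ?case by blast
  next
    case (add f g)
    then obtain f' g' where fg: "polynomial_pullback \<phi> \<Phi> f'" "polynomial_pullback \<phi> \<Phi> g'"
      "\<And>x. ((\<lambda>t. f (x + t *\<^sub>R b)) has_vector_derivative f' x) (at 0)"
      "\<And>x. ((\<lambda>t. g (x + t *\<^sub>R b)) has_vector_derivative g' x) (at 0)" by blast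
    have "polynomial_pullback \<phi> \<Phi> (\<lambda>x. f' x + g' x)" using fg(1,2) by (rule polynomial_pullback.add)
    moreover have "((\<lambda>t. f (x + t *\<^sub>R b) + g (x + t *\<^sub>R b)) has_vector_derivative f' x + g' x) (at 0)" for x
      using fg(3,4) by (rule has_vector_derivative_add)
    ultimately show ?case by blast
  qed
  then obtain f' where f': "polynomial_pullback \<phi> \<Phi> f'" "\<And>x. ((\<lambda>t. f (x + t *\<^sub>R b)) has_vector_derivative f' x) (at 0)" by blast
  have "((\<lambda>t. f (x + t *\<^sub>R b)) has_vector_derivative f' (x + t *\<^sub>R b)) (at t)" for x t
  proof -
    have 1: "((\<lambda>s. f ((x + t *\<^sub>R b) + s *\<^sub>R b)) has_vector_derivative f' (x + t *\<^sub>R b)) (at (t - t))" using f'(2) by simp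
    have 2: "((\<lambda>u. u - t) has_vector_derivative 1) (at t)"
      by (auto intro!: derivative_eq_intros simp flip: has_real_derivative_iff_has_vector_derivative)
    have "((\<lambda>s. f ((x + t *\<^sub>R b) + s *\<^sub>R b)) \<circ> (\<lambda>u. u - t) has_vector_derivative 1 *\<^sub>R f' (x + t *\<^sub>R b)) (at t)"
      by (rule vector_diff_chain_at[OF 2 1])
    then show ?thesis by (simp add: o_def algebra_simps)
  qed
  with f'(1) show ?thesis by blast
qed

lemma polynomial_pullback_measurable:
  fixes \<Phi> :: "'a::euclidean_space \<Rightarrow> 'b::euclidean_space"
  assumes \<phi>: "\<phi> \<in> schwartz" and \<Phi>: "\<Phi> \<in> borel_measurable borel" and f: "polynomial_pullback \<phi> \<Phi> f"
  shows "f \<in> borel_measurable borel"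
  using f
proof induction
  case (base bs p)
  have "continuous_on UNIV (iter_deriv bs \<phi>)"
    using schwartz_iter_deriv_differentiable[OF \<phi> base(1)]
    by (auto intro!: continuous_at_imp_continuous_on differentiable_imp_continuous_within)
  then have 1[measurable]: "iter_deriv bs \<phi> \<in> borel_measurable borel" by (rule borel_measurable_continuous_onI)
  have "continuous_on UNIV p"
    using base(2) continuous_on_polymonial_function real_polynomial_function_eq by blast
  then have 2[measurable]: "p \<in> borel_measurable borel" by (rule borel_measurable_continuous_onI)
  note [measurable] = \<Phi>
  show ?case by measurable
qed measurable

text \<open>Where \<open>x\<close> is bounded polynomially by \<open>\<Phi> x\<close>, the decrease of the derivatives of \<open>\<phi>\<close> in \<open>\<Phi> x\<close> outweighs
any polynomial in \<open>x\<close>.\<close>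

lemma polynomial_pullback_bound:
  fixes \<Phi> :: "'a::euclidean_space \<Rightarrow> 'b::euclidean_space"
  assumes \<phi>: "\<phi> \<in> schwartz"
    and growth: "\<And>x b. x \<in> X \<Longrightarrow> b \<in> Basis \<Longrightarrow> \<bar>x \<bullet> b\<bar> \<le> C * (1 + norm (\<Phi> x))"
    and f: "polynomial_pullback \<phi> \<Phi> f"
  shows "\<exists>D. \<forall>x\<in>X. norm (f x) * (\<Prod>b\<in>Basis. (1 + \<bar>x \<bullet> b\<bar>) ^ M) \<le> D"
  using f
proof induction
  case (base bs p)
  define C' where "C' = 1 + \<bar>C\<bar>"
  define n where "n = DIM('a)"
  obtain K k where K: "\<And>x. \<bar>p x\<bar> \<le> K * (1 + norm x) ^ k"
    using real_polynomial_function_bound[OF base(2)] by blast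
  obtain D where D: "\<And>y. (1 + norm y) ^ (k + n * M) * norm (iter_deriv bs \<phi> y) \<le> D"
    using schwartz_iter_deriv_bound[OF \<phi> base(1)] by blast
  have "norm (of_real (p x) * iter_deriv bs \<phi> (\<Phi> x)) * (\<Prod>b\<in>Basis. (1 + \<bar>x \<bullet> b\<bar>) ^ M)
      \<le> (\<bar>K\<bar> * (1 + real n * C') ^ k * C' ^ (n * M)) * D" if x: "x \<in> X" for x
  proof -
    define B where "B = 1 + norm (\<Phi> x)"
    have B1: "B \<ge> 1" by (simp add: B_def)
    have g: "\<bar>x \<bullet> b\<bar> \<le> \<bar>C\<bar> * B" if "b \<in> Basis" for b
      using growth[OF x that] B1 unfolding B_def by (smt (verit) mult_right_mono norm_ge_zero)
    have g1: "1 + \<bar>x \<bullet> b\<bar> \<le> C' * B" if "b \<in> Basis" for b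
      using g[OF that] B1 by (simp add: C'_def algebra_simps)
    have "(\<Prod>b\<in>Basis. (1 + \<bar>x \<bullet> b\<bar>) ^ M) \<le> (\<Prod>b\<in>(Basis::'a set). (C' * B) ^ M)"
      using g1 by (intro prod_mono conjI power_mono) auto
    also have "\<dots> = C' ^ (n * M) * B ^ (n * M)"
      by (simp add: n_def power_mult_distrib power_mult mult.commute)
    finally have 1: "(\<Prod>b\<in>Basis. (1 + \<bar>x \<bullet> b\<bar>) ^ M) \<le> C' ^ (n * M) * B ^ (n * M)" .
    have "norm x \<le> (\<Sum>b\<in>Basis. \<bar>x \<bullet> b\<bar>)" by (rule norm_le_l1)
    also have "\<dots> \<le> (\<Sum>b\<in>(Basis::'a set). C' * B)" using g1 by (intro sum_mono) force
    finally have "1 + norm x \<le> B + real n * C' * B" using B1 by (simp add: n_def)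
    then have "(1 + norm x) ^ k \<le> (B + real n * C' * B) ^ k" by (intro power_mono) auto
    also have "\<dots> = (1 + real n * C') ^ k * B ^ k" by (simp add: power_mult_distrib[symmetric] algebra_simps)
    finally have 2: "(1 + norm x) ^ k \<le> (1 + real n * C') ^ k * B ^ k" .
    have "\<bar>p x\<bar> \<le> \<bar>K\<bar> * (1 + norm x) ^ k" using K[of x] by (smt (verit) mult_right_mono norm_ge_zero zero_le_power)
    also have "\<dots> \<le> \<bar>K\<bar> * ((1 + real n * C') ^ k * B ^ k)" using 2 by (intro mult_left_mono) auto
    finally have 3: "\<bar>p x\<bar> \<le> \<bar>K\<bar> * ((1 + real n * C') ^ k * B ^ k)" .
    have "norm (of_real (p x) * iter_deriv bs \<phi> (\<Phi> x)) * (\<Prod>b\<in>Basis. (1 + \<bar>x \<bullet> b\<bar>) ^ M)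
        = \<bar>p x\<bar> * norm (iter_deriv bs \<phi> (\<Phi> x)) * (\<Prod>b\<in>Basis. (1 + \<bar>x \<bullet> b\<bar>) ^ M)"
      by (simp add: norm_mult)
    also have "\<dots> \<le> (\<bar>K\<bar> * ((1 + real n * C') ^ k * B ^ k)) * norm (iter_deriv bs \<phi> (\<Phi> x)) * (C' ^ (n * M) * B ^ (n * M))"
      using 1 3 by (intro mult_mono) (auto intro!: mult_nonneg_nonneg prod_nonneg order_trans[OF abs_ge_zero 3])
    also have "\<dots> = (\<bar>K\<bar> * (1 + real n * C') ^ k * C' ^ (n * M)) * (B ^ (k + n * M) * norm (iter_deriv bs \<phi> (\<Phi> x)))"
      by (simp add: power_add mult_ac)
    also have "\<dots> \<le> (\<bar>K\<bar> * (1 + real n * C') ^ k * C' ^ (n * M)) * D"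
      using D[of "\<Phi> x"] unfolding B_def by (intro mult_left_mono) (auto simp: C'_def)
    finally show ?thesis .
  qed
  then show ?case by blast
next
  case (add f g)
  then obtain D E where b: "\<And>x. x \<in> X \<Longrightarrow> norm (f x) * (\<Prod>b\<in>Basis. (1 + \<bar>x \<bullet> b\<bar>) ^ M) \<le> D"
    "\<And>x. x \<in> X \<Longrightarrow> norm (g x) * (\<Prod>b\<in>Basis. (1 + \<bar>x \<bullet> b\<bar>) ^ M) \<le> E" by blast
  have "norm (f x + g x) * (\<Prod>b\<in>Basis. (1 + \<bar>x \<bullet> b\<bar>) ^ M) \<le> D + E" if "x \<in> X" for x
  proof -
    have "norm (f x + g x) * (\<Prod>b\<in>Basis. (1 + \<bar>x \<bullet> b\<bar>) ^ M) \<le> (norm (f x) + norm (g x)) * (\<Prod>b\<in>Basis. (1 + \<bar>x \<bullet> b\<bar>) ^ M)"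
      by (intro mult_right_mono norm_triangle_ineq prod_nonneg) auto
    then show ?thesis using b[OF that] by (simp add: distrib_right)
  qed
  then show ?case by blast
qed

section \<open>Entire continuation of weighted Mellin integrals\<close>

definition admissible_kernel :: "(real \<Rightarrow> complex) \<Rightarrow> bool"
  where "admissible_kernel g \<longleftrightarrow> g \<in> borel_measurable borel \<and>
    (\<exists>C \<sigma> \<tau>. 0 \<le> C \<and> -1 < \<sigma> \<and> -1 < \<tau> \<and> (\<forall>t. norm (g t) \<le> C * power_bound \<sigma> \<tau> t))"

lemma mellin_kernel_locally_bounded:
  assumes "Re z0 > - 2 * real N - 1"
  obtains \<epsilon> C \<sigma> \<tau> where "\<epsilon> > 0" "C \<ge> 0" "-1 < \<sigma>" "-1 < \<tau>"
    "\<And>z t. z \<in> ball z0 \<epsilon> \<Longrightarrow> norm (mellin_kernel N z t) \<le> C * power_bound \<sigma> \<tau> t"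
proof -
  obtain \<epsilon> C \<sigma> \<tau> where e: "\<epsilon> > 0" "C \<ge> 0" "-1 < \<sigma>" "\<sigma> \<le> \<tau>"
    "\<And>z t. z \<in> ball z0 \<epsilon> \<Longrightarrow> t \<noteq> 0 \<Longrightarrow> norm (mellin_kernel N z t) \<le> C * power_bound \<sigma> \<tau> t"
    using locally_power_boundedD[OF locally_power_bounded_mellin_kernel assms] by blast
  have "norm (mellin_kernel N z t) \<le> C * power_bound \<sigma> \<tau> t" if "z \<in> ball z0 \<epsilon>" for z t
    using e that power_bound_nonneg by (cases "t = 0") (auto simp: mellin_kernel_zero)
  then show ?thesis using e by (intro that[of \<epsilon> C \<sigma> \<tau>]) auto
qed

lemma admissible_mellin_kernel:
  assumes "Re z > - 2 * real N - 1"
  shows "admissible_kernel (mellin_kernel N z)"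
proof -
  obtain \<epsilon> C \<sigma> \<tau> where "\<epsilon> > 0" "C \<ge> 0" "-1 < \<sigma>" "-1 < \<tau>"
    "\<And>z' t. z' \<in> ball z \<epsilon> \<Longrightarrow> norm (mellin_kernel N z' t) \<le> C * power_bound \<sigma> \<tau> t"
    using mellin_kernel_locally_bounded[OF assms] by blast
  moreover from this have "\<forall>t. norm (mellin_kernel N z t) \<le> C * power_bound \<sigma> \<tau> t" by simp
  ultimately show ?thesis unfolding admissible_kernel_def using mellin_kernel_measurable by blast
qed

text \<open>The coordinates \<open>e i\<close> with \<open>i \<in> I\<close> are those that will carry powers. The cut-off \<open>\<eta>\<close> is merely measurable:
being constant along these coordinates, it is never differentiated.\<close>

locale polynomial_substitution =
  fixes \<phi> :: "'b::euclidean_space \<Rightarrow> complex" and \<Phi> :: "'a::euclidean_space \<Rightarrow> 'b" and \<eta> :: "'a \<Rightarrow> real"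
    and I :: "'i set" and e :: "'i \<Rightarrow> 'a" and C0 :: real
  assumes \<phi>: "\<phi> \<in> schwartz"
    and poly: "\<And>c. c \<in> Basis \<Longrightarrow> real_polynomial_function (\<lambda>x. \<Phi> x \<bullet> c)"
    and \<eta>_measurable [measurable]: "\<eta> \<in> borel_measurable borel" and \<eta>_bound: "\<And>x. \<bar>\<eta> x\<bar> \<le> 1"
    and \<eta>_invariant: "\<And>i x t. i \<in> I \<Longrightarrow> \<eta> (x + t *\<^sub>R e i) = \<eta> x"
    and growth: "\<And>x b. \<eta> x \<noteq> 0 \<Longrightarrow> b \<in> Basis \<Longrightarrow> \<bar>x \<bullet> b\<bar> \<le> C0 * (1 + norm (\<Phi> x))"
    and fin: "finite I" and inj: "inj_on e I" and eB: "\<And>i. i \<in> I \<Longrightarrow> e i \<in> Basis"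
begin

lemma \<Phi>_measurable [measurable]: "\<Phi> \<in> borel_measurable borel"
proof -
  have ci: "continuous_on UNIV (\<lambda>x. \<Phi> x \<bullet> c)" if "c \<in> Basis" for c
    using poly[OF that] continuous_on_polymonial_function real_polynomial_function_eq by blast
  then have "continuous_on UNIV (\<lambda>x. \<Sum>c\<in>Basis. (\<Phi> x \<bullet> c) *\<^sub>R c)"
    by (intro continuous_on_sum continuous_on_scaleR continuous_on_const) (use ci in auto)
  then show ?thesis by (simp add: euclidean_representation borel_measurable_continuous_onI)
qed

lemmas pullback_measurable [measurable_dest] = polynomial_pullback_measurable[OF \<phi> \<Phi>_measurable]

definition weighted :: "('i \<Rightarrow> real \<Rightarrow> complex) \<Rightarrow> ('a \<Rightarrow> complex) \<Rightarrow> 'a \<Rightarrow> complex"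
  where "weighted g f x = of_real (\<eta> x) * (\<Prod>i\<in>I. g i (x \<bullet> e i)) * f x"

lemma weighted_measurable:
  assumes "\<And>i. i \<in> I \<Longrightarrow> g i \<in> borel_measurable borel" "polynomial_pullback \<phi> \<Phi> f"
  shows "weighted g f \<in> borel_measurable borel"
proof -
  have [measurable]: "f \<in> borel_measurable borel" using assms(2) by (rule pullback_measurable)
  have "(\<lambda>x. g i (x \<bullet> e i)) \<in> borel_measurable borel" if "i \<in> I" for i
    using assms(1)[OF that] by measurable
  then have [measurable]: "(\<lambda>x. \<Prod>i\<in>I. g i (x \<bullet> e i)) \<in> borel_measurable borel"
    by (intro borel_measurable_prod)
  show ?thesis unfolding weighted_def[abs_def] by measurable
qed

text \<open>The dominating function \<open>H\<close> is the same for all kernels with given exponents, as locally uniform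
domination in the parameters requires. It is a product of functions of one coordinate each.\<close>

lemma weighted_dominated:
  assumes st: "\<And>i. i \<in> I \<Longrightarrow> -1 < \<sigma> i" "\<And>i. i \<in> I \<Longrightarrow> -1 < \<tau> i" and f: "polynomial_pullback \<phi> \<Phi> f"
  obtains H where "integrable lborel H"
    "\<And>C g x. (\<And>i. i \<in> I \<Longrightarrow> 0 \<le> C i) \<Longrightarrow> (\<And>i t. i \<in> I \<Longrightarrow> norm (g i t) \<le> C i * power_bound (\<sigma> i) (\<tau> i) t) \<Longrightarrow>
      norm (weighted g f x) \<le> (\<Prod>i\<in>I. C i) * H x"
proof -
  have "\<forall>i\<in>I. \<exists>M0. \<forall>M\<ge>M0. integrable lborel (\<lambda>t. power_bound (\<sigma> i) (\<tau> i) t / (1 + \<bar>t\<bar>) ^ M)"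
    using st by (auto intro!: integrable_power_bound_decay)
  then obtain M0 where M0: "\<And>i M. i \<in> I \<Longrightarrow> M \<ge> M0 i \<Longrightarrow> integrable lborel (\<lambda>t. power_bound (\<sigma> i) (\<tau> i) t / (1 + \<bar>t\<bar>) ^ M)"
    by metis
  \<comment> \<open>large enough for all the kernels at once, and at least 2 for the coordinates without a kernel\<close>
  define M where "M = 2 + (\<Sum>i\<in>I. M0 i)"
  have MM0: "M \<ge> M0 i" if "i \<in> I" for i
    using member_le_sum[OF that, of M0] fin by (simp add: M_def)
  define j where "j b = inv_into I e b" for b
  have j: "j (e i) = i" if "i \<in> I" for i using inj that by (simp add: j_def)
  define q where "q b t = (if b \<in> e ` I then power_bound (\<sigma> (j b)) (\<tau> (j b)) t else 1) / (1 + \<bar>t\<bar>) ^ M" for b and t :: real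
  have "integrable lborel (q b)" for b
  proof (cases "b \<in> e ` I")
    case True
    then obtain i where i: "i \<in> I" "b = e i" by blast
    then have "q b = (\<lambda>t. power_bound (\<sigma> i) (\<tau> i) t / (1 + \<bar>t\<bar>) ^ M)" by (auto simp: q_def j fun_eq_iff)
    then show ?thesis using M0[OF i(1) MM0[OF i(1)]] by simp
  next
    case False
    have "integrable lborel (\<lambda>t::real. \<bar>t\<bar> powr 0 / (1 + \<bar>t\<bar>) ^ M)"
      by (rule integrable_powr_decay) (auto simp: M_def intro!: sum_nonneg)
    then have "integrable lborel (\<lambda>t::real. 1 / (1 + \<bar>t\<bar>) ^ M)"
    proof (rule integrable_cong_AE_imp)
      show "AE t::real in lborel. \<bar>t\<bar> powr 0 / (1 + \<bar>t\<bar>) ^ M = 1 / (1 + \<bar>t\<bar>) ^ M"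
        by (rule AE_mp[OF AE_lborel_singleton[of 0]], rule AE_I2) auto
    qed measurable
    then show ?thesis unfolding q_def using False by simp
  qed
  then have int: "integrable lborel (\<lambda>x. \<Prod>b\<in>Basis. q b (x \<bullet> b))" by (intro integrable_prod_coordinates)
  obtain D where D: "\<And>x. x \<in> {x. \<eta> x \<noteq> 0} \<Longrightarrow> norm (f x) * (\<Prod>b\<in>Basis. (1 + \<bar>x \<bullet> b\<bar>) ^ M) \<le> D"
    using polynomial_pullback_bound[OF \<phi> _ f, of "{x. \<eta> x \<noteq> 0}" C0 M] growth by blast
  have qprod: "(\<Prod>b\<in>Basis. q b (x \<bullet> b)) = (\<Prod>i\<in>I. power_bound (\<sigma> i) (\<tau> i) (x \<bullet> e i)) / (\<Prod>b\<in>Basis. (1 + \<bar>x \<bullet> b\<bar>) ^ M)" for x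
  proof -
    have "(\<Prod>b\<in>Basis. if b \<in> e ` I then power_bound (\<sigma> (j b)) (\<tau> (j b)) (x \<bullet> b) else 1) = (\<Prod>b\<in>e ` I. power_bound (\<sigma> (j b)) (\<tau> (j b)) (x \<bullet> b))"
    proof -
      have "e ` I = Basis \<inter> e ` I" using eB by auto
      then show ?thesis
        using prod.inter_restrict[OF finite_Basis, of "\<lambda>b. power_bound (\<sigma> (j b)) (\<tau> (j b)) (x \<bullet> b)" "e ` I"] by simp
    qed
    also have "\<dots> = (\<Prod>i\<in>I. power_bound (\<sigma> i) (\<tau> i) (x \<bullet> e i))"
      unfolding prod.reindex[OF inj] by (rule prod.cong) (auto simp: j)
    finally show ?thesis unfolding q_def prod_dividef by simp
  qed
  have "norm (weighted g f x) \<le> (\<Prod>i\<in>I. C i) * (\<bar>D\<bar> * (\<Prod>b\<in>Basis. q b (x \<bullet> b)))"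
    if g: "\<And>i. i \<in> I \<Longrightarrow> 0 \<le> C i" "\<And>i t. i \<in> I \<Longrightarrow> norm (g i t) \<le> C i * power_bound (\<sigma> i) (\<tau> i) t" for C g x
  proof (cases "\<eta> x = 0")
    case True
    have "0 \<le> (\<Prod>i\<in>I. C i)" "0 \<le> (\<Prod>b\<in>Basis. q b (x \<bullet> b))"
      using g by (auto intro!: prod_nonneg simp: q_def power_bound_nonneg)
    then show ?thesis using True by (simp add: weighted_def)
  next
    case False
    have Q: "(\<Prod>b\<in>Basis. (1 + \<bar>x \<bullet> b\<bar>) ^ M) > 0" by (intro prod_pos) (auto intro: zero_less_power add_pos_nonneg)
    have "norm (f x) \<le> \<bar>D\<bar> / (\<Prod>b\<in>Basis. (1 + \<bar>x \<bullet> b\<bar>) ^ M)"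
      using D[of x] False Q by (simp add: field_simps)
    moreover have "norm (\<Prod>i\<in>I. g i (x \<bullet> e i)) \<le> (\<Prod>i\<in>I. C i * power_bound (\<sigma> i) (\<tau> i) (x \<bullet> e i))"
      unfolding prod_norm[symmetric] using g by (intro prod_mono) auto
    moreover have "norm (of_real (\<eta> x) :: complex) \<le> 1" using \<eta>_bound by simp
    ultimately have "norm (weighted g f x) \<le> 1 * (\<Prod>i\<in>I. C i * power_bound (\<sigma> i) (\<tau> i) (x \<bullet> e i)) * (\<bar>D\<bar> / (\<Prod>b\<in>Basis. (1 + \<bar>x \<bullet> b\<bar>) ^ M))"
      unfolding weighted_def norm_mult
      by (intro mult_mono mult_nonneg_nonneg prod_nonneg) (use g power_bound_nonneg in auto)
    then show ?thesis by (simp add: qprod prod.distrib mult_ac)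
  qed
  moreover have "integrable lborel (\<lambda>x. \<bar>D\<bar> * (\<Prod>b\<in>Basis. q b (x \<bullet> b)))"
    using int by (rule integrable_mult_right)
  ultimately show ?thesis using that by blast
qed

lemma integrable_weighted:
  assumes g: "\<And>i. i \<in> I \<Longrightarrow> admissible_kernel (g i)" and f: "polynomial_pullback \<phi> \<Phi> f"
  shows "integrable lborel (weighted g f)"
proof -
  have "\<forall>i\<in>I. \<exists>C \<sigma> \<tau>. 0 \<le> C \<and> -1 < \<sigma> \<and> -1 < \<tau> \<and> (\<forall>t. norm (g i t) \<le> C * power_bound \<sigma> \<tau> t)"
    using g by (auto simp: admissible_kernel_def)
  then obtain C \<sigma> \<tau> where b: "\<And>i. i \<in> I \<Longrightarrow> 0 \<le> C i" "\<And>i. i \<in> I \<Longrightarrow> -1 < \<sigma> i" "\<And>i. i \<in> I \<Longrightarrow> -1 < \<tau> i"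
    "\<And>i t. i \<in> I \<Longrightarrow> norm (g i t) \<le> C i * power_bound (\<sigma> i) (\<tau> i) t" by metis
  obtain H where H: "integrable lborel H" "\<And>C g x. (\<And>i. i \<in> I \<Longrightarrow> 0 \<le> C i) \<Longrightarrow>
      (\<And>i t. i \<in> I \<Longrightarrow> norm (g i t) \<le> C i * power_bound (\<sigma> i) (\<tau> i) t) \<Longrightarrow> norm (weighted g f x) \<le> (\<Prod>i\<in>I. C i) * H x"
    by (rule weighted_dominated[OF b(2,3) f]) blast+
  show ?thesis
  proof (rule Bochner_Integration.integrable_bound)
    show "integrable lborel (\<lambda>x. (\<Prod>i\<in>I. C i) * H x)" using H(1) by simp
    show "weighted g f \<in> borel_measurable lborel"
      using g weighted_measurable[OF _ f] by (auto simp: admissible_kernel_def)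
    show "AE x in lborel. norm (weighted g f x) \<le> norm ((\<Prod>i\<in>I. C i) * H x)"
      unfolding real_norm_def by (intro AE_I2 order_trans[OF H(2)[OF b(1,4)] abs_ge_self])
  qed
qed

text \<open>By Fubini it suffices to compare the integrals over the lines parallel to \<open>e j\<close>, where \<open>mellin_kernel_integral\<close>
applies.\<close>

lemma replace_one_kernel:
  assumes j: "j \<in> I" and f: "polynomial_pullback \<phi> \<Phi> f"
  shows "\<exists>f'. polynomial_pullback \<phi> \<Phi> f' \<and> (\<forall>z g. Re z > -1 \<longrightarrow> (\<forall>i\<in>I - {j}. admissible_kernel (g i)) \<longrightarrow>
    (\<integral>x. weighted (g(j := mellin_kernel N z)) f' x \<partial>lborel) = (\<integral>x. weighted (g(j := mellin_kernel 0 z)) f x \<partial>lborel))"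
proof -
  define b where "b = e j"
  have b: "b \<in> Basis" using eB j by (simp add: b_def)
  have "\<forall>f. \<exists>f'. polynomial_pullback \<phi> \<Phi> f \<longrightarrow> polynomial_pullback \<phi> \<Phi> f' \<and> (\<forall>x t. ((\<lambda>t. f (x + t *\<^sub>R b)) has_vector_derivative f' (x + t *\<^sub>R b)) (at t))"
    using polynomial_pullback_derivative[OF \<phi> poly] by blast
  then obtain D where D: "\<And>f. polynomial_pullback \<phi> \<Phi> f \<Longrightarrow> polynomial_pullback \<phi> \<Phi> (D f)"
    "\<And>f x t. polynomial_pullback \<phi> \<Phi> f \<Longrightarrow> ((\<lambda>t. f (x + t *\<^sub>R b)) has_vector_derivative D f (x + t *\<^sub>R b)) (at t)"
    by metis
  define F where "F m = (D ^^ m) f" for m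
  have F: "polynomial_pullback \<phi> \<Phi> (F m)" for m
    by (induction m) (auto simp: F_def f D(1))
  have dF: "((\<lambda>t. F m (x + t *\<^sub>R b)) has_vector_derivative F (Suc m) (x + t *\<^sub>R b)) (at t)" for m x t
    using D(2)[OF F[of m]] by (simp add: F_def)
  show ?thesis
  proof (intro exI[of _ "F (2 * N)"] conjI allI impI F)
    fix z g assume z: "Re z > -1" and g: "\<forall>i\<in>I - {j}. admissible_kernel (g i)"
    show "(\<integral>x. weighted (g(j := mellin_kernel N z)) (F (2 * N)) x \<partial>lborel) = (\<integral>x. weighted (g(j := mellin_kernel 0 z)) f x \<partial>lborel)"
    proof (rule integral_coordinate_cong[OF b])
      have "Re z > - 2 * real N - 1" "Re z > - 2 * real 0 - 1" using z by auto
      then show "integrable lborel (weighted (g(j := mellin_kernel N z)) (F (2 * N)))"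
        "integrable lborel (weighted (g(j := mellin_kernel 0 z)) f)"
        using g admissible_mellin_kernel by (auto intro!: integrable_weighted F f)
      fix x assume x: "x \<bullet> b = 0"
      have slice: "weighted (g(j := k)) h (x + t *\<^sub>R b) =
          (of_real (\<eta> x) * (\<Prod>i\<in>I - {j}. g i (x \<bullet> e i))) * (k t * h (x + t *\<^sub>R b))" for k h t
      proof -
        have "(\<Prod>i\<in>I. (g(j := k)) i ((x + t *\<^sub>R b) \<bullet> e i)) = k ((x + t *\<^sub>R b) \<bullet> e j) * (\<Prod>i\<in>I - {j}. g i ((x + t *\<^sub>R b) \<bullet> e i))"
          using fin j by (subst prod.remove[of _ j]) (auto intro!: prod.cong)
        also have "(x + t *\<^sub>R b) \<bullet> e j = t" using x b by (simp add: inner_add_left b_def[symmetric])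
        also have "(\<Prod>i\<in>I - {j}. g i ((x + t *\<^sub>R b) \<bullet> e i)) = (\<Prod>i\<in>I - {j}. g i (x \<bullet> e i))"
        proof (intro prod.cong refl)
          fix i assume i: "i \<in> I - {j}"
          then have "e i \<noteq> b" using inj j by (auto simp: b_def inj_on_def)
          then show "g i ((x + t *\<^sub>R b) \<bullet> e i) = g i (x \<bullet> e i)"
            using i b eB by (simp add: inner_add_left inner_Basis)
        qed
        finally show ?thesis using \<eta>_invariant[OF j] by (simp add: weighted_def b_def)
      qed
      show "(\<integral>t. weighted (g(j := mellin_kernel N z)) (F (2 * N)) (x + t *\<^sub>R b) \<partial>lborel) =
          (\<integral>t. weighted (g(j := mellin_kernel 0 z)) f (x + t *\<^sub>R b) \<partial>lborel)"
      proof (cases "\<eta> x = 0")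
        case True
        then show ?thesis by (simp add: slice)
      next
        case False
        have "rapid (\<lambda>t. F m (x + t *\<^sub>R b))" for m
          unfolding rapid_def
        proof
          fix M :: nat
          obtain K where K: "\<And>x. x \<in> {x. \<eta> x \<noteq> 0} \<Longrightarrow> norm (F m x) * (\<Prod>b\<in>Basis. (1 + \<bar>x \<bullet> b\<bar>) ^ M) \<le> K"
            using polynomial_pullback_bound[OF \<phi> _ F[of m], of "{x. \<eta> x \<noteq> 0}" C0 M] growth by blast
          have "norm (F m (x + t *\<^sub>R b)) * (1 + \<bar>t\<bar>) ^ M \<le> K" for t
          proof -
            have "(1 + \<bar>t\<bar>) ^ M = (1 + \<bar>(x + t *\<^sub>R b) \<bullet> b\<bar>) ^ M" using x b by (simp add: inner_add_left)
            also have "\<dots> \<le> (\<Prod>c\<in>Basis. (1 + \<bar>(x + t *\<^sub>R b) \<bullet> c\<bar>) ^ M)"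
            proof -
              have "1 \<le> (\<Prod>c\<in>Basis - {b}. (1 + \<bar>(x + t *\<^sub>R b) \<bullet> c\<bar>) ^ M)"
                by (intro prod_ge_1 one_le_power) auto
              then show ?thesis
                using b by (subst prod.remove[of Basis b]) (auto intro!: mult_right_mono[of 1, simplified] simp: mult_le_cancel_left1)
            qed
            finally have "norm (F m (x + t *\<^sub>R b)) * (1 + \<bar>t\<bar>) ^ M \<le> norm (F m (x + t *\<^sub>R b)) * (\<Prod>c\<in>Basis. (1 + \<bar>(x + t *\<^sub>R b) \<bullet> c\<bar>) ^ M)"
              by (intro mult_left_mono) auto
            also have "\<dots> \<le> K" using False \<eta>_invariant[OF j] by (intro K) (simp add: b_def)
            finally show ?thesis .
          qed
          then show "\<exists>D. \<forall>t. norm (F m (x + t *\<^sub>R b)) * (1 + \<bar>t\<bar>) ^ M \<le> D" by blast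
        qed
        from mellin_kernel_integral[where f = "\<lambda>m t. F m (x + t *\<^sub>R b)", OF z dF[where x = x] this, of N]
        have "(\<integral>t. mellin_kernel N z t * F (2 * N) (x + t *\<^sub>R b) \<partial>lborel) = (\<integral>t. mellin_kernel 0 z t * f (x + t *\<^sub>R b) \<partial>lborel)"
          by (simp add: F_def)
        then show ?thesis unfolding slice by simp
      qed
    qed
  qed
qed

lemma replace_all_kernels:
  "\<exists>f. polynomial_pullback \<phi> \<Phi> f \<and> (\<forall>z. (\<forall>i\<in>I. Re (z i) > -1) \<longrightarrow>
    (\<integral>x. weighted (\<lambda>i. mellin_kernel N (z i)) f x \<partial>lborel) =
    (\<integral>x. weighted (\<lambda>i. mellin_kernel 0 (z i)) (\<lambda>x. \<phi> (\<Phi> x)) x \<partial>lborel))"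
proof -
  have "\<exists>f. polynomial_pullback \<phi> \<Phi> f \<and> (\<forall>z. (\<forall>i\<in>I. Re (z i) > -1) \<longrightarrow>
    (\<integral>x. weighted (\<lambda>i. mellin_kernel (if i \<in> J then N else 0) (z i)) f x \<partial>lborel) =
    (\<integral>x. weighted (\<lambda>i. mellin_kernel 0 (z i)) (\<lambda>x. \<phi> (\<Phi> x)) x \<partial>lborel))" if "J \<subseteq> I" for J
    using finite_subset[OF that fin] that
  proof (induction J rule: finite_induct)
    case empty
    then show ?case by (auto intro!: polynomial_pullback_self)
  next
    case (insert j J)
    then obtain f where f: "polynomial_pullback \<phi> \<Phi> f" "\<And>z. (\<forall>i\<in>I. Re (z i) > -1) \<Longrightarrow>
      (\<integral>x. weighted (\<lambda>i. mellin_kernel (if i \<in> J then N else 0) (z i)) f x \<partial>lborel) =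
      (\<integral>x. weighted (\<lambda>i. mellin_kernel 0 (z i)) (\<lambda>x. \<phi> (\<Phi> x)) x \<partial>lborel)" by auto
    have jI: "j \<in> I" using insert.prems by simp
    from replace_one_kernel[OF jI f(1), of N] obtain f' where f': "polynomial_pullback \<phi> \<Phi> f'"
      "\<And>z g. Re z > -1 \<Longrightarrow> (\<forall>i\<in>I - {j}. admissible_kernel (g i)) \<Longrightarrow>
      (\<integral>x. weighted (g(j := mellin_kernel N z)) f' x \<partial>lborel) = (\<integral>x. weighted (g(j := mellin_kernel 0 z)) f x \<partial>lborel)"
      by blast
    show ?case
    proof (intro exI[of _ f'] conjI allI impI f'(1))
      fix z assume z: "\<forall>i\<in>I. Re (z i) > -1"
      define g where "g i = mellin_kernel (if i \<in> J then N else 0) (z i)" for i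
      have "(\<integral>x. weighted (g(j := mellin_kernel N (z j))) f' x \<partial>lborel) = (\<integral>x. weighted (g(j := mellin_kernel 0 (z j))) f x \<partial>lborel)"
      proof (rule f'(2))
        show "Re (z j) > -1" using z jI by blast
        show "\<forall>i\<in>I - {j}. admissible_kernel (g i)"
        proof
          fix i assume "i \<in> I - {j}"
          then have "Re (z i) > -1" using z by blast
          then show "admissible_kernel (g i)" unfolding g_def by (intro admissible_mellin_kernel) auto
        qed
      qed
      moreover have "g(j := mellin_kernel N (z j)) = (\<lambda>i. mellin_kernel (if i \<in> insert j J then N else 0) (z i))"
        by (auto simp: g_def fun_eq_iff)
      moreover have "g(j := mellin_kernel 0 (z j)) = (\<lambda>i. mellin_kernel (if i \<in> J then N else 0) (z i))"
        using insert.hyps by (auto simp: g_def fun_eq_iff)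
      ultimately show "(\<integral>x. weighted (\<lambda>i. mellin_kernel (if i \<in> insert j J then N else 0) (z i)) f' x \<partial>lborel) =
        (\<integral>x. weighted (\<lambda>i. mellin_kernel 0 (z i)) (\<lambda>x. \<phi> (\<Phi> x)) x \<partial>lborel)"
        using f(2)[OF z] by simp
    qed
  qed
  from this[OF order_refl] obtain f where f: "polynomial_pullback \<phi> \<Phi> f" "\<And>z. (\<forall>i\<in>I. Re (z i) > -1) \<Longrightarrow>
    (\<integral>x. weighted (\<lambda>i. mellin_kernel (if i \<in> I then N else 0) (z i)) f x \<partial>lborel) =
    (\<integral>x. weighted (\<lambda>i. mellin_kernel 0 (z i)) (\<lambda>x. \<phi> (\<Phi> x)) x \<partial>lborel)" by blast
  have "weighted (\<lambda>i. mellin_kernel (if i \<in> I then N else 0) (z i)) f = weighted (\<lambda>i. mellin_kernel N (z i)) f" for z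
    by (simp add: weighted_def fun_eq_iff cong: prod.cong)
  then show ?thesis using f by auto
qed

text \<open>For every \<open>N\<close> the kernels of order \<open>N\<close> define a holomorphic function on a convex region \<open>R N\<close>. These
regions exhaust the space of parameters, and the functions agree on the first region, so they agree
wherever two of them are defined.\<close>

theorem entire_extension:
  fixes \<alpha> \<beta> c :: "'i \<Rightarrow> complex"
  defines "\<L> \<equiv> \<lambda>i s. \<alpha> i * fst s + \<beta> i * snd s + c i"
  assumes ne: "\<exists>s. \<forall>i\<in>I. Re (\<L> i s) > -1"
  shows "\<exists>F. holomorphic2_on F UNIV \<and> (\<forall>s. (\<forall>i\<in>I. Re (\<L> i s) > -1) \<longrightarrow>
    F s = (\<integral>x. weighted (\<lambda>i. mellin_kernel 0 (\<L> i s)) (\<lambda>x. \<phi> (\<Phi> x)) x \<partial>lborel))"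
proof -
  have "\<forall>N. \<exists>f. polynomial_pullback \<phi> \<Phi> f \<and> (\<forall>z. (\<forall>i\<in>I. Re (z i) > -1) \<longrightarrow>
    (\<integral>x. weighted (\<lambda>i. mellin_kernel N (z i)) f x \<partial>lborel) =
    (\<integral>x. weighted (\<lambda>i. mellin_kernel 0 (z i)) (\<lambda>x. \<phi> (\<Phi> x)) x \<partial>lborel))"
    using replace_all_kernels by blast
  then obtain f where f: "\<And>N. polynomial_pullback \<phi> \<Phi> (f N)" "\<And>N z. (\<forall>i\<in>I. Re (z i) > -1) \<Longrightarrow>
    (\<integral>x. weighted (\<lambda>i. mellin_kernel N (z i)) (f N) x \<partial>lborel) =
    (\<integral>x. weighted (\<lambda>i. mellin_kernel 0 (z i)) (\<lambda>x. \<phi> (\<Phi> x)) x \<partial>lborel)" by metis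
  define J where "J N s = (\<integral>x. weighted (\<lambda>i. mellin_kernel N (\<L> i s)) (f N) x \<partial>lborel)" for N s
  define R where "R N = {s. \<forall>i\<in>I. Re (\<L> i s) > - 2 * real N - 1}" for N
  have contL: "continuous_on UNIV (\<L> i)" for i unfolding \<L>_def by (intro continuous_intros)
  have openR: "open (R N)" for N
  proof -
    have "R N = (\<Inter>i\<in>I. \<L> i -` {z. Re z > - 2 * real N - 1})" by (auto simp: R_def)
    moreover have "open (\<L> i -` {z. Re z > - 2 * real N - 1})" for i
      using contL[of i] by (intro open_vimage open_halfspace_Re_gt) auto
    ultimately show ?thesis using fin by (simp add: open_INT)
  qed
  have Lcomb: "\<L> i (u *\<^sub>R x + v *\<^sub>R y) = of_real u * \<L> i x + of_real v * \<L> i y" if "u + v = 1" for i x y u v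
  proof -
    have v: "v = 1 - u" using that by simp
    show ?thesis unfolding \<L>_def v by (simp add: scaleR_conv_of_real algebra_simps)
  qed
  have convR: "convex (R N)" for N
  proof (rule convexI)
    fix x y :: "complex \<times> complex" and u v :: real
    assume xy: "x \<in> R N" "y \<in> R N" and uv: "0 \<le> u" "0 \<le> v" "u + v = 1"
    have "Re (\<L> i (u *\<^sub>R x + v *\<^sub>R y)) > - 2 * real N - 1" if "i \<in> I" for i
    proof -
      have g: "Re (\<L> i x) > - 2 * real N - 1" "Re (\<L> i y) > - 2 * real N - 1" using xy that by (auto simp: R_def)
      have "convex {t::real. t > - 2 * real N - 1}" by (simp add: greaterThan_def[symmetric])
      from convexD[OF this, of "Re (\<L> i x)" "Re (\<L> i y)" u v] show ?thesis
        unfolding Lcomb[OF uv(3)] using g uv by simp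
    qed
    then show "u *\<^sub>R x + v *\<^sub>R y \<in> R N" by (simp add: R_def)
  qed
  have R0: "R 0 \<noteq> {}" using ne by (auto simp: R_def)
  have R_mono: "R N \<subseteq> R M" if "N \<le> M" for N M using that by (force simp: R_def)
  have holJ: "holomorphic2_on (J N) (R N)" for N
    unfolding J_def
  proof (rule holomorphic2_on_integral[OF openR])
    show "weighted (\<lambda>i. mellin_kernel N (\<L> i s)) (f N) \<in> borel_measurable lborel" if "s \<in> R N" for s
      using weighted_measurable[OF _ f(1)] by simp
    show "holomorphic2_on (\<lambda>s. weighted (\<lambda>i. mellin_kernel N (\<L> i s)) (f N) x) (R N)" for x
    proof -
      have "holomorphic2_on (\<lambda>s. mellin_kernel N (\<L> i s) t) (R N)" for i t
        unfolding \<L>_def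
        by (rule holomorphic2_on_compose_affine[OF holomorphic_mellin_kernel open_UNIV openR]) simp
      then show ?thesis unfolding weighted_def
        by (intro holomorphic2_on_mult holomorphic2_on_prod holomorphic2_on_const openR)
    qed
    fix s0 assume s0: "s0 \<in> R N"
    have "\<forall>i\<in>I. \<exists>\<epsilon> C \<sigma> \<tau>. \<epsilon> > 0 \<and> C \<ge> 0 \<and> -1 < \<sigma> \<and> -1 < \<tau> \<and>
      (\<forall>z t. z \<in> ball (\<L> i s0) \<epsilon> \<longrightarrow> norm (mellin_kernel N z t) \<le> C * power_bound \<sigma> \<tau> t)"
    proof
      fix i assume "i \<in> I"
      then have "Re (\<L> i s0) > - 2 * real N - 1" using s0 by (simp add: R_def)
      from mellin_kernel_locally_bounded[OF this] show "\<exists>\<epsilon> C \<sigma> \<tau>. \<epsilon> > 0 \<and> C \<ge> 0 \<and> -1 < \<sigma> \<and> -1 < \<tau> \<and>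
        (\<forall>z t. z \<in> ball (\<L> i s0) \<epsilon> \<longrightarrow> norm (mellin_kernel N z t) \<le> C * power_bound \<sigma> \<tau> t)"
        by metis
    qed
    then obtain \<epsilon> C \<sigma> \<tau> where b: "\<And>i. i \<in> I \<Longrightarrow> \<epsilon> i > 0" "\<And>i. i \<in> I \<Longrightarrow> C i \<ge> 0" "\<And>i. i \<in> I \<Longrightarrow> -1 < \<sigma> i" "\<And>i. i \<in> I \<Longrightarrow> -1 < \<tau> i"
      "\<And>i z t. i \<in> I \<Longrightarrow> z \<in> ball (\<L> i s0) (\<epsilon> i) \<Longrightarrow> norm (mellin_kernel N z t) \<le> C i * power_bound (\<sigma> i) (\<tau> i) t"
      by metis
    define U where "U = R N \<inter> (\<Inter>i\<in>I. \<L> i -` ball (\<L> i s0) (\<epsilon> i))"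
    have "open U" unfolding U_def using fin contL
      by (intro open_Int openR open_INT ballI open_vimage) auto
    moreover have "s0 \<in> U" using s0 b(1) by (auto simp: U_def)
    ultimately obtain r where r: "r > 0" "ball s0 r \<subseteq> U" using open_contains_ball by blast
    obtain H where H: "integrable lborel H" "\<And>C g x. (\<And>i. i \<in> I \<Longrightarrow> 0 \<le> C i) \<Longrightarrow>
      (\<And>i t. i \<in> I \<Longrightarrow> norm (g i t) \<le> C i * power_bound (\<sigma> i) (\<tau> i) t) \<Longrightarrow> norm (weighted g (f N) x) \<le> (\<Prod>i\<in>I. C i) * H x"
      by (rule weighted_dominated[OF b(3,4) f(1)[of N]]) blast+
    show "\<exists>r>0. \<exists>H. integrable lborel H \<and> (\<forall>s\<in>ball s0 r. s \<in> R N \<and>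
        (\<forall>x\<in>space lborel. norm (weighted (\<lambda>i. mellin_kernel N (\<L> i s)) (f N) x) \<le> H x))"
    proof (intro exI[of _ r] conjI exI[of _ "\<lambda>x. (\<Prod>i\<in>I. C i) * H x"] ballI)
      fix s x assume s: "s \<in> ball s0 r"
      then show "s \<in> R N" using r by (auto simp: U_def)
      have "\<L> i s \<in> ball (\<L> i s0) (\<epsilon> i)" if "i \<in> I" for i using s r(2) that by (auto simp: U_def)
      then show "norm (weighted (\<lambda>i. mellin_kernel N (\<L> i s)) (f N) x) \<le> (\<Prod>i\<in>I. C i) * H x"
        using b by (intro H(2)) auto
    next
      show "integrable lborel (\<lambda>x. (\<Prod>i\<in>I. C i) * H x)" using H(1) by (rule integrable_mult_right)
    qed (use r in auto)
  qed
  have agree: "J N s = J M s" if "s \<in> R N" "N \<le> M" for N M s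
  proof (rule holomorphic2_identity[OF holJ holomorphic2_on_subset[OF holJ openR R_mono[OF that(2)]] convR openR R0 R_mono[of 0 N] _ that(1)])
    show "J N s = J M s" if "s \<in> R 0" for s
      using f(2)[of "\<lambda>i. \<L> i s"] that by (simp add: J_def R_def)
  qed simp
  have cover: "\<exists>N. s \<in> R N" for s
  proof -
    obtain N where N: "real N \<ge> (\<Sum>i\<in>I. \<bar>Re (\<L> i s)\<bar>)" using real_arch_simple by blast
    have "Re (\<L> i s) > - 2 * real N - 1" if "i \<in> I" for i
    proof -
      have "\<bar>Re (\<L> i s)\<bar> \<le> (\<Sum>i\<in>I. \<bar>Re (\<L> i s)\<bar>)" using that fin by (intro member_le_sum) auto
      then show ?thesis using N by linarith
    qed
    then show ?thesis by (auto simp: R_def)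
  qed
  define n where "n s = (LEAST N. s \<in> R N)" for s
  define F where "F s = J (n s) s" for s
  have n: "s \<in> R (n s)" for s unfolding n_def using LeastI_ex[OF cover] .
  have FJ: "F s = J N s" if "s \<in> R N" for s N
  proof -
    have "n s \<le> N" unfolding n_def using that by (rule Least_le)
    then show ?thesis unfolding F_def using agree[OF n] by blast
  qed
  show ?thesis
  proof (intro exI[of _ F] conjI allI impI)
    show "holomorphic2_on F UNIV"
      unfolding holomorphic2_on_def
    proof (intro conjI ballI)
      fix s :: "complex \<times> complex"
      have "holomorphic2_on F (R (n s))" by (rule holomorphic2_on_cong[OF holJ FJ])
      then show "\<exists>a b. (F has_derivative (\<lambda>(h1, h2). a * h1 + b * h2)) (at s)"
        using n unfolding holomorphic2_on_def by blast
    qed simp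
    fix s assume s: "\<forall>i\<in>I. Re (\<L> i s) > -1"
    then have "F s = J 0 s" by (intro FJ) (simp add: R_def)
    then show "F s = (\<integral>x. weighted (\<lambda>i. mellin_kernel 0 (\<L> i s)) (\<lambda>x. \<phi> (\<Phi> x)) x \<partial>lborel)"
      unfolding J_def using f(2)[OF s] by simp
  qed
qed

end

section \<open>Coordinates on matrices and unipotent congruence\<close>

text \<open>In the rest of the theory the dollar sign only denotes vector components.\<close>

no_notation fps_nth (infixl "$" 75)

lemma triangular_substitution_indexed:
  fixes e :: "'k \<Rightarrow> 'a::euclidean_space" and h :: "'k \<Rightarrow> nat" and \<theta> :: "'k \<Rightarrow> 'a \<Rightarrow> real \<Rightarrow> real"
    and \<rho> :: "'k \<Rightarrow> 'a \<Rightarrow> real \<Rightarrow> ennreal"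
  assumes e: "bij_betw e K Basis"
    and dep: "\<And>k x x' u. k \<in> K \<Longrightarrow> (\<And>c. c \<in> K \<Longrightarrow> h c < h k \<Longrightarrow> x \<bullet> e c = x' \<bullet> e c) \<Longrightarrow>
      \<theta> k x u = \<theta> k x' u \<and> \<rho> k x u = \<rho> k x' u"
    and one: "\<And>k x f. k \<in> K \<Longrightarrow> f \<in> borel_measurable borel \<Longrightarrow>
      (\<integral>\<^sup>+t. f t * indicator (A k) t \<partial>lborel) = (\<integral>\<^sup>+u. f (\<theta> k x u) * \<rho> k x u \<partial>lborel)"
    and m\<theta>: "\<And>k. k \<in> K \<Longrightarrow> (\<lambda>x. \<theta> k x (x \<bullet> e k)) \<in> borel_measurable borel"
    and m\<rho>: "\<And>k. k \<in> K \<Longrightarrow> (\<lambda>x. \<rho> k x (x \<bullet> e k)) \<in> borel_measurable borel"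
    and mA: "\<And>k. k \<in> K \<Longrightarrow> A k \<in> sets borel"
    and mf: "f \<in> borel_measurable borel"
  shows "(\<integral>\<^sup>+x. f x * (\<Prod>k\<in>K. indicator (A k) (x \<bullet> e k)) \<partial>lborel) =
    (\<integral>\<^sup>+x. f (\<Sum>k\<in>K. \<theta> k x (x \<bullet> e k) *\<^sub>R e k) * (\<Prod>k\<in>K. \<rho> k x (x \<bullet> e k)) \<partial>lborel)"
proof -
  define j where "j = inv_into K e"
  have j: "j (e k) = k" if "k \<in> K" for k
    using e that by (simp add: j_def bij_betw_def)
  have jB: "j b \<in> K" "e (j b) = b" if "b \<in> Basis" for b
    using e that by (auto simp: j_def bij_betw_def inv_into_into f_inv_into_f)
  have "(\<integral>\<^sup>+x. f x * (\<Prod>b\<in>Basis. indicator (A (j b)) (x \<bullet> b)) \<partial>lborel) =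
    (\<integral>\<^sup>+x. f (\<Sum>b\<in>Basis. \<theta> (j b) x (x \<bullet> b) *\<^sub>R b) * (\<Prod>b\<in>Basis. \<rho> (j b) x (x \<bullet> b)) \<partial>lborel)"
  proof (rule triangular_substitution[where h = "h \<circ> j"])
    fix b x x' u assume b: "b \<in> Basis" and eq: "\<And>c. c \<in> Basis \<Longrightarrow> (h \<circ> j) c < (h \<circ> j) b \<Longrightarrow> x \<bullet> c = x' \<bullet> c"
    show "\<theta> (j b) x u = \<theta> (j b) x' u \<and> \<rho> (j b) x u = \<rho> (j b) x' u"
    proof (rule dep)
      fix c assume "c \<in> K" "h c < h (j b)"
      then show "x \<bullet> e c = x' \<bullet> e c" using eq[of "e c"] e by (auto simp: j bij_betw_def)
    qed (rule jB[OF b])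
  qed (use jB one m\<theta> m\<rho> mA mf in \<open>auto, (metis jB)+\<close>)
  moreover have "(\<Prod>b\<in>Basis. indicator (A (j b)) (x \<bullet> b)) = (\<Prod>k\<in>K. indicator (A k) (x \<bullet> e k) :: ennreal)" for x
    by (rule prod.reindex_bij_betw[OF e, of "\<lambda>b. indicator (A (j b)) (x \<bullet> b)", symmetric, THEN trans]) (simp add: j)
  moreover have "(\<Prod>b\<in>Basis. \<rho> (j b) x (x \<bullet> b)) = (\<Prod>k\<in>K. \<rho> k x (x \<bullet> e k))" for x
    by (rule prod.reindex_bij_betw[OF e, of "\<lambda>b. \<rho> (j b) x (x \<bullet> b)", symmetric, THEN trans]) (simp add: j)
  moreover have "(\<Sum>b\<in>Basis. \<theta> (j b) x (x \<bullet> b) *\<^sub>R b) = (\<Sum>k\<in>K. \<theta> k x (x \<bullet> e k) *\<^sub>R e k)" for x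
    by (rule sum.reindex_bij_betw[OF e, of "\<lambda>b. \<theta> (j b) x (x \<bullet> b) *\<^sub>R b", symmetric, THEN trans]) (simp add: j)
  ultimately show ?thesis by simp
qed

lemma AE_coordinate_nonzero:
  fixes b :: "'a::euclidean_space"
  assumes "b \<in> Basis"
  shows "AE x in lborel. x \<bullet> b \<noteq> 0"
proof -
  have "negligible {x::'a. x \<bullet> b = 0}"
    using assms by (intro negligible_standard_hyperplane[of b 0, simplified] )
  then have "{x::'a. x \<bullet> b = 0} \<in> null_sets lebesgue" by (simp add: negligible_iff_null_sets)
  from AE_not_in[OF this] show ?thesis by (simp add: AE_completion_iff)
qed

lemma vec_entry_measurable [measurable]: "(\<lambda>y::real^'d^'n::finite. y $ i $ c) \<in> borel_measurable borel"
  by (intro borel_measurable_continuous_onI continuous_intros)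

lemma sym_entry_measurable [measurable]: "(\<lambda>z::'n::finite symmat. mat_of_sym z $ i $ j) \<in> borel_measurable borel"
  unfolding inner_sym_unit[symmetric] by measurable

lemma matrix_basis_bij: "bij_betw (\<lambda>(i, c). axis i (axis c 1)) UNIV (Basis :: (real^'d::finite^'n::finite) set)"
proof -
  have "inj (\<lambda>(i, c). axis i (axis c 1) :: real^'d^'n)"
    by (auto simp: inj_on_def axis_eq_axis)
  moreover have "range (\<lambda>(i, c). axis i (axis c 1) :: real^'d^'n) = Basis"
    by (auto simp: Basis_vec_def image_def)
  ultimately show ?thesis by (simp add: bij_betw_def)
qed

lemma matrix_inner_basis: "(y :: real^'d::finite^'n::finite) \<bullet> axis i (axis c 1) = y $ i $ c"
  by (simp add: inner_axis)

lemma matrix_sum_basis: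
  "(\<Sum>(i, c)\<in>UNIV. t i c *\<^sub>R axis i (axis c 1)) = (\<chi> i c. t i c :: real^'d::finite^'n::finite)"
proof -
  have "(\<Sum>(i, c)\<in>UNIV. t i c *\<^sub>R axis i (axis c 1)) $ k $ l = t k l" for k :: 'n and l :: 'd
  proof -
    have "(\<Sum>(i, c)\<in>UNIV. t i c *\<^sub>R axis i (axis c 1)) $ k $ l = (\<Sum>p\<in>UNIV. if p = (k, l) then t k l else 0)"
    proof -
      have "(\<Sum>(i, c)\<in>UNIV. t i c *\<^sub>R (axis i (axis c 1) :: real^'d^'n)) $ k $ l =
          (\<Sum>p\<in>UNIV. t (fst p) (snd p) * (axis (fst p) (axis (snd p) 1) :: real^'d^'n) $ k $ l)"
        by (simp add: sum_component case_prod_unfold)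
      also have "\<dots> = (\<Sum>p\<in>UNIV. if p = (k, l) then t k l else 0)"
        by (intro sum.cong refl) (auto simp: axis_def)
      finally show ?thesis .
    qed
    then show ?thesis by simp
  qed
  then show ?thesis by (simp add: vec_eq_iff)
qed

lemma symmat_eqI: "(\<And>i j. mat_of_sym A $ i $ j = mat_of_sym B $ i $ j) \<Longrightarrow> A = B"
  by (metis mat_of_sym_inject vec_eq_iff)

lemma quadratic_form_entries:
  "x \<bullet> (mat_of_sym z *v x) = (\<Sum>i\<in>UNIV. \<Sum>j\<in>UNIV. x $ i * x $ j * (z \<bullet> sym_unit i j))"
  by (simp add: inner_vec_def matrix_vector_mult_def sum_distrib_left inner_sym_unit mult_ac)

text \<open>By compactness of the unit sphere, positive definite means that the quadratic form is at least \<open>1 / (m + 1)\<close> there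
for some \<open>m\<close>, so that the cone is a countable union of closed sets.\<close>

lemma pos_definite_measurable [measurable]: "Measurable.pred borel (pos_definite :: 'n::finite symmat \<Rightarrow> bool)"
proof -
  have "{z :: 'n symmat. pos_definite z} = (\<Union>m::nat. \<Inter>x\<in>sphere 0 1. {z. inverse (Suc m) \<le> x \<bullet> (mat_of_sym z *v x)})"
  proof (intro set_eqI iffI)
    fix z :: "'n symmat" assume "z \<in> {z. pos_definite z}"
    then have pd: "pos_definite z" by simp
    have "continuous_on (sphere 0 1) (\<lambda>x::real^'n. x \<bullet> (mat_of_sym z *v x))"
      unfolding quadratic_form_entries by (intro continuous_intros)
    moreover have "axis undefined 1 \<in> (sphere 0 1 :: (real^'n) set)" by (simp add: norm_axis_1)
    then have "(sphere 0 1 :: (real^'n) set) \<noteq> {}" by blast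
    ultimately have "\<exists>x\<in>sphere 0 1. \<forall>w\<in>sphere 0 1. x \<bullet> (mat_of_sym z *v x) \<le> w \<bullet> (mat_of_sym z *v w)"
      by (intro continuous_attains_inf compact_sphere)
    then obtain x0 where x0: "x0 \<in> sphere 0 1" "\<And>x. x \<in> sphere 0 1 \<Longrightarrow> x0 \<bullet> (mat_of_sym z *v x0) \<le> x \<bullet> (mat_of_sym z *v x)"
      by blast
    have "x0 \<bullet> (mat_of_sym z *v x0) > 0" using pd x0(1) unfolding pos_definite_def by (metis mem_sphere_0 norm_zero zero_neq_one)
    then obtain m where m: "inverse (Suc m) < x0 \<bullet> (mat_of_sym z *v x0)" using reals_Archimedean by blast
    then show "z \<in> (\<Union>m::nat. \<Inter>x\<in>sphere 0 1. {z. inverse (Suc m) \<le> x \<bullet> (mat_of_sym z *v x)})"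
    proof (intro UN_I[of m] UNIV_I INT_I)
      fix x :: "real^'n" assume "x \<in> sphere 0 1"
      from x0(2)[OF this] m show "z \<in> {z. inverse (Suc m) \<le> x \<bullet> (mat_of_sym z *v x)}" by simp
    qed
  next
    fix z :: "'n symmat" assume "z \<in> (\<Union>m::nat. \<Inter>x\<in>sphere 0 1. {z. inverse (Suc m) \<le> x \<bullet> (mat_of_sym z *v x)})"
    then obtain m where "\<forall>x\<in>sphere 0 1. inverse (real (Suc m)) \<le> x \<bullet> (mat_of_sym z *v x)" by auto
    then have m: "inverse (real (Suc m)) \<le> x \<bullet> (mat_of_sym z *v x)" if "norm x = 1" for x
      using that by simp
    show "z \<in> {z. pos_definite z}"
      unfolding mem_Collect_eq pos_definite_def
    proof (intro allI impI)
      fix x :: "real^'n" assume x: "x \<noteq> 0"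
      define y where "y = x /\<^sub>R norm x"
      have "norm y = 1" using x by (simp add: y_def)
      then have "0 < y \<bullet> (mat_of_sym z *v y)" using m[of y] less_le_trans[of 0 "inverse (real (Suc m))"] by simp
      moreover have "x = norm x *\<^sub>R y" using x by (simp add: y_def)
      then have "x \<bullet> (mat_of_sym z *v x) = (norm x)\<^sup>2 * (y \<bullet> (mat_of_sym z *v y))"
        using matrix_vector_mult_scaleR[of "mat_of_sym z" "norm x" y]
        by (metis inner_scaleR_left inner_scaleR_right mult.assoc power2_eq_square)
      ultimately show "0 < x \<bullet> (mat_of_sym z *v x)" using x by simp
    qed
  qed
  moreover have "closed (\<Inter>x\<in>sphere 0 1. {z :: 'n symmat. inverse (Suc m) \<le> x \<bullet> (mat_of_sym z *v x)})" for m
    unfolding quadratic_form_entries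
    by (intro closed_INT ballI closed_Collect_le continuous_intros)
  ultimately have "{z :: 'n symmat. pos_definite z} \<in> sets borel" by (simp add: sets.countable_UN)
  then show ?thesis by (simp add: pred_def)
qed

text \<open>An enumeration of the index type: \<open>\<rho> i\<close> is the position of \<open>i\<close> in the order in which pivots are chosen.
Notions such as triangular refer to this order.\<close>

locale index_order =
  fixes \<rho> :: "'n::finite \<Rightarrow> nat"
  assumes \<rho>: "bij_betw \<rho> UNIV {..<CARD('n)}"
begin

lemma \<rho>_inj: "\<rho> i = \<rho> j \<longleftrightarrow> i = j"
  using \<rho> by (auto simp: bij_betw_def inj_on_def)

lemma \<rho>_less: "\<rho> i < CARD('n)"
  using \<rho> by (auto simp: bij_betw_def)

text \<open>One representative of each unordered pair: these pairs index the standard basis of symmetric matrices.\<close>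

definition upper_pairs :: "('n \<times> 'n) set"
  where "upper_pairs = {(i, j). \<rho> i \<le> \<rho> j}"

lemma sym_unit_commute: "sym_unit i j = sym_unit j i"
  by (rule symmat_eqI) (auto simp: sym_unit.rep_eq)

lemma sym_basis_bij: "bij_betw (\<lambda>(i, j). sym_unit i j) upper_pairs (Basis :: 'n symmat set)"
proof -
  have "inj_on (\<lambda>(i, j). sym_unit i j :: 'n symmat) upper_pairs"
  proof (rule inj_onI, clarify)
    fix i j k l assume a: "(i, j) \<in> upper_pairs" "(k, l) \<in> upper_pairs" "(sym_unit i j :: 'n symmat) = sym_unit k l"
    then have "mat_of_sym (sym_unit k l :: 'n symmat) $ i $ j = 1"
      using sym_unit.rep_eq[of i j] by simp
    then have "i = k \<and> j = l \<or> i = l \<and> j = k" by (auto simp: sym_unit.rep_eq split: if_splits)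
    then show "i = k \<and> j = l" using a by (auto simp: upper_pairs_def \<rho>_inj dest: antisym)
  qed
  moreover have "(\<lambda>(i, j). sym_unit i j :: 'n symmat) ` upper_pairs = Basis"
  proof -
    have "sym_unit i j \<in> (\<lambda>(i, j). sym_unit i j :: 'n symmat) ` upper_pairs" for i j
    proof (cases "\<rho> i \<le> \<rho> j")
      case True
      then show ?thesis by (intro rev_image_eqI[of "(i, j)"]) (auto simp: upper_pairs_def)
    next
      case False
      then show ?thesis by (intro rev_image_eqI[of "(j, i)"]) (auto simp: upper_pairs_def sym_unit_commute)
    qed
    then show ?thesis by (auto simp: Basis_symmat_def)
  qed
  ultimately show ?thesis by (simp add: bij_betw_def)
qed

lemma sym_sum_basis:
  assumes "\<rho> k \<le> \<rho> l"
  shows "mat_of_sym (\<Sum>(i, j)\<in>upper_pairs. t i j *\<^sub>R sym_unit i j) $ k $ l = t k l"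
proof -
  have b: "sym_unit k l \<in> (Basis :: 'n symmat set)" by (auto simp: Basis_symmat_def)
  have kl: "(k, l) \<in> upper_pairs" using assms by (simp add: upper_pairs_def)
  have "mat_of_sym (\<Sum>(i, j)\<in>upper_pairs. t i j *\<^sub>R sym_unit i j) $ k $ l = (\<Sum>(i, j)\<in>upper_pairs. t i j *\<^sub>R sym_unit i j) \<bullet> sym_unit k l"
    by (simp add: inner_sym_unit)
  also have "\<dots> = (\<Sum>p\<in>upper_pairs. if p = (k, l) then t k l else 0)"
    unfolding inner_sum_left
  proof (rule sum.cong[OF refl], clarify)
    fix i j assume ij: "(i, j) \<in> upper_pairs"
    have "sym_unit i j \<in> (Basis :: 'n symmat set)" by (auto simp: Basis_symmat_def)
    moreover have "(sym_unit i j :: 'n symmat) = sym_unit k l \<longleftrightarrow> (i, j) = (k, l)"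
      using sym_basis_bij ij kl unfolding bij_betw_def inj_on_def by force
    ultimately show "(t i j *\<^sub>R sym_unit i j :: 'n symmat) \<bullet> sym_unit k l = (if (i, j) = (k, l) then t k l else 0)"
      using b by (auto simp: inner_Basis)
  qed
  also have "\<dots> = t k l" using kl by (subst sum.delta) auto
  finally show ?thesis .
qed

end

lift_definition congruence :: "real^'n^'n \<Rightarrow> 'n::finite symmat \<Rightarrow> 'n symmat" is "\<lambda>L z. L ** z ** transpose L"
  by (simp add: matrix_transpose_mul matrix_mul_assoc)

lift_definition gram :: "real^'n::finite^'n \<Rightarrow> 'n symmat" is "\<lambda>A. A ** transpose A"
  by (simp add: matrix_transpose_mul)

lemma gram_entry: "mat_of_sym (gram A) $ i $ j = (\<Sum>k\<in>UNIV. A $ i $ k * A $ j $ k)"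
  by (simp add: gram.rep_eq matrix_matrix_mult_def transpose_def)

lemma congruence_entry: "mat_of_sym (congruence L z) $ i $ j = (\<Sum>k\<in>UNIV. \<Sum>l\<in>UNIV. L $ i $ k * L $ j $ l * mat_of_sym z $ k $ l)"
proof -
  have "mat_of_sym (congruence L z) $ i $ j = (\<Sum>l\<in>UNIV. (\<Sum>k\<in>UNIV. L $ i $ k * mat_of_sym z $ k $ l) * L $ j $ l)"
    by (simp add: congruence.rep_eq matrix_matrix_mult_def transpose_def)
  also have "\<dots> = (\<Sum>l\<in>UNIV. \<Sum>k\<in>UNIV. L $ i $ k * L $ j $ l * mat_of_sym z $ k $ l)"
    unfolding sum_distrib_right by (intro sum.cong refl) (simp add: mult_ac)
  finally show ?thesis by (subst sum.swap)
qed

context index_order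
begin

definition unit_lower :: "real^'n^'n \<Rightarrow> bool"
  where "unit_lower L \<longleftrightarrow> (\<forall>i. L $ i $ i = 1) \<and> (\<forall>i j. \<rho> i < \<rho> j \<longrightarrow> L $ i $ j = 0)"

text \<open>The entry of \<open>L z L\<^sup>T\<close> at \<open>(i, j)\<close> is that of \<open>z\<close> plus a combination of entries at earlier positions, so that
congruence is a succession of translations.\<close>

lemma nn_integral_congruence:
  fixes f :: "'n symmat \<Rightarrow> ennreal"
  assumes L: "unit_lower L" and f: "f \<in> borel_measurable borel"
  shows "(\<integral>\<^sup>+z. f z \<partial>lborel) = (\<integral>\<^sup>+z. f (congruence L z) \<partial>lborel)"
proof -
  define \<theta> where "\<theta> p x u = u + (\<Sum>k\<in>UNIV. \<Sum>l\<in>UNIV. if (k, l) = p then 0 else L $ fst p $ k * L $ snd p $ l * mat_of_sym x $ k $ l)"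
    for p and x :: "'n symmat" and u :: real
  define e where "e = (\<lambda>(i, j). sym_unit i j :: 'n symmat)"
  have inner_e: "x \<bullet> e (i, j) = mat_of_sym x $ i $ j" for x i j by (simp add: e_def inner_sym_unit)
  have "(\<integral>\<^sup>+x. f x * (\<Prod>k\<in>upper_pairs. indicator UNIV (x \<bullet> e k)) \<partial>lborel) =
    (\<integral>\<^sup>+x. f (\<Sum>k\<in>upper_pairs. \<theta> k x (x \<bullet> e k) *\<^sub>R e k) * (\<Prod>k\<in>upper_pairs. 1) \<partial>lborel)"
  proof (rule triangular_substitution_indexed[where h = "\<lambda>(i, j). \<rho> i + \<rho> j" and \<rho> = "\<lambda>_ _ _. 1" and A = "\<lambda>_. UNIV"])
    show "bij_betw e upper_pairs Basis" unfolding e_def by (rule sym_basis_bij)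
    fix p x x' u assume p: "p \<in> upper_pairs"
      and eq: "\<And>c. c \<in> upper_pairs \<Longrightarrow> (case c of (i, j) \<Rightarrow> \<rho> i + \<rho> j) < (case p of (i, j) \<Rightarrow> \<rho> i + \<rho> j) \<Longrightarrow> x \<bullet> e c = x' \<bullet> e c"
    obtain i j where ij: "p = (i, j)" by fastforce
    have ent: "mat_of_sym x $ k $ l = mat_of_sym x' $ k $ l" if "\<rho> k + \<rho> l < \<rho> i + \<rho> j" for k l
    proof (cases "\<rho> k \<le> \<rho> l")
      case True
      then show ?thesis using eq[of "(k, l)"] that by (simp add: ij upper_pairs_def inner_e)
    next
      case False
      then have "mat_of_sym x $ l $ k = mat_of_sym x' $ l $ k" using eq[of "(l, k)"] that by (simp add: ij upper_pairs_def inner_e)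
      then show ?thesis by (simp add: mat_of_sym_commute)
    qed
    have "L $ i $ k * L $ j $ l * mat_of_sym x $ k $ l = L $ i $ k * L $ j $ l * mat_of_sym x' $ k $ l" if "(k, l) \<noteq> (i, j)" for k l
    proof (cases "\<rho> k \<le> \<rho> i \<and> \<rho> l \<le> \<rho> j")
      case True
      then have "\<rho> k + \<rho> l < \<rho> i + \<rho> j" using that \<rho>_inj[of k i] \<rho>_inj[of l j] by fastforce
      then show ?thesis by (simp add: ent)
    next
      case False
      then have "L $ i $ k = 0 \<or> L $ j $ l = 0" using L by (auto simp: unit_lower_def not_le)
      then show ?thesis by auto
    qed
    then show "\<theta> p x u = \<theta> p x' u \<and> (1 :: ennreal) = 1"
      unfolding \<theta>_def ij by (auto intro!: sum.cong)
  next
    fix p x and f :: "real \<Rightarrow> ennreal" assume "f \<in> borel_measurable borel"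
    from nn_integral_affine_coordinate[OF this, of 1 "\<theta> p x 0"]
    show "(\<integral>\<^sup>+t. f t * indicator UNIV t \<partial>lborel) = (\<integral>\<^sup>+u. f (\<theta> p x u) * 1 \<partial>lborel)"
      by (simp add: \<theta>_def add_ac)
  qed (use f in \<open>auto simp: \<theta>_def\<close>)
  moreover have "(\<Sum>k\<in>upper_pairs. \<theta> k x (x \<bullet> e k) *\<^sub>R e k) = congruence L x" for x
  proof -
    have up: "mat_of_sym (\<Sum>k\<in>upper_pairs. \<theta> k x (x \<bullet> e k) *\<^sub>R e k) $ i $ j = mat_of_sym (congruence L x) $ i $ j"
      if "\<rho> i \<le> \<rho> j" for i j
    proof -
      have "(\<Sum>k\<in>upper_pairs. \<theta> k x (x \<bullet> e k) *\<^sub>R e k) = (\<Sum>(i, j)\<in>upper_pairs. \<theta> (i, j) x (mat_of_sym x $ i $ j) *\<^sub>R sym_unit i j)"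
        by (intro sum.cong) (auto simp: e_def inner_sym_unit)
      then have "mat_of_sym (\<Sum>k\<in>upper_pairs. \<theta> k x (x \<bullet> e k) *\<^sub>R e k) $ i $ j = \<theta> (i, j) x (mat_of_sym x $ i $ j)"
        using sym_sum_basis[OF that] by simp
      also have "\<dots> = (\<Sum>p\<in>UNIV. if p = (i, j) then mat_of_sym x $ i $ j else 0) +
          (\<Sum>p\<in>UNIV. if p = (i, j) then 0 else L $ i $ fst p * L $ j $ snd p * mat_of_sym x $ fst p $ snd p)"
      proof -
        have "(\<Sum>k\<in>UNIV. \<Sum>l\<in>UNIV. if (k, l) = (i, j) then 0 else L $ i $ k * L $ j $ l * mat_of_sym x $ k $ l) =
            (\<Sum>p\<in>UNIV. if p = (i, j) then 0 else L $ i $ fst p * L $ j $ snd p * mat_of_sym x $ fst p $ snd p)"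
          unfolding sum.cartesian_product UNIV_Times_UNIV
          by (intro sum.cong refl) (simp only: case_prod_unfold prod.collapse)
        then show ?thesis unfolding \<theta>_def fst_conv snd_conv by simp
      qed
      also have "\<dots> = (\<Sum>p\<in>UNIV. L $ i $ fst p * L $ j $ snd p * mat_of_sym x $ fst p $ snd p)"
        unfolding sum.distrib[symmetric]
      proof (rule sum.cong[OF refl])
        fix p
        show "(if p = (i, j) then mat_of_sym x $ i $ j else 0) +
            (if p = (i, j) then 0 else L $ i $ fst p * L $ j $ snd p * mat_of_sym x $ fst p $ snd p) =
            L $ i $ fst p * L $ j $ snd p * mat_of_sym x $ fst p $ snd p"
          by (cases "p = (i, j)") (use L in \<open>simp_all add: unit_lower_def\<close>)
      qed
      also have "\<dots> = mat_of_sym (congruence L x) $ i $ j"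
        by (simp add: congruence_entry sum.cartesian_product case_prod_unfold UNIV_Times_UNIV[symmetric] del: UNIV_Times_UNIV)
      finally show ?thesis .
    qed
    show ?thesis
    proof (rule symmat_eqI)
      fix i j show "mat_of_sym (\<Sum>k\<in>upper_pairs. \<theta> k x (x \<bullet> e k) *\<^sub>R e k) $ i $ j = mat_of_sym (congruence L x) $ i $ j"
        using up[of i j] up[of j i] by (cases "\<rho> i \<le> \<rho> j") (simp_all add: mat_of_sym_commute[of _ i j])
    qed
  qed
  ultimately show ?thesis by simp
qed

end

section \<open>Cholesky coordinates on the positive definite cone\<close>

context index_order
begin

lemma \<rho>_surj: "m < CARD('n) \<Longrightarrow> \<exists>i. \<rho> i = m"
  using \<rho> unfolding bij_betw_def by (metis imageE lessThan_iff)

definition upper_part :: "'n symmat \<Rightarrow> real^'n^'n"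
  where "upper_part u = (\<chi> i j. if \<rho> i \<le> \<rho> j then mat_of_sym u $ i $ j else 0)"

text \<open>A Cholesky factorization exists only on the cone. To have a bijection of the whole space, a diagonal entry that
is not positive is kept as a diagonal defect, with 1 in place of its root. Then the map \<open>pivot_compose\<close>
below is a triangular substitution without exceptions, and the cone is cut out by the positivity of the diagonal.\<close>

definition pivot_root :: "'n symmat \<Rightarrow> 'n \<Rightarrow> real"
  where "pivot_root x j = (if mat_of_sym x $ j $ j > 0 then sqrt (mat_of_sym x $ j $ j) else 1)"

definition pivot_factor :: "'n symmat \<Rightarrow> real^'n^'n"
  where "pivot_factor x = (\<chi> i j. if i = j then pivot_root x j else upper_part x $ i $ j)"

definition pivot_defect :: "'n symmat \<Rightarrow> 'n \<Rightarrow> real"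
  where "pivot_defect x j = mat_of_sym x $ j $ j - (pivot_root x j)\<^sup>2"

lift_definition diagonal :: "('n \<Rightarrow> real) \<Rightarrow> 'n symmat" is "\<lambda>f. \<chi> i j. if i = j then f i else 0"
  by (auto simp: transpose_def vec_eq_iff)

definition pivot_compose :: "'n symmat \<Rightarrow> 'n symmat"
  where "pivot_compose x = gram (pivot_factor x) + diagonal (pivot_defect x)"

lemma pivot_root_pos: "pivot_root x j > 0"
  by (simp add: pivot_root_def)

lemma pivot_defect_zero: "mat_of_sym x $ j $ j > 0 \<Longrightarrow> pivot_defect x j = 0"
  by (simp add: pivot_defect_def pivot_root_def)

lemma pivot_factor_upper: "\<rho> j < \<rho> i \<Longrightarrow> pivot_factor x $ i $ j = 0"
  using \<rho>_inj[of i j] by (auto simp: pivot_factor_def upper_part_def)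

lemma quadratic_pivot_compose:
  "w \<bullet> (mat_of_sym (pivot_compose x) *v w) =
    (\<Sum>k\<in>UNIV. ((transpose (pivot_factor x) *v w) $ k)\<^sup>2) + (\<Sum>k\<in>UNIV. pivot_defect x k * (w $ k)\<^sup>2)"
proof -
  define T where "T = pivot_factor x"
  have "mat_of_sym (pivot_compose x) = T ** transpose T + mat_of_sym (diagonal (pivot_defect x))"
    by (simp add: pivot_compose_def plus_symmat.rep_eq gram.rep_eq T_def)
  then have "w \<bullet> (mat_of_sym (pivot_compose x) *v w) = w \<bullet> (T *v (transpose T *v w)) + w \<bullet> (mat_of_sym (diagonal (pivot_defect x)) *v w)"
    by (simp only: matrix_vector_mult_add_rdistrib inner_add_right matrix_vector_mul_assoc)
  also have "w \<bullet> (T *v (transpose T *v w)) = (transpose T *v w) \<bullet> (transpose T *v w)"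
    by (metis dot_lmul_matrix vector_transpose_matrix transpose_transpose transpose_matrix_vector)
  also have "\<dots> = (\<Sum>k\<in>UNIV. ((transpose T *v w) $ k)\<^sup>2)" by (simp add: inner_vec_def power2_eq_square)
  also have "w \<bullet> (mat_of_sym (diagonal (pivot_defect x)) *v w) = (\<Sum>k\<in>UNIV. pivot_defect x k * (w $ k)\<^sup>2)"
    by (simp add: inner_vec_def matrix_vector_mult_def diagonal.rep_eq power2_eq_square if_distrib if_distribR mult_ac cong: if_cong)
  finally show ?thesis by (simp add: T_def)
qed

text \<open>If the diagonal is not positive, let \<open>j\<close> be the last position with a nonpositive entry. A vector \<open>w\<close> that vanishes
before \<open>j\<close> and is orthogonal to the later columns of the triangular factor gives the quadratic form the value
\<open>x j j * (w j)\<^sup>2\<close>.\<close>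

lemma pos_definite_pivot_compose:
  "pos_definite (pivot_compose x) \<longleftrightarrow> (\<forall>j. mat_of_sym x $ j $ j > 0)"
proof
  assume pos: "\<forall>j. mat_of_sym x $ j $ j > 0"
  show "pos_definite (pivot_compose x)"
    unfolding pos_definite_def
  proof (intro allI impI)
    fix w :: "real^'n" assume w: "w \<noteq> 0"
    define S where "S = {i. w $ i \<noteq> 0}"
    have "S \<noteq> {}" using w by (auto simp: S_def vec_eq_iff)
    \<comment> \<open>the first coordinate of the transposed product that can be nonzero is nonzero\<close>
    then obtain i where i: "i \<in> S" "\<And>k. k \<in> S \<Longrightarrow> \<rho> i \<le> \<rho> k"
      using ex_has_least_nat[of "\<lambda>i. i \<in> S" _ \<rho>] by blast
    have "(transpose (pivot_factor x) *v w) $ i = (\<Sum>k\<in>UNIV. if k = i then pivot_root x i * w $ i else 0)"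
      unfolding matrix_vector_mult_def transpose_def
    proof (simp only: vec_lambda_beta, rule sum.cong[OF refl])
      fix k show "pivot_factor x $ k $ i * w $ k = (if k = i then pivot_root x i * w $ i else 0)"
      proof (cases "k = i \<or> w $ k = 0")
        case False
        then have "\<rho> i < \<rho> k" using i(2)[of k] \<rho>_inj[of i k] by (auto simp: S_def)
        then show ?thesis using False by (simp add: pivot_factor_upper)
      qed (auto simp: pivot_factor_def)
    qed
    then have "(transpose (pivot_factor x) *v w) $ i \<noteq> 0" using i(1) pivot_root_pos[of x i] by (simp add: S_def)
    then have "0 < (\<Sum>k\<in>UNIV. ((transpose (pivot_factor x) *v w) $ k)\<^sup>2)"
      by (intro sum_pos2[of UNIV i]) auto
    then show "0 < w \<bullet> (mat_of_sym (pivot_compose x) *v w)"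
      using pos by (simp add: quadratic_pivot_compose pivot_defect_zero)
  qed
next
  assume pd: "pos_definite (pivot_compose x)"
  show "\<forall>j. mat_of_sym x $ j $ j > 0"
  proof (rule ccontr)
    assume "\<not> ?thesis"
    then have ne: "{j. mat_of_sym x $ j $ j \<le> 0} \<noteq> {}" by (auto simp: not_less)
    define S where "S = {j. mat_of_sym x $ j $ j \<le> 0}"
    have "Max (\<rho> ` S) \<in> \<rho> ` S" using ne by (intro Max_in) (auto simp: S_def)
    then obtain j where "j \<in> S" "\<rho> j = Max (\<rho> ` S)" by auto
    then have j: "mat_of_sym x $ j $ j \<le> 0" "\<And>k. k \<in> S \<Longrightarrow> \<rho> k \<le> \<rho> j" by (auto simp: S_def)
    have j: "mat_of_sym x $ j $ j \<le> 0" "\<And>k. \<rho> j < \<rho> k \<Longrightarrow> mat_of_sym x $ k $ k > 0"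
      using j by (auto simp: S_def not_le[symmetric])
    \<comment> \<open>a kernel vector of a matrix with a zero row makes the form nonpositive\<close>
    define B :: "real^'n^'n" where "B = (\<chi> k. if k = j then 0 else if \<rho> k < \<rho> j then axis k 1 else transpose (pivot_factor x) $ k)"
    have "det B = 0" by (rule det_zero_row(1)[of j]) (simp add: B_def row_def vec_eq_iff)
    then have "\<not> invertible B" by (simp add: invertible_det_nz)
    then obtain w where w: "w \<noteq> 0" "B *v w = 0"
      unfolding invertible_left_inverse matrix_left_invertible_ker by blast
    have Bk: "(B *v w) $ k = 0" for k using w by simp
    have w0: "w $ k = 0" if "\<rho> k < \<rho> j" for k
    proof -
      have "(B *v w) $ k = w $ k" using that
      proof -
        have "(B *v w) $ k = (\<Sum>l\<in>UNIV. axis k 1 $ l * w $ l)"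
          using that by (auto simp: B_def matrix_vector_mult_def)
        also have "\<dots> = (\<Sum>l\<in>UNIV. if l = k then w $ k else 0)"
          by (intro sum.cong) (auto simp: axis_def)
        finally show ?thesis by simp
      qed
      then show ?thesis using Bk by simp
    qed
    have Tw: "(transpose (pivot_factor x) *v w) $ k = (if k = j then pivot_root x j * w $ j else 0)" for k
    proof -
      consider "\<rho> k < \<rho> j" | "k = j" | "\<rho> j < \<rho> k" using \<rho>_inj[of k j] by linarith
      then show ?thesis
      proof cases
        case 1
        have "pivot_factor x $ i $ k * w $ i = 0" for i
          using 1 w0[of i] pivot_factor_upper[of k i x] by (cases "\<rho> i < \<rho> j") auto
        then have "(\<Sum>i\<in>UNIV. pivot_factor x $ i $ k * w $ i) = 0" by (intro sum.neutral) blast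
        then show ?thesis using 1 by (auto simp: matrix_vector_mult_def transpose_def)
      next
        case 2
        have "pivot_factor x $ i $ j * w $ i = (if i = j then pivot_root x j * w $ j else 0)" for i
          using w0[of i] pivot_factor_upper[of j i x] \<rho>_inj[of i j] by (cases "\<rho> i < \<rho> j") (auto simp: pivot_factor_def)
        then show ?thesis using 2 by (simp add: matrix_vector_mult_def transpose_def)
      next
        case 3
        have "(B *v w) $ k = (transpose (pivot_factor x) *v w) $ k"
          using 3 by (auto simp: B_def matrix_vector_mult_def)
        then show ?thesis using Bk 3 by auto
      qed
    qed
    have def: "pivot_defect x k * (w $ k)\<^sup>2 = (if k = j then pivot_defect x j * (w $ j)\<^sup>2 else 0)" for k
      using w0[of k] j(2)[of k] pivot_defect_zero[of x k] \<rho>_inj[of k j] by (cases "\<rho> k < \<rho> j") auto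
    have "w \<bullet> (mat_of_sym (pivot_compose x) *v w) = (pivot_root x j * w $ j)\<^sup>2 + pivot_defect x j * (w $ j)\<^sup>2"
    proof -
      have "(\<Sum>k\<in>UNIV. ((transpose (pivot_factor x) *v w) $ k)\<^sup>2) = (\<Sum>k\<in>UNIV. if k = j then (pivot_root x j * w $ j)\<^sup>2 else 0)"
        by (rule sum.cong[OF refl]) (simp add: Tw del: transpose_matrix_vector)
      moreover have "(\<Sum>k\<in>UNIV. pivot_defect x k * (w $ k)\<^sup>2) = (\<Sum>k\<in>UNIV. if k = j then pivot_defect x j * (w $ j)\<^sup>2 else 0)"
        by (rule sum.cong[OF refl]) (rule def)
      ultimately show ?thesis unfolding quadratic_pivot_compose by simp
    qed
    also have "\<dots> = mat_of_sym x $ j $ j * (w $ j)\<^sup>2" by (simp add: pivot_defect_def algebra_simps)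
    also have "\<dots> \<le> 0" using j(1) by (simp add: mult_nonpos_nonneg)
    finally show False using pd w(1) unfolding pos_definite_def by force
  qed
qed

lemma pivot_compose_entry:
  assumes "\<rho> i \<le> \<rho> j"
  shows "mat_of_sym (pivot_compose x) $ i $ j =
    (if i = j then mat_of_sym x $ j $ j else pivot_root x j * mat_of_sym x $ i $ j) +
    (\<Sum>k | \<rho> j < \<rho> k. mat_of_sym x $ i $ k * mat_of_sym x $ j $ k)"
proof -
  have "(\<Sum>k\<in>UNIV. pivot_factor x $ i $ k * pivot_factor x $ j $ k) =
      (\<Sum>k\<in>UNIV. (if k = j then pivot_factor x $ i $ j * pivot_root x j else 0) +
        (if \<rho> j < \<rho> k then mat_of_sym x $ i $ k * mat_of_sym x $ j $ k else 0))"
  proof (rule sum.cong[OF refl])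
    fix k
    consider "\<rho> k < \<rho> j" | "k = j" | "\<rho> j < \<rho> k" using \<rho>_inj[of k j] by linarith
    then show "pivot_factor x $ i $ k * pivot_factor x $ j $ k =
      (if k = j then pivot_factor x $ i $ j * pivot_root x j else 0) +
        (if \<rho> j < \<rho> k then mat_of_sym x $ i $ k * mat_of_sym x $ j $ k else 0)"
      using assms by cases (auto simp: pivot_factor_upper pivot_factor_def upper_part_def)
  qed
  also have "\<dots> = pivot_factor x $ i $ j * pivot_root x j + (\<Sum>k | \<rho> j < \<rho> k. mat_of_sym x $ i $ k * mat_of_sym x $ j $ k)"
    by (simp add: sum.distrib sum.If_cases)
  finally show ?thesis using assms
    by (auto simp: pivot_compose_def plus_symmat.rep_eq gram_entry diagonal.rep_eq pivot_defect_def
        pivot_factor_def upper_part_def power2_eq_square)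
qed

text \<open>The columns are treated from the last to the first, the diagonal entry of each column first: the entry at \<open>(i, j)\<close>
is multiplied by the root of the diagonal entry of column \<open>j\<close> and translated by entries of later columns.\<close>

lemma nn_integral_pivot_compose:
  fixes f :: "'n symmat \<Rightarrow> ennreal"
  assumes f: "f \<in> borel_measurable borel"
  shows "(\<integral>\<^sup>+z. f z \<partial>lborel) =
    (\<integral>\<^sup>+x. f (pivot_compose x) * (\<Prod>(i, j)\<in>upper_pairs. if i = j then 1 else ennreal (pivot_root x j)) \<partial>lborel)"
proof -
  define a where "a p x = (if fst p = snd p then 1 else pivot_root x (snd p))" for p x
  define c where "c p x = (\<Sum>k | \<rho> (snd p) < \<rho> k. mat_of_sym x $ fst p $ k * mat_of_sym x $ snd p $ k)" for p and x :: "'n symmat"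
  define e where "e = (\<lambda>(i, j). sym_unit i j :: 'n symmat)"
  have inner_e: "x \<bullet> e (i, j) = mat_of_sym x $ i $ j" for x i j by (simp add: e_def inner_sym_unit)
  have apos: "a p x > 0" for p x using pivot_root_pos by (simp add: a_def)
  have [measurable]: "(\<lambda>x. pivot_root x j) \<in> borel_measurable borel" for j
    unfolding pivot_root_def by measurable
  have [measurable]: "a p \<in> borel_measurable borel" for p unfolding a_def[abs_def] by measurable
  have [measurable]: "c p \<in> borel_measurable borel" for p unfolding c_def[abs_def] by measurable
  \<comment> \<open>later columns first, and within a column the diagonal entry first\<close>
  define h where "h = (\<lambda>(i, j). 2 * (CARD('n) - \<rho> j) + (if i = j then 0 else 1 :: nat))"
  have "(\<integral>\<^sup>+x. f x * (\<Prod>k\<in>upper_pairs. indicator UNIV (x \<bullet> e k)) \<partial>lborel) =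
    (\<integral>\<^sup>+x. f (\<Sum>k\<in>upper_pairs. (c k x + a k x * (x \<bullet> e k)) *\<^sub>R e k) * (\<Prod>k\<in>upper_pairs. ennreal \<bar>a k x\<bar>) \<partial>lborel)"
  proof (rule triangular_substitution_indexed[where h = h and \<rho> = "\<lambda>k x u. ennreal \<bar>a k x\<bar>"
        and \<theta> = "\<lambda>k x u. c k x + a k x * u" and A = "\<lambda>_. UNIV"])
    show "bij_betw e upper_pairs Basis" unfolding e_def by (rule sym_basis_bij)
    fix p x x' u assume p: "p \<in> upper_pairs"
      and eq: "\<And>q. q \<in> upper_pairs \<Longrightarrow> h q < h p \<Longrightarrow> x \<bullet> e q = x' \<bullet> e q"
    obtain i j where ij: "p = (i, j)" "\<rho> i \<le> \<rho> j" using p by (auto simp: upper_pairs_def)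
    have later: "mat_of_sym x $ l $ k = mat_of_sym x' $ l $ k" if "\<rho> l \<le> \<rho> j" "\<rho> j < \<rho> k" for k l
      using eq[of "(l, k)"] that diff_less_mono2[OF that(2) \<rho>_less[of k, THEN less_trans[OF that(2)]]] by (auto simp: h_def ij upper_pairs_def inner_e split: if_splits)
    have "mat_of_sym x $ j $ j = mat_of_sym x' $ j $ j" if "i \<noteq> j"
      using eq[of "(j, j)"] that by (auto simp: h_def ij upper_pairs_def inner_e)
    then have "a p x = a p x'" by (auto simp: a_def ij pivot_root_def)
    moreover have "c p x = c p x'" unfolding c_def ij using later ij(2) by (auto intro!: sum.cong)
    ultimately show "c p x + a p x * u = c p x' + a p x' * u \<and> ennreal \<bar>a p x\<bar> = ennreal \<bar>a p x'\<bar>" by simp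
  next
    fix p x and f :: "real \<Rightarrow> ennreal" assume "f \<in> borel_measurable borel"
    from nn_integral_affine_coordinate[OF this, of "a p x" "c p x"] apos[of p x]
    show "(\<integral>\<^sup>+t. f t * indicator UNIV t \<partial>lborel) = (\<integral>\<^sup>+u. f (c p x + a p x * u) * ennreal \<bar>a p x\<bar> \<partial>lborel)"
      by simp
  qed (use f in auto)
  moreover have "(\<Sum>k\<in>upper_pairs. (c k x + a k x * (x \<bullet> e k)) *\<^sub>R e k) = pivot_compose x" for x
  proof -
    have up: "mat_of_sym (\<Sum>k\<in>upper_pairs. (c k x + a k x * (x \<bullet> e k)) *\<^sub>R e k) $ i $ j = mat_of_sym (pivot_compose x) $ i $ j"
      if "\<rho> i \<le> \<rho> j" for i j
    proof -
      have "(\<Sum>k\<in>upper_pairs. (c k x + a k x * (x \<bullet> e k)) *\<^sub>R e k) = (\<Sum>(i, j)\<in>upper_pairs. (c (i, j) x + a (i, j) x * mat_of_sym x $ i $ j) *\<^sub>R sym_unit i j)"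
        by (intro sum.cong) (auto simp: e_def inner_sym_unit)
      then show ?thesis
        using sym_sum_basis[OF that] pivot_compose_entry[OF that] by (simp add: a_def c_def)
    qed
    show ?thesis
    proof (rule symmat_eqI)
      fix i j show "mat_of_sym (\<Sum>k\<in>upper_pairs. (c k x + a k x * (x \<bullet> e k)) *\<^sub>R e k) $ i $ j = mat_of_sym (pivot_compose x) $ i $ j"
        using up[of i j] up[of j i] by (cases "\<rho> i \<le> \<rho> j") (simp_all add: mat_of_sym_commute[of _ i j])
    qed
  qed
  moreover have "(\<Prod>k\<in>upper_pairs. ennreal \<bar>a k x\<bar>) = (\<Prod>(i, j)\<in>upper_pairs. if i = j then 1 else ennreal (pivot_root x j))" for x
    using pivot_root_pos by (intro prod.cong) (auto simp: a_def less_imp_le)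
  ultimately show ?thesis by simp
qed

text \<open>The signs make \<open>pivot_root * (entry)\<close> equal to the product \<open>u j j * u i j\<close> without absolute values, so
that the composite with \<open>pivot_compose\<close> is the polynomial map \<open>gram \<circ> upper_part\<close>.\<close>

definition signed_square :: "'n symmat \<Rightarrow> 'n symmat"
  where "signed_square u = (\<Sum>(i, j)\<in>upper_pairs. (if i = j then (mat_of_sym u $ i $ i)\<^sup>2
    else (if mat_of_sym u $ j $ j < 0 then -1 else 1) * mat_of_sym u $ i $ j) *\<^sub>R sym_unit i j)"

lemma signed_square_entry:
  assumes "\<rho> i \<le> \<rho> j"
  shows "mat_of_sym (signed_square u) $ i $ j = (if i = j then (mat_of_sym u $ i $ i)\<^sup>2
    else (if mat_of_sym u $ j $ j < 0 then -1 else 1) * mat_of_sym u $ i $ j)"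
  unfolding signed_square_def by (rule sym_sum_basis[OF assms])

lemma nn_integral_signed_square:
  fixes f :: "'n symmat \<Rightarrow> ennreal"
  assumes f: "f \<in> borel_measurable borel"
  shows "(\<integral>\<^sup>+x. f x * (\<Prod>j\<in>UNIV. indicator {0<..} (mat_of_sym x $ j $ j)) \<partial>lborel) =
    (\<integral>\<^sup>+u. f (signed_square u) * (\<Prod>j\<in>UNIV. ennreal \<bar>mat_of_sym u $ j $ j\<bar>) \<partial>lborel)"
proof -
  define e where "e = (\<lambda>(i, j). sym_unit i j :: 'n symmat)"
  have inner_e: "x \<bullet> e p = mat_of_sym x $ fst p $ snd p" for x p by (simp add: e_def inner_sym_unit case_prod_unfold)
  define A :: "'n \<times> 'n \<Rightarrow> real set" where "A p = (if fst p = snd p then {0<..} else UNIV)" for p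
  define sg :: "'n symmat \<Rightarrow> 'n \<Rightarrow> real" where "sg x j = (if mat_of_sym x $ j $ j < 0 then -1 else 1)" for x j
  define \<theta> where "\<theta> p x u = (if fst p = snd p then u\<^sup>2 else sg x (snd p) * u)" for p x and u :: real
  define w where "w p x u = (if fst p = snd p then ennreal \<bar>u\<bar> else 1)" for p :: "'n \<times> 'n" and x :: "'n symmat" and u :: real
  have [measurable]: "(\<lambda>x. sg x j) \<in> borel_measurable borel" for j unfolding sg_def by measurable
  have "(\<integral>\<^sup>+x. f x * (\<Prod>p\<in>upper_pairs. indicator (A p) (x \<bullet> e p)) \<partial>lborel) =
    (\<integral>\<^sup>+x. f (\<Sum>p\<in>upper_pairs. \<theta> p x (x \<bullet> e p) *\<^sub>R e p) * (\<Prod>p\<in>upper_pairs. w p x (x \<bullet> e p)) \<partial>lborel)"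
  proof (rule triangular_substitution_indexed[where h = "\<lambda>p. if fst p = snd p then 0 else 1"])
    show "bij_betw e upper_pairs Basis" unfolding e_def by (rule sym_basis_bij)
    fix p x x' u assume p: "p \<in> upper_pairs"
      and eq: "\<And>q. q \<in> upper_pairs \<Longrightarrow> (if fst q = snd q then 0 else 1 :: nat) < (if fst p = snd p then 0 else 1) \<Longrightarrow> x \<bullet> e q = x' \<bullet> e q"
    show "\<theta> p x u = \<theta> p x' u \<and> w p x u = w p x' u"
      using eq[of "(snd p, snd p)"] by (auto simp: \<theta>_def w_def sg_def upper_pairs_def inner_e)
  next
    fix p x and f :: "real \<Rightarrow> ennreal" assume f: "f \<in> borel_measurable borel"
    show "(\<integral>\<^sup>+t. f t * indicator (A p) t \<partial>lborel) = (\<integral>\<^sup>+u. f (\<theta> p x u) * w p x u \<partial>lborel)"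
    proof (cases "fst p = snd p")
      case True
      then show ?thesis using nn_integral_square_substitution[OF f] by (simp add: A_def \<theta>_def w_def)
    next
      case False
      have "sg x (snd p) \<noteq> 0" "\<bar>sg x (snd p)\<bar> = 1" by (auto simp: sg_def)
      then show ?thesis using nn_integral_affine_coordinate[OF f, of "sg x (snd p)" 0] False
        by (simp add: A_def \<theta>_def w_def)
    qed
  next
    fix p
    show "(\<lambda>x. \<theta> p x (x \<bullet> e p)) \<in> borel_measurable borel" unfolding \<theta>_def by measurable
    show "(\<lambda>x. w p x (x \<bullet> e p)) \<in> borel_measurable borel" unfolding w_def by measurable
  qed (use f in \<open>auto simp: A_def\<close>)
  moreover have diag: "(\<Prod>p\<in>upper_pairs. if fst p = snd p then g (fst p) else 1) = (\<Prod>j\<in>UNIV. g j)" for g :: "'n \<Rightarrow> ennreal"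
  proof -
    have "(\<Prod>p\<in>upper_pairs. if fst p = snd p then g (fst p) else 1) = (\<Prod>p\<in>(\<lambda>j. (j, j)) ` UNIV. g (fst p))"
      by (subst prod.inter_filter[symmetric]) (auto simp: upper_pairs_def intro!: prod.cong)
    then show ?thesis by (subst (asm) prod.reindex) (auto simp: inj_on_def)
  qed
  moreover have "(\<Prod>p\<in>upper_pairs. indicator (A p) (x \<bullet> e p) :: ennreal) = (\<Prod>j\<in>UNIV. indicator {0<..} (mat_of_sym x $ j $ j))" for x
    unfolding diag[symmetric] by (intro prod.cong refl) (auto simp: A_def inner_e)
  moreover have "(\<Prod>p\<in>upper_pairs. w p x (x \<bullet> e p)) = (\<Prod>j\<in>UNIV. ennreal \<bar>mat_of_sym x $ j $ j\<bar>)" for x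
    unfolding diag[symmetric] by (intro prod.cong refl) (auto simp: w_def inner_e)
  moreover have "(\<Sum>p\<in>upper_pairs. \<theta> p x (x \<bullet> e p) *\<^sub>R e p) = signed_square x" for x
    unfolding signed_square_def by (intro sum.cong refl) (auto simp: \<theta>_def sg_def e_def inner_sym_unit)
  ultimately show ?thesis by simp
qed

lemma pivot_compose_signed_square:
  assumes nz: "\<And>j. mat_of_sym u $ j $ j \<noteq> 0"
  shows "pivot_compose (signed_square u) = gram (upper_part u)"
    and "pivot_root (signed_square u) j = \<bar>mat_of_sym u $ j $ j\<bar>"
proof -
  define S where "S = signed_square u"
  have dg: "mat_of_sym S $ j $ j = (mat_of_sym u $ j $ j)\<^sup>2" for j by (simp add: S_def signed_square_entry)
  have Sent: "mat_of_sym S $ i $ j = (if i = j then (mat_of_sym u $ i $ i)\<^sup>2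
    else (if mat_of_sym u $ j $ j < 0 then -1 else 1) * mat_of_sym u $ i $ j)" if "\<rho> i \<le> \<rho> j" for i j
    unfolding S_def by (rule signed_square_entry[OF that])
  have root: "pivot_root S j = \<bar>mat_of_sym u $ j $ j\<bar>" for j
    using nz[of j] by (simp add: pivot_root_def dg)
  show "pivot_root (signed_square u) j = \<bar>mat_of_sym u $ j $ j\<bar>" using root by (simp add: S_def)
  define sg :: "'n \<Rightarrow> real" where "sg j = (if mat_of_sym u $ j $ j < 0 then -1 else 1)" for j
  have fac: "pivot_factor S $ i $ j = sg j * upper_part u $ i $ j" for i j
    by (cases "i = j") (auto simp: pivot_factor_def root upper_part_def sg_def Sent)
  have sg2: "sg k * a * (sg k * b) = a * b" for a b k by (simp add: sg_def)
  have def: "pivot_defect S = (\<lambda>j. 0)" using nz by (auto simp: pivot_defect_zero dg fun_eq_iff)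
  show "pivot_compose (signed_square u) = gram (upper_part u)"
    by (rule symmat_eqI)
      (simp add: pivot_compose_def S_def[symmetric] plus_symmat.rep_eq gram_entry fac sg2 def diagonal.rep_eq)
qed

lemma prod_upper_pairs:
  "(\<Prod>(i, j)\<in>upper_pairs. if i = j then 1 else g j) = (\<Prod>j\<in>UNIV. g j ^ \<rho> j)" for g :: "'n \<Rightarrow> ennreal"
proof -
  have card: "card {i. \<rho> i < \<rho> j} = \<rho> j" for j
  proof -
    have "\<rho> ` {i. \<rho> i < \<rho> j} = {..<\<rho> j}"
      using \<rho>_surj less_trans[OF _ \<rho>_less[of j]] by (auto simp: image_iff)
    then have "bij_betw \<rho> {i. \<rho> i < \<rho> j} {..<\<rho> j}"
      by (simp add: bij_betw_def inj_on_def \<rho>_inj)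
    then show ?thesis by (simp add: bij_betw_same_card)
  qed
  have "(\<Prod>(i, j)\<in>upper_pairs. if i = j then 1 else g j) = (\<Prod>(j, i)\<in>(SIGMA j:UNIV. {i. \<rho> i \<le> \<rho> j}). if i = j then 1 else g j)"
    by (rule prod.reindex_bij_witness[of _ prod.swap prod.swap]) (auto simp: upper_pairs_def)
  also have "\<dots> = (\<Prod>j\<in>UNIV. \<Prod>i | \<rho> i \<le> \<rho> j. if i = j then 1 else g j)"
    by (rule prod.Sigma[symmetric]) auto
  also have "\<dots> = (\<Prod>j\<in>UNIV. g j ^ \<rho> j)"
  proof (rule prod.cong[OF refl])
    fix j
    have "{i. \<rho> i \<le> \<rho> j} = insert j {i. \<rho> i < \<rho> j}" using \<rho>_inj[of _ j] by (auto simp: le_less)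
    then have "(\<Prod>i | \<rho> i \<le> \<rho> j. if i = j then 1 else g j) = (\<Prod>i | \<rho> i < \<rho> j. if i = j then 1 else g j)"
      by simp
    also have "\<dots> = (\<Prod>i | \<rho> i < \<rho> j. g j)" by (rule prod.cong) auto
    finally have "(\<Prod>i | \<rho> i \<le> \<rho> j. if i = j then 1 else g j) = (\<Prod>i | \<rho> i < \<rho> j. g j)" .
    then show "(\<Prod>i | \<rho> i \<le> \<rho> j. if i = j then 1 else g j) = g j ^ \<rho> j" by (simp add: card)
  qed
  finally show ?thesis .
qed

text \<open>Of the exponent \<open>\<rho> j + 1\<close>, the part \<open>\<rho> j\<close> comes from scaling the entries above the diagonal of column
\<open>j\<close>, and 1 from squaring the diagonal entry. Each positive definite matrix is reached once for every choice of the
signs of the diagonal entries.\<close>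

theorem nn_integral_Cholesky:
  fixes f :: "'n symmat \<Rightarrow> ennreal"
  assumes f[measurable]: "f \<in> borel_measurable borel"
  shows "(\<integral>\<^sup>+z. f z * indicator {z. pos_definite z} z \<partial>lborel) =
    (\<integral>\<^sup>+u. f (gram (upper_part u)) * (\<Prod>j\<in>UNIV. ennreal (\<bar>mat_of_sym u $ j $ j\<bar> ^ (\<rho> j + 1))) \<partial>lborel)"
proof -
  have [measurable]: "(\<lambda>x. pivot_root x j) \<in> borel_measurable borel" for j
    unfolding pivot_root_def by measurable
  have gm[measurable]: "pivot_compose \<in> borel_measurable borel"
  proof -
    have ent: "(\<lambda>x. mat_of_sym (pivot_compose x) $ i $ j) \<in> borel_measurable borel" if "\<rho> i \<le> \<rho> j" for i j
      unfolding pivot_compose_entry[OF that] by measurable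
    have "(\<lambda>x. pivot_compose x \<bullet> b) \<in> borel_measurable borel" if "b \<in> Basis" for b
    proof -
      have "b \<in> (\<lambda>(i, j). sym_unit i j) ` upper_pairs" using that sym_basis_bij by (simp add: bij_betw_def)
      then obtain i j where "b = sym_unit i j" "\<rho> i \<le> \<rho> j" by (auto simp: upper_pairs_def)
      then show ?thesis using ent[of i j] by (simp add: inner_sym_unit)
    qed
    then show ?thesis by (simp add: borel_measurable_euclidean_space[of pivot_compose])
  qed
  have "(\<integral>\<^sup>+z. f z * indicator {z. pos_definite z} z \<partial>lborel) =
      (\<integral>\<^sup>+x. f (pivot_compose x) * indicator {z. pos_definite z} (pivot_compose x) * (\<Prod>j\<in>UNIV. ennreal (pivot_root x j) ^ \<rho> j) \<partial>lborel)"
    by (subst nn_integral_pivot_compose) (auto simp: prod_upper_pairs)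
  also have "\<dots> = (\<integral>\<^sup>+x. (f (pivot_compose x) * (\<Prod>j\<in>UNIV. ennreal (pivot_root x j) ^ \<rho> j)) * (\<Prod>j\<in>UNIV. indicator {0<..} (mat_of_sym x $ j $ j)) \<partial>lborel)"
  proof (rule nn_integral_cong)
    fix x
    have "indicator {z. pos_definite z} (pivot_compose x) = (\<Prod>j\<in>UNIV. indicator {0<..} (mat_of_sym x $ j $ j) :: ennreal)"
    proof (cases "\<forall>j. mat_of_sym x $ j $ j > 0")
      case False
      then have "(\<Prod>j\<in>UNIV. indicator {0<..} (mat_of_sym x $ j $ j) :: ennreal) = 0"
      proof (intro prod_zero)
        from False obtain j where "\<not> mat_of_sym x $ j $ j > 0" by blast
        then show "\<exists>j\<in>UNIV. indicator {0<..} (mat_of_sym x $ j $ j) = (0 :: ennreal)"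
          by (intro bexI[of _ j]) auto
      qed auto
      then show ?thesis using False by (simp add: pos_definite_pivot_compose)
    qed (simp add: pos_definite_pivot_compose)
    then show "f (pivot_compose x) * indicator {z. pos_definite z} (pivot_compose x) * (\<Prod>j\<in>UNIV. ennreal (pivot_root x j) ^ \<rho> j) =
      (f (pivot_compose x) * (\<Prod>j\<in>UNIV. ennreal (pivot_root x j) ^ \<rho> j)) * (\<Prod>j\<in>UNIV. indicator {0<..} (mat_of_sym x $ j $ j))"
      by (simp add: mult_ac)
  qed
  also have "\<dots> = (\<integral>\<^sup>+u. (f (pivot_compose (signed_square u)) * (\<Prod>j\<in>UNIV. ennreal (pivot_root (signed_square u) j) ^ \<rho> j)) *
      (\<Prod>j\<in>UNIV. ennreal \<bar>mat_of_sym u $ j $ j\<bar>) \<partial>lborel)"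
    by (rule nn_integral_signed_square) measurable
  also have "\<dots> = (\<integral>\<^sup>+u. f (gram (upper_part u)) * (\<Prod>j\<in>UNIV. ennreal (\<bar>mat_of_sym u $ j $ j\<bar> ^ (\<rho> j + 1))) \<partial>lborel)"
  proof (rule nn_integral_cong_AE)
    have "AE u::'n symmat in lborel. mat_of_sym u $ j $ j \<noteq> 0" for j
      using AE_coordinate_nonzero[of "sym_unit j j :: 'n symmat"] by (auto simp: Basis_symmat_def inner_sym_unit)
    then have "AE u::'n symmat in lborel. \<forall>j\<in>UNIV. mat_of_sym u $ j $ j \<noteq> 0"
      by (intro AE_finite_allI) auto
    then show "AE u in lborel. (f (pivot_compose (signed_square u)) * (\<Prod>j\<in>UNIV. ennreal (pivot_root (signed_square u) j) ^ \<rho> j)) *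
      (\<Prod>j\<in>UNIV. ennreal \<bar>mat_of_sym u $ j $ j\<bar>) = f (gram (upper_part u)) * (\<Prod>j\<in>UNIV. ennreal (\<bar>mat_of_sym u $ j $ j\<bar> ^ (\<rho> j + 1)))"
    proof (rule AE_mp, intro AE_I2 impI)
      fix u :: "'n symmat" assume "\<forall>j\<in>UNIV. mat_of_sym u $ j $ j \<noteq> 0"
      then have nz: "\<And>j. mat_of_sym u $ j $ j \<noteq> 0" by blast
      show "(f (pivot_compose (signed_square u)) * (\<Prod>j\<in>UNIV. ennreal (pivot_root (signed_square u) j) ^ \<rho> j)) *
        (\<Prod>j\<in>UNIV. ennreal \<bar>mat_of_sym u $ j $ j\<bar>) = f (gram (upper_part u)) * (\<Prod>j\<in>UNIV. ennreal (\<bar>mat_of_sym u $ j $ j\<bar> ^ (\<rho> j + 1)))"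
      proof -
        have "ennreal \<bar>mat_of_sym u $ j $ j\<bar> ^ \<rho> j * ennreal \<bar>mat_of_sym u $ j $ j\<bar> =
            ennreal (\<bar>mat_of_sym u $ j $ j\<bar> ^ (\<rho> j + 1))" for j
          by (simp add: ennreal_power ennreal_mult'[symmetric] mult.commute)
        then show ?thesis
          unfolding pivot_compose_signed_square[OF nz] mult.assoc prod.distrib[symmetric] by simp
      qed
    qed
  qed
  finally show ?thesis .
qed

end

section \<open>Gaussian elimination with pivoting\<close>

text \<open>In addition to the order of the rows, \<open>\<kappa>\<close> enumerates the columns. The row \<open>piv c\<close> supplies the pivot of the
column \<open>c\<close>.\<close>

locale elimination_order = index_order \<rho> for \<rho> :: "'n::finite \<Rightarrow> nat" +
  fixes \<kappa> :: "'d::finite \<Rightarrow> nat"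
  assumes \<kappa>: "bij_betw \<kappa> UNIV {..<CARD('d)}" and card_le: "CARD('d) \<le> CARD('n)"
begin

definition piv :: "'d \<Rightarrow> 'n"
  where "piv c = inv \<rho> (\<kappa> c)"

definition col :: "'n \<Rightarrow> 'd"
  where "col j = inv \<kappa> (\<rho> j)"

lemma \<kappa>_inj: "\<kappa> a = \<kappa> b \<longleftrightarrow> a = b"
  using \<kappa> by (auto simp: bij_betw_def inj_on_def)

lemma \<kappa>_less: "\<kappa> c < CARD('d)" "\<kappa> c < CARD('n)"
proof -
  show "\<kappa> c < CARD('d)" using \<kappa> by (auto simp: bij_betw_def)
  then show "\<kappa> c < CARD('n)" using card_le by simp
qed

lemma \<rho>_piv [simp]: "\<rho> (piv c) = \<kappa> c"
  unfolding piv_def using \<rho> \<kappa>_less(2)[of c] by (intro f_inv_into_f) (auto simp: bij_betw_def)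

lemma \<kappa>_col: "\<rho> j < CARD('d) \<Longrightarrow> \<kappa> (col j) = \<rho> j"
  unfolding col_def using \<kappa> by (intro f_inv_into_f) (auto simp: bij_betw_def)

lemma col_piv [simp]: "col (piv c) = c"
  using \<kappa>_col[of "piv c"] \<kappa>_less(1)[of c] by (simp add: \<kappa>_inj)

text \<open>Both factors of the elimination are read off one matrix \<open>p\<close>, as is usual for stored LU factorizations: the
entries of \<open>p\<close> below the pivots are the multipliers, the others form the reduced matrix.\<close>

definition Lower :: "real^'d^'n \<Rightarrow> real^'n^'n"
  where "Lower p = (\<chi> i j. if i = j then 1 else if \<rho> j < \<rho> i \<and> \<rho> j < CARD('d) then p $ i $ col j else 0)"

definition Reduced :: "real^'d^'n \<Rightarrow> real^'d^'n"
  where "Reduced p = (\<chi> i c. if \<rho> i \<le> \<kappa> c then p $ i $ c else 0)"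

lemma unit_lower_Lower: "unit_lower (Lower p)"
  by (auto simp: unit_lower_def Lower_def)

lemma Lower_Reduced_entry:
  "(Lower p ** Reduced p) $ i $ c = (if \<rho> i \<le> \<kappa> c then p $ i $ c else p $ i $ c * p $ piv c $ c) +
    (\<Sum>j | \<rho> j < min (\<rho> i) (\<kappa> c). p $ i $ col j * p $ j $ c)"
proof -
  have "(Lower p ** Reduced p) $ i $ c = (\<Sum>j\<in>UNIV. Lower p $ i $ j * Reduced p $ j $ c)"
    by (simp add: matrix_matrix_mult_def)
  also have "\<dots> = (\<Sum>j\<in>UNIV. (if j = (if \<rho> i \<le> \<kappa> c then i else piv c) then (if \<rho> i \<le> \<kappa> c then p $ i $ c else p $ i $ c * p $ piv c $ c) else 0) +
      (if \<rho> j < min (\<rho> i) (\<kappa> c) then p $ i $ col j * p $ j $ c else 0))"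
  proof (rule sum.cong[OF refl])
    fix j
    show "Lower p $ i $ j * Reduced p $ j $ c = (if j = (if \<rho> i \<le> \<kappa> c then i else piv c) then (if \<rho> i \<le> \<kappa> c then p $ i $ c else p $ i $ c * p $ piv c $ c) else 0) +
      (if \<rho> j < min (\<rho> i) (\<kappa> c) then p $ i $ col j * p $ j $ c else 0)"
    proof (cases "\<rho> i \<le> \<kappa> c")
      case True
      have "\<rho> i < CARD('d)" using True \<kappa>_less(1)[of c] by simp
      consider "\<rho> j < \<rho> i" | "j = i" | "\<rho> i < \<rho> j" using \<rho>_inj[of i j] by (metis nat_neq_iff)
      then show ?thesis
      proof cases
        case 1
        then have "i \<noteq> j" by auto
        then show ?thesis using 1 True \<open>\<rho> i < CARD('d)\<close> by (simp add: Lower_def Reduced_def)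
      next
        case 3
        then have "i \<noteq> j" by auto
        then show ?thesis using 3 True by (simp add: Lower_def)
      qed (use True in \<open>simp add: Lower_def Reduced_def\<close>)
    next
      case False
      consider "\<rho> j < \<kappa> c" | "j = piv c" | "\<rho> j > \<kappa> c"
        using \<rho>_inj[of j "piv c"] unfolding \<rho>_piv by (metis nat_neq_iff)
      then show ?thesis
      proof cases
        case 1
        then have "i \<noteq> j" "j \<noteq> piv c" using False by auto
        then show ?thesis using 1 False \<kappa>_less(1)[of c] by (simp add: Lower_def Reduced_def)
      next
        case 2
        then have "i \<noteq> j" using False by auto
        then show ?thesis using 2 False \<kappa>_less(1)[of c] by (simp add: Lower_def Reduced_def)
      next
        case 3
        then have "j \<noteq> piv c" by auto
        then show ?thesis using 3 False by (simp add: Reduced_def)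
      qed
    qed
  qed
  also have "\<dots> = (if \<rho> i \<le> \<kappa> c then p $ i $ c else p $ i $ c * p $ piv c $ c) +
      (\<Sum>j | \<rho> j < min (\<rho> i) (\<kappa> c). p $ i $ col j * p $ j $ c)"
    by (simp add: sum.distrib sum.If_cases del: min_less_iff_conj)
  finally show ?thesis .
qed

lemma card_above: "card {i. \<kappa> c < \<rho> i} = CARD('n) - 1 - \<kappa> c"
proof -
  have "\<rho> ` {i. \<kappa> c < \<rho> i} = {\<kappa> c<..<CARD('n)}"
    using \<rho>_surj \<rho>_less by (auto simp: image_iff) metis
  then have "bij_betw \<rho> {i. \<kappa> c < \<rho> i} {\<kappa> c<..<CARD('n)}"
    by (simp add: bij_betw_def inj_on_def \<rho>_inj)
  then show ?thesis by (simp add: bij_betw_same_card)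
qed

text \<open>Column by column and downwards within each column, the entries of the product are translates of those of \<open>p\<close>,
multiplied by the pivot of their column if they lie below it. The exponent counts the rows below the pivot.\<close>

lemma nn_integral_elimination:
  fixes f :: "real^'d^'n \<Rightarrow> ennreal"
  assumes f: "f \<in> borel_measurable borel"
  shows "(\<integral>\<^sup>+y. f y \<partial>lborel) =
    (\<integral>\<^sup>+p. f (Lower p ** Reduced p) * (\<Prod>c\<in>UNIV. ennreal (\<bar>p $ piv c $ c\<bar> ^ (CARD('n) - 1 - \<kappa> c))) \<partial>lborel)"
proof -
  define e where "e = (\<lambda>(i, c). axis i (axis c 1) :: real^'d^'n)"
  have inner_e: "x \<bullet> e q = x $ fst q $ snd q" for x q by (simp add: e_def matrix_inner_basis case_prod_unfold)
  \<comment> \<open>a vanishing pivot is replaced by 1 to keep every elementary substitution invertible\<close>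
  define a where "a q x = (if \<rho> (fst q) \<le> \<kappa> (snd q) \<or> x $ piv (snd q) $ snd q = 0 then 1 else x $ piv (snd q) $ snd q)"
    for q and x :: "real^'d^'n"
  define b where "b q x = (\<Sum>j | \<rho> j < min (\<rho> (fst q)) (\<kappa> (snd q)). x $ fst q $ col j * x $ j $ snd q)"
    for q and x :: "real^'d^'n"
  have a0: "a q x \<noteq> 0" for q x by (simp add: a_def)
  have [measurable]: "a q \<in> borel_measurable borel" "b q \<in> borel_measurable borel" for q
    unfolding a_def[abs_def] b_def[abs_def] by measurable
  \<comment> \<open>the columns one after the other, each from its first row to its last\<close>
  define h where "h q = \<kappa> (snd q) * CARD('n) + \<rho> (fst q)" for q
  have "(\<integral>\<^sup>+x. f x * (\<Prod>k\<in>UNIV. indicator UNIV (x \<bullet> e k)) \<partial>lborel) =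
    (\<integral>\<^sup>+x. f (\<Sum>k\<in>UNIV. (b k x + a k x * (x \<bullet> e k)) *\<^sub>R e k) * (\<Prod>k\<in>UNIV. ennreal \<bar>a k x\<bar>) \<partial>lborel)"
  proof (rule triangular_substitution_indexed[where h = h and \<rho> = "\<lambda>k x u. ennreal \<bar>a k x\<bar>"
        and \<theta> = "\<lambda>k x u. b k x + a k x * u" and A = "\<lambda>_. UNIV"])
    show "bij_betw e UNIV Basis" unfolding e_def by (rule matrix_basis_bij)
    fix q x x' u assume eq: "\<And>k. k \<in> UNIV \<Longrightarrow> h k < h q \<Longrightarrow> x \<bullet> e k = x' \<bullet> e k"
    obtain i c where q: "q = (i, c)" by fastforce
    have h_less: "x $ j $ l = x' $ j $ l" if "\<kappa> l < \<kappa> c \<or> l = c \<and> \<rho> j < \<rho> i" for j l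
    proof -
      have "h (j, l) < h (i, c)"
      proof (cases "\<kappa> l < \<kappa> c")
        case True
        have "h (j, l) < (\<kappa> l + 1) * CARD('n)" using \<rho>_less[of j] by (simp add: h_def)
        also have "\<dots> \<le> \<kappa> c * CARD('n)" using True by (intro mult_right_mono) auto
        finally show ?thesis by (simp add: h_def)
      qed (use that in \<open>simp add: h_def\<close>)
      then show ?thesis using eq[of "(j, l)"] by (simp add: q inner_e)
    qed
    have "b q x = b q x'"
      unfolding b_def q
    proof (rule sum.cong[OF refl])
      fix j assume "j \<in> {j. \<rho> j < min (\<rho> (fst (i, c))) (\<kappa> (snd (i, c)))}"
      then have j: "\<rho> j < \<rho> i" "\<rho> j < \<kappa> c" by auto
      then have "\<kappa> (col j) < \<kappa> c" using \<kappa>_less(1)[of c] by (simp add: \<kappa>_col)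
      then show "x $ fst (i, c) $ col j * x $ j $ snd (i, c) = x' $ fst (i, c) $ col j * x' $ j $ snd (i, c)"
        using h_less[of "col j" i] h_less[of c j] j by simp
    qed
    moreover have "a q x = a q x'" using h_less[of c "piv c"] by (auto simp: a_def q)
    ultimately show "b q x + a q x * u = b q x' + a q x' * u \<and> ennreal \<bar>a q x\<bar> = ennreal \<bar>a q x'\<bar>" by simp
  next
    fix q x and f :: "real \<Rightarrow> ennreal" assume "f \<in> borel_measurable borel"
    from nn_integral_affine_coordinate[OF this a0]
    show "(\<integral>\<^sup>+t. f t * indicator UNIV t \<partial>lborel) = (\<integral>\<^sup>+u. f (b q x + a q x * u) * ennreal \<bar>a q x\<bar> \<partial>lborel)"
      by simp
  qed (use f in auto)
  then have "(\<integral>\<^sup>+x. f x \<partial>lborel) = (\<integral>\<^sup>+x. f (\<Sum>k\<in>UNIV. (b k x + a k x * (x \<bullet> e k)) *\<^sub>R e k) * (\<Prod>k\<in>UNIV. ennreal \<bar>a k x\<bar>) \<partial>lborel)"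
    by simp
  also have "\<dots> = (\<integral>\<^sup>+p. f (Lower p ** Reduced p) * (\<Prod>c\<in>UNIV. ennreal (\<bar>p $ piv c $ c\<bar> ^ (CARD('n) - 1 - \<kappa> c))) \<partial>lborel)"
  proof (rule nn_integral_cong_AE)
    have "AE p::real^'d^'n in lborel. p $ piv c $ c \<noteq> 0" for c
      using AE_coordinate_nonzero[of "axis (piv c) (axis c 1) :: real^'d^'n"] by (simp add: matrix_inner_basis axis_in_Basis_iff)
    then have "AE p::real^'d^'n in lborel. \<forall>c\<in>UNIV. p $ piv c $ c \<noteq> 0"
      by (intro AE_finite_allI) auto
    then show "AE x in lborel. f (\<Sum>k\<in>UNIV. (b k x + a k x * (x \<bullet> e k)) *\<^sub>R e k) * (\<Prod>k\<in>UNIV. ennreal \<bar>a k x\<bar>) =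
      f (Lower x ** Reduced x) * (\<Prod>c\<in>UNIV. ennreal (\<bar>x $ piv c $ c\<bar> ^ (CARD('n) - 1 - \<kappa> c)))"
    proof (rule AE_mp, intro AE_I2 impI)
      fix x :: "real^'d^'n" assume "\<forall>c\<in>UNIV. x $ piv c $ c \<noteq> 0"
      then have nz: "\<And>c. x $ piv c $ c \<noteq> 0" by blast
      have "(\<Sum>k\<in>UNIV. (b k x + a k x * (x \<bullet> e k)) *\<^sub>R e k) =
          (\<Sum>(i, c)\<in>UNIV. (b (i, c) x + a (i, c) x * x $ i $ c) *\<^sub>R axis i (axis c 1))"
        by (intro sum.cong refl) (auto simp: e_def matrix_inner_basis)
      also have "\<dots> = Lower x ** Reduced x"
        unfolding matrix_sum_basis using nz
        by (simp add: vec_eq_iff Lower_Reduced_entry a_def b_def add.commute mult.commute)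
      finally have 1: "(\<Sum>k\<in>UNIV. (b k x + a k x * (x \<bullet> e k)) *\<^sub>R e k) = Lower x ** Reduced x" .
      have "(\<Prod>k\<in>UNIV. ennreal \<bar>a k x\<bar>) = (\<Prod>c\<in>UNIV. \<Prod>i\<in>UNIV. if \<kappa> c < \<rho> i then ennreal \<bar>x $ piv c $ c\<bar> else 1)"
      proof -
        have "(\<Prod>k\<in>UNIV. ennreal \<bar>a k x\<bar>) = (\<Prod>(i, c)\<in>UNIV \<times> UNIV. if \<kappa> c < \<rho> i then ennreal \<bar>x $ piv c $ c\<bar> else 1)"
          unfolding UNIV_Times_UNIV by (intro prod.cong refl) (auto simp: a_def nz not_le)
        also have "\<dots> = (\<Prod>i\<in>UNIV. \<Prod>c\<in>UNIV. if \<kappa> c < \<rho> i then ennreal \<bar>x $ piv c $ c\<bar> else 1)"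
          by (rule prod.cartesian_product[symmetric])
        finally show ?thesis by (subst prod.swap)
      qed
      also have "\<dots> = (\<Prod>c\<in>UNIV. ennreal (\<bar>x $ piv c $ c\<bar> ^ (CARD('n) - 1 - \<kappa> c)))"
        by (intro prod.cong refl) (simp add: prod.If_cases card_above ennreal_power)
      finally show "f (\<Sum>k\<in>UNIV. (b k x + a k x * (x \<bullet> e k)) *\<^sub>R e k) * (\<Prod>k\<in>UNIV. ennreal \<bar>a k x\<bar>) =
        f (Lower x ** Reduced x) * (\<Prod>c\<in>UNIV. ennreal (\<bar>x $ piv c $ c\<bar> ^ (CARD('n) - 1 - \<kappa> c)))"
        unfolding 1 by simp
    qed
  qed
  finally show ?thesis .
qed

end

text \<open>The probability of \<open>i\<close> when one of the entries of largest absolute value is chosen uniformly at random.\<close>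

definition maximal_weight :: "'n set \<Rightarrow> ('n \<Rightarrow> real) \<Rightarrow> 'n \<Rightarrow> real"
  where "maximal_weight M v i = of_bool (\<forall>j\<in>M. \<bar>v j\<bar> \<le> \<bar>v i\<bar>) / (\<Sum>k\<in>M. of_bool (\<forall>j\<in>M. \<bar>v j\<bar> \<le> \<bar>v k\<bar>))"

lemma sum_maximal_weight:
  assumes "finite M" "M \<noteq> {}"
  shows "(\<Sum>i\<in>M. maximal_weight M v i) = 1"
proof -
  have "Max ((\<lambda>j. \<bar>v j\<bar>) ` M) \<in> (\<lambda>j. \<bar>v j\<bar>) ` M" using assms by (intro Max_in) auto
  then obtain k where k: "k \<in> M" "Max ((\<lambda>j. \<bar>v j\<bar>) ` M) = \<bar>v k\<bar>" by blast
  have "\<forall>j\<in>M. \<bar>v j\<bar> \<le> \<bar>v k\<bar>" using assms(1) unfolding k(2)[symmetric] by auto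
  then have "0 < (\<Sum>k\<in>M. of_bool (\<forall>j\<in>M. \<bar>v j\<bar> \<le> \<bar>v k\<bar>) :: real)"
    using assms k(1) by (intro sum_pos2[of M k]) auto
  then show ?thesis unfolding maximal_weight_def by (simp add: sum_divide_distrib[symmetric])
qed

lemma maximal_weight_bounds: "0 \<le> maximal_weight M v i" "finite M \<Longrightarrow> i \<in> M \<Longrightarrow> maximal_weight M v i \<le> 1"
proof -
  show nn: "0 \<le> maximal_weight M v i" for i unfolding maximal_weight_def by (intro divide_nonneg_nonneg sum_nonneg) auto
  assume "finite M" "i \<in> M"
  then have "maximal_weight M v i \<le> (\<Sum>i\<in>M. maximal_weight M v i)" by (intro member_le_sum nn)
  then show "maximal_weight M v i \<le> 1" using sum_maximal_weight[of M v] \<open>i \<in> M\<close> \<open>finite M\<close> by (cases "M = {}") auto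
qed

lemma maximal_weight_nonzeroD: "maximal_weight M v i \<noteq> 0 \<Longrightarrow> j \<in> M \<Longrightarrow> \<bar>v j\<bar> \<le> \<bar>v i\<bar>"
  by (auto simp: maximal_weight_def split: if_splits)

lemma maximal_weight_cong: "i \<in> M \<Longrightarrow> (\<And>j. j \<in> M \<Longrightarrow> v j = v' j) \<Longrightarrow> maximal_weight M v i = maximal_weight M v' i"
  unfolding maximal_weight_def by (simp cong: sum.cong)

lemma maximal_weight_scale: "r \<noteq> 0 \<Longrightarrow> maximal_weight M (\<lambda>j. v j * r) i = maximal_weight M v i"
  unfolding maximal_weight_def by (simp add: abs_mult mult_le_cancel_right)

lemma maximal_weight_measurable:
  assumes "finite M" and "i \<in> M" and m: "\<And>j. j \<in> M \<Longrightarrow> (\<lambda>x. v x j) \<in> borel_measurable N"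
  shows "(\<lambda>x. maximal_weight M (v x) i) \<in> borel_measurable N"
proof -
  have "Measurable.pred N (\<lambda>x. \<forall>j\<in>M. \<bar>v x j\<bar> \<le> \<bar>v x k\<bar>)" if "k \<in> M" for k
  proof (rule pred_intros_finite(3)[OF assms(1)])
    fix j assume "j \<in> M"
    note [measurable] = m[OF this] m[OF that]
    show "Measurable.pred N (\<lambda>x. \<bar>v x j\<bar> \<le> \<bar>v x k\<bar>)" by measurable
  qed
  then have b: "(\<lambda>x. of_bool (\<forall>j\<in>M. \<bar>v x j\<bar> \<le> \<bar>v x k\<bar>) :: real) \<in> borel_measurable N" if "k \<in> M" for k
    using that by (intro measurable_compose[of _ N "count_space UNIV" of_bool]) auto
  show ?thesis unfolding maximal_weight_def
    by (intro borel_measurable_divide borel_measurable_sum b assms(2))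
qed

definition eliminate :: "'d \<Rightarrow> 'n \<Rightarrow> real^'d^'n::finite \<Rightarrow> real^'d::finite^'n"
  where "eliminate c i y = (\<chi> j l. y $ j $ l - y $ j $ c / y $ i $ c * y $ i $ l)"

text \<open>The probability that elimination with partial pivoting, with ties broken at random, selects the rows in the order
\<open>xs\<close>. Once the columns are used up, every remaining row is equally likely.\<close>

fun pivot_weight :: "(nat \<Rightarrow> 'd) \<Rightarrow> nat \<Rightarrow> 'n list \<Rightarrow> real^'d::finite^'n::finite \<Rightarrow> real" where
  "pivot_weight \<gamma> k [] y = 1"
| "pivot_weight \<gamma> k (i # xs) y =
    maximal_weight (set (i # xs)) (\<lambda>j. if k < CARD('d) then y $ j $ \<gamma> k else 0) i *
    pivot_weight \<gamma> (Suc k) xs (if k < CARD('d) then eliminate (\<gamma> k) i y else y)"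

lemma eliminate_measurable [measurable]: "(eliminate c i :: real^'d::finite^'n::finite \<Rightarrow> _) \<in> borel_measurable borel"
proof -
  have "(\<lambda>y. eliminate c i y \<bullet> b) \<in> borel_measurable borel" if "b \<in> Basis" for b :: "real^'d^'n"
  proof -
    have "b \<in> range (\<lambda>(j, l). axis j (axis l 1) :: real^'d^'n)" using that matrix_basis_bij[where 'd = 'd and 'n = 'n] by (simp add: bij_betw_def)
    then obtain j l where b: "b = axis j (axis l 1)" by auto
    show ?thesis unfolding b matrix_inner_basis eliminate_def by simp
  qed
  then show ?thesis by (simp add: borel_measurable_euclidean_space[of "eliminate c i :: real^'d^'n \<Rightarrow> _"])
qed

lemma pivot_weight_measurable [measurable]:
  "(pivot_weight \<gamma> k xs :: real^'d::finite^'n::finite \<Rightarrow> real) \<in> borel_measurable borel"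
proof (induction xs arbitrary: k)
  case (Cons i xs)
  note [measurable] = Cons
  have mw: "(\<lambda>y::real^'d^'n. maximal_weight (set (i # xs)) (\<lambda>j. if k < CARD('d) then y $ j $ \<gamma> k else 0) i) \<in> borel_measurable borel"
    by (rule maximal_weight_measurable) auto
  show ?case
  proof (cases "k < CARD('d)")
    case True
    have "(\<lambda>y. pivot_weight \<gamma> (Suc k) xs (eliminate (\<gamma> k) i y)) \<in> borel_measurable borel"
      by (rule measurable_compose[OF eliminate_measurable Cons])
    then show ?thesis unfolding pivot_weight.simps using True by (intro borel_measurable_times mw) auto
  next
    case False
    then show ?thesis unfolding pivot_weight.simps using Cons by (intro borel_measurable_times mw) auto
  qed
qed (simp add: fun_eq_iff[of "pivot_weight \<gamma> _ []" "\<lambda>_. 1", THEN iffD2])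

lemma pivot_weight_nonneg: "pivot_weight \<gamma> k xs y \<ge> 0"
  by (induction \<gamma> k xs y rule: pivot_weight.induct) (auto simp: maximal_weight_bounds)

lemma sum_pivot_weight:
  assumes "finite M"
  shows "(\<Sum>xs\<in>permutations_of_set M. pivot_weight \<gamma> k xs y) = 1"
  using assms
proof (induction "card M" arbitrary: M k y)
  case 0
  then show ?case by simp
next
  case (Suc m)
  then have ne: "M \<noteq> {}" by auto
  have "(\<Sum>xs\<in>permutations_of_set M. pivot_weight \<gamma> k xs y) =
      (\<Sum>i\<in>M. \<Sum>xs\<in>(#) i ` permutations_of_set (M - {i}). pivot_weight \<gamma> k xs y)"
    unfolding permutations_of_set_nonempty[OF ne]
    using Suc.prems by (intro sum.UNION_disjoint) auto
  also have "\<dots> = (\<Sum>i\<in>M. maximal_weight M (\<lambda>j. if k < CARD('b) then y $ j $ \<gamma> k else 0) i)"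
  proof (rule sum.cong[OF refl])
    fix i assume i: "i \<in> M"
    define y' where "y' = (if k < CARD('b) then eliminate (\<gamma> k) i y else y)"
    have "(\<Sum>xs\<in>(#) i ` permutations_of_set (M - {i}). pivot_weight \<gamma> k xs y) =
        (\<Sum>xs\<in>permutations_of_set (M - {i}). pivot_weight \<gamma> k (i # xs) y)"
      by (subst sum.reindex) auto
    also have "\<dots> = (\<Sum>xs\<in>permutations_of_set (M - {i}). maximal_weight M (\<lambda>j. if k < CARD('b) then y $ j $ \<gamma> k else 0) i * pivot_weight \<gamma> (Suc k) xs y')"
      using i by (intro sum.cong refl) (auto simp: y'_def permutations_of_set_def insert_absorb)
    also have "\<dots> = maximal_weight M (\<lambda>j. if k < CARD('b) then y $ j $ \<gamma> k else 0) i"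
      using Suc.hyps(1)[of "M - {i}" "Suc k" y'] Suc.hyps(2) Suc.prems i
      by (simp add: sum_distrib_left[symmetric])
    finally show "(\<Sum>xs\<in>(#) i ` permutations_of_set (M - {i}). pivot_weight \<gamma> k xs y) =
      maximal_weight M (\<lambda>j. if k < CARD('b) then y $ j $ \<gamma> k else 0) i" .
  qed
  also have "\<dots> = 1" using Suc.prems ne by (rule sum_maximal_weight)
  finally show ?case .
qed

context elimination_order
begin

text \<open>The weight of the cell in its own coordinates. At stage \<open>k\<close>, the column to be eliminated is the corresponding
column of \<open>Lower p\<close> times the pivot, and maximality is insensitive to scaling; so the pivots drop out.\<close>

definition bounded_weight :: "'n list \<Rightarrow> real^'d^'n \<Rightarrow> real"
  where "bounded_weight xs p = (\<Prod>k<CARD('n). maximal_weight {j. k \<le> \<rho> j}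
    (\<lambda>j. if k < CARD('d) then Lower p $ j $ (xs ! k) else 0) (xs ! k))"

lemma pivot_weight_Lower_Reduced:
  assumes xs: "length xs = CARD('n)" "\<And>k. k < CARD('n) \<Longrightarrow> \<rho> (xs ! k) = k"
    and nz: "\<And>c. p $ piv c $ c \<noteq> 0"
  shows "pivot_weight (inv \<kappa>) 0 xs (Lower p ** Reduced p) = bounded_weight xs p"
proof -
  have sd: "set (drop k xs) = {j. k \<le> \<rho> j}" for k
  proof -
    have "j \<in> set (drop k xs) \<longleftrightarrow> k \<le> \<rho> j" for j
    proof -
      have "j = xs ! (\<rho> j)" using xs(2)[OF \<rho>_less[of j]] by (simp add: \<rho>_inj)
      show ?thesis
      proof
        assume "j \<in> set (drop k xs)"
        then obtain m where "m < length (drop k xs)" "drop k xs ! m = j" by (auto simp: in_set_conv_nth)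
        then have "k + m < CARD('n)" "xs ! (k + m) = j" using xs(1) by auto
        then show "k \<le> \<rho> j" using xs(2)[of "k + m"] by simp
      next
        assume "k \<le> \<rho> j"
        then have "drop k xs ! (\<rho> j - k) = j" "\<rho> j - k < length (drop k xs)"
          using \<open>j = xs ! (\<rho> j)\<close> \<rho>_less[of j] xs(1) by auto
        then show "j \<in> set (drop k xs)" by (metis nth_mem)
      qed
    qed
    then show ?thesis by blast
  qed
  have "pivot_weight (inv \<kappa>) k (drop k xs) y = (\<Prod>m\<in>{k..<CARD('n)}. maximal_weight {j. m \<le> \<rho> j}
    (\<lambda>j. if m < CARD('d) then Lower p $ j $ (xs ! m) else 0) (xs ! m))"
    if "k \<le> CARD('n)" "\<And>j c. k \<le> \<rho> j \<Longrightarrow> y $ j $ c = (\<Sum>l | k \<le> \<rho> l. Lower p $ j $ l * Reduced p $ l $ c)" for k y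
    using that
  proof (induction "CARD('n) - k" arbitrary: k y)
    case 0
    then show ?case using xs(1) by simp
  next
    case (Suc m)
    then have k: "k < CARD('n)" by simp
    define i where "i = xs ! k"
    have ri: "\<rho> i = k" using xs(2)[OF k] by (simp add: i_def)
    have dr: "drop k xs = i # drop (Suc k) xs" using k xs(1) by (simp add: i_def Cons_nth_drop_Suc)
    have ins: "{l. k \<le> \<rho> l} = insert i {l. Suc k \<le> \<rho> l}"
    proof -
      have "l = i \<longleftrightarrow> \<rho> l = k" for l using ri \<rho>_inj[of l i] by simp
      moreover have "k \<le> \<rho> l \<longleftrightarrow> \<rho> l = k \<or> Suc k \<le> \<rho> l" for l by arith
      ultimately show ?thesis by blast
    qed
    have split_sum: "(\<Sum>l | k \<le> \<rho> l. Lower p $ j $ l * Reduced p $ l $ c) =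
        Lower p $ j $ i * Reduced p $ i $ c + (\<Sum>l | Suc k \<le> \<rho> l. Lower p $ j $ l * Reduced p $ l $ c)" for j c
      unfolding ins using ri by (subst sum.insert) auto
    have iii: "Lower p $ i $ i = 1" by (simp add: Lower_def)
    show ?case
    proof (cases "k < CARD('d)")
      case True
      define c0 where "c0 = inv \<kappa> k"
      have c0: "\<kappa> c0 = k" unfolding c0_def using \<kappa> True by (intro f_inv_into_f) (auto simp: bij_betw_def)
      have pc: "piv c0 = i" using ri c0 \<rho>_inj[of "piv c0" i] by simp
      define r where "r = p $ i $ c0"
      have r: "r \<noteq> 0" using nz[of c0] by (simp add: r_def pc)
      have Rr: "Reduced p $ i $ c0 = r" by (simp add: Reduced_def ri c0 r_def)
      have yc0: "y $ j $ c0 = Lower p $ j $ i * r" if "k \<le> \<rho> j" for j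
      proof -
        have "(\<Sum>l | Suc k \<le> \<rho> l. Lower p $ j $ l * Reduced p $ l $ c0) = 0"
          by (intro sum.neutral) (auto simp: Reduced_def c0)
        then show ?thesis using Suc.prems(2)[OF that] split_sum[of j c0] Rr by simp
      qed
      have yi: "y $ i $ c = Reduced p $ i $ c" for c
      proof -
        have "(\<Sum>l | Suc k \<le> \<rho> l. Lower p $ i $ l * Reduced p $ l $ c) = 0"
          using ri by (intro sum.neutral) (auto simp: Lower_def)
        then show ?thesis using Suc.prems(2)[of i c] split_sum[of i c] ri iii by simp
      qed
      have el: "eliminate c0 i y $ j $ c = (\<Sum>l | Suc k \<le> \<rho> l. Lower p $ j $ l * Reduced p $ l $ c)"
        if "Suc k \<le> \<rho> j" for j c
      proof -
        have "y $ j $ c0 / y $ i $ c0 = Lower p $ j $ i" using yc0[of j] yc0[of i] that r ri iii by simp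
        then have "eliminate c0 i y $ j $ c = y $ j $ c - Lower p $ j $ i * y $ i $ c"
          by (simp only: eliminate_def vec_lambda_beta)
        then show ?thesis using Suc.prems(2)[of j c] split_sum[of j c] that yi[of c] by simp
      qed
      have "pivot_weight (inv \<kappa>) k (drop k xs) y = maximal_weight {j. k \<le> \<rho> j} (\<lambda>j. y $ j $ c0) i * pivot_weight (inv \<kappa>) (Suc k) (drop (Suc k) xs) (eliminate c0 i y)"
        unfolding dr using sd[of k] dr True by (simp add: c0_def)
      also have "maximal_weight {j. k \<le> \<rho> j} (\<lambda>j. y $ j $ c0) i = maximal_weight {j. k \<le> \<rho> j} (\<lambda>j. Lower p $ j $ i * r) i"
        using ri yc0 by (intro maximal_weight_cong) auto
      also have "\<dots> = maximal_weight {j. k \<le> \<rho> j} (\<lambda>j. Lower p $ j $ i) i"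
        by (rule maximal_weight_scale[OF r])
      also have "pivot_weight (inv \<kappa>) (Suc k) (drop (Suc k) xs) (eliminate c0 i y) = (\<Prod>m\<in>{Suc k..<CARD('n)}. maximal_weight {j. m \<le> \<rho> j}
        (\<lambda>j. if m < CARD('d) then Lower p $ j $ (xs ! m) else 0) (xs ! m))"
        using Suc.hyps k el by (intro Suc.hyps(1)) auto
      finally show ?thesis using k True by (simp add: prod.atLeast_Suc_lessThan i_def)
    next
      case False
      have "Reduced p $ i $ c = 0" for c using ri False \<kappa>_less(1)[of c] by (auto simp: Reduced_def)
      then have y: "y $ j $ c = (\<Sum>l | Suc k \<le> \<rho> l. Lower p $ j $ l * Reduced p $ l $ c)" if "Suc k \<le> \<rho> j" for j c
        using Suc.prems(2)[of j c] split_sum[of j c] that by simp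
      have "pivot_weight (inv \<kappa>) k (drop k xs) y = maximal_weight {j. k \<le> \<rho> j} (\<lambda>j. 0) i * pivot_weight (inv \<kappa>) (Suc k) (drop (Suc k) xs) y"
        unfolding dr using sd[of k] dr False by simp
      also have "pivot_weight (inv \<kappa>) (Suc k) (drop (Suc k) xs) y = (\<Prod>m\<in>{Suc k..<CARD('n)}. maximal_weight {j. m \<le> \<rho> j}
        (\<lambda>j. if m < CARD('d) then Lower p $ j $ (xs ! m) else 0) (xs ! m))"
        using Suc.hyps k y by (intro Suc.hyps(1)) auto
      finally show ?thesis using k False by (simp add: prod.atLeast_Suc_lessThan i_def)
    qed
  qed
  from this[of 0 "Lower p ** Reduced p"] show ?thesis
    by (simp add: bounded_weight_def matrix_matrix_mult_def lessThan_atLeast0)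
qed

lemma Lower_entry_measurable [measurable]: "(\<lambda>p. Lower p $ i $ j) \<in> borel_measurable borel"
  unfolding Lower_def by simp

lemma bounded_weight_measurable:
  assumes "\<And>k. k < CARD('n) \<Longrightarrow> \<rho> (xs ! k) = k"
  shows "bounded_weight xs \<in> borel_measurable borel"
  unfolding bounded_weight_def[abs_def] using assms
  by (intro borel_measurable_prod maximal_weight_measurable) auto

lemma bounded_weight_bounds:
  assumes "\<And>k. k < CARD('n) \<Longrightarrow> \<rho> (xs ! k) = k"
  shows "0 \<le> bounded_weight xs p" "bounded_weight xs p \<le> 1"
  unfolding bounded_weight_def using assms
  by (auto intro!: prod_nonneg prod_le_1 maximal_weight_bounds)

text \<open>In its own column of \<open>Lower p\<close> the pivot row has the entry 1, which is largest wherever the weight is nonzero.\<close>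

lemma bounded_weight_nonzeroD:
  fixes p :: "real^'d^'n"
  assumes xs: "\<And>k. k < CARD('n) \<Longrightarrow> \<rho> (xs ! k) = k" and nz: "bounded_weight xs p \<noteq> 0" and jc: "\<kappa> c < \<rho> j"
  shows "\<bar>p $ j $ c\<bar> \<le> 1"
proof -
  define k where "k = \<kappa> c"
  have k: "k < CARD('n)" "k < CARD('d)" using \<kappa>_less[of c] by (auto simp: k_def)
  have i: "xs ! k = piv c" using xs[OF k(1)] \<rho>_inj[of "xs ! k" "piv c"] by (simp add: k_def)
  have "maximal_weight {j. k \<le> \<rho> j} (\<lambda>j. if k < CARD('d) then Lower p $ j $ (xs ! k) else 0) (xs ! k) \<noteq> 0"
    using nz k(1) unfolding bounded_weight_def by (auto simp: prod_zero_iff)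
  moreover have kj: "k \<le> \<rho> j" using jc by (simp add: k_def)
  ultimately have "\<bar>Lower p $ j $ piv c\<bar> \<le> \<bar>Lower p $ piv c $ piv c\<bar>"
    using maximal_weight_nonzeroD[of "{j. k \<le> \<rho> j}" "\<lambda>j. if k < CARD('d) then Lower p $ j $ (xs ! k) else 0" "xs ! k" j]
    by (simp add: i k(2))
  moreover have "Lower p $ j $ piv c = p $ j $ c" "Lower p $ piv c $ piv c = 1"
    using jc \<kappa>_less(1)[of c] by (auto simp: Lower_def)
  ultimately show ?thesis by simp
qed

lemma Lower_cong:
  fixes p p' :: "real^'d^'n"
  assumes "\<And>j c. \<kappa> c < \<rho> j \<Longrightarrow> p $ j $ c = p' $ j $ c"
  shows "Lower p = Lower p'"
  using assms \<kappa>_col by (simp add: Lower_def vec_eq_iff)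

lemma bounded_weight_cong:
  fixes p p' :: "real^'d^'n"
  assumes "\<And>j c. \<kappa> c < \<rho> j \<Longrightarrow> p $ j $ c = p' $ j $ c"
  shows "bounded_weight xs p = bounded_weight xs p'"
proof -
  have "Lower p = Lower p'" by (rule Lower_cong[OF assms])
  then show ?thesis by (simp only: bounded_weight_def)
qed

end

section \<open>The two determinants in factored coordinates\<close>

text \<open>A permutation that never decreases the rank \<open>f\<close> is the identity.\<close>

lemma det_triangular:
  fixes A :: "real^'k::finite^'k" and f :: "'k \<Rightarrow> nat"
  assumes f: "inj f" and tri: "\<And>i j. f j < f i \<Longrightarrow> A $ i $ j = 0"
  shows "det A = (\<Prod>i\<in>UNIV. A $ i $ i)"
proof -
  have "(\<Prod>i\<in>UNIV. A $ i $ p i) = 0" if p: "p permutes UNIV" "p \<noteq> id" for p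
  proof (rule ccontr)
    assume "(\<Prod>i\<in>UNIV. A $ i $ p i) \<noteq> 0"
    then have nz: "A $ i $ p i \<noteq> 0" for i by simp
    have le: "f i \<le> f (p i)" for i using tri[of "p i" i] nz[of i] by (meson not_le)
    have "(\<Sum>i\<in>UNIV. f (p i)) = (\<Sum>i\<in>UNIV. f i)"
      using p(1) by (intro sum.reindex_bij_betw) (simp add: permutes_bij)
    then have "f (p i) = f i" for i
      using sum_mono_inv[of f UNIV "\<lambda>i. f (p i)" i] le by auto
    then have "p = id" using f by (auto simp: inj_def fun_eq_iff)
    with p(2) show False by simp
  qed
  then have "det A = (\<Sum>p\<in>{id}. of_int (sign p) * (\<Prod>i\<in>UNIV. A $ i $ p i))"
    unfolding det_def by (intro sum.mono_neutral_right) (auto simp: permutes_id)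
  then show ?thesis by (simp add: sign_id)
qed

text \<open>The block diagonal matrix of \<open>L\<close> and the identity, which turns a simultaneous change of \<open>z\<close> and \<open>y\<close> into a
congruence of the bordered matrix.\<close>

definition border_extend :: "real^'n^'n \<Rightarrow> real^('n::finite + 'd::finite)^('n + 'd)"
  where "border_extend L = (\<chi> p q. case (p, q) of
      (Inl i, Inl j) \<Rightarrow> L $ i $ j | (Inr a, Inr b) \<Rightarrow> (if a = b then 1 else 0) | _ \<Rightarrow> 0)"

lemma sum_Plus_UNIV:
  "(\<Sum>p\<in>(UNIV :: ('a::finite + 'b::finite) set). g p) = (\<Sum>i\<in>UNIV. g (Inl i)) + (\<Sum>a\<in>UNIV. g (Inr a))"
  by (simp add: UNIV_Plus_UNIV[symmetric] sum.Plus del: UNIV_Plus_UNIV)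

lemma prod_Plus_UNIV:
  "(\<Prod>p\<in>(UNIV :: ('a::finite + 'b::finite) set). g p) = (\<Prod>i\<in>UNIV. g (Inl i)) * (\<Prod>a\<in>UNIV. g (Inr a))"
  by (simp add: UNIV_Plus_UNIV[symmetric] prod.Plus del: UNIV_Plus_UNIV)

lemma bordered_simps [simp]:
  "bordered z y $ Inl i $ Inl j = z $ i $ j" "bordered z y $ Inl i $ Inr b = y $ i $ b"
  "bordered z y $ Inr a $ Inl j = y $ j $ a" "bordered z y $ Inr a $ Inr b = 0"
  by (simp_all add: bordered_def transpose_def)

lemma border_extend_simps [simp]:
  "border_extend L $ Inl i $ Inl j = L $ i $ j" "border_extend L $ Inl i $ Inr b = 0"
  "border_extend L $ Inr a $ Inl j = 0" "border_extend L $ Inr a $ Inr b = (if a = b then 1 else 0)"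
  by (simp_all add: border_extend_def)

lemma bordered_congruence:
  "bordered (L ** z ** transpose L) (L ** y) = border_extend L ** bordered z y ** transpose (border_extend L)"
proof -
  have "bordered (L ** z ** transpose L) (L ** y) $ p $ q = (border_extend L ** bordered z y ** transpose (border_extend L)) $ p $ q" for p q
    by (cases p; cases q)
      (simp_all add: matrix_matrix_mult_def transpose_def sum_Plus_UNIV if_distrib if_distribR sum_distrib_right mult.commute cong: if_cong)
  then show ?thesis by (simp add: vec_eq_iff)
qed

context elimination_order
begin

lemma det_unit_lower: "unit_lower L \<Longrightarrow> det L = 1"
proof -
  assume L: "unit_lower L"
  have "inj (\<lambda>i. CARD('n) - \<rho> i)"
  proof (rule injI)
    fix i j assume "CARD('n) - \<rho> i = CARD('n) - \<rho> j"
    then have "\<rho> i = \<rho> j" using \<rho>_less[of i] \<rho>_less[of j] by linarith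
    then show "i = j" by (simp add: \<rho>_inj)
  qed
  then have "det L = (\<Prod>i\<in>UNIV. L $ i $ i)"
    by (rule det_triangular) (use L in \<open>auto simp: unit_lower_def\<close>)
  then show ?thesis using L by (simp add: unit_lower_def)
qed

lemma det_border_extend: "unit_lower L \<Longrightarrow> det (border_extend L :: real^('n + 'd)^('n + 'd)) = 1"
proof -
  assume L: "unit_lower L"
  define f :: "'n + 'd \<Rightarrow> nat" where "f p = (case p of Inl i \<Rightarrow> CARD('n) - \<rho> i | Inr a \<Rightarrow> CARD('n) + 1 + \<kappa> a)" for p
  have "inj f"
  proof (rule injI)
    fix p q assume eq: "f p = f q"
    show "p = q"
    proof (cases p; cases q)
      fix i j assume pq: "p = Inl i" "q = Inl j"
      then have "\<rho> i = \<rho> j" using eq \<rho>_less[of i] \<rho>_less[of j] unfolding f_def by simp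
      then show ?thesis using pq by (simp add: \<rho>_inj)
    qed (use eq in \<open>auto simp: f_def \<kappa>_inj\<close>)
  qed
  then have "det (border_extend L :: real^('n + 'd)^('n + 'd)) = (\<Prod>p\<in>UNIV. (border_extend L :: real^('n + 'd)^('n + 'd)) $ p $ p)"
  proof (rule det_triangular)
    fix p q assume "f q < f p"
    then show "(border_extend L :: real^('n + 'd)^('n + 'd)) $ p $ q = 0"
      using L by (cases p; cases q) (auto simp: f_def unit_lower_def)
  qed
  then show ?thesis using L by (simp add: prod_Plus_UNIV unit_lower_def)
qed

definition swap_pivots :: "'d set \<Rightarrow> 'n + 'd \<Rightarrow> 'n + 'd"
  where "swap_pivots C p = (case p of
    Inl j \<Rightarrow> if \<rho> j < CARD('d) \<and> col j \<in> C then Inr (col j) else Inl j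
  | Inr c \<Rightarrow> if c \<in> C then Inl (piv c) else Inr c)"

lemma piv_col: "\<rho> j < CARD('d) \<Longrightarrow> piv (col j) = j"
  using \<rho>_inj[of "piv (col j)" j] by (simp add: \<kappa>_col)

lemma swap_pivots_invol: "swap_pivots C (swap_pivots C p) = p"
  by (cases p) (auto simp: swap_pivots_def piv_col \<kappa>_less)

lemma swap_pivots_permutes: "swap_pivots C permutes UNIV"
  by (rule bij_imp_permutes) (auto intro!: involuntory_imp_bij swap_pivots_invol)

lemma sign_swap_pivots: "sign (swap_pivots C) = (-1) ^ card C"
  using finite[of C]
proof (induction C rule: finite_induct)
  case empty
  have "swap_pivots {} = id" by (auto simp: swap_pivots_def fun_eq_iff split: sum.split)
  then show ?case by (simp add: sign_id)
next
  case (insert c C)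
  have eq: "swap_pivots (insert c C) = Transposition.transpose (Inl (piv c)) (Inr c) \<circ> swap_pivots C"
  proof
    fix p
    show "swap_pivots (insert c C) p = (Transposition.transpose (Inl (piv c)) (Inr c) \<circ> swap_pivots C) p"
    proof (cases p)
      case (Inl j)
      then show ?thesis
        using insert.hyps \<kappa>_less(1)[of c] piv_col[of j]
        by (auto simp: swap_pivots_def Transposition.transpose_def)
    next
      case (Inr a)
      then show ?thesis
        using insert.hyps \<rho>_inj[of "piv a" "piv c"] \<kappa>_inj[of a c]
        by (auto simp: swap_pivots_def Transposition.transpose_def)
    qed
  qed
  have p1: "permutation (swap_pivots C)"
    unfolding permutation_permutes using swap_pivots_permutes[of C] finite by blast
  have p2: "permutation (Transposition.transpose (Inl (piv c)) (Inr c) :: 'n + 'd \<Rightarrow> _)"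
    by (rule permutation_swap_id)
  have "sign (swap_pivots (insert c C)) = sign (Transposition.transpose (Inl (piv c)) (Inr c) :: 'n + 'd \<Rightarrow> _) * sign (swap_pivots C)"
    unfolding eq by (rule sign_compose[OF p2 p1])
  then show ?case using insert by (simp add: sign_swap_id)
qed

text \<open>Exchanging, for each column \<open>c\<close> of \<open>R\<close>, the columns \<open>Inl (piv c)\<close> and \<open>Inr c\<close> of the bordered matrix accounts for
the sign, and leaves a product of two matrices that are triangular for suitable orders of the indices. The first
one carries the pivots twice, and each of the two carries the remaining diagonal of \<open>U\<close> once.\<close>

lemma det_bordered_factored:
  assumes U: "\<And>i j. \<rho> j < \<rho> i \<Longrightarrow> U $ i $ j = 0" and R: "\<And>i c. \<kappa> c < \<rho> i \<Longrightarrow> (R :: real^'d^'n) $ i $ c = 0"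
  shows "(-1) ^ CARD('d) * det (bordered (U ** transpose U) R) =
    (\<Prod>c\<in>UNIV. (R $ piv c $ c)\<^sup>2) * (\<Prod>j | CARD('d) \<le> \<rho> j. (U $ j $ j)\<^sup>2)"
proof -
  define B where "B = bordered (U ** transpose U) R"
  define X :: "real^('n + 'd)^('n + 'd)" where "X = (\<chi> p q. case (p, q) of
      (Inl i, Inl j) \<Rightarrow> (if \<rho> j < CARD('d) then R $ i $ col j else U $ i $ j)
    | (Inl i, Inr c) \<Rightarrow> (U ** transpose U) $ i $ piv c
    | (Inr a, Inl j) \<Rightarrow> 0
    | (Inr a, Inr c) \<Rightarrow> R $ piv c $ a)"
  define Y :: "real^('n + 'd)^('n + 'd)" where "Y = (\<chi> p q. case (p, q) of
      (Inl k, Inl j) \<Rightarrow> (if CARD('d) \<le> \<rho> j \<and> CARD('d) \<le> \<rho> k then U $ j $ k else if k = j then 1 else 0)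
    | (Inr a, Inr c) \<Rightarrow> (if a = c then 1 else 0)
    | _ \<Rightarrow> 0)"
  have X[simp]: "X $ Inl i $ Inl j = (if \<rho> j < CARD('d) then R $ i $ col j else U $ i $ j)"
    "X $ Inl i $ Inr c = (U ** transpose U) $ i $ piv c" "X $ Inr a $ Inl j = 0" "X $ Inr a $ Inr c = R $ piv c $ a" for i j a c
    by (simp_all add: X_def)
  have Y[simp]: "Y $ Inl k $ Inl j = (if CARD('d) \<le> \<rho> j \<and> CARD('d) \<le> \<rho> k then U $ j $ k else if k = j then 1 else 0)"
    "Y $ Inl k $ Inr c = 0" "Y $ Inr a $ Inl j = 0" "Y $ Inr a $ Inr c = (if a = c then 1 else 0)" for k j a c
    by (simp_all add: Y_def)
  have R0: "R $ i $ c = 0" if "CARD('d) \<le> \<rho> i" for i c using R[of c i] \<kappa>_less(1)[of c] that by simp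
  have Ysum: "(\<Sum>k\<in>UNIV. g k * Y $ Inl k $ Inl j) = (if \<rho> j < CARD('d) then g j else (\<Sum>k | CARD('d) \<le> \<rho> k. g k * U $ j $ k))" for g j
  proof (cases "\<rho> j < CARD('d)")
    case True
    then have "(\<Sum>k\<in>UNIV. g k * Y $ Inl k $ Inl j) = (\<Sum>k\<in>UNIV. if k = j then g j else 0)"
      by (intro sum.cong) auto
    then show ?thesis using True by simp
  next
    case False
    then have "(\<Sum>k\<in>UNIV. g k * Y $ Inl k $ Inl j) = (\<Sum>k\<in>UNIV. if CARD('d) \<le> \<rho> k then g k * U $ j $ k else 0)"
      by (intro sum.cong) auto
    then show ?thesis using False by (simp add: sum.If_cases)
  qed
  have UU: "(U ** transpose U) $ i $ j = (\<Sum>k | CARD('d) \<le> \<rho> k. U $ i $ k * U $ j $ k)" if "CARD('d) \<le> \<rho> j" for i j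
  proof -
    have "(U ** transpose U) $ i $ j = (\<Sum>k\<in>UNIV. U $ i $ k * U $ j $ k)"
      by (simp add: matrix_matrix_mult_def transpose_def)
    also have "\<dots> = (\<Sum>k | CARD('d) \<le> \<rho> k. U $ i $ k * U $ j $ k)"
      using U that by (intro sum.mono_neutral_right) (auto simp: not_le)
    finally show ?thesis .
  qed
  have "(\<chi> p q. B $ p $ swap_pivots UNIV q) = X ** Y"
  proof -
    have "B $ p $ swap_pivots UNIV q = (X ** Y) $ p $ q" for p q
    proof (cases q)
      case (Inl j)
      have "(X ** Y) $ p $ q = (\<Sum>k\<in>UNIV. X $ p $ Inl k * Y $ Inl k $ Inl j)"
        by (simp add: matrix_matrix_mult_def sum_Plus_UNIV Inl del: X Y(1))
      also have "\<dots> = B $ p $ swap_pivots UNIV q"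
        unfolding Ysum
        by (cases p) (auto simp: B_def Inl swap_pivots_def UU R0 not_less intro!: sum.cong)
      finally show ?thesis by simp
    next
      case (Inr c)
      have "(X ** Y) $ p $ q = X $ p $ Inr c"
        by (simp add: matrix_matrix_mult_def sum_Plus_UNIV Inr if_distrib cong: if_cong del: X)
      then show ?thesis by (cases p) (simp_all add: B_def Inr swap_pivots_def)
    qed
    then show ?thesis by (simp add: vec_eq_iff)
  qed
  then have "det X * det Y = of_int (sign (swap_pivots (UNIV :: 'd set))) * det B"
    using det_permute_columns[OF swap_pivots_permutes, of B UNIV] by (simp add: det_mul)
  also have "\<dots> = (-1) ^ CARD('d) * det B" by (simp add: sign_swap_pivots)
  finally have XY: "(-1) ^ CARD('d) * det B = det X * det Y" by simp
  have split: "(\<Prod>j\<in>UNIV. if \<rho> j < CARD('d) then g j else g' j) = (\<Prod>c\<in>UNIV. g (piv c)) * (\<Prod>j | CARD('d) \<le> \<rho> j. g' j)" for g g' :: "'n \<Rightarrow> real"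
  proof -
    have "bij_betw piv UNIV {j. \<rho> j < CARD('d)}"
      by (rule bij_betw_byWitness[where f' = col]) (auto simp: piv_col \<kappa>_less)
    then have "(\<Prod>c\<in>UNIV. g (piv c)) = (\<Prod>j | \<rho> j < CARD('d). g j)" by (rule prod.reindex_bij_betw)
    then show ?thesis by (simp add: prod.If_cases not_less Collect_neg_eq[symmetric])
  qed
  have dX: "det X = (\<Prod>c\<in>UNIV. R $ piv c $ c) * (\<Prod>j | CARD('d) \<le> \<rho> j. U $ j $ j) * (\<Prod>c\<in>UNIV. R $ piv c $ c)"
  proof -
    \<comment> \<open>the lower right block of \<open>X\<close> is lower triangular, hence the reversed order on its indices\<close>
    define f :: "'n + 'd \<Rightarrow> nat" where "f p = (case p of Inl i \<Rightarrow> \<rho> i | Inr a \<Rightarrow> CARD('n) + (CARD('d) - \<kappa> a))" for p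
    have "inj f"
    proof (rule injI)
      fix p q assume eq: "f p = f q"
      show "p = q"
      proof (cases p; cases q)
        fix a b assume pq: "p = Inr a" "q = Inr b"
        then have "\<kappa> a = \<kappa> b" using eq \<kappa>_less(1)[of a] \<kappa>_less(1)[of b] unfolding f_def by simp
        then show ?thesis using pq by (simp add: \<kappa>_inj)
      next
        fix i b assume "p = Inl i" "q = Inr b"
        then show ?thesis using eq \<rho>_less[of i] by (simp add: f_def)
      next
        fix i b assume "p = Inr b" "q = Inl i"
        then show ?thesis using eq \<rho>_less[of i] by (simp add: f_def)
      qed (use eq in \<open>auto simp: f_def \<rho>_inj\<close>)
    qed
    then have "det X = (\<Prod>p\<in>UNIV. X $ p $ p)"
    proof (rule det_triangular)
      fix p q assume lt: "f q < f p"
      show "X $ p $ q = 0"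
      proof (cases p; cases q)
        fix i j assume pq: "p = Inl i" "q = Inl j"
        then have "\<rho> j < \<rho> i" using lt by (simp add: f_def)
        then show ?thesis using pq U R[of "col j" i] by (simp add: \<kappa>_col)
      next
        fix i b assume "p = Inl i" "q = Inr b"
        then show ?thesis using lt \<rho>_less[of i] by (simp add: f_def)
      next
        fix a c assume pq: "p = Inr a" "q = Inr c"
        then have "\<kappa> a < \<kappa> c" using lt \<kappa>_less(1)[of a] \<kappa>_less(1)[of c] by (simp add: f_def) 
        then show ?thesis using pq R[of a "piv c"] by simp
      qed simp
    qed
    also have "\<dots> = (\<Prod>j\<in>UNIV. if \<rho> j < CARD('d) then R $ j $ col j else U $ j $ j) * (\<Prod>c\<in>UNIV. R $ piv c $ c)"
      by (simp add: prod_Plus_UNIV)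
    finally show ?thesis by (simp add: split)
  qed
  have dY: "det Y = (\<Prod>j | CARD('d) \<le> \<rho> j. U $ j $ j)"
  proof -
    define f :: "'n + 'd \<Rightarrow> nat" where "f p = (case p of Inl i \<Rightarrow> CARD('n) - \<rho> i | Inr a \<Rightarrow> CARD('n) + 1 + \<kappa> a)" for p
    have "inj f"
    proof (rule injI)
      fix p q assume eq: "f p = f q"
      show "p = q"
      proof (cases p; cases q)
        fix i j assume pq: "p = Inl i" "q = Inl j"
        then have "\<rho> i = \<rho> j" using eq \<rho>_less[of i] \<rho>_less[of j] unfolding f_def by simp
        then show ?thesis using pq by (simp add: \<rho>_inj)
      qed (use eq in \<open>auto simp: f_def \<kappa>_inj\<close>)
    qed
    then have "det Y = (\<Prod>p\<in>UNIV. Y $ p $ p)"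
    proof (rule det_triangular)
      fix p q assume lt: "f q < f p"
      then show "Y $ p $ q = 0"
        by (cases p; cases q) (auto simp: f_def U)
    qed
    also have "\<dots> = (\<Prod>j\<in>UNIV. if \<rho> j < CARD('d) then 1 else U $ j $ j)"
      by (simp add: prod_Plus_UNIV) (auto intro!: prod.cong)
    finally show ?thesis by (simp add: split)
  qed
  show ?thesis
    unfolding B_def[symmetric] XY dX dY by (simp add: prod_power_distrib[symmetric] power2_eq_square prod.distrib)
qed

definition chart :: "'n symmat \<times> (real^'d^'n) \<Rightarrow> 'n symmat \<times> (real^'d^'n)"
  where "chart x = (congruence (Lower (snd x)) (gram (upper_part (fst x))), Lower (snd x) ** Reduced (snd x))"

lemma P2_chart: "P2 (chart x) = (\<Prod>c\<in>UNIV. (snd x $ piv c $ c)\<^sup>2) * (\<Prod>j | CARD('d) \<le> \<rho> j. (mat_of_sym (fst x) $ j $ j)\<^sup>2)"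
proof -
  obtain u p where x: "x = (u, p)" by fastforce
  have "P2 (chart x) = (-1) ^ CARD('d) * det (bordered (upper_part u ** transpose (upper_part u)) (Reduced p))"
    using det_border_extend[OF unit_lower_Lower, of p]
    by (simp add: P2_def chart_def x congruence.rep_eq gram.rep_eq bordered_congruence det_mul)
  also have "\<dots> = (\<Prod>c\<in>UNIV. (Reduced p $ piv c $ c)\<^sup>2) * (\<Prod>j | CARD('d) \<le> \<rho> j. (upper_part u $ j $ j)\<^sup>2)"
    by (rule det_bordered_factored) (auto simp: upper_part_def Reduced_def)
  finally show ?thesis by (simp add: x Reduced_def upper_part_def)
qed

lemma P1_chart: "P1 (chart x) = (\<Prod>j\<in>UNIV. (mat_of_sym (fst x) $ j $ j)\<^sup>2)"
proof -
  have "det (upper_part u) = (\<Prod>j\<in>UNIV. upper_part u $ j $ j)" for u :: "'n symmat"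
    using \<rho>_inj by (intro det_triangular[of \<rho>]) (auto simp: inj_def upper_part_def)
  then have "det (upper_part u) = (\<Prod>j\<in>UNIV. mat_of_sym u $ j $ j)" for u :: "'n symmat"
    by (simp add: upper_part_def)
  then show ?thesis
    using det_unit_lower[OF unit_lower_Lower, of "snd x"]
    by (simp add: P1_def chart_def congruence.rep_eq gram.rep_eq det_mul power2_eq_square prod.distrib)
qed

text \<open>The quadratic form of the congruent matrix at \<open>x\<close> is that of \<open>z\<close> at \<open>L\<^sup>T x\<close>.\<close>

lemma pos_definite_congruence:
  assumes "unit_lower L"
  shows "pos_definite (congruence L z) \<longleftrightarrow> pos_definite z"
proof -
  have q: "x \<bullet> (mat_of_sym (congruence L z) *v x) = (transpose L *v x) \<bullet> (mat_of_sym z *v (transpose L *v x))" for x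
  proof -
    have "x \<bullet> (mat_of_sym (congruence L z) *v x) = x \<bullet> (L *v (mat_of_sym z *v (transpose L *v x)))"
      by (simp only: congruence.rep_eq matrix_vector_mul_assoc matrix_mul_assoc)
    also have "\<dots> = (transpose L *v x) \<bullet> (mat_of_sym z *v (transpose L *v x))"
      by (metis dot_lmul_matrix transpose_matrix_vector transpose_transpose)
    finally show ?thesis .
  qed
  have inv: "invertible (transpose L)"
    using det_unit_lower[OF assms] by (simp add: invertible_det_nz det_transpose)
  then have bij: "bij ((*v) (transpose L))" by (simp add: invertible_eq_bij)
  show ?thesis
  proof
    assume pd: "pos_definite (congruence L z)"
    show "pos_definite z" unfolding pos_definite_def
    proof (intro allI impI)
      fix x :: "real^'n" assume x: "x \<noteq> 0"
      obtain w where w: "x = transpose L *v w" using bij by (metis bij_pointE)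
      have "w \<noteq> 0" using x w by auto
      then show "0 < x \<bullet> (mat_of_sym z *v x)" using pd unfolding pos_definite_def q w by blast
    qed
  next
    assume pd: "pos_definite z"
    show "pos_definite (congruence L z)" unfolding pos_definite_def q
    proof (intro allI impI)
      fix x :: "real^'n" assume x: "x \<noteq> 0"
      have "transpose L *v x \<noteq> 0"
        using bij x by (metis bij_pointE matrix_vector_mult_0_right)
      then show "0 < (transpose L *v x) \<bullet> (mat_of_sym z *v (transpose L *v x))" using pd unfolding pos_definite_def by blast
    qed
  qed
qed

end

text \<open>A kernel vector of \<open>y\<close>, extended by 0, is a kernel vector of the bordered matrix.\<close>

lemma P2_eq_0_if_rank_deficient:
  fixes y :: "real^'d::finite^'n::finite"
  assumes "rank y \<noteq> CARD('d)"
  shows "P2 (z, y) = 0"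
proof -
  have "\<not> inj ((*v) y)" using assms full_rank_injective[of y] by simp
  then obtain v where v: "v \<noteq> 0" "y *v v = 0"
    using linear_injective_0[OF matrix_vector_mul_linear, of y] by auto
  define w :: "real^('n + 'd)" where "w = (\<chi> p. case p of Inl i \<Rightarrow> 0 | Inr c \<Rightarrow> v $ c)"
  have "w \<noteq> 0" using v(1) by (auto simp: w_def vec_eq_iff split: sum.splits)
  moreover have "bordered (mat_of_sym z) y *v w = 0"
  proof -
    have yv: "(\<Sum>c\<in>UNIV. y $ i $ c * v $ c) = 0" for i
      using v(2) by (simp add: matrix_vector_mult_def vec_eq_iff)
    have "(bordered (mat_of_sym z) y *v w) $ p = 0" for p
      by (cases p) (simp_all add: matrix_vector_mult_def sum_Plus_UNIV w_def yv)
    then show ?thesis by (simp add: vec_eq_iff)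
  qed
  ultimately have "\<not> invertible (bordered (mat_of_sym z) y)"
    unfolding invertible_left_inverse matrix_left_invertible_ker by blast
  then show ?thesis by (simp add: P2_def invertible_det_nz)
qed

section \<open>Charts of the enhanced cone\<close>

lemma bounded_linear_sym_entry: "bounded_linear (\<lambda>x::'n::finite symmat \<times> 'b::real_normed_vector. mat_of_sym (fst x) $ i $ j)"
  unfolding inner_sym_unit[symmetric]
  by (intro bounded_linear_compose[OF bounded_linear_inner_left bounded_linear_fst])

lemma bounded_linear_mat_entry: "bounded_linear (\<lambda>x::'a::real_normed_vector \<times> (real^'d::finite^'n::finite). snd x $ i $ c)"
  by (intro bounded_linear_compose[OF bounded_linear_vec_nth] bounded_linear_snd bounded_linear_compose[OF bounded_linear_vec_nth bounded_linear_snd])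

context elimination_order
begin

lemma polynomial_Lower: "real_polynomial_function (\<lambda>x::'n symmat \<times> (real^'d^'n). Lower (snd x) $ i $ j)"
proof -
  have "(\<lambda>x::'n symmat \<times> (real^'d^'n). Lower (snd x) $ i $ j) =
      (if i = j then (\<lambda>x. 1) else if \<rho> j < \<rho> i \<and> \<rho> j < CARD('d) then (\<lambda>x. snd x $ i $ col j) else (\<lambda>x. 0))"
    by (auto simp: Lower_def fun_eq_iff)
  then show ?thesis
    using bounded_linear_mat_entry by (auto intro: real_polynomial_function.intros(1,2))
qed

lemma polynomial_Reduced: "real_polynomial_function (\<lambda>x::'n symmat \<times> (real^'d^'n). Reduced (snd x) $ i $ c)"
proof -
  have "(\<lambda>x::'n symmat \<times> (real^'d^'n). Reduced (snd x) $ i $ c) =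
      (if \<rho> i \<le> \<kappa> c then (\<lambda>x. snd x $ i $ c) else (\<lambda>x. 0))"
    by (auto simp: Reduced_def fun_eq_iff)
  then show ?thesis
    using bounded_linear_mat_entry by (auto intro: real_polynomial_function.intros(1,2))
qed

lemma polynomial_upper_part: "real_polynomial_function (\<lambda>x::'n symmat \<times> (real^'d^'n). upper_part (fst x) $ i $ j)"
proof -
  have "(\<lambda>x::'n symmat \<times> (real^'d^'n). upper_part (fst x) $ i $ j) =
      (if \<rho> i \<le> \<rho> j then (\<lambda>x. mat_of_sym (fst x) $ i $ j) else (\<lambda>x. 0))"
    by (auto simp: upper_part_def fun_eq_iff)
  then show ?thesis
    using bounded_linear_sym_entry by (auto intro: real_polynomial_function.intros(1,2))
qed

lemma polynomial_chart:
  assumes "b \<in> Basis"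
  shows "real_polynomial_function (\<lambda>x. chart x \<bullet> b)"
proof -
  have b: "b \<in> (\<lambda>u. (u, 0)) ` Basis \<or> b \<in> (\<lambda>v. (0, v)) ` Basis" using assms by (simp add: Basis_prod_def)
  from b show ?thesis
  proof
    assume "b \<in> (\<lambda>u. (u, 0)) ` Basis"
    then obtain i j where bb: "b = (sym_unit i j, 0)" by (auto simp: Basis_symmat_def)
    have "(\<lambda>x. chart x \<bullet> b) = (\<lambda>x. \<Sum>k\<in>UNIV. \<Sum>l\<in>UNIV. Lower (snd x) $ i $ k * Lower (snd x) $ j $ l *
        (\<Sum>m\<in>UNIV. upper_part (fst x) $ k $ m * upper_part (fst x) $ l $ m))"
      by (simp add: bb chart_def inner_sym_unit congruence_entry gram_entry)
    then show ?thesis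
      by (auto intro!: real_polynomial_function_sum real_polynomial_function.intros(4) polynomial_Lower polynomial_upper_part)
  next
    assume "b \<in> (\<lambda>v. (0, v)) ` Basis"
    then obtain v where v: "v \<in> Basis" "b = (0, v)" by blast
    have "v \<in> range (\<lambda>(i, c). axis i (axis c 1) :: real^'d^'n)"
      using matrix_basis_bij[where 'd = 'd and 'n = 'n] v(1) by (simp add: bij_betw_def)
    then obtain i c where bb: "b = (0, axis i (axis c 1))" using v(2) by auto
    have "(\<lambda>x. chart x \<bullet> b) = (\<lambda>x. \<Sum>k\<in>UNIV. Lower (snd x) $ i $ k * Reduced (snd x) $ k $ c)"
      by (simp add: bb chart_def matrix_inner_basis matrix_matrix_mult_def)
    then show ?thesis
      by (auto intro!: real_polynomial_function_sum real_polynomial_function.intros(4) polynomial_Lower polynomial_Reduced)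
  qed
qed

lemma chart_measurable [measurable]: "chart \<in> borel_measurable borel"
proof -
  have ci: "continuous_on UNIV (\<lambda>x. chart x \<bullet> b)" if "b \<in> Basis" for b
    using polynomial_chart[OF that] continuous_on_polymonial_function real_polynomial_function_eq by blast
  have "continuous_on UNIV (\<lambda>x. \<Sum>b\<in>Basis. (chart x \<bullet> b) *\<^sub>R b)"
    by (intro continuous_on_sum continuous_on_scaleR continuous_on_const) (use ci in auto)
  then show ?thesis by (simp add: euclidean_representation borel_measurable_continuous_onI)
qed

text \<open>Multipliers of absolute value at most 1 make forward substitution stable: solving \<open>y = L R\<close> for \<open>R\<close> and
\<open>z = L U U\<^sup>T L\<^sup>T\<close> for \<open>U U\<^sup>T\<close> loses at most a factor \<open>1 + n\<close> for each row passed in the first case, and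
\<open>(1 + n)\<^sup>2\<close> for each row or column passed in the second. The squares of the entries of \<open>U\<close> are bounded by the diagonal of \<open>U U\<^sup>T\<close>.\<close>

lemma chart_growth:
  fixes p :: "real^'d^'n"
  assumes bnd: "\<And>j c. \<kappa> c < \<rho> j \<Longrightarrow> \<bar>p $ j $ c\<bar> \<le> 1" and b: "b \<in> Basis"
  shows "\<bar>(u, p) \<bullet> b\<bar> \<le> (1 + real CARD('n)) ^ (4 * CARD('n)) * (1 + norm (chart (u, p)))"
proof -
  define n where "n = real CARD('n)"
  define B where "B = 1 + norm (chart (u, p))"
  have B1: "B \<ge> 1" by (simp add: B_def)
  have n1: "1 + n \<ge> 1" by (simp add: n_def)
  have L1: "\<bar>Lower p $ i $ j\<bar> \<le> 1" for i j
    using bnd[of "col j" i] by (auto simp: Lower_def \<kappa>_col)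
  have small: "(1 + n) ^ k * B \<le> (1 + n) ^ (4 * CARD('n)) * B" if "k \<le> 4 * CARD('n)" for k
    using that n1 B1 by (intro mult_right_mono power_increasing) auto
  \<comment> \<open>the factor of \<open>y\<close>: forward substitution\<close>
  have yB: "\<bar>(Lower p ** Reduced p) $ i $ c\<bar> \<le> B" for i c
  proof -
    have "\<bar>chart (u, p) \<bullet> (0, axis i (axis c 1))\<bar> \<le> norm (chart (u, p)) * norm (0 :: 'n symmat, axis i (axis c 1) :: real^'d^'n)"
      by (rule Cauchy_Schwarz_ineq2)
    moreover have "norm (axis i (axis c 1) :: real^'d^'n) = 1" by (simp add: axis_in_Basis_iff)
    ultimately show ?thesis by (simp add: chart_def matrix_inner_basis norm_Pair B_def)
  qed
  have pB: "\<bar>p $ i $ c\<bar> \<le> (1 + n) ^ \<rho> i * B" if "\<rho> i \<le> \<kappa> c" for i c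
    using that
  proof (induction "\<rho> i" arbitrary: i rule: less_induct)
    case (less i)
    have m: "min (\<rho> i) (\<kappa> c) = \<rho> i" using less.prems by simp
    have "\<bar>\<Sum>j | \<rho> j < \<rho> i. p $ i $ col j * p $ j $ c\<bar> \<le> (\<Sum>j | \<rho> j < \<rho> i. \<bar>p $ i $ col j * p $ j $ c\<bar>)"
      by (rule sum_abs)
    also have "\<dots> \<le> (\<Sum>j | \<rho> j < \<rho> i. (1 + n) ^ (\<rho> i - 1) * B)"
    proof (rule sum_mono)
      fix j assume "j \<in> {j. \<rho> j < \<rho> i}"
      then have j: "\<rho> j < \<rho> i" by simp
      then have "\<rho> j < CARD('d)" using less.prems \<kappa>_less(1)[of c] by simp
      then have "\<bar>p $ i $ col j\<bar> \<le> 1" using bnd[of "col j" i] j by (simp add: \<kappa>_col)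
      moreover have "\<bar>p $ j $ c\<bar> \<le> (1 + n) ^ \<rho> j * B" using less.hyps[OF j] j less.prems by simp
      moreover have "(1 + n) ^ \<rho> j * B \<le> (1 + n) ^ (\<rho> i - 1) * B"
        using j n1 B1 by (intro mult_right_mono power_increasing) auto
      ultimately show "\<bar>p $ i $ col j * p $ j $ c\<bar> \<le> (1 + n) ^ (\<rho> i - 1) * B"
        unfolding abs_mult using mult_mono[of "\<bar>p $ i $ col j\<bar>" 1 "\<bar>p $ j $ c\<bar>" "(1 + n) ^ (\<rho> i - 1) * B"] by simp
    qed
    also have "\<dots> = real (card {j. \<rho> j < \<rho> i}) * ((1 + n) ^ (\<rho> i - 1) * B)" by simp
    also have "real (card {j. \<rho> j < \<rho> i}) * ((1 + n) ^ (\<rho> i - 1) * B) \<le> n * ((1 + n) ^ (\<rho> i - 1) * B) * of_bool (0 < \<rho> i)"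
    proof (cases "0 < \<rho> i")
      case True
      have "card {j. \<rho> j < \<rho> i} \<le> CARD('n)" by (intro card_mono) auto
      then show ?thesis using True n1 B1 by (simp add: n_def mult_right_mono)
    qed simp
    finally have s: "\<bar>\<Sum>j | \<rho> j < \<rho> i. p $ i $ col j * p $ j $ c\<bar> \<le> n * ((1 + n) ^ (\<rho> i - 1) * B) * of_bool (0 < \<rho> i)" .
    have "p $ i $ c = (Lower p ** Reduced p) $ i $ c - (\<Sum>j | \<rho> j < \<rho> i. p $ i $ col j * p $ j $ c)"
      using less.prems by (simp only: Lower_Reduced_entry m if_True)
    then have "\<bar>p $ i $ c\<bar> \<le> B + n * ((1 + n) ^ (\<rho> i - 1) * B) * of_bool (0 < \<rho> i)"
      using yB[of i c] s by linarith
    also have "\<dots> \<le> (1 + n) ^ \<rho> i * B"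
    proof (cases "\<rho> i")
      case (Suc k)
      have "1 * B \<le> (1 + n) ^ k * B" using n1 B1 by (intro mult_right_mono one_le_power) auto
      then show ?thesis using Suc by (simp add: algebra_simps)
    qed simp
    finally show ?case .
  qed
  \<comment> \<open>the Gram matrix: undoing the unipotent congruence\<close>
  define Z where "Z i j = mat_of_sym (gram (upper_part u)) $ i $ j" for i j
  have zB: "\<bar>mat_of_sym (congruence (Lower p) (gram (upper_part u))) $ i $ j\<bar> \<le> B" for i j
  proof -
    have nu: "norm (sym_unit i j :: 'n symmat) = 1"
      by (rule norm_Basis) (auto simp: Basis_symmat_def)
    have "\<bar>chart (u, p) \<bullet> (sym_unit i j, 0)\<bar> \<le> norm (chart (u, p)) * norm (sym_unit i j :: 'n symmat, 0 :: real^'d^'n)"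
      by (rule Cauchy_Schwarz_ineq2)
    then show ?thesis by (simp add: chart_def inner_sym_unit norm_Pair nu B_def)
  qed
  have ZB: "\<bar>Z i j\<bar> \<le> (1 + n) ^ (2 * (\<rho> i + \<rho> j)) * B" for i j
  proof (induction "\<rho> i + \<rho> j" arbitrary: i j rule: less_induct)
    case (less i j)
    define m where "m = \<rho> i + \<rho> j"
    have tm: "\<bar>Lower p $ i $ fst q * Lower p $ j $ snd q * Z (fst q) (snd q)\<bar> \<le> (1 + n) ^ (2 * (m - 1)) * B * of_bool (0 < m)"
      if q: "q \<noteq> (i, j)" for q
    proof (cases "\<rho> (fst q) \<le> \<rho> i \<and> \<rho> (snd q) \<le> \<rho> j")
      case True
      then have lt: "\<rho> (fst q) + \<rho> (snd q) < m" using q \<rho>_inj[of "fst q" i] \<rho>_inj[of "snd q" j]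
        unfolding m_def by (cases q) fastforce
      have "\<bar>Z (fst q) (snd q)\<bar> \<le> (1 + n) ^ (2 * (\<rho> (fst q) + \<rho> (snd q))) * B"
        using less.hyps[of "fst q" "snd q"] lt unfolding m_def by blast
      also have "\<dots> \<le> (1 + n) ^ (2 * (m - 1)) * B"
        using lt n1 B1 by (intro mult_right_mono power_increasing) auto
      finally have z: "\<bar>Z (fst q) (snd q)\<bar> \<le> (1 + n) ^ (2 * (m - 1)) * B" .
      have "\<bar>Lower p $ i $ fst q * Lower p $ j $ snd q\<bar> \<le> 1 * 1"
        unfolding abs_mult by (intro mult_mono L1) auto
      then have "\<bar>Lower p $ i $ fst q * Lower p $ j $ snd q * Z (fst q) (snd q)\<bar> \<le> 1 * ((1 + n) ^ (2 * (m - 1)) * B)"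
        unfolding abs_mult[of "_ * _"] using z by (intro mult_mono) auto
      then show ?thesis using lt by simp
    next
      case False
      then have "Lower p $ i $ fst q * Lower p $ j $ snd q = 0"
        using unit_lower_Lower[of p] by (auto simp: unit_lower_def not_le)
      then have 0: "\<bar>Lower p $ i $ fst q * Lower p $ j $ snd q * Z (fst q) (snd q)\<bar> = 0"
        by (simp only: mult_zero_left abs_zero)
      show ?thesis unfolding 0 using n1 B1 by simp
    qed
    have "mat_of_sym (congruence (Lower p) (gram (upper_part u))) $ i $ j = (\<Sum>q\<in>UNIV. Lower p $ i $ fst q * Lower p $ j $ snd q * Z (fst q) (snd q))"
      unfolding congruence_entry Z_def sum.cartesian_product UNIV_Times_UNIV by (simp add: case_prod_unfold)
    also have "\<dots> = Z i j + (\<Sum>q\<in>UNIV - {(i, j)}. Lower p $ i $ fst q * Lower p $ j $ snd q * Z (fst q) (snd q))"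
      by (subst sum.remove[of _ "(i, j)"]) (auto simp: Lower_def)
    finally have "\<bar>Z i j\<bar> \<le> B + \<bar>\<Sum>q\<in>UNIV - {(i, j)}. Lower p $ i $ fst q * Lower p $ j $ snd q * Z (fst q) (snd q)\<bar>"
      using zB[of i j] by linarith
    also have "\<bar>\<Sum>q\<in>UNIV - {(i, j)}. Lower p $ i $ fst q * Lower p $ j $ snd q * Z (fst q) (snd q)\<bar> \<le>
        (\<Sum>q\<in>UNIV - {(i, j)}. (1 + n) ^ (2 * (m - 1)) * B * of_bool (0 < m))"
      by (rule order_trans[OF sum_abs sum_mono]) (use tm in auto)
    also have "\<dots> \<le> (\<Sum>q\<in>(UNIV :: ('n \<times> 'n) set). (1 + n) ^ (2 * (m - 1)) * B * of_bool (0 < m))"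
      using n1 B1 by (intro sum_mono2) auto
    also have "\<dots> = n\<^sup>2 * ((1 + n) ^ (2 * (m - 1)) * B * of_bool (0 < m))"
      by (simp add: n_def power2_eq_square)
    finally have "\<bar>Z i j\<bar> \<le> B + n\<^sup>2 * ((1 + n) ^ (2 * (m - 1)) * B * of_bool (0 < m))" by simp
    also have "\<dots> \<le> (1 + n) ^ (2 * m) * B"
    proof (cases m)
      case (Suc k)
      define E where "E = (1 + n) ^ (2 * k) * B"
      have "1 * B \<le> E" unfolding E_def using n1 B1 by (intro mult_right_mono one_le_power) auto
      moreover have "0 \<le> 2 * n * E" unfolding E_def using n1 B1 by (simp add: n_def)
      ultimately have "B + n\<^sup>2 * E \<le> (1 + n)\<^sup>2 * E" by (simp add: power2_eq_square algebra_simps)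
      then show ?thesis using Suc by (simp add: E_def power_add power2_eq_square mult_ac)
    qed simp
    finally show ?case unfolding m_def .
  qed
  have uB: "\<bar>mat_of_sym u $ i $ j\<bar> \<le> (1 + n) ^ (4 * CARD('n)) * B" if ij: "\<rho> i \<le> \<rho> j" for i j
  proof -
    have "(upper_part u $ i $ j)\<^sup>2 \<le> (\<Sum>k\<in>UNIV. (upper_part u $ i $ k)\<^sup>2)"
      by (rule member_le_sum) auto
    also have "\<dots> = Z i i" by (simp add: Z_def gram_entry power2_eq_square)
    also have "\<dots> \<le> \<bar>Z i i\<bar>" by simp
    also have "\<dots> \<le> (1 + n) ^ (2 * (\<rho> i + \<rho> i)) * B" by (rule ZB)
    also have "\<dots> \<le> (1 + n) ^ (4 * CARD('n)) * B" using \<rho>_less[of i] by (intro small) auto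
    also have "\<dots> \<le> ((1 + n) ^ (4 * CARD('n)) * B)\<^sup>2"
    proof -
      have "1 \<le> (1 + n) ^ (4 * CARD('n)) * B"
        using n1 B1 one_le_power[OF n1] mult_mono[of 1 "(1 + n) ^ (4 * CARD('n))" 1 B] by simp
      then show ?thesis unfolding power2_eq_square by (simp add: mult_le_cancel_left1)
    qed
    finally have "\<bar>upper_part u $ i $ j\<bar> \<le> \<bar>(1 + n) ^ (4 * CARD('n)) * B\<bar>" by (simp add: abs_le_square_iff)
    then show ?thesis using ij n1 B1 by (simp add: upper_part_def)
  qed
  have bb: "b \<in> (\<lambda>u. (u, 0)) ` Basis \<or> b \<in> (\<lambda>v. (0, v)) ` Basis" using b by (simp add: Basis_prod_def)
  have "\<bar>(u, p) \<bullet> b\<bar> \<le> (1 + n) ^ (4 * CARD('n)) * B"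
    using bb
  proof
    assume "b \<in> (\<lambda>u. (u, 0)) ` Basis"
    then obtain i j where "b = (sym_unit i j, 0)" by (auto simp: Basis_symmat_def)
    then show ?thesis
      using uB[of i j] uB[of j i] by (cases "\<rho> i \<le> \<rho> j") (auto simp: inner_sym_unit mat_of_sym_commute[of u i j])
  next
    assume "b \<in> (\<lambda>v. (0, v)) ` Basis"
    then obtain v where v: "v \<in> Basis" "b = (0, v)" by blast
    have "v \<in> range (\<lambda>(i, c). axis i (axis c 1) :: real^'d^'n)"
      using matrix_basis_bij[where 'd = 'd and 'n = 'n] v(1) by (simp add: bij_betw_def)
    then obtain i c where bic: "b = (0, axis i (axis c 1))" using v(2) by auto
    show ?thesis
    proof (cases "\<rho> i \<le> \<kappa> c")
      case True
      have "\<bar>p $ i $ c\<bar> \<le> (1 + n) ^ (4 * CARD('n)) * B"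
        using pB[OF True] small[of "\<rho> i"] \<rho>_less[of i] by simp
      then show ?thesis by (simp add: bic matrix_inner_basis)
    next
      case False
      then have "\<bar>p $ i $ c\<bar> \<le> 1" using bnd[of c i] by simp
      also have "1 \<le> (1 + n) ^ (4 * CARD('n)) * B"
        using n1 B1 one_le_power[OF n1, of "4 * CARD('n)"] mult_mono[of 1 "(1 + n) ^ (4 * CARD('n))" 1 B] by simp
      finally show ?thesis by (simp add: bic matrix_inner_basis)
    qed
  qed
  then show ?thesis by (simp add: n_def B_def)
qed

definition jacobian :: "'n symmat \<times> (real^'d^'n) \<Rightarrow> real"
  where "jacobian x = (\<Prod>c\<in>UNIV. \<bar>snd x $ piv c $ c\<bar> ^ (CARD('n) - 1 - \<kappa> c)) *
    (\<Prod>j\<in>UNIV. \<bar>mat_of_sym (fst x) $ j $ j\<bar> ^ (\<rho> j + 1))"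

lemma jacobian_nonneg: "jacobian x \<ge> 0"
  unfolding jacobian_def by (intro mult_nonneg_nonneg prod_nonneg) auto

lemma jacobian_measurable [measurable]: "jacobian \<in> borel_measurable borel"
proof -
  have "(\<lambda>x::'n symmat \<times> (real^'d^'n). snd x $ i $ c) \<in> borel_measurable borel"
    "(\<lambda>x::'n symmat \<times> (real^'d^'n). mat_of_sym (fst x) $ i $ j) \<in> borel_measurable borel" for i j c
    using linear_continuous_on[OF bounded_linear_mat_entry] linear_continuous_on[OF bounded_linear_sym_entry]
    by (auto intro!: borel_measurable_continuous_onI)
  then show ?thesis
    unfolding jacobian_def[abs_def]
    by (intro borel_measurable_times borel_measurable_prod borel_measurable_power borel_measurable_abs)
qed

end

locale pivot_chart = elimination_order \<rho> \<kappa> for \<rho> :: "'n::finite \<Rightarrow> nat" and \<kappa> :: "'d::finite \<Rightarrow> nat" +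
  fixes xs :: "'n list"
  assumes xs_length: "length xs = CARD('n)" and xs_nth: "\<And>k. k < CARD('n) \<Longrightarrow> \<rho> (xs ! k) = k"
begin

lemma bounded_weight_borel [measurable]: "bounded_weight xs \<in> borel_measurable borel"
  by (rule bounded_weight_measurable[OF xs_nth])

text \<open>Elimination in the variable \<open>y\<close>, then unipotent congruence and the Cholesky substitution in the variable \<open>z\<close>, with
\<open>y\<close> fixed.\<close>

lemma nn_integral_chart:
  fixes f :: "'n symmat \<times> (real^'d^'n) \<Rightarrow> ennreal"
  assumes f[measurable]: "f \<in> borel_measurable borel"
  shows "(\<integral>\<^sup>+w. f w * ennreal (pivot_weight (inv \<kappa>) 0 xs (snd w)) * indicator {z. pos_definite z} (fst w) \<partial>lborel) =
    (\<integral>\<^sup>+x. f (chart x) * ennreal (bounded_weight xs (snd x) * jacobian x) \<partial>lborel)"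
proof -
  define \<omega> where "\<omega> = (pivot_weight (inv \<kappa>) 0 xs :: real^'d^'n \<Rightarrow> real)"
  define pd :: "'n symmat \<Rightarrow> ennreal" where "pd = indicator {z. pos_definite z}"
  have [measurable]: "\<omega> \<in> borel_measurable borel" by (simp add: \<omega>_def)
  have [measurable]: "pd \<in> borel_measurable borel" unfolding pd_def by measurable
  define J1 where "J1 p = (\<Prod>c\<in>UNIV. ennreal (\<bar>p $ piv c $ c\<bar> ^ (CARD('n) - 1 - \<kappa> c)))" for p :: "real^'d^'n"
  define J2 where "J2 u = (\<Prod>j\<in>UNIV. ennreal (\<bar>mat_of_sym u $ j $ j\<bar> ^ (\<rho> j + 1)))" for u :: "'n symmat"
  have [measurable]: "J1 \<in> borel_measurable borel" "J2 \<in> borel_measurable borel"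
    unfolding J1_def[abs_def] J2_def[abs_def] by measurable
  have pairing: "(\<integral>\<^sup>+w. g w \<partial>lborel) = (\<integral>\<^sup>+y. (\<integral>\<^sup>+z. g (z, y) \<partial>lborel) \<partial>lborel)"
    if "g \<in> borel_measurable borel" for g :: "'n symmat \<times> (real^'d^'n) \<Rightarrow> ennreal"
    using lborel_pair.nn_integral_snd[of "\<lambda>w. g w"] that by (simp add: lborel_prod)
  define G where "G y = (\<integral>\<^sup>+z. f (z, y) * pd z \<partial>lborel)" for y
  have [measurable]: "(\<lambda>(y, z). f (z, y) * pd z) \<in> borel_measurable (borel \<Otimes>\<^sub>M lborel)"
    by measurable
  have [measurable]: "G \<in> borel_measurable borel"
    unfolding G_def by (rule lborel.borel_measurable_nn_integral) measurable
  have GL: "G (Lower p ** Reduced p) = (\<integral>\<^sup>+u. f (chart (u, p)) * J2 u \<partial>lborel)" for p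
  proof -
    define y where "y = Lower p ** Reduced p"
    have [measurable]: "(\<lambda>z. f (z, y)) \<in> borel_measurable borel" by measurable
    have cm: "congruence (Lower p) \<in> borel_measurable borel"
    proof -
      have "(\<lambda>z. congruence (Lower p) z \<bullet> b) \<in> borel_measurable borel" if "b \<in> Basis" for b
        using that by (auto simp: Basis_symmat_def inner_sym_unit congruence_entry)
      then show ?thesis by (simp add: borel_measurable_euclidean_space[of "congruence (Lower p)"])
    qed
    note [measurable] = cm
    have "G y = (\<integral>\<^sup>+z. f (congruence (Lower p) z, y) * pd (congruence (Lower p) z) \<partial>lborel)"
      unfolding G_def by (rule nn_integral_congruence[OF unit_lower_Lower]) measurable
    also have "\<dots> = (\<integral>\<^sup>+z. f (congruence (Lower p) z, y) * indicator {z. pos_definite z} z \<partial>lborel)"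
      by (simp add: pd_def indicator_def pos_definite_congruence[OF unit_lower_Lower])
    also have "\<dots> = (\<integral>\<^sup>+u. f (congruence (Lower p) (gram (upper_part u)), y) * J2 u \<partial>lborel)"
      unfolding J2_def by (rule nn_integral_Cholesky) measurable
    finally show ?thesis by (simp add: y_def chart_def)
  qed
  have "(\<integral>\<^sup>+w. f w * ennreal (\<omega> (snd w)) * pd (fst w) \<partial>lborel) = (\<integral>\<^sup>+y. (\<integral>\<^sup>+z. f (z, y) * ennreal (\<omega> y) * pd z \<partial>lborel) \<partial>lborel)"
  proof (subst pairing)
    have [measurable]: "(fst :: 'n symmat \<times> (real^'d^'n) \<Rightarrow> _) \<in> borel_measurable borel"
      "(snd :: 'n symmat \<times> (real^'d^'n) \<Rightarrow> _) \<in> borel_measurable borel"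
      by (intro borel_measurable_continuous_onI continuous_intros)+
    show "(\<lambda>w. f w * ennreal (\<omega> (snd w)) * pd (fst w)) \<in> borel_measurable borel" by measurable
  qed simp
  also have "\<dots> = (\<integral>\<^sup>+y. ennreal (\<omega> y) * G y \<partial>lborel)"
    unfolding G_def by (intro nn_integral_cong) (subst nn_integral_cmult[symmetric], auto simp: mult_ac)
  also have "\<dots> = (\<integral>\<^sup>+p. ennreal (\<omega> (Lower p ** Reduced p)) * G (Lower p ** Reduced p) * J1 p \<partial>lborel)"
    unfolding J1_def by (rule nn_integral_elimination) measurable
  also have "\<dots> = (\<integral>\<^sup>+p. ennreal (bounded_weight xs p) * (\<integral>\<^sup>+u. f (chart (u, p)) * J2 u \<partial>lborel) * J1 p \<partial>lborel)"
  proof (rule nn_integral_cong_AE)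
    have "AE p::real^'d^'n in lborel. p $ piv c $ c \<noteq> 0" for c
      using AE_coordinate_nonzero[of "axis (piv c) (axis c 1) :: real^'d^'n"] by (simp add: matrix_inner_basis axis_in_Basis_iff)
    then have "AE p::real^'d^'n in lborel. \<forall>c\<in>UNIV. p $ piv c $ c \<noteq> 0"
      by (intro AE_finite_allI) auto
    then show "AE p in lborel. ennreal (\<omega> (Lower p ** Reduced p)) * G (Lower p ** Reduced p) * J1 p =
      ennreal (bounded_weight xs p) * (\<integral>\<^sup>+u. f (chart (u, p)) * J2 u \<partial>lborel) * J1 p"
    proof (rule AE_mp, intro AE_I2 impI)
      fix p :: "real^'d^'n" assume "\<forall>c\<in>UNIV. p $ piv c $ c \<noteq> 0"
      then have "\<omega> (Lower p ** Reduced p) = bounded_weight xs p"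
        unfolding \<omega>_def by (intro pivot_weight_Lower_Reduced xs_length xs_nth) auto
      then show "ennreal (\<omega> (Lower p ** Reduced p)) * G (Lower p ** Reduced p) * J1 p =
        ennreal (bounded_weight xs p) * (\<integral>\<^sup>+u. f (chart (u, p)) * J2 u \<partial>lborel) * J1 p" by (simp add: GL)
    qed
  qed
  also have "\<dots> = (\<integral>\<^sup>+p. (\<integral>\<^sup>+u. f (chart (u, p)) * ennreal (bounded_weight xs p * jacobian (u, p)) \<partial>lborel) \<partial>lborel)"
  proof (rule nn_integral_cong)
    fix p :: "real^'d^'n"
    have [measurable]: "(\<lambda>u. f (chart (u, p))) \<in> borel_measurable borel" by measurable
    have j: "ennreal (bounded_weight xs p * jacobian (u, p)) = ennreal (bounded_weight xs p) * J1 p * J2 u" for u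
    proof -
      have 1: "J1 p = ennreal (\<Prod>c\<in>UNIV. \<bar>p $ piv c $ c\<bar> ^ (CARD('n) - 1 - \<kappa> c))"
        unfolding J1_def by (rule prod_ennreal) simp
      have 2: "J2 u = ennreal (\<Prod>j\<in>UNIV. \<bar>mat_of_sym u $ j $ j\<bar> ^ (\<rho> j + 1))"
        unfolding J2_def by (rule prod_ennreal) (rule zero_le_power, simp)
      have 3: "0 \<le> (\<Prod>c\<in>UNIV. \<bar>p $ piv c $ c\<bar> ^ (CARD('n) - 1 - \<kappa> c))" "0 \<le> (\<Prod>j\<in>UNIV. \<bar>mat_of_sym u $ j $ j\<bar> ^ (\<rho> j + 1))"
        by (intro prod_nonneg ballI zero_le_power abs_ge_zero)+
      have 4: "0 \<le> bounded_weight xs p" by (rule bounded_weight_bounds[OF xs_nth])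
      show ?thesis
        unfolding jacobian_def fst_conv snd_conv 1 2 mult.assoc
        by (subst ennreal_mult[OF 4 mult_nonneg_nonneg[OF 3]], subst ennreal_mult[OF 3], rule refl)
    qed
    have "ennreal (bounded_weight xs p) * (\<integral>\<^sup>+u. f (chart (u, p)) * J2 u \<partial>lborel) * J1 p =
        (ennreal (bounded_weight xs p) * J1 p) * (\<integral>\<^sup>+u. f (chart (u, p)) * J2 u \<partial>lborel)" by (simp add: mult_ac)
    also have "\<dots> = (\<integral>\<^sup>+u. (ennreal (bounded_weight xs p) * J1 p) * (f (chart (u, p)) * J2 u) \<partial>lborel)"
      by (rule nn_integral_cmult[symmetric]) measurable
    finally show "ennreal (bounded_weight xs p) * (\<integral>\<^sup>+u. f (chart (u, p)) * J2 u \<partial>lborel) * J1 p =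
        (\<integral>\<^sup>+u. f (chart (u, p)) * ennreal (bounded_weight xs p * jacobian (u, p)) \<partial>lborel)"
      unfolding j by (simp add: mult_ac)
  qed
  also have "\<dots> = (\<integral>\<^sup>+x. f (chart x) * ennreal (bounded_weight xs (snd x) * jacobian x) \<partial>lborel)"
  proof -
    have [measurable]: "(snd :: 'n symmat \<times> (real^'d^'n) \<Rightarrow> _) \<in> borel_measurable borel"
      by (intro borel_measurable_continuous_onI continuous_intros)
    have "(\<lambda>x. f (chart x) * ennreal (bounded_weight xs (snd x) * jacobian x)) \<in> borel_measurable borel"
      by measurable
    from pairing[OF this] show ?thesis by simp
  qed
  finally show ?thesis by (simp add: \<omega>_def pd_def)
qed

end

section \<open>The zeta integral over one cell\<close>

lemma rGamma_nonzero: "Re z > 0 \<Longrightarrow> rGamma z \<noteq> 0"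
  by (auto simp: rGamma_eq_zero_iff elim!: nonpos_Ints_cases)

text \<open>On the negative half line \<open>Ln\<close> has the constant imaginary part \<open>\<pi>\<close>, so that the branch cut does no harm.\<close>

lemma real_powr_measurable: "(\<lambda>t::real. complex_of_real t powr z) \<in> borel_measurable borel"
proof -
  have "complex_of_real t powr z = (if t = 0 then 0 else if 0 < t then exp (z * of_real (ln t))
    else exp (z * (of_real (ln (- t)) + \<i> * pi)))" for t
    by (auto simp: powr_def Ln_of_real Ln_of_real' mult.commute)
  then show ?thesis by simp
qed

lemma zeta_integrand_measurable:
  fixes \<phi> :: "'n::finite symmat \<times> (real^'d::finite^'n) \<Rightarrow> complex"
  assumes "\<phi> \<in> schwartz"
  shows "zeta_integrand \<phi> s \<in> borel_measurable borel"
proof -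
  have "\<phi> differentiable (at x)" for x
    using schwartz_iter_deriv_differentiable[OF assms, of "[]" x] by simp
  then have "continuous_on UNIV \<phi>"
    by (meson continuous_at_imp_continuous_on differentiable_imp_continuous_within)
  then have 1[measurable]: "\<phi> \<in> borel_measurable borel" by (rule borel_measurable_continuous_onI)
  have entry: "continuous_on UNIV (\<lambda>w::'n symmat \<times> (real^'d^'n). mat_of_sym (fst w) $ i $ j)"
    "continuous_on UNIV (\<lambda>w::'n symmat \<times> (real^'d^'n). snd w $ i $ c)" for i j c
    using linear_continuous_on[OF bounded_linear_mat_entry] linear_continuous_on[OF bounded_linear_sym_entry] by auto
  have "continuous_on UNIV (\<lambda>w::'n symmat \<times> (real^'d^'n). bordered (mat_of_sym (fst w)) (snd w) $ p $ q)" for p q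
    by (cases p; cases q) (simp_all add: entry)
  then have "continuous_on UNIV (P1 :: 'n symmat \<times> (real^'d^'n) \<Rightarrow> real)" "continuous_on UNIV (P2 :: 'n symmat \<times> (real^'d^'n) \<Rightarrow> real)"
    unfolding P1_def P2_def case_prod_unfold det_def using entry
    by (auto intro!: continuous_on_sum continuous_on_prod continuous_on_mult continuous_on_const)
  then have [measurable]: "(P1 :: 'n symmat \<times> (real^'d^'n) \<Rightarrow> real) \<in> borel_measurable borel" "(P2 :: 'n symmat \<times> (real^'d^'n) \<Rightarrow> real) \<in> borel_measurable borel"
    by (auto intro: borel_measurable_continuous_onI)
  note [measurable] = real_powr_measurable
  show ?thesis unfolding zeta_integrand_def case_prod_unfold by measurable
qed

lemma powr_of_real_mult:
  assumes "0 \<le> a" "0 \<le> b"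
  shows "complex_of_real (a * b) powr z = complex_of_real a powr z * complex_of_real b powr z"
  unfolding of_real_mult using assms by (intro powr_times_real) auto

lemma powr_of_real_prod:
  assumes "\<And>i. i \<in> A \<Longrightarrow> 0 \<le> t i"
  shows "complex_of_real (\<Prod>i\<in>A. t i) powr z = (\<Prod>i\<in>A. complex_of_real (t i) powr z)"
  using assms
  by (induction A rule: infinite_finite_induct)
    (simp_all add: powr_of_real_mult prod_nonneg del: of_real_mult of_real_prod)

lemma powr_of_real_power:
  assumes "0 < t"
  shows "complex_of_real (t ^ k) powr z = complex_of_real t powr (of_nat k * z)"
  using assms by (simp add: powr_def Ln_of_real ln_realpow mult_ac del: of_real_power)

context elimination_order
begin

definition pivot_coordinate :: "'n + 'd \<Rightarrow> 'n symmat \<times> (real^'d^'n)"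
  where "pivot_coordinate = case_sum (\<lambda>j. (sym_unit j j, 0)) (\<lambda>c. (0, axis (piv c) (axis c 1)))"

text \<open>The exponents \<open>2 * s1\<close> and \<open>2 * s2\<close> come from the squares in \<open>P1_chart\<close> and \<open>P2_chart\<close>, the constants from
\<open>jacobian\<close>.\<close>

definition pivot_exponent :: "'n + 'd \<Rightarrow> complex \<times> complex \<Rightarrow> complex"
  where "pivot_exponent i s = case_sum (\<lambda>_. 2) (\<lambda>_. 0) i * fst s +
    case_sum (\<lambda>j. if CARD('d) \<le> \<rho> j then 2 else 0) (\<lambda>_. 2) i * snd s +
    of_nat (case_sum (\<lambda>j. \<rho> j + 1) (\<lambda>c. CARD('n) - 1 - \<kappa> c) i)"

lemma inner_pivot_coordinate [simp]:
  "x \<bullet> pivot_coordinate (Inl j) = mat_of_sym (fst x) $ j $ j"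
  "x \<bullet> pivot_coordinate (Inr c) = snd x $ piv c $ c"
  by (simp_all add: pivot_coordinate_def inner_prod_def inner_sym_unit matrix_inner_basis)

lemma pivot_coordinate_Basis: "pivot_coordinate i \<in> Basis"
proof (cases i)
  case (Inl j)
  then show ?thesis by (auto simp: pivot_coordinate_def Basis_prod_def Basis_symmat_def)
next
  case (Inr c)
  then show ?thesis by (auto simp: pivot_coordinate_def Basis_prod_def axis_in_Basis_iff)
qed

lemma inj_pivot_coordinate: "inj pivot_coordinate"
proof (rule injI)
  fix a b :: "'n + 'd" assume eq: "pivot_coordinate a = pivot_coordinate b"
  have ne: "(sym_unit j j :: 'n symmat) \<noteq> 0" for j
    by (rule nonzero_Basis) (auto simp: Basis_symmat_def)
  show "a = b"
  proof (cases a; cases b)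
    fix i j assume ab: "a = Inl i" "b = Inl j"
    then have "mat_of_sym (sym_unit i i) $ i $ i = mat_of_sym (sym_unit j j) $ i $ i"
      using eq by (simp add: pivot_coordinate_def)
    then show ?thesis using ab by (simp add: sym_unit.rep_eq split: if_splits)
  qed (use eq ne in \<open>auto simp: pivot_coordinate_def axis_eq_axis\<close>)
qed

lemma zeta_integrand_chart:
  assumes nz: "\<And>i. x \<bullet> pivot_coordinate i \<noteq> 0"
  shows "zeta_integrand \<phi> s (chart x) * of_real (jacobian x) =
    (\<Prod>i\<in>UNIV. of_real \<bar>x \<bullet> pivot_coordinate i\<bar> powr pivot_exponent i s) * \<phi> (chart x)"
proof -
  define t where "t j = \<bar>mat_of_sym (fst x) $ j $ j\<bar>" for j
  define r where "r c = \<bar>snd x $ piv c $ c\<bar>" for c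
  have t: "t j > 0" for j using nz[of "Inl j"] by (simp add: t_def)
  have r: "r c > 0" for c using nz[of "Inr c"] by (simp add: r_def)
  have tp: "complex_of_real (t j) powr (of_nat k) = of_real (t j ^ k)" for j k
    using t[of j] by (simp add: powr_nat)
  have rp: "complex_of_real (r c) powr (of_nat k) = of_real (r c ^ k)" for c k
    using r[of c] by (simp add: powr_nat)
  obtain s1 s2 where s: "s = (s1, s2)" by fastforce
  have "P1 (chart x) = (\<Prod>j\<in>UNIV. (t j)\<^sup>2)" by (simp add: P1_chart t_def)
  then have P1: "of_real (P1 (chart x)) powr s1 = (\<Prod>j\<in>UNIV. of_real (t j) powr (2 * s1))"
    by (simp only: powr_of_real_prod[OF zero_le_power2] powr_of_real_power[OF t]) simp
  have "P2 (chart x) = (\<Prod>c\<in>UNIV. (r c)\<^sup>2) * (\<Prod>j | CARD('d) \<le> \<rho> j. (t j)\<^sup>2)" by (simp add: P2_chart t_def r_def)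
  also have "(\<Prod>j | CARD('d) \<le> \<rho> j. (t j)\<^sup>2) = (\<Prod>j\<in>UNIV. if CARD('d) \<le> \<rho> j then (t j)\<^sup>2 else 1)"
    by (simp add: prod.If_cases)
  finally have "of_real (P2 (chart x)) powr s2 = of_real (\<Prod>c\<in>UNIV. (r c)\<^sup>2) powr s2 * of_real (\<Prod>j\<in>UNIV. if CARD('d) \<le> \<rho> j then (t j)\<^sup>2 else 1) powr s2"
    by (simp only:) (intro powr_of_real_mult prod_nonneg, auto)
  also have "of_real (\<Prod>c\<in>UNIV. (r c)\<^sup>2) powr s2 = (\<Prod>c\<in>UNIV. of_real (r c) powr (2 * s2))"
    by (simp only: powr_of_real_prod[OF zero_le_power2] powr_of_real_power[OF r]) simp
  also have "of_real (\<Prod>j\<in>UNIV. if CARD('d) \<le> \<rho> j then (t j)\<^sup>2 else 1) powr s2 =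
      (\<Prod>j\<in>UNIV. of_real (t j) powr (if CARD('d) \<le> \<rho> j then 2 * s2 else 0))"
  proof (subst powr_of_real_prod)
    show "(\<Prod>j\<in>UNIV. complex_of_real (if CARD('d) \<le> \<rho> j then (t j)\<^sup>2 else 1) powr s2) =
      (\<Prod>j\<in>UNIV. of_real (t j) powr (if CARD('d) \<le> \<rho> j then 2 * s2 else 0))"
    proof (rule prod.cong[OF refl])
      fix j
      show "complex_of_real (if CARD('d) \<le> \<rho> j then (t j)\<^sup>2 else 1) powr s2 = of_real (t j) powr (if CARD('d) \<le> \<rho> j then 2 * s2 else 0)"
        using t[of j] powr_of_real_power[OF t, of j 2 s2] by (simp del: of_real_power)
    qed
  qed simp
  finally have P2: "of_real (P2 (chart x)) powr s2 = (\<Prod>c\<in>UNIV. of_real (r c) powr (2 * s2)) *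
      (\<Prod>j\<in>UNIV. of_real (t j) powr (if CARD('d) \<le> \<rho> j then 2 * s2 else 0))" .
  have J: "complex_of_real (jacobian x) = (\<Prod>c\<in>UNIV. of_real (r c) powr of_nat (CARD('n) - 1 - \<kappa> c)) * (\<Prod>j\<in>UNIV. of_real (t j) powr of_nat (\<rho> j + 1))"
    unfolding jacobian_def tp rp by (simp only: t_def r_def of_real_mult of_real_prod)
  have "(\<Prod>i\<in>UNIV. complex_of_real \<bar>x \<bullet> pivot_coordinate i\<bar> powr pivot_exponent i s) =
    (\<Prod>j\<in>UNIV. of_real (t j) powr (2 * s1 + (if CARD('d) \<le> \<rho> j then 2 * s2 else 0) + of_nat (\<rho> j + 1))) *
    (\<Prod>c\<in>UNIV. of_real (r c) powr (2 * s2 + of_nat (CARD('n) - 1 - \<kappa> c)))"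
  proof -
    have "(if CARD('d) \<le> \<rho> j then 2 else 0) * s2 = (if CARD('d) \<le> \<rho> j then 2 * s2 else 0)" for j by simp
    then show ?thesis
      unfolding prod_Plus_UNIV by (simp add: pivot_exponent_def s t_def r_def del: of_nat_Suc of_nat_add of_nat_diff)
  qed
  also have "\<dots> = of_real (P1 (chart x)) powr s1 * of_real (P2 (chart x)) powr s2 * of_real (jacobian x)"
    unfolding P1 P2 J powr_add prod.distrib by (simp only: mult_ac)
  finally show ?thesis by (simp add: zeta_integrand_def s mult_ac)
qed

end

context pivot_chart
begin

definition cell_weight :: "'n symmat \<times> (real^'d^'n) \<Rightarrow> real"
  where "cell_weight w = pivot_weight (inv \<kappa>) 0 xs (snd w) * indicator {z. pos_definite z} (fst w)"

lemma snd_measurable: "(snd :: 'n symmat \<times> (real^'d^'n) \<Rightarrow> _) \<in> borel_measurable borel"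
  and fst_measurable: "(fst :: 'n symmat \<times> (real^'d^'n) \<Rightarrow> _) \<in> borel_measurable borel"
  by (intro borel_measurable_continuous_onI continuous_intros)+

lemma cell_weight_measurable [measurable]: "cell_weight \<in> borel_measurable borel"
proof -
  note [measurable] = snd_measurable fst_measurable
  show ?thesis unfolding cell_weight_def[abs_def] by measurable
qed

lemma cell_weight_nonneg: "cell_weight w \<ge> 0"
  by (simp add: cell_weight_def pivot_weight_nonneg)

definition chart_weight :: "'n symmat \<times> (real^'d^'n) \<Rightarrow> real"
  where "chart_weight x = bounded_weight xs (snd x) * jacobian x"

lemma chart_weight_measurable [measurable]: "chart_weight \<in> borel_measurable borel"
proof -
  note [measurable] = snd_measurable
  show ?thesis unfolding chart_weight_def[abs_def] by measurable
qed

lemma chart_weight_nonneg: "chart_weight x \<ge> 0"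
  by (simp add: chart_weight_def jacobian_nonneg bounded_weight_bounds[OF xs_nth])

text \<open>The substitution rule for nonnegative functions identifies two measures, which transfers it to complex integrands.\<close>

lemma distr_chart:
  "distr (density lborel (\<lambda>x. ennreal (chart_weight x))) borel chart = density lborel (\<lambda>w. ennreal (cell_weight w))"
proof (rule measure_eqI)
  fix A :: "('n symmat \<times> (real^'d^'n)) set"
  assume "A \<in> sets (distr (density lborel (\<lambda>x. ennreal (chart_weight x))) borel chart)"
  then have A[measurable]: "A \<in> sets borel" by simp
  have "emeasure (distr (density lborel (\<lambda>x. ennreal (chart_weight x))) borel chart) A =
      (\<integral>\<^sup>+x. ennreal (chart_weight x) * indicator (chart -` A) x \<partial>lborel)"
    using measurable_sets[OF chart_measurable A] by (simp add: emeasure_distr emeasure_density)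
  also have "\<dots> = (\<integral>\<^sup>+x. indicator A (chart x) * ennreal (bounded_weight xs (snd x) * jacobian x) \<partial>lborel)"
    by (simp add: chart_weight_def indicator_vimage mult.commute)
  also have "\<dots> = (\<integral>\<^sup>+w. indicator A w * ennreal (pivot_weight (inv \<kappa>) 0 xs (snd w)) * indicator {z. pos_definite z} (fst w) \<partial>lborel)"
    by (rule nn_integral_chart[symmetric]) measurable
  also have "\<dots> = (\<integral>\<^sup>+w. ennreal (cell_weight w) * indicator A w \<partial>lborel)"
    by (intro nn_integral_cong) (simp add: cell_weight_def indicator_def)
  also have "\<dots> = emeasure (density lborel (\<lambda>w. ennreal (cell_weight w))) A"
    by (simp add: emeasure_density)
  finally show "emeasure (distr (density lborel (\<lambda>x. ennreal (chart_weight x))) borel chart) A =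
    emeasure (density lborel (\<lambda>w. ennreal (cell_weight w))) A" .
qed simp

lemma chart_change_of_variables:
  fixes f :: "'n symmat \<times> (real^'d^'n) \<Rightarrow> complex"
  assumes f[measurable]: "f \<in> borel_measurable borel"
  shows "integrable lborel (\<lambda>w. cell_weight w *\<^sub>R f w) \<longleftrightarrow> integrable lborel (\<lambda>x. chart_weight x *\<^sub>R f (chart x))"
    and "(\<integral>w. cell_weight w *\<^sub>R f w \<partial>lborel) = (\<integral>x. chart_weight x *\<^sub>R f (chart x) \<partial>lborel)"
proof -
  have c: "chart \<in> measurable (density lborel (\<lambda>x. ennreal (chart_weight x))) borel"
    using chart_measurable by simp
  show "integrable lborel (\<lambda>w. cell_weight w *\<^sub>R f w) \<longleftrightarrow> integrable lborel (\<lambda>x. chart_weight x *\<^sub>R f (chart x))"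
    using integrable_distr_eq[OF c f] unfolding distr_chart
    by (simp add: integrable_density cell_weight_nonneg chart_weight_nonneg)
  show "(\<integral>w. cell_weight w *\<^sub>R f w \<partial>lborel) = (\<integral>x. chart_weight x *\<^sub>R f (chart x) \<partial>lborel)"
    using integral_distr[OF c f] unfolding distr_chart
    by (simp add: integral_density cell_weight_nonneg chart_weight_nonneg)
qed

lemma polynomial_substitution_chart:
  assumes "\<phi> \<in> schwartz"
  shows "polynomial_substitution \<phi> chart (\<lambda>x. bounded_weight xs (snd x)) UNIV pivot_coordinate ((1 + real CARD('n)) ^ (4 * CARD('n)))"
proof
  show "\<phi> \<in> schwartz" by (rule assms)
  show "real_polynomial_function (\<lambda>x. chart x \<bullet> c)" if "c \<in> Basis" for c
    using that by (rule polynomial_chart)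
  note [measurable] = snd_measurable
  show "(\<lambda>x::'n symmat \<times> (real^'d^'n). bounded_weight xs (snd x)) \<in> borel_measurable borel" by measurable
  show "\<bar>bounded_weight xs (snd x)\<bar> \<le> 1" for x :: "'n symmat \<times> (real^'d^'n)"
    using bounded_weight_bounds[OF xs_nth, of "snd x"] by simp
  show "bounded_weight xs (snd (x + t *\<^sub>R pivot_coordinate i)) = bounded_weight xs (snd x)" for i x t
  proof (rule bounded_weight_cong)
    fix j c assume "\<kappa> c < \<rho> j"
    then show "snd (x + t *\<^sub>R pivot_coordinate i) $ j $ c = snd x $ j $ c"
      by (cases i) (auto simp: pivot_coordinate_def axis_def)
  qed
  show "\<bar>x \<bullet> b\<bar> \<le> (1 + real CARD('n)) ^ (4 * CARD('n)) * (1 + norm (chart x))"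
    if "bounded_weight xs (snd x) \<noteq> 0" "b \<in> Basis" for x b
    using chart_growth[OF bounded_weight_nonzeroD[OF xs_nth that(1)] that(2), of "fst x"] by simp
  show "inj_on pivot_coordinate UNIV" by (rule inj_pivot_coordinate)
  show "pivot_coordinate i \<in> Basis" for i by (rule pivot_coordinate_Basis)
qed simp_all

theorem cell_continuation:
  assumes \<phi>: "\<phi> \<in> schwartz"
  shows "(\<forall>i. Re (pivot_exponent i s) > -1) \<Longrightarrow> integrable lborel (\<lambda>w. cell_weight w *\<^sub>R zeta_integrand \<phi> s w)"
    and "\<exists>F. holomorphic2_on F UNIV \<and> (\<forall>s. (\<forall>i. Re (pivot_exponent i s) > -1) \<longrightarrow>
      F s = (\<Prod>i\<in>UNIV. rGamma ((pivot_exponent i s + 1) / 2)) * (\<integral>w. cell_weight w *\<^sub>R zeta_integrand \<phi> s w \<partial>lborel))"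
proof -
  interpret S: polynomial_substitution \<phi> chart "\<lambda>x. bounded_weight xs (snd x)" UNIV pivot_coordinate "(1 + real CARD('n)) ^ (4 * CARD('n))"
    by (rule polynomial_substitution_chart[OF \<phi>])
  define G where "G s = (\<Prod>i\<in>UNIV. rGamma ((pivot_exponent i s + 1) / 2))" for s
  let ?K = "\<lambda>s. S.weighted (\<lambda>i. mellin_kernel 0 (pivot_exponent i s)) (\<lambda>x. \<phi> (chart x))"
  have ae: "AE x in lborel. ?K s x = G s * (chart_weight x *\<^sub>R zeta_integrand \<phi> s (chart x))" for s
  proof -
    have "AE x in lborel. \<forall>i\<in>UNIV. x \<bullet> pivot_coordinate i \<noteq> 0"
      by (intro AE_finite_allI finite AE_coordinate_nonzero pivot_coordinate_Basis)
    then show ?thesis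
    proof (rule AE_mp, intro AE_I2 impI)
      fix x assume "\<forall>i\<in>UNIV. x \<bullet> pivot_coordinate i \<noteq> 0"
      then have "zeta_integrand \<phi> s (chart x) * of_real (jacobian x) =
        (\<Prod>i\<in>UNIV. of_real \<bar>x \<bullet> pivot_coordinate i\<bar> powr pivot_exponent i s) * \<phi> (chart x)"
        by (intro zeta_integrand_chart) auto
      then have z: "of_real (jacobian x) * zeta_integrand \<phi> s (chart x) =
        (\<Prod>i\<in>UNIV. of_real \<bar>x \<bullet> pivot_coordinate i\<bar> powr pivot_exponent i s) * \<phi> (chart x)"
        by (simp only: mult.commute)
      show "?K s x = G s * (chart_weight x *\<^sub>R zeta_integrand \<phi> s (chart x))"
        unfolding S.weighted_def mellin_kernel_0 prod.distrib G_def[symmetric] chart_weight_def scaleR_conv_of_real of_real_mult mult.assoc z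
        by (simp only: mult_ac)
    qed
  qed
  have m: "(\<lambda>x. G s * (chart_weight x *\<^sub>R zeta_integrand \<phi> s (chart x))) \<in> borel_measurable lborel" for s
  proof -
    note [measurable] = zeta_integrand_measurable[OF \<phi>] chart_measurable
    show ?thesis by measurable
  qed
  have K: "?K s \<in> borel_measurable lborel" for s
    using S.weighted_measurable[OF mellin_kernel_measurable polynomial_pullback_self] by simp
  show "integrable lborel (\<lambda>w. cell_weight w *\<^sub>R zeta_integrand \<phi> s w)" if s: "\<forall>i. Re (pivot_exponent i s) > -1"
  proof -
    have "integrable lborel (?K s)"
      using s by (intro S.integrable_weighted admissible_mellin_kernel polynomial_pullback_self) auto
    then have int: "integrable lborel (\<lambda>x. G s * (chart_weight x *\<^sub>R zeta_integrand \<phi> s (chart x)))"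
      using integrable_cong_AE[OF K m ae] by blast
    have "rGamma ((pivot_exponent i s + 1) / 2) \<noteq> 0" for i
    proof -
      have "Re ((pivot_exponent i s + 1) / 2) > 0" using s[rule_format, of i] by simp
      then show ?thesis by (rule rGamma_nonzero)
    qed
    then have "G s \<noteq> 0" by (simp add: G_def)
    then have "(\<lambda>x. inverse (G s) * (G s * (chart_weight x *\<^sub>R zeta_integrand \<phi> s (chart x)))) =
        (\<lambda>x. chart_weight x *\<^sub>R zeta_integrand \<phi> s (chart x))"
      by (simp add: fun_eq_iff mult.assoc[symmetric] del: mult_scaleR_right)
    with integrable_mult_right[OF int, of "inverse (G s)"]
    have "integrable lborel (\<lambda>x. chart_weight x *\<^sub>R zeta_integrand \<phi> s (chart x))" by simp
    then show ?thesis using chart_change_of_variables(1)[OF zeta_integrand_measurable[OF \<phi>]] by blast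
  qed
  have "\<exists>F. holomorphic2_on F UNIV \<and> (\<forall>s. (\<forall>i\<in>UNIV. Re (pivot_exponent i s) > -1) \<longrightarrow> F s = (\<integral>x. ?K s x \<partial>lborel))"
    unfolding pivot_exponent_def
  proof (rule S.entire_extension, intro exI[of _ "0 :: complex \<times> complex"] ballI)
    fix i :: "'n + 'd"
    show "Re (case_sum (\<lambda>_. 2) (\<lambda>_. 0) i * fst 0 + case_sum (\<lambda>j. if CARD('d) \<le> \<rho> j then 2 else 0) (\<lambda>_. 2) i * snd 0 +
      of_nat (case_sum (\<lambda>j. \<rho> j + 1) (\<lambda>c. CARD('n) - 1 - \<kappa> c) i)) > -1"
      by (simp add: less_le_trans[of "-1" 0])
  qed
  moreover have "(\<integral>x. ?K s x \<partial>lborel) = G s * (\<integral>w. cell_weight w *\<^sub>R zeta_integrand \<phi> s w \<partial>lborel)" for s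
    unfolding integral_cong_AE[OF K m ae] chart_change_of_variables(2)[OF zeta_integrand_measurable[OF \<phi>]]
    by (rule integral_mult_right_zero)
  ultimately show "\<exists>F. holomorphic2_on F UNIV \<and> (\<forall>s. (\<forall>i. Re (pivot_exponent i s) > -1) \<longrightarrow>
      F s = (\<Prod>i\<in>UNIV. rGamma ((pivot_exponent i s + 1) / 2)) * (\<integral>w. cell_weight w *\<^sub>R zeta_integrand \<phi> s w \<partial>lborel))"
    unfolding G_def by auto
qed

end

section \<open>Gamma factors and the global continuation\<close>

text \<open>Working with reciprocals throughout avoids poles: \<open>rGamma_multi\<close> is entire, and it vanishes exactly at
the poles of \<open>Gamma_multi\<close>.\<close>

definition rGamma_multi :: "nat \<Rightarrow> complex \<Rightarrow> complex"
  where "rGamma_multi k \<alpha> = (\<Prod>j=1..k. rGamma (\<alpha> - (of_nat j - 1) / 2))"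

lemma Gamma_multi_eq: "Gamma_multi k \<alpha> = inverse (rGamma_multi k \<alpha>)"
  by (simp add: Gamma_multi_def rGamma_multi_def Gamma_def prod_inversef[symmetric] comp_def)

lemma rGamma_multi_eq_0_iff: "rGamma_multi k \<alpha> = 0 \<longleftrightarrow> \<alpha> \<in> Gamma_multi_poles k"
  by (auto simp: rGamma_multi_def Gamma_multi_poles_def prod_zero_iff rGamma_eq_zero_iff)

lemma holomorphic2_rGamma_multi:
  "holomorphic2_on (\<lambda>s. rGamma_multi k (\<alpha> * fst s + \<beta> * snd s + c)) UNIV"
  unfolding rGamma_multi_def
proof (rule holomorphic2_on_prod[OF open_UNIV])
  fix j
  have "holomorphic2_on (\<lambda>s. rGamma (\<alpha> * fst s + \<beta> * snd s + (c - (of_nat j - 1) / 2))) UNIV"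
    by (rule holomorphic2_on_compose_affine[OF _ open_UNIV open_UNIV]) (auto intro!: holomorphic_intros)
  then show "holomorphic2_on (\<lambda>s. rGamma (\<alpha> * fst s + \<beta> * snd s + c - (of_nat j - 1) / 2)) UNIV"
    by (simp add: add_diff_eq)
qed

lemma holomorphic2_on_inverse:
  assumes "holomorphic2_on f U" "\<And>s. s \<in> U \<Longrightarrow> f s \<noteq> 0"
  shows "holomorphic2_on (\<lambda>s. inverse (f s)) U"
  unfolding holomorphic2_on_def
proof (intro conjI ballI)
  show "open U" using assms(1) by (rule holomorphic2_on_open)
  fix s assume s: "s \<in> U"
  then obtain a b where "(f has_derivative (\<lambda>(h1, h2). a * h1 + b * h2)) (at s)"
    using assms(1) unfolding holomorphic2_on_def by blast
  from Deriv.has_derivative_inverse[OF assms(2)[OF s] this]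
  have "((\<lambda>s. inverse (f s)) has_derivative
      (\<lambda>(h1, h2). (- (inverse (f s) * a * inverse (f s))) * h1 + (- (inverse (f s) * b * inverse (f s))) * h2)) (at s)"
    by (rule has_derivative_eq_rhs) (auto simp: fun_eq_iff algebra_simps)
  then show "\<exists>a b. ((\<lambda>s. inverse (f s)) has_derivative (\<lambda>(h1, h2). a * h1 + b * h2)) (at s)" by blast
qed

lemma holomorphic2_on_continuous:
  assumes "holomorphic2_on f U"
  shows "continuous_on U f"
  using assms unfolding holomorphic2_on_def
  by (meson continuous_at_imp_continuous_on has_derivative_continuous)

definition rGamma_enhanced :: "nat \<Rightarrow> nat \<Rightarrow> complex \<times> complex \<Rightarrow> complex"
  where "rGamma_enhanced n d s = rGamma_multi d (fst s + (of_nat d + 1) / 2) * rGamma_multi d (snd s + (of_nat d + 1) / 2) *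
    rGamma_multi d (snd s + of_nat n / 2) * rGamma_multi (n - d) (fst s + snd s + (of_nat n + 1) / 2)"

lemma Gamma_enhanced_eq: "Gamma_enhanced n d s = inverse (rGamma_enhanced n d s)"
  by (cases s) (simp add: Gamma_enhanced_def rGamma_enhanced_def Gamma_multi_eq)

lemma rGamma_enhanced_eq_0_iff: "rGamma_enhanced n d s = 0 \<longleftrightarrow> s \<in> Gamma_enhanced_poles n d"
  by (cases s) (auto simp: rGamma_enhanced_def Gamma_enhanced_poles_def rGamma_multi_eq_0_iff)

lemma holomorphic2_rGamma_enhanced: "holomorphic2_on (rGamma_enhanced n d) UNIV"
  unfolding rGamma_enhanced_def[abs_def]
  using holomorphic2_rGamma_multi[of d 1 0 "(of_nat d + 1) / 2"] holomorphic2_rGamma_multi[of d 0 1 "(of_nat d + 1) / 2"]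
    holomorphic2_rGamma_multi[of d 0 1 "of_nat n / 2"] holomorphic2_rGamma_multi[of "n - d" 1 1 "(of_nat n + 1) / 2"]
  by (intro holomorphic2_on_mult) simp_all

lemma rGamma_multi_nonzero:
  assumes "Re \<alpha> > (real k - 1) / 2"
  shows "rGamma_multi k \<alpha> \<noteq> 0"
proof -
  have "rGamma (\<alpha> - (of_nat j - 1) / 2) \<noteq> 0" if "j \<in> {1..k}" for j
    using assms that by (intro rGamma_nonzero) (simp add: field_simps)
  then show ?thesis by (simp add: rGamma_multi_def)
qed

lemma rGamma_enhanced_nonzero:
  assumes "d \<le> n" "0 < Re (fst s)" "0 < Re (snd s)"
  shows "rGamma_enhanced n d s \<noteq> 0"
  unfolding rGamma_enhanced_def mult_eq_0_iff de_Morgan_disj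
  using assms by (intro conjI rGamma_multi_nonzero) (auto simp: field_simps of_nat_diff)

lemma meromorphic2_divide:
  assumes F: "holomorphic2_on F UNIV" and h: "holomorphic2_on h UNIV" and t: "h t \<noteq> 0"
  shows "meromorphic2 (\<lambda>s. inverse (h s) * F s)" "holomorphic2_on (\<lambda>s. inverse (h s) * F s) {s. h s \<noteq> 0}"
proof -
  show "meromorphic2 (\<lambda>s. inverse (h s) * F s)"
    unfolding meromorphic2_def
  proof
    fix s
    show "\<exists>U g k. s \<in> U \<and> connected U \<and> holomorphic2_on g U \<and> holomorphic2_on k U \<and> (\<exists>t\<in>U. k t \<noteq> 0) \<and>
        (\<forall>t\<in>U. k t \<noteq> 0 \<longrightarrow> inverse (h t) * F t = g t / k t)"
      by (rule exI[of _ UNIV], rule exI[of _ F], rule exI[of _ h]) (use F h t in \<open>auto simp: divide_inverse simp del: split_paired_Ex intro!: exI[of _ t]\<close>)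
  qed
  have "open {s. h s \<noteq> 0}"
    using holomorphic2_on_continuous[OF h] by (intro open_Collect_neq continuous_on_const)
  then have "holomorphic2_on h {s. h s \<noteq> 0}" "holomorphic2_on F {s. h s \<noteq> 0}"
    using F h by (auto intro: holomorphic2_on_subset)
  then show "holomorphic2_on (\<lambda>s. inverse (h s) * F s) {s. h s \<noteq> 0}"
    by (intro holomorphic2_on_mult holomorphic2_on_inverse) auto
qed

context elimination_order
begin

text \<open>The diagonal entries of \<open>U\<close> at the positions \<open>k < d\<close> contribute \<open>rGamma (s1 + (k + 2) / 2)\<close>, those at
\<open>d \<le> k\<close> contribute \<open>rGamma (s1 + s2 + (k + 2) / 2)\<close>, and the pivots contribute \<open>rGamma (s2 + (n - k) / 2)\<close>. In
particular, the result does not depend on the cell.\<close>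

lemma prod_rGamma_pivot_exponent:
  "(\<Prod>i\<in>UNIV. rGamma ((pivot_exponent i s + 1) / 2)) =
    rGamma_multi CARD('d) (fst s + (of_nat CARD('d) + 1) / 2) * rGamma_multi CARD('d) (snd s + of_nat CARD('n) / 2) *
    rGamma_multi (CARD('n) - CARD('d)) (fst s + snd s + (of_nat CARD('n) + 1) / 2)"
proof -
  define n where "n = CARD('n)"
  define d where "d = CARD('d)"
  have dn: "d \<le> n" using card_le by (simp add: d_def n_def)
  define g where "g k = rGamma ((2 * fst s + (if d \<le> k then 2 * snd s else 0) + of_nat (k + 1) + 1) / 2)" for k :: nat
  define g' where "g' k = rGamma ((2 * snd s + of_nat (n - 1 - k) + 1) / 2)" for k :: nat
  have "rGamma ((pivot_exponent (Inl j) s + 1) / 2) = g (\<rho> j)" for j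
    by (simp add: g_def pivot_exponent_def d_def)
  then have "(\<Prod>j\<in>UNIV. rGamma ((pivot_exponent (Inl j) s + 1) / 2)) = (\<Prod>k<n. g k)"
    using prod.reindex_bij_betw[OF \<rho>, of g] by (simp add: n_def)
  also have "{..<n} = {..<d} \<union> {d..<n}" using dn by auto
  also have "prod g ({..<d} \<union> {d..<n}) = (\<Prod>k<d. g k) * (\<Prod>k\<in>{d..<n}. g k)"
    by (rule prod.union_disjoint) auto
  also have "(\<Prod>k<d. g k) = rGamma_multi d (fst s + (of_nat d + 1) / 2)"
    unfolding rGamma_multi_def
  proof (rule prod.reindex_bij_witness[of _ "\<lambda>j. d - j" "\<lambda>k. d - k"])
    fix k assume "k \<in> {..<d}"
    then have "k < d" by simp
    then show "rGamma (fst s + (of_nat d + 1) / 2 - (of_nat (d - k) - 1) / 2) = g k"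
      unfolding g_def by (intro arg_cong[of _ _ rGamma]) (simp add: of_nat_diff field_simps)
  qed auto
  also have "(\<Prod>k\<in>{d..<n}. g k) = rGamma_multi (n - d) (fst s + snd s + (of_nat n + 1) / 2)"
    unfolding rGamma_multi_def
  proof (rule prod.reindex_bij_witness[of _ "\<lambda>j. n - j" "\<lambda>k. n - k"])
    fix k assume "k \<in> {d..<n}"
    then have "k < n" "d \<le> k" by auto
    then show "rGamma (fst s + snd s + (of_nat n + 1) / 2 - (of_nat (n - k) - 1) / 2) = g k"
      unfolding g_def by (intro arg_cong[of _ _ rGamma]) (simp add: of_nat_diff field_simps)
  qed auto
  finally have 1: "(\<Prod>j\<in>UNIV. rGamma ((pivot_exponent (Inl j) s + 1) / 2)) =
    rGamma_multi d (fst s + (of_nat d + 1) / 2) * rGamma_multi (n - d) (fst s + snd s + (of_nat n + 1) / 2)" .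
  have "rGamma ((pivot_exponent (Inr c) s + 1) / 2) = g' (\<kappa> c)" for c
    by (simp add: g'_def pivot_exponent_def n_def)
  then have "(\<Prod>c\<in>UNIV. rGamma ((pivot_exponent (Inr c) s + 1) / 2)) = (\<Prod>k<d. g' k)"
    using prod.reindex_bij_betw[OF \<kappa>, of g'] by (simp add: d_def)
  also have "\<dots> = rGamma_multi d (snd s + of_nat n / 2)"
    unfolding rGamma_multi_def
  proof (rule prod.reindex_bij_witness[of _ "\<lambda>j. j - 1" "\<lambda>k. k + 1"])
    fix k assume "k \<in> {..<d}"
    then have "Suc k \<le> n" using dn by simp
    then have n: "of_nat n = (1 + of_nat k + of_nat (n - 1 - k) :: complex)"
      using of_nat_diff[of "Suc k" n, where 'a = complex] by simp
    then show "rGamma (snd s + of_nat n / 2 - (of_nat (k + 1) - 1) / 2) = g' k"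
      unfolding g'_def n by (intro arg_cong[of _ _ rGamma]) (simp add: field_simps)
  qed auto
  finally show ?thesis unfolding prod_Plus_UNIV 1 n_def d_def by simp
qed

end

context pivot_chart
begin

text \<open>Here the enumeration of the rows has disappeared from the statement, so that the cells may be added up.\<close>

lemma cell_entire:
  assumes \<phi>: "\<phi> \<in> schwartz"
  shows "0 < Re (fst s) \<Longrightarrow> 0 < Re (snd s) \<Longrightarrow>
      integrable lborel (\<lambda>w. (pivot_weight (inv \<kappa>) 0 xs (snd w) * indicator {z. pos_definite z} (fst w)) *\<^sub>R zeta_integrand \<phi> s w)"
    and "\<exists>F. holomorphic2_on F UNIV \<and> (\<forall>s. 0 < Re (fst s) \<longrightarrow> 0 < Re (snd s) \<longrightarrow>
      rGamma_multi CARD('d) (snd s + (of_nat CARD('d) + 1) / 2) * F s = rGamma_enhanced CARD('n) CARD('d) s *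
        (\<integral>w. (pivot_weight (inv \<kappa>) 0 xs (snd w) * indicator {z. pos_definite z} (fst w)) *\<^sub>R zeta_integrand \<phi> s w \<partial>lborel))"
proof -
  have pos: "Re (pivot_exponent i s) > -1" if "0 < Re (fst s)" "0 < Re (snd s)" for i s
    using that by (cases i) (auto simp: pivot_exponent_def intro: less_le_trans[of "-1" 0])
  show "integrable lborel (\<lambda>w. (pivot_weight (inv \<kappa>) 0 xs (snd w) * indicator {z. pos_definite z} (fst w)) *\<^sub>R zeta_integrand \<phi> s w)"
    if "0 < Re (fst s)" "0 < Re (snd s)"
    using cell_continuation(1)[OF \<phi>, of s] pos[OF that] by (simp only: cell_weight_def) blast
  obtain F where "holomorphic2_on F UNIV" and F: "\<And>s. (\<forall>i. Re (pivot_exponent i s) > -1) \<Longrightarrow>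
      F s = (\<Prod>i\<in>UNIV. rGamma ((pivot_exponent i s + 1) / 2)) * (\<integral>w. cell_weight w *\<^sub>R zeta_integrand \<phi> s w \<partial>lborel)"
    using cell_continuation(2)[OF \<phi>] by blast
  moreover have "rGamma_multi CARD('d) (snd s + (of_nat CARD('d) + 1) / 2) * F s = rGamma_enhanced CARD('n) CARD('d) s *
      (\<integral>w. (pivot_weight (inv \<kappa>) 0 xs (snd w) * indicator {z. pos_definite z} (fst w)) *\<^sub>R zeta_integrand \<phi> s w \<partial>lborel)"
    if "0 < Re (fst s)" "0 < Re (snd s)" for s
    using F[of s] pos[OF that]
    unfolding prod_rGamma_pivot_exponent rGamma_enhanced_def cell_weight_def by (simp only: mult_ac simp_thms)
  ultimately show "\<exists>F. holomorphic2_on F UNIV \<and> (\<forall>s. 0 < Re (fst s) \<longrightarrow> 0 < Re (snd s) \<longrightarrow>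
      rGamma_multi CARD('d) (snd s + (of_nat CARD('d) + 1) / 2) * F s = rGamma_enhanced CARD('n) CARD('d) s *
        (\<integral>w. (pivot_weight (inv \<kappa>) 0 xs (snd w) * indicator {z. pos_definite z} (fst w)) *\<^sub>R zeta_integrand \<phi> s w \<partial>lborel))"
    by blast
qed

end

lemma pivot_chart_exists:
  fixes xs :: "'n::finite list" and \<kappa> :: "'d::finite \<Rightarrow> nat"
  assumes \<kappa>: "bij_betw \<kappa> UNIV {..<CARD('d)}" and "CARD('d) \<le> CARD('n)" and xs: "xs \<in> permutations_of_set UNIV"
  shows "\<exists>\<rho>. pivot_chart \<rho> \<kappa> xs"
proof -
  have d: "distinct xs" "set xs = UNIV" using xs by (auto simp: permutations_of_set_def)
  then have l: "length xs = CARD('n)" by (metis distinct_card)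
  define \<rho> where "\<rho> = the_inv_into {..<CARD('n)} ((!) xs)"
  have b: "bij_betw ((!) xs) {..<CARD('n)} UNIV"
    using bij_betw_nth[OF d(1), of "{..<CARD('n)}" UNIV] d(2) l by simp
  have "bij_betw \<rho> UNIV {..<CARD('n)}"
    unfolding \<rho>_def by (rule bij_betw_the_inv_into[OF b])
  moreover have "\<rho> (xs ! k) = k" if "k < CARD('n)" for k
    unfolding \<rho>_def using b that by (intro the_inv_into_f_f) (auto simp: bij_betw_def)
  ultimately have "pivot_chart \<rho> \<kappa> xs"
    using \<kappa> assms(2) l by unfold_locales
  then show ?thesis by blast
qed

text \<open>On matrices of deficient rank the integrand vanishes because \<open>P2\<close> does.\<close>

lemma enhanced_cone_zeta_integrand:
  "indicator enhanced_cone w *\<^sub>R zeta_integrand \<phi> s w = indicator {z. pos_definite z} (fst w) *\<^sub>R zeta_integrand \<phi> s w"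
  for w :: "'n::finite symmat \<times> (real^'d::finite^'n)"
proof (cases "rank (snd w) = CARD('d)")
  case True
  then show ?thesis by (cases w) (simp add: enhanced_cone_def indicator_def)
next
  case False
  then have "P2 w = 0" using P2_eq_0_if_rank_deficient[of "snd w" "fst w"] by simp
  then show ?thesis by (simp add: zeta_integrand_def case_prod_unfold)
qed

lemma indicator_scaleR_sum_pivot_weight:
  fixes f :: "'n::finite symmat \<times> (real^'d::finite^'n) \<Rightarrow> complex"
  shows "indicator {z. pos_definite z} (fst w) *\<^sub>R f w =
    (\<Sum>xs\<in>permutations_of_set UNIV. (pivot_weight \<gamma> 0 xs (snd w) * indicator {z. pos_definite z} (fst w)) *\<^sub>R f w)"
  by (simp add: scaleR_sum_left[symmetric] sum_distrib_right[symmetric] sum_pivot_weight)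

theorem theorem2p2:
  assumes "CARD('d::finite) \<le> CARD('n::finite)"
  shows "\<exists>c\<ge>0. \<forall>\<phi> \<in> (schwartz :: ('n symmat \<times> (real^'d^'n) \<Rightarrow> complex) set).
    (\<forall>s1 s2. Re s1 > c \<longrightarrow> Re s2 > c \<longrightarrow>
        set_integrable lborel enhanced_cone (zeta_integrand \<phi> (s1, s2))) \<and>
    (\<exists>F. holomorphic2_on F UNIV \<and>
      (\<forall>s1 s2. Re s1 > c \<longrightarrow> Re s2 > c \<longrightarrow>
        F (s1, s2) = 1 / Gamma_enhanced CARD('n) CARD('d) (s1, s2) * zeta_integral \<phi> (s1, s2)) \<and>
      (\<exists>M. meromorphic2 M \<and>
        holomorphic2_on M (- Gamma_enhanced_poles CARD('n) CARD('d)) \<and>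
        (\<forall>s1 s2. Re s1 > c \<longrightarrow> Re s2 > c \<longrightarrow> M (s1, s2) = zeta_integral \<phi> (s1, s2)) \<and>
        (\<forall>s. s \<notin> Gamma_enhanced_poles CARD('n) CARD('d) \<longrightarrow>
          M s = Gamma_enhanced CARD('n) CARD('d) s * F s)))"
proof (intro exI[of _ 0] conjI order_refl ballI)
  fix \<phi> :: "'n symmat \<times> (real^'d^'n) \<Rightarrow> complex" assume \<phi>: "\<phi> \<in> schwartz"
  define \<Gamma>' where "\<Gamma>' = rGamma_enhanced CARD('n) CARD('d)"
  define X where "X = permutations_of_set (UNIV :: 'n set)"
  obtain \<kappa> :: "'d \<Rightarrow> nat" where \<kappa>: "bij_betw \<kappa> UNIV {..<CARD('d)}"
    using ex_bij_betw_finite_nat[of "UNIV :: 'd set"] by (auto simp: lessThan_atLeast0)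
  define f where "f xs s w = (pivot_weight (inv \<kappa>) 0 xs (snd w) * indicator {z. pos_definite z} (fst w)) *\<^sub>R zeta_integrand \<phi> s w" for xs s w
  have chart: "\<exists>\<rho>. pivot_chart \<rho> \<kappa> xs" if "xs \<in> X" for xs
    using pivot_chart_exists[OF \<kappa> assms] that by (simp add: X_def)
  have int: "integrable lborel (f xs s)" if "xs \<in> X" "0 < Re (fst s)" "0 < Re (snd s)" for xs s
    using chart[OF that(1)] pivot_chart.cell_entire(1)[OF _ \<phi> that(2,3)] unfolding f_def by blast
  have "\<exists>F. holomorphic2_on F UNIV \<and> (\<forall>s. 0 < Re (fst s) \<longrightarrow> 0 < Re (snd s) \<longrightarrow>
      rGamma_multi CARD('d) (snd s + (of_nat CARD('d) + 1) / 2) * F s = \<Gamma>' s * (\<integral>w. f xs s w \<partial>lborel))" if "xs \<in> X" for xs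
    using chart[OF that] pivot_chart.cell_entire(2)[OF _ \<phi>] unfolding f_def \<Gamma>'_def by blast
  then obtain H where H: "\<And>xs. xs \<in> X \<Longrightarrow> holomorphic2_on (H xs) UNIV"
    "\<And>xs s. xs \<in> X \<Longrightarrow> 0 < Re (fst s) \<Longrightarrow> 0 < Re (snd s) \<Longrightarrow>
      rGamma_multi CARD('d) (snd s + (of_nat CARD('d) + 1) / 2) * H xs s = \<Gamma>' s * (\<integral>w. f xs s w \<partial>lborel)" by metis
  \<comment> \<open>the first factor is the reciprocal of the gamma factor that does not come from the cells\<close>
  define F where "F s = rGamma_multi CARD('d) (snd s + (of_nat CARD('d) + 1) / 2) * (\<Sum>xs\<in>X. H xs s)" for s
  have sum_f: "indicator enhanced_cone w *\<^sub>R zeta_integrand \<phi> s w = (\<Sum>xs\<in>X. f xs s w)" for s w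
    unfolding enhanced_cone_zeta_integrand f_def X_def by (rule indicator_scaleR_sum_pivot_weight)
  show "\<forall>s1 s2. Re s1 > 0 \<longrightarrow> Re s2 > 0 \<longrightarrow> set_integrable lborel enhanced_cone (zeta_integrand \<phi> (s1, s2))"
    unfolding set_integrable_def sum_f using int by (auto intro!: Bochner_Integration.integrable_sum)
  have hF: "holomorphic2_on F UNIV"
    unfolding F_def using holomorphic2_rGamma_multi[of "CARD('d)" 0 1 "(of_nat CARD('d) + 1) / 2"]
    by (intro holomorphic2_on_mult holomorphic2_on_sum H open_UNIV) simp_all
  have F: "F s = \<Gamma>' s * zeta_integral \<phi> s" if "0 < Re (fst s)" "0 < Re (snd s)" for s
  proof -
    have "zeta_integral \<phi> s = (\<Sum>xs\<in>X. \<integral>w. f xs s w \<partial>lborel)"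
      unfolding zeta_integral_def set_lebesgue_integral_def sum_f
      using int that by (intro Bochner_Integration.integral_sum) auto
    then show ?thesis using H(2) that by (simp add: F_def sum_distrib_left)
  qed
  have nz: "\<Gamma>' s \<noteq> 0" if "0 < Re (fst s)" "0 < Re (snd s)" for s
    unfolding \<Gamma>'_def using assms that by (rule rGamma_enhanced_nonzero)
  have "meromorphic2 (\<lambda>s. inverse (\<Gamma>' s) * F s)" "holomorphic2_on (\<lambda>s. inverse (\<Gamma>' s) * F s) {s. \<Gamma>' s \<noteq> 0}"
    using meromorphic2_divide[OF hF, of \<Gamma>' "(1, 1)"] nz[of "(1, 1)"] holomorphic2_rGamma_enhanced by (auto simp: \<Gamma>'_def)
  moreover have "{s. \<Gamma>' s \<noteq> 0} = - Gamma_enhanced_poles CARD('n) CARD('d)"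
    by (auto simp: \<Gamma>'_def rGamma_enhanced_eq_0_iff)
  moreover have "1 / Gamma_enhanced CARD('n) CARD('d) s = \<Gamma>' s" "Gamma_enhanced CARD('n) CARD('d) s = inverse (\<Gamma>' s)" for s
    by (simp_all add: \<Gamma>'_def Gamma_enhanced_eq divide_inverse)
  ultimately show "\<exists>F. holomorphic2_on F UNIV \<and>
      (\<forall>s1 s2. Re s1 > 0 \<longrightarrow> Re s2 > 0 \<longrightarrow>
        F (s1, s2) = 1 / Gamma_enhanced CARD('n) CARD('d) (s1, s2) * zeta_integral \<phi> (s1, s2)) \<and>
      (\<exists>M. meromorphic2 M \<and>
        holomorphic2_on M (- Gamma_enhanced_poles CARD('n) CARD('d)) \<and>
        (\<forall>s1 s2. Re s1 > 0 \<longrightarrow> Re s2 > 0 \<longrightarrow> M (s1, s2) = zeta_integral \<phi> (s1, s2)) \<and>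
        (\<forall>s. s \<notin> Gamma_enhanced_poles CARD('n) CARD('d) \<longrightarrow>
          M s = Gamma_enhanced CARD('n) CARD('d) s * F s))"
    using hF F nz
    by (intro exI[of _ F] exI[of _ "\<lambda>s. inverse (\<Gamma>' s) * F s"] conjI allI impI) simp_all
qed

end
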